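(* Let $T>0$, $b>0$, let $m_0,f,g$ satisfy the standing assumptions (i)–(iv) of the context, let $c>0$ be such that $\|m_0\|\le c$, and let $R>ce^{C_gT}$. Let $\mu_0:=R^{-1}(m_0\triangleright_R)\in\mathcal P^1(\mathbb R^d\cup\{\star\})$. A flow of probabilities $\mu(\cdot):[0,T]\to\mathcal P^1(\mathbb R^d\cup\{\star\})$ with $\mu(0)=\mu_0$ is a solution of $$\frac{d}{dt}\mu(t)=L_t^*[\mu(t)]\mu(t)$$ if and only if $m(\cdot)$ defined by $m(t):=R\,\mu(t)|_{\mathbb R^d}$ is a weak solution of the balance equation $$\partial_t m(t)+\operatorname{div}(f(t,x,m(t))m(t))=g(t,x,m(t))m(t),\qquad m(0)=m_0 .$$ In particular, there exists a unique solution of $\frac{d}{dt}\mu(t)=L_t^*[\mu(t)]\mu(t)$ with the initial condition $\mu(0)=\mu_0$.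
   Context: $\mathcal M(X)$: finite nonnegative Borel measures on a Polish space $X$; $\|m\|:=m(X)$. $\mathcal M^1(\mathbb R^d)$: those $m\in\mathcal M(\mathbb R^d)$ with $\int\|x\|\,m(dx)<\infty$. PRW-distance: for $b>0$, $m_1,m_2\in\mathcal M(\mathbb R^d)$, $$\mathcal W_{1,b}(m_1,m_2):=\inf\Big\{b\|m_1-\widehat m_1\|+b\|m_2-\widehat m_2\|+\int\|x_1-x_2\|\,\varpi(d(x_1,x_2))\Big\},$$ over $\widehat m_1\le m_1$, $\widehat m_2\le m_2$ with $\|\widehat m_1\|=\|\widehat m_2\|$ and measures $\varpi$ with marginals $\widehat m_1,\widehat m_2$. $\mathcal M(\mathbb R^d)$ carries this metric. Standing assumptions on $f:[0,T]\times\mathbb R^d\times\mathcal M(\mathbb R^d)\to\mathbb R^d$, $g:[0,T]\times\mathbb R^d\times\mathcal M(\mathbb R^d)\to\mathbb R$, $m_0$: (i) $m_0\in\mathcal M^1(\mathbb R^d)$; (ii) $f,g$ are continuous; (iii) $\|f(t,x_1,m_1)-f(t,x_2,m_2)\|\le C_{Lf}(\|x_1-x_2\|+\mathcal W_{1,b}(m_1,m_2))$, and similarly for $g$ with constant $C_{Lg}$; (iv) $\|f\|\le C_f$, $|g|\le C_g$ everywhere. Augmented space: $\star$ is an extra (remote) point; $\mathbb R^d\cup\{\star\}$ has the metric $\rho_\star(x,\star)=\rho_\star(\star,x)=b$ for $x\in\mathbb R^d$, $\rho_\star(\star,\star)=0$, $\rho_\star(x,y)=\min(\|x-y\|,2b)$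 for $x,y\in\mathbb R^d$. For $m\in\mathcal M(\mathbb R^d)$ and $R>\|m\|$, $(m\triangleright_R)(\Upsilon):=m(\Upsilon\cap\mathbb R^d)+(R-\|m\|)\mathbf 1_\Upsilon(\star)$. $\mathcal P^1(\mathbb R^d\cup\{\star\})$ is the set of probabilities $\mu$ with $\int_{\mathbb R^d}\|x\|\mu(dx)<\infty$; $\mu|_{\mathbb R^d}$ is the restriction of $\mu$ to $\mathbb R^d$. A flow of probabilities is a map $[0,T]\to\mathcal P^1(\mathbb R^d\cup\{\star\})$ continuous for the Wasserstein distance $W_1$ associated with $\rho_\star$. For a probability $\mu$ on $\mathbb R^d\cup\{\star\}$ set $f_R(t,x,\mu):=f(t,x,R\mu|_{\mathbb R^d})$, $g_R(t,x,\mu):=g(t,x,R\mu|_{\mathbb R^d})$ for $x\in\mathbb R^d$, and $f_R(t,\star,\mu):=0$, $g_R(t,\star,\mu):=0$; $g_R^+:=\max(g_R,0)$, $g_R^-:=\max(-g_R,0)$. Generator: for $\phi:\mathbb R^d\cup\{\star\}\to\mathbb R$ with $\phi|_{\mathbb R^d}\in C^1(\mathbb R^d)$ and $\mu$ with $\mu(\{\star\})>0$, $$L_t[\mu]\phi(x):=\langle f_R(t,x,\mu),\nabla\phi(x)\rangle+\int_{\{0,1\}}\big(\phi(x+u(\star-x))-\phi(x)\big)\nu^-(t,x,\mu,du)+\int_{\mathbb R^d\cup\{\star\}}(\phi(y)-\phi(x))\,\nu^+(t,x,\mu,dy),$$ where $x+u(\star-x)$ means $x$ for $u=0$ and $\star$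 for $u=1$; the first term is $0$ at $x=\star$; $\nu^-(t,x,\mu,\{1\})=g_R^-(t,x,\mu)$, $\nu^-(t,x,\mu,\{0\})=0$; $\nu^+(t,x,\mu,\cdot)=0$ for $x\in\mathbb R^d$; and $$\int\phi(y)\,\nu^+(t,\star,\mu,dy)=\mu(\{\star\})^{-1}\int_{\mathbb R^d}\phi(y)g_R^+(t,y,\mu)\mu(dy).$$ Solution: a flow $\mu(\cdot)$ (with $\mu(t,\{\star\})>0$ for all $t$, so that $L_t[\mu(t)]$ is defined) solves $\frac{d}{dt}\mu(t)=L_t^*[\mu(t)]\mu(t)$ if for every $\phi\in C_0^1(\mathbb R^d\cup\{\star\})$ and $t\in[0,T]$ $$\int\phi(x)\mu(t,dx)-\int\phi(x)\mu(0,dx)=\int_0^t\int L_\tau[\mu(\tau)]\phi(x)\,\mu(\tau,dx)\,d\tau,$$ where $C_0^1(\mathbb R^d\cup\{\star\})$ consists of the functions whose restriction to $\mathbb R^d$ is $C^1$ with compact support and whose value at $\star$ is an arbitrary real number. Weak solution of the balance equation: a continuous map $m(\cdot):[0,T]\to\mathcal M(\mathbb R^d)$ such that for all $\phi\in C_c^1([0,T]\times\mathbb R^d)$, $s\in[0,T]$, $$\int\phi(s,x)m(s,dx)-\int\phi(0,x)m_0(dx)=\int_0^s\!\!\int\big[\partial_t\phi(t,x)+\langle\nabla\phi(t,x),f(t,x,m(t))\rangle+\phi(t,x)g(t,x,m(t))\big]m(t,dx)\,dt.$$ *)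

theory Defs
  imports "HOL-Probability.Probability"
begin

text \<open>
  The space \<open>\<real>\<^sup>d\<close> is an arbitrary type of class \<open>euclidean_space\<close>. Flows are total functions on
  \<open>real\<close> of which only the values on \<open>{0..T}\<close> matter. The remote point
  \<open>\<star>\<close> of the augmented space is \<open>None\<close>, in the type \<open>'a option\<close>.
\<close>

definition fin_measures :: "'a::euclidean_space measure set" where
  "fin_measures = {m. finite_measure m \<and> sets m = sets borel}"

definition fin_measures1 :: "'a::euclidean_space measure set" where
  "fin_measures1 = {m \<in> fin_measures. (\<integral>\<^sup>+ x. ennreal (norm x) \<partial>m) < \<infinity>}"

text \<open>
  The infimum is taken in \<open>ennreal\<close> because the transport cost of a plan may be infinite; the
  infimum itself is finite, as the plan \<open>0\<close> is admissible.
  Note that \<open>\<parallel>m - n\<parallel> = \<parallel>m\<parallel> - \<parallel>n\<parallel>\<close> for \<open>n \<le> m\<close>.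
\<close>

definition prw_plans ::
    "'a::euclidean_space measure \<Rightarrow> 'a measure \<Rightarrow> ('a measure \<times> 'a measure \<times> ('a \<times> 'a) measure) set"
  where
  "prw_plans m1 m2 = {(n1, n2, w).
     n1 \<in> fin_measures \<and> n2 \<in> fin_measures \<and>
     (\<forall>A\<in>sets borel. emeasure n1 A \<le> emeasure m1 A) \<and>
     (\<forall>A\<in>sets borel. emeasure n2 A \<le> emeasure m2 A) \<and>
     measure n1 UNIV = measure n2 UNIV \<and>
     sets w = sets (borel \<Otimes>\<^sub>M borel) \<and>
     distr w borel fst = n1 \<and> distr w borel snd = n2}"

definition prw_dist :: "real \<Rightarrow> 'a::euclidean_space measure \<Rightarrow> 'a measure \<Rightarrow> real" where
  "prw_dist b m1 m2 = enn2real (INF (n1, n2, w) \<in> prw_plans m1 m2.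
     ennreal (b * (measure m1 UNIV - measure n1 UNIV) + b * (measure m2 UNIV - measure n2 UNIV))
     + (\<integral>\<^sup>+ (x1, x2). ennreal (norm (x1 - x2)) \<partial>w))"

text \<open>Continuity on \<open>[0,T] \<times> \<real>\<^sup>d \<times> \<M>(\<real>\<^sup>d)\<close> for the PRW-metric on the last factor.\<close>

definition jointly_continuous ::
    "real \<Rightarrow> real \<Rightarrow> (real \<Rightarrow> 'a::euclidean_space \<Rightarrow> 'a measure \<Rightarrow> 'c::metric_space) \<Rightarrow> bool" where
  "jointly_continuous b T h \<longleftrightarrow>
     (\<forall>t\<in>{0..T}. \<forall>x. \<forall>m\<in>fin_measures. \<forall>\<epsilon>>0. \<exists>\<delta>>0.
        \<forall>t'\<in>{0..T}. \<forall>x'. \<forall>m'\<in>fin_measures.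
          \<bar>t' - t\<bar> < \<delta> \<longrightarrow> norm (x' - x) < \<delta> \<longrightarrow> prw_dist b m m' < \<delta> \<longrightarrow>
          dist (h t' x' m') (h t x m) < \<epsilon>)"

fun rho_star :: "real \<Rightarrow> 'a::euclidean_space option \<Rightarrow> 'a option \<Rightarrow> real" where
  "rho_star b None None = 0"
| "rho_star b (Some x) None = b"
| "rho_star b None (Some y) = b"
| "rho_star b (Some x) (Some y) = min (norm (x - y)) (2 * b)"

lemma Metric_space_rho_star:
  assumes "b > 0"
  shows "Metric_space UNIV (rho_star b :: 'a::euclidean_space option \<Rightarrow> 'a option \<Rightarrow> real)"
proof
  fix x y z :: "'a option"
  show "0 \<le> rho_star b x y"
    using assms by (cases x; cases y) auto
  show "rho_star b x y = rho_star b y x"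
    by (cases x; cases y) (auto simp: norm_minus_commute)
  show "rho_star b x y = 0 \<longleftrightarrow> x = y"
    using assms by (cases x; cases y) (auto simp: min_def)
  have tri: "norm (u - w) \<le> norm (u - v) + norm (v - w)" for u v w :: 'a
    using norm_triangle_ineq[of "u - v" "v - w"] by simp
  show "rho_star b x z \<le> rho_star b x y + rho_star b y z"
  proof (cases "x = None \<or> y = None \<or> z = None")
    case True
    then show ?thesis
      using assms by (cases x; cases y; cases z) auto
  next
    case False
    then obtain u v w where "x = Some u" "y = Some v" "z = Some w" by auto
    then show ?thesis
      using assms tri[of u w v] norm_ge_zero[of "u - v"] norm_ge_zero[of "v - w"]
      by (simp add: min_def del: norm_ge_zero)
  qed
qed

lemma openin_star_iff:
  fixes U :: "'a::euclidean_space option set"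
  assumes "b > 0"
  shows "openin (Metric_space.mtopology UNIV (rho_star b)) U \<longleftrightarrow> open (Some -` U)"
proof -
  interpret Metric_space UNIV "rho_star b :: 'a option \<Rightarrow> 'a option \<Rightarrow> real"
    by (rule Metric_space_rho_star[OF assms])
  show ?thesis
  proof
    assume U: "openin mtopology U"
    show "open (Some -` U)"
      unfolding open_dist
    proof
      fix x assume "x \<in> Some -` U"
      then obtain r where r: "r > 0" "mball (Some x) r \<subseteq> U"
        using U by (auto simp: openin_mtopology)
      have "y \<in> Some -` U" if "dist y x < r" for y
      proof -
        have "rho_star b (Some x) (Some y) < r"
          using that by (simp add: dist_norm norm_minus_commute)
        then show ?thesis using r(2) by auto
      qed
      with r(1) show "\<exists>e>0. \<forall>y. dist y x < e \<longrightarrow> y \<in> Some -` U" by blast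
    qed
  next
    assume O: "open (Some -` U)"
    show "openin mtopology U"
      unfolding openin_mtopology
    proof (intro conjI subset_UNIV allI impI)
      fix x assume x: "x \<in> U"
      show "\<exists>r>0. mball x r \<subseteq> U"
      proof (cases x)
        case None
        have "mball x b \<subseteq> U"
        proof
          fix y assume "y \<in> mball x b"
          then show "y \<in> U" using None x assms by (cases y) auto
        qed
        then show ?thesis using assms by blast
      next
        case (Some u)
        then obtain e where e: "e > 0" "\<And>y. dist y u < e \<Longrightarrow> y \<in> Some -` U"
          using O x unfolding open_dist by blast
        have "mball x (min e b) \<subseteq> U"
        proof
          fix y assume y: "y \<in> mball x (min e b)"
          show "y \<in> U"
          proof (cases y)
            case None
            then show ?thesis using y Some by simp
          next
            case S: (Some v)
            have "norm (u - v) < e" using y Some S assms by (auto simp: min_def split: if_splits)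
            then show ?thesis using e(2)[of v] S by (simp add: dist_norm norm_minus_commute)
          qed
        qed
        then show ?thesis using e(1) assms by (intro exI[of _ "min e b"]) auto
      qed
    qed
  qed
qed

definition star_borel :: "real \<Rightarrow> 'a::euclidean_space option measure" where
  "star_borel b = sigma UNIV {U. openin (Metric_space.mtopology UNIV (rho_star b)) U}"

lemma space_star_borel [simp]: "space (star_borel b) = UNIV"
  by (simp add: star_borel_def)

lemma sets_star_borel_iff:
  fixes A :: "'a::euclidean_space option set"
  assumes "b > 0"
  shows "A \<in> sets (star_borel b) \<longleftrightarrow> Some -` A \<in> sets borel"
proof -
  have eq: "sets (star_borel b) = sigma_sets UNIV {U :: 'a option set. open (Some -` U)}"
    by (simp add: star_borel_def openin_star_iff[OF assms])
  have 1: "Some -` A \<in> sets borel" if "A \<in> sigma_sets UNIV {U :: 'a option set. open (Some -` U)}" for A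
    using that
  proof induction
    case (Compl a)
    have "Some -` (UNIV - a) = UNIV - Some -` a" by auto
    then show ?case using Compl by (simp add: borel_comp Compl_eq_Diff_UNIV[symmetric])
  next
    case (Union a)
    then show ?case by (auto simp: vimage_UN)
  qed auto
  have rS: "range Some \<in> sets (star_borel b :: 'a option measure)"
    by (auto simp: eq vimage_def intro!: sigma_sets.Basic)
  have N: "{None} \<in> sets (star_borel b :: 'a option measure)"
    by (auto simp: eq vimage_def intro!: sigma_sets.Basic)
  have 2: "Some ` B \<in> sets (star_borel b)" if "B \<in> sigma_sets UNIV {S :: 'a set. open S}" for B
    using that
  proof induction
    case (Basic a)
    then show ?case by (auto simp: eq inj_vimage_image_eq intro!: sigma_sets.Basic)
  next
    case (Compl a)
    have "Some ` (UNIV - a) = range Some - Some ` a" by auto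
    then show ?case using Compl rS by auto
  next
    case (Union a)
    then show ?case by (auto simp: image_UN)
  qed auto
  have "A \<in> sets (star_borel b)" if "Some -` A \<in> sets borel"
  proof -
    have "Some ` (Some -` A) \<in> sets (star_borel b)"
      using that 2[of "Some -` A"] by (simp add: borel_def del: image_vimage_eq)
    moreover have "A = Some ` (Some -` A) \<union> (A \<inter> {None})"
    proof (rule set_eqI)
      show "x \<in> A \<longleftrightarrow> x \<in> Some ` (Some -` A) \<union> (A \<inter> {None})" for x by (cases x) auto
    qed
    moreover have "A \<inter> {None} \<in> sets (star_borel b)"
      using N by (cases "None \<in> A") auto
    ultimately show ?thesis by (metis sets.Un)
  qed
  then show ?thesis using 1 eq by blast
qed

definition prob1_star :: "real \<Rightarrow> 'a::euclidean_space option measure set" where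
  "prob1_star b = {\<mu>. prob_space \<mu> \<and> sets \<mu> = sets (star_borel b) \<and>
     (\<integral>\<^sup>+ x. (case x of None \<Rightarrow> 0 | Some y \<Rightarrow> ennreal (norm y)) \<partial>\<mu>) < \<infinity>}"

text \<open>The measure \<open>m \<triangleright>\<^sub>R\<close>, meant for \<open>R > \<parallel>m\<parallel>\<close>.\<close>

definition augment :: "real \<Rightarrow> real \<Rightarrow> 'a::euclidean_space measure \<Rightarrow> 'a option measure" where
  "augment b R m = measure_of UNIV (sets (star_borel b))
     (\<lambda>U. emeasure m (Some -` U) + ennreal (R - measure m UNIV) * indicator U None)"

lemma emeasure_augment:
  assumes "b > 0" "sets m = sets borel" "U \<in> sets (star_borel b)"
  shows "emeasure (augment b R m) U =
    emeasure m (Some -` U) + ennreal (R - measure m UNIV) * indicator U None"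
proof (rule emeasure_measure_of[OF augment_def])
  show "countably_additive (sets (augment b R m))
     (\<lambda>U. emeasure m (Some -` U) + ennreal (R - measure m UNIV) * indicator U None)"
  proof (rule countably_additiveI)
    fix A :: "nat \<Rightarrow> 'a option set"
    assume A: "range A \<subseteq> sets (augment b R m)" "disjoint_family A"
    have A': "range (\<lambda>i. Some -` A i) \<subseteq> sets m"
    proof -
      have "A i \<in> sets (star_borel b)" for i
        using A(1) sets.sigma_sets_eq[of "star_borel b :: 'a option measure"]
        unfolding augment_def by (auto simp: sets_measure_of)
      then show ?thesis using sets_star_borel_iff[OF assms(1)] assms(2) by auto
    qed
    have d: "disjoint_family (\<lambda>i. Some -` A i)" using A(2) by (auto simp: disjoint_family_on_def)
    have "(\<Sum>i. emeasure m (Some -` A i) + ennreal (R - measure m UNIV) * indicator (A i) None) =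
       (\<Sum>i. emeasure m (Some -` A i)) + (\<Sum>i. ennreal (R - measure m UNIV) * indicator (A i) None)"
      by (rule suminf_add[symmetric]) auto
    also have "\<dots> = emeasure m (\<Union>i. Some -` A i)
        + ennreal (R - measure m UNIV) * indicator (\<Union>i. A i) None"
      using suminf_emeasure[OF A' d] suminf_indicator[OF A(2)] by simp
    finally show "(\<Sum>i. emeasure m (Some -` A i) + ennreal (R - measure m UNIV) * indicator (A i) None)
      = emeasure m (Some -` \<Union> (range A)) + ennreal (R - measure m UNIV) * indicator (\<Union> (range A)) None"
      by (simp add: vimage_UN)
  qed
  show "U \<in> sets (augment b R m)"
    using assms(3) unfolding augment_def by (auto simp: sets_measure_of)
qed (auto simp: positive_def)

definition restr :: "'a::euclidean_space option measure \<Rightarrow> 'a measure" where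
  "restr \<mu> = distr (restrict_space \<mu> (range Some)) borel the"

lemma emeasure_restr:
  assumes "b > 0" "sets \<mu> = sets (star_borel b)" "A \<in> sets borel"
  shows "emeasure (restr \<mu>) A = emeasure \<mu> (Some ` A)"
proof -
  have sp: "space \<mu> = UNIV" using sets_eq_imp_space_eq[OF assms(2)] by simp
  have S: "Some ` B \<in> sets \<mu>" if "B \<in> sets borel" for B
    using that assms(1,2) by (simp add: sets_star_borel_iff inj_vimage_image_eq)
  have v: "the -` B \<inter> range Some = Some ` B" for B :: "'a set" by auto
  have R: "range Some \<in> sets \<mu>" using S[of UNIV] by simp
  have m: "the \<in> borel_measurable (restrict_space \<mu> (range Some))"
    by (rule measurableI) (auto simp: space_restrict_space sp v sets_restrict_space_iff R S)
  show ?thesis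
    unfolding restr_def using assms(3) R
    by (subst emeasure_distr[OF m])
       (auto simp: space_restrict_space sp v intro!: emeasure_restrict_space)
qed

definition scaled_restr :: "real \<Rightarrow> 'a::euclidean_space option measure \<Rightarrow> 'a measure" where
  "scaled_restr R \<mu> = scale_measure (ennreal R) (restr \<mu>)"

definition W1_star :: "real \<Rightarrow> 'a::euclidean_space option measure \<Rightarrow> 'a option measure \<Rightarrow> real" where
  "W1_star b \<mu> \<nu> = enn2real (INF w \<in> {w. sets w = sets (star_borel b \<Otimes>\<^sub>M star_borel b) \<and>
       distr w (star_borel b) fst = \<mu> \<and> distr w (star_borel b) snd = \<nu>}.
     \<integral>\<^sup>+ (x, y). ennreal (rho_star b x y) \<partial>w)"

definition prob_flow :: "real \<Rightarrow> real \<Rightarrow> (real \<Rightarrow> 'a::euclidean_space option measure) \<Rightarrow> bool" where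
  "prob_flow b T \<mu> \<longleftrightarrow> (\<forall>t\<in>{0..T}. \<mu> t \<in> prob1_star b) \<and>
     (\<forall>t\<in>{0..T}. \<forall>\<epsilon>>0. \<exists>\<delta>>0. \<forall>s\<in>{0..T}. \<bar>s - t\<bar> < \<delta> \<longrightarrow> W1_star b (\<mu> t) (\<mu> s) < \<epsilon>)"

text \<open>\<open>f\<^sub>R\<close> and \<open>g\<^sub>R\<close>, extended by \<open>0\<close> to the remote point.\<close>

definition aug_fun ::
    "real \<Rightarrow> (real \<Rightarrow> 'a::euclidean_space \<Rightarrow> 'a measure \<Rightarrow> 'c::zero) \<Rightarrow>
     real \<Rightarrow> 'a option \<Rightarrow> 'a option measure \<Rightarrow> 'c" where
  "aug_fun R h t x \<mu> = (case x of None \<Rightarrow> 0 | Some y \<Rightarrow> h t y (scaled_restr R \<mu>))"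

definition grad :: "('a::euclidean_space \<Rightarrow> real) \<Rightarrow> 'a \<Rightarrow> 'a" where
  "grad h x = (THE D. GDERIV h x :> D)"

text \<open>The point \<open>x + u (\<star> - x)\<close> for \<open>u \<in> {0, 1}\<close>.\<close>

definition jump :: "'a option \<Rightarrow> real \<Rightarrow> 'a option" where
  "jump x u = (if u = 0 then x else None)"

definition nu_minus ::
    "real \<Rightarrow> (real \<Rightarrow> 'a::euclidean_space \<Rightarrow> 'a measure \<Rightarrow> real) \<Rightarrow>
     real \<Rightarrow> 'a option \<Rightarrow> 'a option measure \<Rightarrow> real measure" where
  "nu_minus R g t x \<mu> =
     scale_measure (ennreal (max (- aug_fun R g t x \<mu>) 0)) (return (count_space {0, 1}) 1)"

text \<open>The density below vanishes at the remote point, because \<open>g\<^sub>R\<close> does.\<close>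

definition nu_plus ::
    "real \<Rightarrow> (real \<Rightarrow> 'a::euclidean_space \<Rightarrow> 'a measure \<Rightarrow> real) \<Rightarrow>
     real \<Rightarrow> 'a option \<Rightarrow> 'a option measure \<Rightarrow> 'a option measure" where
  "nu_plus R g t x \<mu> = (case x of
       Some y \<Rightarrow> null_measure \<mu>
     | None \<Rightarrow> scale_measure (ennreal (inverse (measure \<mu> {None})))
                 (density \<mu> (\<lambda>y. ennreal (max (aug_fun R g t y \<mu>) 0))))"

lemma integral_nu_plus:
  assumes "\<phi> \<in> borel_measurable \<mu>" "(\<lambda>y. aug_fun R g t y \<mu>) \<in> borel_measurable \<mu>"
  shows "(\<integral>y. \<phi> y \<partial>(nu_plus R g t None \<mu>)) =
    inverse (measure \<mu> {None}) * (\<integral>y. max (aug_fun R g t y \<mu>) 0 * \<phi> y \<partial>\<mu>)"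
proof -
  have "(\<integral>y. \<phi> y \<partial>(nu_plus R g t None \<mu>)) = (\<integral>y. \<phi> y \<partial>(density \<mu> (\<lambda>y. ennreal
      (inverse (measure \<mu> {None}) * max (aug_fun R g t y \<mu>) 0))))"
    using assms unfolding nu_plus_def
    by (auto intro!: arg_cong2[where f = lebesgue_integral] measure_eqI
      simp: emeasure_density nn_integral_cmult[symmetric] ennreal_mult mult.assoc)
  also have "\<dots> = (\<integral>y. inverse (measure \<mu> {None}) * (max (aug_fun R g t y \<mu>) 0 * \<phi> y) \<partial>\<mu>)"
    using assms by (subst integral_density) (auto simp: mult.assoc)
  finally show ?thesis by simp
qed

definition generator ::
    "real \<Rightarrow> (real \<Rightarrow> 'a::euclidean_space \<Rightarrow> 'a measure \<Rightarrow> 'a) \<Rightarrow>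
     (real \<Rightarrow> 'a \<Rightarrow> 'a measure \<Rightarrow> real) \<Rightarrow>
     real \<Rightarrow> 'a option measure \<Rightarrow> ('a option \<Rightarrow> real) \<Rightarrow> 'a option \<Rightarrow> real" where
  "generator R f g t \<mu> \<phi> x =
     (case x of None \<Rightarrow> 0 | Some y \<Rightarrow> aug_fun R f t x \<mu> \<bullet> grad (\<lambda>z. \<phi> (Some z)) y)
     + (\<integral>u. (\<phi> (jump x u) - \<phi> x) \<partial>(nu_minus R g t x \<mu>))
     + (\<integral>y. (\<phi> y - \<phi> x) \<partial>(nu_plus R g t x \<mu>))"

definition C01_star :: "('a::euclidean_space option \<Rightarrow> real) set" where
  "C01_star = {\<phi>.
     (\<exists>D. (\<forall>x. GDERIV (\<lambda>z. \<phi> (Some z)) x :> D x) \<and> continuous_on UNIV D) \<and>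
     compact (closure {x. \<phi> (Some x) \<noteq> 0})}"

definition solves_flow_eq ::
    "real \<Rightarrow> real \<Rightarrow> real \<Rightarrow> (real \<Rightarrow> 'a::euclidean_space \<Rightarrow> 'a measure \<Rightarrow> 'a) \<Rightarrow>
     (real \<Rightarrow> 'a \<Rightarrow> 'a measure \<Rightarrow> real) \<Rightarrow> (real \<Rightarrow> 'a option measure) \<Rightarrow> bool" where
  "solves_flow_eq b T R f g \<mu> \<longleftrightarrow>
     prob_flow b T \<mu> \<and>
     (\<forall>t\<in>{0..T}. measure (\<mu> t) {None} > 0) \<and>
     (\<forall>\<phi>\<in>C01_star. \<forall>t\<in>{0..T}.
        (\<integral>x. \<phi> x \<partial>(\<mu> t)) - (\<integral>x. \<phi> x \<partial>(\<mu> 0)) =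
        (LINT \<tau>:{0..t}|lborel. (\<integral>x. generator R f g \<tau> (\<mu> \<tau>) \<phi> x \<partial>(\<mu> \<tau>))))"

text \<open>
  \<open>C\<^sub>c\<^sup>1([0,T] \<times> \<real>\<^sup>d)\<close>: the time derivative is one-sided at \<open>0\<close> and \<open>T\<close>, and test functions need not
  vanish there.
\<close>

definition C1c :: "real \<Rightarrow> (real \<Rightarrow> 'a::euclidean_space \<Rightarrow> real) set" where
  "C1c T = {\<phi>.
     (\<exists>dt dx.
        (\<forall>t\<in>{0..T}. \<forall>x. ((\<lambda>s. \<phi> s x) has_real_derivative dt t x) (at t within {0..T}) \<and>
                        GDERIV (\<phi> t) x :> dx t x) \<and>
        continuous_on ({0..T} \<times> UNIV) (\<lambda>(t, x). dt t x) \<and>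
        continuous_on ({0..T} \<times> UNIV) (\<lambda>(t, x). dx t x)) \<and>
     compact (closure {(t, x). t \<in> {0..T} \<and> \<phi> t x \<noteq> 0})}"

definition weak_solution ::
    "real \<Rightarrow> real \<Rightarrow> (real \<Rightarrow> 'a::euclidean_space \<Rightarrow> 'a measure \<Rightarrow> 'a) \<Rightarrow>
     (real \<Rightarrow> 'a \<Rightarrow> 'a measure \<Rightarrow> real) \<Rightarrow> 'a measure \<Rightarrow> (real \<Rightarrow> 'a measure) \<Rightarrow> bool" where
  "weak_solution b T f g m0 m \<longleftrightarrow>
     (\<forall>t\<in>{0..T}. m t \<in> fin_measures) \<and>
     (\<forall>t\<in>{0..T}. \<forall>\<epsilon>>0. \<exists>\<delta>>0. \<forall>s\<in>{0..T}. \<bar>s - t\<bar> < \<delta> \<longrightarrow> prw_dist b (m t) (m s) < \<epsilon>) \<and>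
     (\<forall>\<phi>\<in>C1c T. \<forall>s\<in>{0..T}.
        (\<integral>x. \<phi> s x \<partial>(m s)) - (\<integral>x. \<phi> 0 x \<partial>m0) =
        (LINT t:{0..s}|lborel.
           (\<integral>x. vector_derivative (\<lambda>r. \<phi> r x) (at t within {0..T})
                 + grad (\<phi> t) x \<bullet> f t x (m t) + \<phi> t x * g t x (m t) \<partial>(m t))))"

end

theory Submission
  imports Defs
begin

text \<open>Only the mass outside the remote point \<open>\<star>\<close> is free in a probability on the augmented space, so a flow
  \<open>\<mu>\<close> and the curve \<open>m(t) = R \<mu>(t)|\<close> determine each other. Tested against a function \<open>\<phi>\<close>, the two jump terms
  of the generator add up to \<open>g (\<phi> - \<phi>(\<star>))\<close> integrated over \<open>m / R\<close>: deaths send mass to \<open>\<star>\<close>, and the factor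
  \<open>1 / \<mu>{\<star>}\<close> in the birth kernel cancels against the mass from which births start. Hence the equation for
  \<open>\<mu>\<close> is the weak balance equation with test functions constant in time, plus the balance of the total
  mass (\<open>solves_flow_eq_iff\<close>). The latter follows from the former by cutting off the constant \<open>1\<close>
  (\<open>weak_eq_bounded_test\<close>), and moving test functions follow from constant ones because the integral of a
  moving test function is differentiable in time (\<open>weak_eq_moving_test\<close>). Gronwall's inequality bounds the mass
  by \<open>c exp (C\<^sub>g T) < R\<close>, so \<open>\<star>\<close> never loses all its mass. The continuity notions match since the
  transport metric is bounded by \<open>R\<close> times the Wasserstein distance (\<open>prw_dist_scaled_restr_le\<close>).

  Existence and uniqueness come from characteristics. If particles move with \<open>X' = f\<close> and carry weights
  with \<open>(log w)' = g\<close>, then \<open>m(t) = X\<^sub>t#(w\<^sub>t m\<^sub>0)\<close> is a weak solution (\<open>weak_eq_characteristics\<close>). Since \<open>m(t)\<close> depends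
  on \<open>(X, w)\<close> in a Lipschitz way for the transport metric, the system of displacements and log-weights is
  a Volterra equation in a space of bounded continuous functions, and Picard iteration gives exactly one
  solution (\<open>nonlinear_picard\<close>). Realising all these measures as laws of random points of the
  augmented space on one probability space (\<open>star_law_W1\<close>) yields the metric estimate and the flow at once.

  It remains to see that every weak solution arises in this way. Freeze the coefficients along a
  solution \<open>m\<close>: both \<open>m\<close> and the measure transported by the corresponding characteristics solve the
  same linear equation, so uniqueness for linear equations with Lipschitz coefficients suffices
  (\<open>weak_eq_unique\<close>). There, test functions carried along the flow are only Lipschitz and hence not admissible, and
  the measures may be singular. The way out is to mollify the transported test function: the velocity
  varies by \<open>O(\<epsilon>)\<close> on the averaging ball, so mollification commutes with an Euler step of length \<open>\<delta>\<close> up to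
  \<open>O(\<delta> \<epsilon>)\<close> (\<open>mollify_backward_step\<close>). The dual Lipschitz distance of the two mollified solutions then
  satisfies a Gronwall inequality with source \<open>O(\<epsilon>)\<close>, and \<open>\<epsilon> \<rightarrow> 0\<close>.\<close>

section \<open>Measures on the augmented space\<close>

lemma fin_measuresD:
  assumes "m \<in> fin_measures"
  shows "finite_measure m" "sets m = sets borel" "space m = UNIV"
  using assms sets_eq_imp_space_eq[of m borel] by (auto simp: fin_measures_def)

lemma scale_measure_eq_density: "scale_measure r M = density M (\<lambda>_. r)"
  by (rule measure_eqI) (auto simp: emeasure_density nn_integral_cmult_indicator)

lemma integral_scale_measure:
  fixes \<phi> :: "'a \<Rightarrow> real"
  assumes "\<phi> \<in> borel_measurable M" "0 \<le> r"
  shows "(\<integral>x. \<phi> x \<partial>scale_measure (ennreal r) M) = r * (\<integral>x. \<phi> x \<partial>M)"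
  using assms by (simp add: scale_measure_eq_density integral_density)

lemma measurable_the_star:
  assumes "b > 0"
  shows "the \<in> star_borel b \<rightarrow>\<^sub>M borel"
proof (rule measurableI)
  fix A :: "'a set" assume "A \<in> sets borel"
  then show "the -` A \<inter> space (star_borel b) \<in> sets (star_borel b)"
    using assms by (simp add: sets_star_borel_iff vimage_comp o_def vimage_def)
qed simp

lemma measurable_Some_star:
  assumes "b > 0"
  shows "Some \<in> borel \<rightarrow>\<^sub>M star_borel b"
  by (rule measurableI) (use assms in \<open>simp_all add: sets_star_borel_iff\<close>)

lemma sets_star_None:
  assumes "b > 0"
  shows "{None} \<in> sets (star_borel b)" "range Some \<in> sets (star_borel b)"
  using assms by (simp_all add: sets_star_borel_iff vimage_def)

lemma star_measurable:
  fixes F :: "'a::euclidean_space option \<Rightarrow> 'b::topological_space"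
  assumes b: "b > 0" and s: "sets \<mu> = sets (star_borel b)" and F: "(\<lambda>x. F (Some x)) \<in> borel_measurable borel"
  shows "F \<in> borel_measurable \<mu>"
proof (rule measurableI)
  fix E :: "'b set" assume E: "E \<in> sets borel"
  have "Some -` (F -` E) = (\<lambda>x. F (Some x)) -` E" by auto
  then have "Some -` (F -` E) \<in> sets borel" using measurable_sets[OF F E] by simp
  then show "F -` E \<inter> space \<mu> \<in> sets \<mu>"
    using sets_star_borel_iff[OF b, of "F -` E"] s sets_eq_imp_space_eq[OF s] by simp
qed simp

lemma sets_restr [simp]: "sets (restr \<mu>) = sets borel" "space (restr \<mu>) = UNIV"
  by (simp_all add: restr_def)

lemma measurable_the_restrict:
  assumes "b > 0" "sets \<mu> = sets (star_borel b)"
  shows "the \<in> restrict_space \<mu> (range Some) \<rightarrow>\<^sub>M borel"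
  by (rule measurable_restrict_space1)
     (use measurable_the_star[OF assms(1)] assms(2) in \<open>simp add: measurable_def sets_eq_imp_space_eq[OF assms(2)]\<close>)

lemma nn_integral_star:
  fixes F :: "'a::euclidean_space option \<Rightarrow> ennreal"
  assumes b: "b > 0" and s: "sets \<mu> = sets (star_borel b)" and F: "F \<in> borel_measurable (star_borel b)"
  shows "(\<integral>\<^sup>+x. F x \<partial>\<mu>) = (\<integral>\<^sup>+x. F (Some x) \<partial>restr \<mu>) + F None * emeasure \<mu> {None}"
proof -
  have sp: "space \<mu> = UNIV" using sets_eq_imp_space_eq[OF s] by simp
  have FS: "(\<lambda>x. F (Some x)) \<in> borel_measurable borel"
    using measurable_compose[OF measurable_Some_star[OF b] F] .
  have FT: "(\<lambda>x. F (Some (the x))) \<in> borel_measurable \<mu>"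
    using measurable_compose[OF measurable_the_star[OF b] FS] s by (simp cong: measurable_cong_sets)
  have R: "range Some \<inter> space \<mu> \<in> sets \<mu>" "range Some \<in> sets \<mu>" "{None} \<in> sets \<mu>"
    using sets_star_None[OF b] by (simp_all add: s sp)
  have "(\<integral>\<^sup>+x. F x \<partial>\<mu>) =
      (\<integral>\<^sup>+x. F (Some (the x)) * indicator (range Some) x + F None * indicator {None} x \<partial>\<mu>)"
    by (rule nn_integral_cong, rename_tac x, case_tac x) auto
  also have "\<dots> = (\<integral>\<^sup>+x. F (Some (the x)) * indicator (range Some) x \<partial>\<mu>) + F None * emeasure \<mu> {None}"
    using FT R by (subst nn_integral_add) (auto simp: nn_integral_cmult_indicator)
  also have "(\<integral>\<^sup>+x. F (Some (the x)) * indicator (range Some) x \<partial>\<mu>) = (\<integral>\<^sup>+x. F (Some x) \<partial>restr \<mu>)"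
    unfolding restr_def
    using FS R(1) by (simp add: nn_integral_distr[OF measurable_the_restrict[OF b s]] nn_integral_restrict_space)
  finally show ?thesis .
qed

lemma integral_star:
  fixes \<phi> :: "'a::euclidean_space option \<Rightarrow> real"
  assumes b: "b > 0" and s: "sets \<mu> = sets (star_borel b)" and fm: "finite_measure \<mu>" and i: "integrable \<mu> \<phi>"
  shows "(\<integral>x. \<phi> x \<partial>\<mu>) = (\<integral>x. \<phi> (Some x) \<partial>restr \<mu>) + \<phi> None * measure \<mu> {None}"
proof -
  interpret finite_measure \<mu> by fact
  have sp: "space \<mu> = UNIV" using sets_eq_imp_space_eq[OF s] by simp
  have F: "\<phi> \<in> borel_measurable (star_borel b)"
    using i s by (simp cong: measurable_cong_sets add: borel_measurable_integrable)
  have FS: "(\<lambda>x. \<phi> (Some x)) \<in> borel_measurable borel"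
    using measurable_compose[OF measurable_Some_star[OF b] F] .
  have R: "range Some \<inter> space \<mu> \<in> sets \<mu>" "range Some \<in> sets \<mu>" "{None} \<in> sets \<mu>"
    using sets_star_None[OF b] by (simp_all add: s sp)
  have "(\<integral>x. \<phi> x \<partial>\<mu>) = (\<integral>x. indicator (range Some) x *\<^sub>R \<phi> x + indicator {None} x *\<^sub>R \<phi> None \<partial>\<mu>)"
    by (rule Bochner_Integration.integral_cong, simp, rename_tac x, case_tac x) auto
  also have "\<dots> = (\<integral>x. indicator (range Some) x *\<^sub>R \<phi> x \<partial>\<mu>) + \<phi> None * measure \<mu> {None}"
    using i R
    by (subst Bochner_Integration.integral_add)
       (auto intro!: integrable_real_mult_indicator simp: emeasure_finite less_top[symmetric] mult.commute)
  also have "(\<integral>x. indicator (range Some) x *\<^sub>R \<phi> x \<partial>\<mu>) = (\<integral>x. \<phi> (Some x) \<partial>restr \<mu>)"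
    unfolding restr_def
    by (subst integral_distr[OF measurable_the_restrict[OF b s] FS], subst integral_restrict_space[OF R(1)])
       (auto intro!: Bochner_Integration.integral_cong split: split_indicator)
  finally show ?thesis .
qed

lemma finite_measure_restr:
  assumes "b > 0" "sets \<mu> = sets (star_borel b)" "finite_measure \<mu>"
  shows "finite_measure (restr \<mu>)"
proof -
  interpret finite_measure \<mu> by fact
  show ?thesis
    by (rule finite_measureI) (simp add: emeasure_restr[OF assms(1,2)])
qed

lemma scaled_restr_in_fin_measures:
  assumes "b > 0" "sets \<mu> = sets (star_borel b)" "finite_measure \<mu>"
  shows "scaled_restr R \<mu> \<in> fin_measures"
proof -
  interpret finite_measure "restr \<mu>" using finite_measure_restr[OF assms] .
  show ?thesis unfolding fin_measures_def scaled_restr_def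
    by (auto intro!: finite_measureI simp: space_scale_measure ennreal_mult_eq_top_iff)
qed

lemma integral_scaled_restr:
  fixes \<phi> :: "'a::euclidean_space \<Rightarrow> real"
  assumes "R \<ge> 0" "\<phi> \<in> borel_measurable borel"
  shows "(\<integral>x. \<phi> x \<partial>scaled_restr R \<mu>) = R * (\<integral>x. \<phi> x \<partial>restr \<mu>)"
  unfolding scaled_restr_def
  by (rule integral_scale_measure) (use assms in \<open>simp_all cong: measurable_cong_sets\<close>)

lemma prob1_starD:
  assumes "\<mu> \<in> prob1_star b"
  shows "prob_space \<mu>" "finite_measure \<mu>" "sets \<mu> = sets (star_borel b)" "space \<mu> = UNIV"
  using assms sets_eq_imp_space_eq[of \<mu> "star_borel b"]
  by (auto simp: prob1_star_def prob_space_imp_sigma_finite prob_space.finite_measure)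

lemma measure_scaled_restr:
  assumes "b > 0" "sets \<mu> = sets (star_borel b)" "prob_space \<mu>" "R \<ge> 0"
  shows "measure (scaled_restr R (\<mu> :: 'a::euclidean_space option measure)) UNIV = R * (1 - measure \<mu> {None})"
proof -
  interpret prob_space \<mu> by fact
  have sp: "space \<mu> = UNIV" using sets_eq_imp_space_eq[OF assms(2)] by simp
  have "range Some = space \<mu> - {None}"
    using sp notin_range_Some by auto
  then have "measure \<mu> (range Some) = 1 - measure \<mu> {None}"
    using sets_star_None(1)[OF assms(1), where 'a = 'a] assms(2) by (metis prob_compl)
  moreover have "measure (restr \<mu>) UNIV = measure \<mu> (range Some)"
    using emeasure_restr[OF assms(1,2), of UNIV] by (simp add: measure_def)
  ultimately show ?thesis using assms(4) unfolding scaled_restr_def by simp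
qed

text \<open>A probability on the augmented space has no freedom at the remote point: the mass there is
  what the restriction leaves over.\<close>

lemma star_measure_eqI:
  fixes \<mu> \<nu> :: "'a::euclidean_space option measure"
  assumes b: "b > 0" and R: "R > 0"
    and m: "sets \<mu> = sets (star_borel b)" "prob_space \<mu>" and n: "sets \<nu> = sets (star_borel b)" "prob_space \<nu>"
    and eq: "scaled_restr R \<mu> = scaled_restr R \<nu>"
  shows "\<mu> = \<nu>"
proof (rule measure_eqI)
  show "sets \<mu> = sets \<nu>" using m n by simp
  fix A assume A: "A \<in> sets \<mu>"
  have r: "emeasure \<mu> (Some ` B) = emeasure \<nu> (Some ` B)" if B: "B \<in> sets borel" for B
  proof -
    have "ennreal R * emeasure \<mu> (Some ` B) = ennreal R * emeasure \<nu> (Some ` B)"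
      using arg_cong[OF eq, of "\<lambda>M. emeasure M B"] emeasure_restr[OF b m(1) B] emeasure_restr[OF b n(1) B]
      by (simp add: scaled_restr_def)
    then show ?thesis using R by (simp add: ennreal_mult_cancel_left)
  qed
  have "measure \<mu> {None} = measure \<nu> {None}"
    using measure_scaled_restr[OF b m, of R] measure_scaled_restr[OF b n, of R] eq R by simp
  then have N: "emeasure \<mu> {None} = emeasure \<nu> {None}"
    using m n by (simp add: prob_space.finite_measure finite_measure.emeasure_eq_measure)
  have B: "Some -` A \<in> sets borel" using A m(1) sets_star_borel_iff[OF b] by auto
  have AA: "A = Some ` (Some -` A) \<union> (A \<inter> {None})"
  proof (rule set_eqI)
    show "x \<in> A \<longleftrightarrow> x \<in> Some ` (Some -` A) \<union> (A \<inter> {None})" for x by (cases x) auto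
  qed
  have SS: "Some ` (Some -` A) \<in> sets (star_borel b)"
    using B sets_star_borel_iff[OF b, of "Some ` (Some -` A)"] by (simp only: inj_vimage_image_eq[OF inj_Some])
  have NN: "A \<inter> {None} \<in> sets (star_borel b)" using sets_star_None[OF b] A m(1) by auto
  have "emeasure M A = emeasure M (Some ` (Some -` A)) + emeasure M (A \<inter> {None})"
    if "sets M = sets (star_borel b)" for M
    by (subst AA, subst plus_emeasure) (use that SS NN in auto)
  then show "emeasure \<mu> A = emeasure \<nu> A"
    using m n r[OF B] N by (cases "None \<in> A") auto
qed

lemma scaled_restr_augment:
  fixes m0 :: "'a::euclidean_space measure"
  assumes b: "b > 0" and R: "R > 0" and m0: "m0 \<in> fin_measures" and le: "measure m0 UNIV \<le> R"
  defines "\<mu>0 \<equiv> scale_measure (ennreal (inverse R)) (augment b R m0)"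
  shows "sets \<mu>0 = sets (star_borel b)" "prob_space \<mu>0" "scaled_restr R \<mu>0 = m0"
proof -
  note m = fin_measuresD[OF m0]
  show s: "sets \<mu>0 = sets (star_borel b)"
    using sets.sigma_sets_eq[of "star_borel b :: 'a option measure"]
    by (simp add: \<mu>0_def augment_def)
  then have sp: "space \<mu>0 = UNIV" using sets_eq_imp_space_eq[OF s] by simp
  have e: "emeasure \<mu>0 U = ennreal (inverse R) * (emeasure m0 (Some -` U) + ennreal (R - measure m0 UNIV) * indicator U None)"
    if "U \<in> sets (star_borel b)" for U
    using emeasure_augment[OF b m(2) that] by (simp add: \<mu>0_def)
  have mm: "emeasure m0 UNIV = ennreal (measure m0 UNIV)"
    using m finite_measure.emeasure_eq_measure by metis
  have "emeasure \<mu>0 UNIV = 1"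
    using e[of UNIV] sets.top[of "star_borel b :: 'a option measure"] le R
    by (simp add: mm ennreal_plus[symmetric] ennreal_mult''[symmetric] del: ennreal_plus)
  then show "prob_space \<mu>0" by (intro prob_spaceI) (simp add: sp)
  show "scaled_restr R \<mu>0 = m0"
  proof (rule measure_eqI)
    show "sets (scaled_restr R \<mu>0) = sets m0" by (simp add: scaled_restr_def m)
    fix A assume "A \<in> sets (scaled_restr R \<mu>0)"
    then have A: "A \<in> sets borel" by (simp add: scaled_restr_def)
    then have S: "Some ` A \<in> sets (star_borel b)"
      using sets_star_borel_iff[OF b, of "Some ` A"] by (simp only: inj_vimage_image_eq[OF inj_Some])
    have "emeasure (scaled_restr R \<mu>0) A = ennreal R * (ennreal (inverse R) * emeasure m0 A)"
      using emeasure_restr[OF b s A] e[OF S] by (simp add: scaled_restr_def inj_vimage_image_eq)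
    also have "\<dots> = emeasure m0 A"
      using R by (simp add: mult.assoc[symmetric] ennreal_mult''[symmetric])
    finally show "emeasure (scaled_restr R \<mu>0) A = emeasure m0 A" .
  qed
qed

section \<open>The transport metric\<close>

lemma fin_measures_integrable:
  fixes \<Psi> :: "'a::euclidean_space \<Rightarrow> real"
  assumes "m \<in> fin_measures" "\<Psi> \<in> borel_measurable borel" "\<And>x. \<bar>\<Psi> x\<bar> \<le> A"
  shows "integrable m \<Psi>"
proof -
  interpret finite_measure m using fin_measuresD[OF assms(1)] by simp
  show ?thesis
    by (rule integrable_const_bound[where B = A])
       (use assms fin_measuresD[OF assms(1)] in \<open>auto cong: measurable_cong_sets\<close>)
qed

lemma fin_measures_integral_bound:
  fixes \<Psi> :: "'a::euclidean_space \<Rightarrow> real"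
  assumes m: "m \<in> fin_measures" and "\<And>x. \<bar>\<Psi> x\<bar> \<le> A"
  shows "\<bar>\<integral>x. \<Psi> x \<partial>m\<bar> \<le> A * measure m UNIV"
proof (cases "integrable m \<Psi>")
  case True
  interpret finite_measure m using fin_measuresD[OF m] by simp
  have "\<bar>\<integral>x. \<Psi> x \<partial>m\<bar> \<le> (\<integral>x. \<bar>\<Psi> x\<bar> \<partial>m)" by (rule integral_abs_bound)
  also have "\<dots> \<le> (\<integral>x. A \<partial>m)"
    by (rule integral_mono) (use assms True in \<open>auto simp: emeasure_finite\<close>)
  also have "\<dots> = A * measure m UNIV" using fin_measuresD[OF m] by simp
  finally show ?thesis .
next
  case False
  have "0 \<le> A" using assms(2)[of undefined] by linarith
  then show ?thesis using False by (simp add: not_integrable_integral_eq)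
qed

lemma prw_dist_le:
  assumes "(n1, n2, w) \<in> prw_plans m1 m2" "c \<ge> 0"
    and "ennreal (b * (measure m1 UNIV - measure n1 UNIV) + b * (measure m2 UNIV - measure n2 UNIV))
     + (\<integral>\<^sup>+ (x1, x2). ennreal (norm (x1 - x2)) \<partial>w) \<le> ennreal c"
  shows "prw_dist b m1 m2 \<le> c"
proof -
  have "(INF (n1, n2, w) \<in> prw_plans m1 m2.
     ennreal (b * (measure m1 UNIV - measure n1 UNIV) + b * (measure m2 UNIV - measure n2 UNIV))
     + (\<integral>\<^sup>+ (x1, x2). ennreal (norm (x1 - x2)) \<partial>w)) \<le> ennreal c"
    by (rule INF_lower2[OF assms(1)]) (use assms(3) in simp)
  then show ?thesis unfolding prw_dist_def using enn2real_mono[of _ "ennreal c"] assms(2) by fastforce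
qed

lemma prw_dist_nonneg: "0 \<le> prw_dist b m1 m2"
  by (simp add: prw_dist_def)

lemma prw_plans_null: "(null_measure borel, null_measure borel, null_measure (borel \<Otimes>\<^sub>M borel)) \<in> prw_plans m1 m2"
proof -
  have "distr (null_measure M) N h = null_measure N" if "h \<in> M \<rightarrow>\<^sub>M N" for h :: "'x \<Rightarrow> 'y" and M N
    by (rule measure_eqI) (use that in \<open>auto simp: emeasure_distr\<close>)
  then show ?thesis
    by (auto simp: prw_plans_def fin_measures_def intro!: finite_measureI)
qed

lemma measure_mono_fin_measures:
  assumes "n \<in> fin_measures" "m \<in> fin_measures" "\<And>A. A \<in> sets borel \<Longrightarrow> emeasure n A \<le> emeasure m A"
  shows "measure n UNIV \<le> measure m UNIV"
  using assms(3)[of UNIV] fin_measuresD(1)[OF assms(2)]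
  by (simp add: measure_def finite_measure.finite_emeasure_space enn2real_mono finite_measure.emeasure_finite less_top[symmetric])

text \<open>The null plan has finite cost, so the infimum is finite and its real value is approached by plans of
  finite cost.\<close>

lemma prw_dist_near_optimal:
  fixes m1 m2 :: "'a::euclidean_space measure"
  assumes b: "b > 0" and m: "m1 \<in> fin_measures" "m2 \<in> fin_measures" and \<delta>: "\<delta> > 0"
  obtains n1 n2 w where "(n1, n2, w) \<in> prw_plans m1 m2" "integrable w (\<lambda>p. norm (fst p - snd p))"
    "b * (measure m1 UNIV - measure n1 UNIV) + b * (measure m2 UNIV - measure n2 UNIV)
      + (\<integral>p. norm (fst p - snd p) \<partial>w) < prw_dist b m1 m2 + \<delta>"
proof -
  let ?c = "\<lambda>(n1 :: 'a measure, n2 :: 'a measure, w :: ('a \<times> 'a) measure). ennreal (b * (measure m1 UNIV - measure n1 UNIV) + b * (measure m2 UNIV - measure n2 UNIV))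
     + (\<integral>\<^sup>+ (x1, x2). ennreal (norm (x1 - x2)) \<partial>w)"
  let ?I = "INF q \<in> prw_plans m1 m2. ?c q"
  have "?I \<le> ?c (null_measure borel, null_measure borel, null_measure (borel \<Otimes>\<^sub>M borel))"
    by (rule INF_lower[where f = ?c, OF prw_plans_null])
  also have "\<dots> < \<top>" by (simp add: less_top[symmetric])
  finally have "ennreal (prw_dist b m1 m2) = ?I" unfolding prw_dist_def by (simp add: less_top)
  moreover have "ennreal (prw_dist b m1 m2) < ennreal (prw_dist b m1 m2 + \<delta>)"
    using \<delta> prw_dist_nonneg[of b m1 m2] by (simp add: ennreal_less_iff)
  ultimately obtain q where q: "q \<in> prw_plans m1 m2" "?c q < ennreal (prw_dist b m1 m2 + \<delta>)"
    by (metis (no_types, lifting) INF_less_iff)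
  obtain n1 n2 w where qq: "q = (n1, n2, w)" by (cases q) auto
  have p: "(n1, n2, w) \<in> prw_plans m1 m2" using q(1) qq by simp
  then have n: "n1 \<in> fin_measures" "n2 \<in> fin_measures" "sets w = sets (borel \<Otimes>\<^sub>M borel)"
    "measure n1 UNIV \<le> measure m1 UNIV" "measure n2 UNIV \<le> measure m2 UNIV"
    using m measure_mono_fin_measures[of n1 m1] measure_mono_fin_measures[of n2 m2] by (auto simp: prw_plans_def)
  let ?r = "b * (measure m1 UNIV - measure n1 UNIV) + b * (measure m2 UNIV - measure n2 UNIV)"
  have r: "0 \<le> ?r" using n b by simp
  have c: "ennreal ?r + (\<integral>\<^sup>+ p. ennreal (norm (fst p - snd p)) \<partial>w) < ennreal (prw_dist b m1 m2 + \<delta>)"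
    using q(2) qq by (simp add: case_prod_beta')
  have me: "(\<lambda>p. norm (fst p - snd p)) \<in> borel_measurable w"
    unfolding measurable_cong_sets[OF n(3) refl] by measurable
  have fin: "(\<integral>\<^sup>+ p. ennreal (norm (fst p - snd p)) \<partial>w) < \<infinity>"
  proof -
    have "(\<integral>\<^sup>+ p. ennreal (norm (fst p - snd p)) \<partial>w) \<le> ennreal ?r + (\<integral>\<^sup>+ p. ennreal (norm (fst p - snd p)) \<partial>w)"
      by (simp add: add_increasing)
    also note c
    finally show ?thesis using less_trans[OF _ ennreal_less_top] by (simp add: less_top)
  qed
  have i: "integrable w (\<lambda>p. norm (fst p - snd p))"
    by (rule integrableI_bounded) (use me fin in auto)
  have "(\<integral>\<^sup>+ p. ennreal (norm (fst p - snd p)) \<partial>w) = ennreal (\<integral>p. norm (fst p - snd p) \<partial>w)"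
    by (rule nn_integral_eq_integral[OF i]) auto
  then have "ennreal (?r + (\<integral>p. norm (fst p - snd p) \<partial>w)) < ennreal (prw_dist b m1 m2 + \<delta>)"
    using c r by (simp add: ennreal_plus)
  then have "?r + (\<integral>p. norm (fst p - snd p) \<partial>w) < prw_dist b m1 m2 + \<delta>"
    using r by (subst (asm) ennreal_less_iff) auto
  then show thesis using that p i by blast
qed

lemma integral_diff_submeasure:
  fixes \<Psi> :: "'a::euclidean_space \<Rightarrow> real"
  assumes n: "n \<in> fin_measures" and m: "m \<in> fin_measures"
    and le: "\<And>A. A \<in> sets borel \<Longrightarrow> emeasure n A \<le> emeasure m A"
    and \<Psi>: "\<Psi> \<in> borel_measurable borel" "\<And>x. \<bar>\<Psi> x\<bar> \<le> A"
  shows "\<bar>(\<integral>x. \<Psi> x \<partial>m) - (\<integral>x. \<Psi> x \<partial>n)\<bar> \<le> A * (measure m UNIV - measure n UNIV)"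
proof -
  have s: "sets n = sets m" using n m by (simp add: fin_measures_def)
  have "n \<le> m" using le fin_measuresD[OF n] fin_measuresD[OF m] by (subst le_measure) auto
  have one: "(\<integral>x. \<Phi> x \<partial>m) - (\<integral>x. \<Phi> x \<partial>n) \<le> A * (measure m UNIV - measure n UNIV)"
    if \<Phi>: "\<Phi> \<in> borel_measurable borel" "\<And>x. \<bar>\<Phi> x\<bar> \<le> A" for \<Phi>
  proof -
    have i: "integrable k \<Phi>" "integrable k (\<lambda>_. A)" "(\<integral>x. A - \<Phi> x \<partial>k) = A * measure k UNIV - (\<integral>x. \<Phi> x \<partial>k)"
      if k: "k \<in> fin_measures" for k
    proof -
      interpret finite_measure k using fin_measuresD[OF k] by simp
      show i: "integrable k \<Phi>" using fin_measures_integrable[OF k \<Phi>] .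
      show "integrable k (\<lambda>_. A)" by simp
      show "(\<integral>x. A - \<Phi> x \<partial>k) = A * measure k UNIV - (\<integral>x. \<Phi> x \<partial>k)"
        using i fin_measuresD[OF k] by simp
    qed
    have nn: "0 \<le> A - \<Phi> x" for x using \<Phi>(2)[of x] by linarith
    have e: "ennreal (\<integral>x. A - \<Phi> x \<partial>k) = (\<integral>\<^sup>+x. ennreal (A - \<Phi> x) \<partial>k)" if k: "k \<in> fin_measures" for k
      by (rule nn_integral_eq_integral[symmetric]) (use i[OF k] nn in auto)
    have "ennreal (\<integral>x. A - \<Phi> x \<partial>n) \<le> ennreal (\<integral>x. A - \<Phi> x \<partial>m)"
      unfolding e[OF n] e[OF m] by (rule nn_integral_mono_measure[OF s \<open>n \<le> m\<close>])
    moreover have "0 \<le> (\<integral>x. A - \<Phi> x \<partial>m)" by (rule Bochner_Integration.integral_nonneg) (use nn in auto)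
    ultimately have "(\<integral>x. A - \<Phi> x \<partial>n) \<le> (\<integral>x. A - \<Phi> x \<partial>m)" by simp
    then show ?thesis unfolding i(3)[OF n] i(3)[OF m] by (simp add: algebra_simps)
  qed
  from one[OF \<Psi>] one[of "\<lambda>x. - \<Psi> x"] \<Psi> show ?thesis by (simp add: abs_le_iff)
qed

text \<open>The easy half of the duality for the transport metric, with a slack \<open>\<epsilon>\<close> in the Lipschitz bound so
  that it also covers integrands that are merely uniformly continuous.\<close>

lemma integral_diff_le_prw_dist:
  fixes \<Psi> :: "'a::euclidean_space \<Rightarrow> real"
  assumes b: "b > 0" and m: "m1 \<in> fin_measures" "m2 \<in> fin_measures"
    and \<Psi>: "\<Psi> \<in> borel_measurable borel" "\<And>x. \<bar>\<Psi> x\<bar> \<le> A"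
    and mod: "\<And>x y. \<bar>\<Psi> x - \<Psi> y\<bar> \<le> \<epsilon> + K * norm (x - y)" and pos: "\<epsilon> \<ge> 0" "K \<ge> 0"
  shows "\<bar>(\<integral>x. \<Psi> x \<partial>m1) - (\<integral>x. \<Psi> x \<partial>m2)\<bar> \<le> \<epsilon> * measure m1 UNIV + (K + A / b) * prw_dist b m1 m2"
proof -
  have A: "A \<ge> 0" using \<Psi>(2)[of undefined] by linarith
  have main: "\<bar>(\<integral>x. \<Psi> x \<partial>m1) - (\<integral>x. \<Psi> x \<partial>m2)\<bar> \<le> \<epsilon> * measure m1 UNIV + (K + A / b) * (prw_dist b m1 m2 + \<delta>)"
    if \<delta>: "\<delta> > 0" for \<delta>
  proof -
    obtain n1 n2 w where p: "(n1, n2, w) \<in> prw_plans m1 m2" and i: "integrable w (\<lambda>p. norm (fst p - snd p))"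
      and c: "b * (measure m1 UNIV - measure n1 UNIV) + b * (measure m2 UNIV - measure n2 UNIV)
      + (\<integral>p. norm (fst p - snd p) \<partial>w) < prw_dist b m1 m2 + \<delta>"
      using prw_dist_near_optimal[OF b m \<delta>] .
    have n: "n1 \<in> fin_measures" "n2 \<in> fin_measures" and sw: "sets w = sets (borel \<Otimes>\<^sub>M borel)"
      and le: "\<And>A. A \<in> sets borel \<Longrightarrow> emeasure n1 A \<le> emeasure m1 A" "\<And>A. A \<in> sets borel \<Longrightarrow> emeasure n2 A \<le> emeasure m2 A"
      and d: "distr w borel fst = n1" "distr w borel snd = n2"
      using p by (auto simp: prw_plans_def)
    have f: "fst \<in> borel_measurable w" "snd \<in> borel_measurable w"
      unfolding measurable_cong_sets[OF sw refl] by measurable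
    have spw: "space w = UNIV" using sets_eq_imp_space_eq[OF sw] by (simp add: space_pair_measure)
    have mw: "emeasure w UNIV = emeasure n1 UNIV"
      using d(1) f spw emeasure_distr[OF f(1), of UNIV] by simp
    interpret w: finite_measure w
      using fin_measuresD[OF n(1)] mw spw by (intro finite_measureI) (simp add: finite_measure.emeasure_finite)
    have mw': "measure w UNIV = measure n1 UNIV" using mw by (simp add: measure_def)
    have i1: "integrable w (\<lambda>p. \<Psi> (fst p))" and i2: "integrable w (\<lambda>p. \<Psi> (snd p))"
      using \<Psi> f by (auto intro!: w.integrable_const_bound[where B = A])
    have e1: "(\<integral>x. \<Psi> x \<partial>n1) = (\<integral>p. \<Psi> (fst p) \<partial>w)" and e2: "(\<integral>x. \<Psi> x \<partial>n2) = (\<integral>p. \<Psi> (snd p) \<partial>w)"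
      using d integral_distr[OF f(1) \<Psi>(1)] integral_distr[OF f(2) \<Psi>(1)] by auto
    have "\<bar>(\<integral>x. \<Psi> x \<partial>n1) - (\<integral>x. \<Psi> x \<partial>n2)\<bar> = \<bar>\<integral>p. \<Psi> (fst p) - \<Psi> (snd p) \<partial>w\<bar>"
      using i1 i2 e1 e2 by simp
    also have "\<dots> \<le> (\<integral>p. \<bar>\<Psi> (fst p) - \<Psi> (snd p)\<bar> \<partial>w)" by (rule integral_abs_bound)
    also have "\<dots> \<le> (\<integral>p. \<epsilon> + K * norm (fst p - snd p) \<partial>w)"
      by (rule integral_mono) (use i1 i2 i mod in auto)
    also have "\<dots> = \<epsilon> * measure n1 UNIV + K * (\<integral>p. norm (fst p - snd p) \<partial>w)"
      using i spw mw' by simp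
    finally have 1: "\<bar>(\<integral>x. \<Psi> x \<partial>n1) - (\<integral>x. \<Psi> x \<partial>n2)\<bar> \<le> \<epsilon> * measure n1 UNIV + K * (\<integral>p. norm (fst p - snd p) \<partial>w)" .
    have nm: "measure n1 UNIV \<le> measure m1 UNIV" "measure n2 UNIV \<le> measure m2 UNIV"
      using measure_mono_fin_measures n m le by blast+
    let ?J = "\<integral>p. norm (fst p - snd p) \<partial>w" and ?D = "(measure m1 UNIV - measure n1 UNIV) + (measure m2 UNIV - measure n2 UNIV)"
    have J: "?J \<ge> 0" by simp
    have D: "?D \<ge> 0" using nm by simp
    have c': "b * ?D + ?J < prw_dist b m1 m2 + \<delta>" using c by (simp add: algebra_simps)
    have "b * ?D \<le> prw_dist b m1 m2 + \<delta>" using c' J by linarith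
    then have "?D \<le> (prw_dist b m1 m2 + \<delta>) / b" using b by (simp add: pos_le_divide_eq mult.commute)
    then have t1: "A * ?D \<le> A / b * (prw_dist b m1 m2 + \<delta>)"
      using mult_left_mono[of ?D "(prw_dist b m1 m2 + \<delta>) / b" A] A by simp
    have "b * ?D \<ge> 0" using D b by simp
    then have "?J \<le> prw_dist b m1 m2 + \<delta>" using c' by linarith
    then have t2: "K * ?J \<le> K * (prw_dist b m1 m2 + \<delta>)" using pos mult_left_mono by blast
    have t3: "\<epsilon> * measure n1 UNIV \<le> \<epsilon> * measure m1 UNIV" using nm pos by (simp add: mult_left_mono)
    have "\<bar>(\<integral>x. \<Psi> x \<partial>m1) - (\<integral>x. \<Psi> x \<partial>m2)\<bar> \<le> A * ?D + (\<epsilon> * measure n1 UNIV + K * ?J)"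
      using integral_diff_submeasure[OF n(1) m(1) le(1) \<Psi>] integral_diff_submeasure[OF n(2) m(2) le(2) \<Psi>] 1
      unfolding distrib_left by linarith
    then show ?thesis using t1 t2 t3 by (simp add: distrib_right)
  qed
  show ?thesis
  proof (rule field_le_epsilon)
    fix e :: real assume e: "e > 0"
    have k: "K + A / b \<ge> 0" using pos A b by simp
    have "(K + A / b) * (e / (K + A / b + 1)) \<le> e"
      using k e by (simp add: field_simps)
    then show "\<bar>(\<integral>x. \<Psi> x \<partial>m1) - (\<integral>x. \<Psi> x \<partial>m2)\<bar> \<le> \<epsilon> * measure m1 UNIV + (K + A / b) * prw_dist b m1 m2 + e"
      using main[of "e / (K + A / b + 1)"] e k by (simp add: distrib_left add_nonneg_pos)
  qed
qed

lemma mass_diff_le_prw_dist: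
  assumes b: "b > 0" and m: "m1 \<in> fin_measures" "m2 \<in> fin_measures"
  shows "\<bar>measure m1 UNIV - measure m2 UNIV\<bar> \<le> prw_dist b m1 m2 / b"
  using integral_diff_le_prw_dist[OF b m, of "\<lambda>_. 1" 1 0 0] fin_measuresD[OF m(1)] fin_measuresD[OF m(2)] by simp

lemma W1_star_le:
  assumes "sets w = sets (star_borel b \<Otimes>\<^sub>M star_borel b)" "distr w (star_borel b) fst = \<mu>" "distr w (star_borel b) snd = \<nu>"
    and "(\<integral>\<^sup>+ (x, y). ennreal (rho_star b x y) \<partial>w) \<le> ennreal c" "c \<ge> 0"
  shows "W1_star b \<mu> \<nu> \<le> c"
proof -
  have "(INF w \<in> {w. sets w = sets (star_borel b \<Otimes>\<^sub>M star_borel b) \<and>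
       distr w (star_borel b) fst = \<mu> \<and> distr w (star_borel b) snd = \<nu>}.
     \<integral>\<^sup>+ (x, y). ennreal (rho_star b x y) \<partial>w) \<le> ennreal c"
    by (rule INF_lower2[of w]) (use assms in auto)
  then show ?thesis unfolding W1_star_def using enn2real_mono[of _ "ennreal c"] assms(5) by fastforce
qed

lemma rho_star_the:
  "rho_star b x y = (if x = None then (if y = None then 0 else b)
     else if y = None then b else min (norm (the x - the y)) (2 * b))"
  by (cases x; cases y) auto

lemma measurable_star_fns:
  assumes b: "b > 0" and sw: "sets w = sets (star_borel b \<Otimes>\<^sub>M star_borel b)"
  shows "fst \<in> w \<rightarrow>\<^sub>M star_borel b" "snd \<in> w \<rightarrow>\<^sub>M star_borel b"
    "(\<lambda>p. the (fst p)) \<in> w \<rightarrow>\<^sub>M borel" "(\<lambda>p. the (snd p)) \<in> w \<rightarrow>\<^sub>M borel"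
    "Measurable.pred w (\<lambda>p. fst p = None)" "Measurable.pred w (\<lambda>p. snd p = None)"
proof -
  show f: "fst \<in> w \<rightarrow>\<^sub>M star_borel b" "snd \<in> w \<rightarrow>\<^sub>M star_borel b"
    unfolding measurable_cong_sets[OF sw refl] by measurable
  show "(\<lambda>p. the (fst p)) \<in> w \<rightarrow>\<^sub>M borel" "(\<lambda>p. the (snd p)) \<in> w \<rightarrow>\<^sub>M borel"
    using measurable_compose[OF f(1) measurable_the_star[OF b]] measurable_compose[OF f(2) measurable_the_star[OF b]] by auto
  have N: "Measurable.pred (star_borel b) (\<lambda>x. x = None)"
    using sets_star_None(1)[OF b] by (simp add: pred_def)
  show "Measurable.pred w (\<lambda>p. fst p = None)" "Measurable.pred w (\<lambda>p. snd p = None)"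
    using measurable_compose[OF f(1) N] measurable_compose[OF f(2) N] by auto
qed

lemma measurable_rho_star:
  assumes b: "b > 0" and sw: "sets w = sets (star_borel b \<Otimes>\<^sub>M star_borel b)"
  shows "(\<lambda>p. rho_star b (fst p) (snd p)) \<in> borel_measurable w"
  using measurable_star_fns[OF b sw, measurable] unfolding rho_star_the by measurable

lemma rho_star_bounds:
  assumes "b > 0"
  shows "0 \<le> rho_star b x y" "rho_star b x y \<le> 2 * b"
  using assms by (auto simp: rho_star_the)

lemma abs_rho_star_le: "b > 0 \<Longrightarrow> \<bar>rho_star b x y\<bar> \<le> 2 * b"
  using rho_star_bounds[of b x y] by simp

text \<open>The product coupling exists and the augmented metric is bounded, so the infimum is finite; without a
  coupling the real value of the infimum would be \<open>0\<close>.\<close>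

lemma W1_star_near_optimal:
  fixes \<mu> \<nu> :: "'a::euclidean_space option measure"
  assumes b: "b > 0" and m: "sets \<mu> = sets (star_borel b)" "prob_space \<mu>"
    and n: "sets \<nu> = sets (star_borel b)" "prob_space \<nu>" and \<delta>: "\<delta> > 0"
  obtains w where "sets w = sets (star_borel b \<Otimes>\<^sub>M star_borel b)" "distr w (star_borel b) fst = \<mu>"
    "distr w (star_borel b) snd = \<nu>" "prob_space w"
    "(\<integral>p. rho_star b (fst p) (snd p) \<partial>w) < W1_star b \<mu> \<nu> + \<delta>"
proof -
  let ?P = "{w. sets w = sets (star_borel b \<Otimes>\<^sub>M star_borel b) \<and>
       distr w (star_borel b) fst = \<mu> \<and> distr w (star_borel b) snd = \<nu>}"
  let ?c = "\<lambda>w :: ('a option \<times> 'a option) measure. \<integral>\<^sup>+ (x, y). ennreal (rho_star b x y) \<partial>w"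
  have prob: "prob_space w" if w: "w \<in> ?P" for w
  proof -
    have "emeasure w (space w) = emeasure \<mu> UNIV"
      using w emeasure_distr[OF measurable_star_fns(1)[OF b, of w], of UNIV] sets.top[of "star_borel b :: 'a option measure"]
      by auto
    then show ?thesis
      using prob_space.emeasure_space_1[OF m(2)] sets_eq_imp_space_eq[OF m(1)] by (intro prob_spaceI) simp
  qed
  have real: "?c w = ennreal (\<integral>p. rho_star b (fst p) (snd p) \<partial>w)" if w: "w \<in> ?P" for w
  proof -
    interpret prob_space w using prob[OF w] .
    have "integrable w (\<lambda>p. rho_star b (fst p) (snd p))"
      by (rule integrable_const_bound[where B = "2 * b"])
         (use abs_rho_star_le[OF b] measurable_rho_star[OF b, of w] w in auto)
    then show ?thesis
      using nn_integral_eq_integral[of w "\<lambda>p. rho_star b (fst p) (snd p)"] 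
      by (simp add: case_prod_beta' rho_star_bounds(1)[OF b])
  qed
  interpret m: prob_space \<mu> by fact
  interpret n: prob_space \<nu> by fact
  interpret pair_prob_space \<mu> \<nu> ..
  have "distr (\<mu> \<Otimes>\<^sub>M \<nu>) (star_borel b) fst = distr (\<mu> \<Otimes>\<^sub>M \<nu>) \<mu> fst"
    "distr (\<mu> \<Otimes>\<^sub>M \<nu>) (star_borel b) snd = distr (\<mu> \<Otimes>\<^sub>M \<nu>) \<nu> snd"
    by (rule distr_cong; simp add: m n)+
  moreover have "distr (\<mu> \<Otimes>\<^sub>M \<nu>) \<nu> snd = \<nu>"
  proof (rule measure_eqI)
    fix A assume A: "A \<in> sets (distr (\<mu> \<Otimes>\<^sub>M \<nu>) \<nu> snd)"
    have "emeasure (distr (\<mu> \<Otimes>\<^sub>M \<nu>) \<nu> snd) A = emeasure (\<mu> \<Otimes>\<^sub>M \<nu>) (space \<mu> \<times> A)"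
      using A by (auto simp: emeasure_distr space_pair_measure dest: sets.sets_into_space intro!: arg_cong2[where f = emeasure])
    then show "emeasure (distr (\<mu> \<Otimes>\<^sub>M \<nu>) \<nu> snd) A = emeasure \<nu> A"
      using A by (simp add: n.emeasure_pair_measure_Times m.emeasure_space_1)
  qed simp
  ultimately have prodP: "\<mu> \<Otimes>\<^sub>M \<nu> \<in> ?P"
    using n.distr_pair_fst[of \<mu>] m n by (simp cong: sets_pair_measure_cong)
  have "(INF w \<in> ?P. ?c w) \<le> ?c (\<mu> \<Otimes>\<^sub>M \<nu>)" by (rule INF_lower[OF prodP])
  also have "\<dots> < \<top>" using real[OF prodP] by simp
  finally have "ennreal (W1_star b \<mu> \<nu>) = (INF w \<in> ?P. ?c w)" unfolding W1_star_def by (simp add: less_top)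
  moreover have "0 \<le> W1_star b \<mu> \<nu>" by (simp add: W1_star_def)
  then have "ennreal (W1_star b \<mu> \<nu>) < ennreal (W1_star b \<mu> \<nu> + \<delta>)"
    using \<delta> by (simp add: ennreal_less_iff)
  ultimately obtain w where w: "w \<in> ?P" "?c w < ennreal (W1_star b \<mu> \<nu> + \<delta>)"
    by (metis (no_types, lifting) INF_less_iff)
  have "0 \<le> (\<integral>p. rho_star b (fst p) (snd p) \<partial>w)"
    by (rule Bochner_Integration.integral_nonneg) (use rho_star_bounds[OF b] in auto)
  then have "(\<integral>p. rho_star b (fst p) (snd p) \<partial>w) < W1_star b \<mu> \<nu> + \<delta>"
    using w(2) unfolding real[OF w(1)] by (simp add: ennreal_less_iff)
  then show thesis using that[of w] w(1) prob[OF w(1)] by blast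
qed

text \<open>A coupling on the augmented space becomes an admissible plan when only the pairs of points of
  the original space at distance less than \<open>2b\<close> are kept: a discarded point costs \<open>b\<close>, so a pair with the
  remote point costs \<open>b\<close> and a distant pair costs \<open>2b\<close>, exactly as for the augmented metric.\<close>

lemma prw_dist_scaled_restr_le:
  fixes \<mu> \<nu> :: "'a::euclidean_space option measure"
  assumes b: "b > 0" and R: "R > 0" and m: "sets \<mu> = sets (star_borel b)" "prob_space \<mu>"
    and n: "sets \<nu> = sets (star_borel b)" "prob_space \<nu>"
  shows "prw_dist b (scaled_restr R \<mu>) (scaled_restr R \<nu>) \<le> R * W1_star b \<mu> \<nu>"
proof -
  have main: "prw_dist b (scaled_restr R \<mu>) (scaled_restr R \<nu>) \<le> R * (\<integral>p. rho_star b (fst p) (snd p) \<partial>W)"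
    if sW: "sets W = sets (star_borel b \<Otimes>\<^sub>M star_borel b)" and d: "distr W (star_borel b) fst = \<mu>"
    "distr W (star_borel b) snd = \<nu>" and pW: "prob_space W" for W
  proof -
    interpret prob_space W by fact
    note [measurable] = measurable_star_fns[OF b sW]
    have spW: "space W = UNIV" using sets_eq_imp_space_eq[OF sW] by (simp add: space_pair_measure)
    \<comment> \<open>The pairs that the plan keeps.\<close>
    define S where "S p \<longleftrightarrow> fst p \<noteq> None \<and> snd p \<noteq> None \<and> norm (the (fst p) - the (snd p)) < 2 * b"
      for p :: "'a option \<times> 'a option"
    have S[measurable]: "Measurable.pred W S" unfolding S_def by measurable
    define V where "V = density W (\<lambda>p. ennreal (R * of_bool (S p)))"
    have [measurable_cong, simp]: "sets V = sets W" "space V = UNIV" by (simp_all add: V_def spW)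
    define h where "h p = (the (fst p), the (snd p))" for p :: "'a option \<times> 'a option"
    have h[measurable]: "h \<in> W \<rightarrow>\<^sub>M borel \<Otimes>\<^sub>M borel" unfolding h_def by measurable
    have h': "h \<in> V \<rightarrow>\<^sub>M borel \<Otimes>\<^sub>M borel" by measurable
    define w where "w = distr V (borel \<Otimes>\<^sub>M borel) h"
    define n1 where "n1 = distr w borel fst"
    define n2 where "n2 = distr w borel snd"
    have n1: "n1 = distr V borel (\<lambda>p. the (fst p))" and n2: "n2 = distr V borel (\<lambda>p. the (snd p))"
      unfolding n1_def n2_def w_def by (subst distr_distr[OF _ h'], simp, simp add: o_def h_def)+
    have V: "emeasure V A = (\<integral>\<^sup>+p. ennreal (R * of_bool (S p)) * indicator A p \<partial>W)" if "A \<in> sets W" for A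
      unfolding V_def using that by (subst emeasure_density) auto
    have VU: "emeasure V UNIV = ennreal (R * measure W {p. S p})"
    proof -
      have "emeasure V UNIV = (\<integral>\<^sup>+p. ennreal (R * indicator {p. S p} p) \<partial>W)"
        using V[of UNIV] spW sets.top[of W] by (auto simp: indicator_def intro!: nn_integral_cong)
      also have "\<dots> = (\<integral>\<^sup>+p. ennreal R * indicator {p. S p} p \<partial>W)"
        by (auto intro!: nn_integral_cong simp: indicator_def)
      also have "\<dots> = ennreal R * emeasure W {p. S p}"
        using predE[OF S] spW by (intro nn_integral_cmult_indicator) simp
      finally show ?thesis using R by (simp add: emeasure_eq_measure ennreal_mult'')
    qed
    have N1: "emeasure n1 A = emeasure V {p. the (fst p) \<in> A}" if "A \<in> sets borel" for A
      unfolding n1 using that by (subst emeasure_distr) (auto simp: vimage_def)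
    have N2: "emeasure n2 A = emeasure V {p. the (snd p) \<in> A}" if "A \<in> sets borel" for A
      unfolding n2 using that by (subst emeasure_distr) (auto simp: vimage_def)
    have NU: "emeasure n1 UNIV = emeasure V UNIV" "emeasure n2 UNIV = emeasure V UNIV"
      using N1[of UNIV] N2[of UNIV] by simp_all
    have fin: "n1 \<in> fin_measures" "n2 \<in> fin_measures"
      using NU VU by (auto simp: fin_measures_def n1 n2 intro!: finite_measureI)
    have M: "emeasure (scaled_restr R \<mu>) A = (\<integral>\<^sup>+p. ennreal (R * of_bool (fst p \<in> Some ` A)) \<partial>W)"
            "emeasure (scaled_restr R \<nu>) A = (\<integral>\<^sup>+p. ennreal (R * of_bool (snd p \<in> Some ` A)) \<partial>W)"
      if A: "A \<in> sets borel" for A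
    proof -
      have SA: "Some ` A \<in> sets (star_borel b)"
        using sets_star_borel_iff[OF b, of "Some ` A"] A by (simp only: inj_vimage_image_eq[OF inj_Some])
      have f: "fst -` (Some ` A) \<in> sets W" "snd -` (Some ` A) \<in> sets W"
        using measurable_sets[OF measurable_star_fns(1)[OF b sW] SA] measurable_sets[OF measurable_star_fns(2)[OF b sW] SA] spW by auto
      have g: "(\<integral>\<^sup>+p. ennreal (R * of_bool (u p \<in> Some ` A)) \<partial>W) = ennreal R * emeasure W (u -` Some ` A)"
        if "u -` Some ` A \<in> sets W" for u :: "'a option \<times> 'a option \<Rightarrow> 'a option"
        using R by (subst nn_integral_cmult_indicator[OF that, symmetric])
                   (auto intro!: nn_integral_cong simp: indicator_def ennreal_mult'')
      have "emeasure \<mu> (Some ` A) = emeasure W (fst -` Some ` A)" "emeasure \<nu> (Some ` A) = emeasure W (snd -` Some ` A)"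
        using d emeasure_distr[OF measurable_star_fns(1)[OF b sW] SA] emeasure_distr[OF measurable_star_fns(2)[OF b sW] SA] spW
        by auto
      then show "emeasure (scaled_restr R \<mu>) A = (\<integral>\<^sup>+p. ennreal (R * of_bool (fst p \<in> Some ` A)) \<partial>W)"
            "emeasure (scaled_restr R \<nu>) A = (\<integral>\<^sup>+p. ennreal (R * of_bool (snd p \<in> Some ` A)) \<partial>W)"
        unfolding g[OF f(1)] g[OF f(2)]
        by (simp_all add: scaled_restr_def emeasure_restr[OF b m(1) A] emeasure_restr[OF b n(1) A])
    qed
    have le: "emeasure n1 A \<le> emeasure (scaled_restr R \<mu>) A" "emeasure n2 A \<le> emeasure (scaled_restr R \<nu>) A"
      if A: "A \<in> sets borel" for A
    proof -
      have "{p. the (fst p) \<in> A} \<in> sets W" "{p. the (snd p) \<in> A} \<in> sets W"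
        using measurable_sets[OF measurable_star_fns(3)[OF b sW] A] measurable_sets[OF measurable_star_fns(4)[OF b sW] A] spW
        by (auto simp: vimage_def)
      then show "emeasure n1 A \<le> emeasure (scaled_restr R \<mu>) A" "emeasure n2 A \<le> emeasure (scaled_restr R \<nu>) A"
        unfolding N1[OF A] N2[OF A] M[OF A] by (simp_all add: V) (rule nn_integral_mono; use R in \<open>force simp: indicator_def S_def\<close>)+
    qed
    have plan: "(n1, n2, w) \<in> prw_plans (scaled_restr R \<mu>) (scaled_restr R \<nu>)"
      unfolding prw_plans_def mem_Collect_eq prod.case
    proof (intro conjI)
      show "measure n1 UNIV = measure n2 UNIV" using NU by (simp add: measure_def)
      show "sets w = sets (borel \<Otimes>\<^sub>M borel)" by (simp add: w_def)
    qed (use fin le n1_def n2_def in blast)+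
    have mn: "measure n1 UNIV = R * measure W {p. S p}" "measure n2 UNIV = R * measure W {p. S p}"
      using NU VU R by (auto simp: measure_def)
    have ib: "integrable W (\<lambda>p. of_bool (Q p) :: real)" if "Measurable.pred W Q" for Q
      by (rule integrable_const_bound[where B = 1]) (use that in auto)
    have mi: "(\<integral>p. of_bool (Q p) \<partial>W) = measure W {p. Q p}" if "Measurable.pred W Q" for Q
    proof -
      have "{p. Q p} \<in> sets W" using predE[OF that] spW by simp
      then have "(\<integral>p. indicator {p. Q p} p \<partial>W) = measure W {p. Q p}" by simp
      then show ?thesis by (simp add: indicator_def)
    qed
    have mM: "measure (scaled_restr R \<mu>) UNIV = R * measure W {p. fst p \<noteq> None}"
             "measure (scaled_restr R \<nu>) UNIV = R * measure W {p. snd p \<noteq> None}"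
    proof -
      have eq: "(\<integral>\<^sup>+p. ennreal (R * of_bool (u p \<in> range Some)) \<partial>W) = ennreal (R * measure W {p. u p \<noteq> None})"
        if "Measurable.pred W (\<lambda>p. u p = None)" for u :: "'a option \<times> 'a option \<Rightarrow> 'a option"
      proof -
        have [measurable]: "Measurable.pred W (\<lambda>p. u p \<noteq> None)" using that by measurable
        have "(\<integral>\<^sup>+p. ennreal (R * of_bool (u p \<in> range Some)) \<partial>W) = (\<integral>\<^sup>+p. ennreal (R * of_bool (u p \<noteq> None)) \<partial>W)"
          by (intro nn_integral_cong arg_cong[of _ _ "\<lambda>z. ennreal (R * of_bool z)"]) (auto simp: notin_range_Some)
        also have "\<dots> = ennreal (\<integral>p. R * of_bool (u p \<noteq> None) \<partial>W)"
          by (rule nn_integral_eq_integral)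
             (use R in \<open>auto intro!: integrable_mult_right ib simp del: not_None_eq\<close>)
        finally show ?thesis using mi[of "\<lambda>p. u p \<noteq> None"] by (simp del: not_None_eq)
      qed
      show "measure (scaled_restr R \<mu>) UNIV = R * measure W {p. fst p \<noteq> None}"
             "measure (scaled_restr R \<nu>) UNIV = R * measure W {p. snd p \<noteq> None}"
        using M[of UNIV] eq[of fst] eq[of snd] R by (simp_all add: measure_def)
    qed
    let ?N = "\<lambda>p :: 'a option \<times> 'a option. R * of_bool (S p) * norm (the (fst p) - the (snd p))"
    have iN: "integrable W ?N"
    proof (rule integrable_const_bound[where B = "R * (2 * b)"])
      show "AE p in W. norm (?N p) \<le> R * (2 * b)" using R b by (auto simp: S_def)
    qed measurable
    have cost: "(\<integral>\<^sup>+ (x1, x2). ennreal (norm (x1 - x2)) \<partial>w) = ennreal (\<integral>p. ?N p \<partial>W)"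
    proof -
      have "(\<integral>\<^sup>+ (x1, x2). ennreal (norm (x1 - x2)) \<partial>w) = (\<integral>\<^sup>+ p. ennreal (norm (the (fst p) - the (snd p))) \<partial>V)"
        unfolding w_def by (subst nn_integral_distr[OF h']) (auto simp: h_def split_beta)
      also have "\<dots> = (\<integral>\<^sup>+ p. ennreal (?N p) \<partial>W)"
        unfolding V_def using R by (subst nn_integral_density) (auto intro!: nn_integral_cong simp: ennreal_mult'')
      also have "\<dots> = ennreal (\<integral>p. ?N p \<partial>W)"
        by (rule nn_integral_eq_integral) (use iN R in auto)
      finally show ?thesis .
    qed
    let ?D = "b * (measure (scaled_restr R \<mu>) UNIV - measure n1 UNIV) + b * (measure (scaled_restr R \<nu>) UNIV - measure n2 UNIV)"
    have "R * (\<integral>p. rho_star b (fst p) (snd p) \<partial>W) = (\<integral>p. R * rho_star b (fst p) (snd p) \<partial>W)" by simp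
    also have "\<dots> = (\<integral>p. b * (R * of_bool (fst p \<noteq> None) - R * of_bool (S p)) + b * (R * of_bool (snd p \<noteq> None) - R * of_bool (S p)) + ?N p \<partial>W)"
      by (rule Bochner_Integration.integral_cong) (auto simp: rho_star_the S_def min_def)
    also have "\<dots> = ?D + (\<integral>p. ?N p \<partial>W)"
      unfolding mn mM using iN ib[of "\<lambda>p. fst p \<noteq> None"] ib[of "\<lambda>p. snd p \<noteq> None"] ib[of S]
        mi[of "\<lambda>p. fst p \<noteq> None"] mi[of "\<lambda>p. snd p \<noteq> None"] mi[of S]
      by (simp del: not_None_eq)
    finally have tot: "R * (\<integral>p. rho_star b (fst p) (snd p) \<partial>W) = ?D + (\<integral>p. ?N p \<partial>W)" .
    have D: "0 \<le> ?D"
    proof -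
      have sr: "scaled_restr R \<mu> \<in> fin_measures" "scaled_restr R \<nu> \<in> fin_measures"
        using scaled_restr_in_fin_measures[OF b] m n prob_space.finite_measure by blast+
      have "measure n1 UNIV \<le> measure (scaled_restr R \<mu>) UNIV" "measure n2 UNIV \<le> measure (scaled_restr R \<nu>) UNIV"
        using measure_mono_fin_measures fin sr le by blast+
      then show ?thesis using b by simp
    qed
    have N0: "0 \<le> (\<integral>p. ?N p \<partial>W)" by (rule Bochner_Integration.integral_nonneg) (use R in auto)
    show ?thesis
      by (rule prw_dist_le[OF plan]) (use D N0 in \<open>simp_all add: cost tot ennreal_plus[symmetric] del: ennreal_plus\<close>)
  qed
  show ?thesis
  proof (rule field_le_epsilon)
    fix e :: real assume e: "e > 0"
    obtain w where w: "sets w = sets (star_borel b \<Otimes>\<^sub>M star_borel b)" "distr w (star_borel b) fst = \<mu>"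
    "distr w (star_borel b) snd = \<nu>" "prob_space w"
    "(\<integral>p. rho_star b (fst p) (snd p) \<partial>w) < W1_star b \<mu> \<nu> + e / R"
      using W1_star_near_optimal[OF b m n, of "e / R"] e R by auto
    show "prw_dist b (scaled_restr R \<mu>) (scaled_restr R \<nu>) \<le> R * W1_star b \<mu> \<nu> + e"
      using main[OF w(1-4)] mult_strict_left_mono[OF w(5) R] R by (simp add: distrib_left)
  qed
qed

section \<open>Continuous curves of measures\<close>

definition prw_continuous :: "real \<Rightarrow> real \<Rightarrow> (real \<Rightarrow> 'a::euclidean_space measure) \<Rightarrow> bool" where
  "prw_continuous b T m \<longleftrightarrow> (\<forall>t\<in>{0..T}. m t \<in> fin_measures) \<and>
     (\<forall>t\<in>{0..T}. \<forall>\<epsilon>>0. \<exists>\<delta>>0. \<forall>s\<in>{0..T}. \<bar>s - t\<bar> < \<delta> \<longrightarrow> prw_dist b (m t) (m s) < \<epsilon>)"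

lemma prw_continuousD:
  assumes "prw_continuous b T m"
  shows "t \<in> {0..T} \<Longrightarrow> m t \<in> fin_measures"
    "t \<in> {0..T} \<Longrightarrow> \<epsilon> > 0 \<Longrightarrow> \<exists>\<delta>>0. \<forall>s\<in>{0..T}. \<bar>s - t\<bar> < \<delta> \<longrightarrow> prw_dist b (m t) (m s) < \<epsilon>"
  using assms unfolding prw_continuous_def by blast+

lemma continuous_on_mass:
  assumes b: "b > 0" and m: "prw_continuous b T m"
  shows "continuous_on {0..T} (\<lambda>t. measure (m t) UNIV)"
  unfolding continuous_on_iff
proof (intro ballI allI impI)
  fix t \<epsilon> :: real assume t: "t \<in> {0..T}" and \<epsilon>: "\<epsilon> > 0"
  obtain \<delta> where \<delta>: "\<delta> > 0" "\<forall>s\<in>{0..T}. \<bar>s - t\<bar> < \<delta> \<longrightarrow> prw_dist b (m t) (m s) < b * \<epsilon>"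
    using prw_continuousD(2)[OF m t, of "b * \<epsilon>"] b \<epsilon> by auto
  have "dist (measure (m s) UNIV) (measure (m t) UNIV) < \<epsilon>" if s: "s \<in> {0..T}" "dist s t < \<delta>" for s
  proof -
    have "prw_dist b (m t) (m s) / b < \<epsilon>"
      using \<delta>(2) s b by (simp add: dist_real_def pos_divide_less_eq mult.commute)
    then show ?thesis
      using mass_diff_le_prw_dist[OF b prw_continuousD(1)[OF m t] prw_continuousD(1)[OF m s(1)]]
      by (simp add: dist_real_def)
  qed
  then show "\<exists>d>0. \<forall>x'\<in>{0..T}. dist x' t < d \<longrightarrow> dist (measure (m x') UNIV) (measure (m t) UNIV) < \<epsilon>"
    using \<delta>(1) by blast
qed

lemma mass_bounded:
  assumes b: "b > 0" and m: "prw_continuous b T m"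
  obtains N where "N > 0" "\<And>t. t \<in> {0..T} \<Longrightarrow> measure (m t) UNIV \<le> N"
proof -
  have "compact ((\<lambda>t. measure (m t) UNIV) ` {0..T})"
    by (rule compact_continuous_image[OF continuous_on_mass[OF b m]]) simp
  then obtain B where "\<forall>x\<in>(\<lambda>t. measure (m t) UNIV) ` {0..T}. norm x \<le> B"
    using compact_imp_bounded bounded_iff by metis
  then have "measure (m t) UNIV \<le> max 1 B" if "t \<in> {0..T}" for t
    using that by (force simp: abs_le_iff)
  then show thesis by (intro that[of "max 1 B"]) auto
qed

text \<open>Compactness of the support turns continuity into the modulus that \<open>integral_diff_le_prw_dist\<close> takes as
  its slack.\<close>

lemma uniformly_continuous_compact_support:
  fixes \<Theta> :: "real \<Rightarrow> 'a::euclidean_space \<Rightarrow> real"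
  assumes \<Theta>: "continuous_on ({0..T} \<times> UNIV) (\<lambda>(t, x). \<Theta> t x)" and K: "compact K"
    and z: "\<And>t x. t \<in> {0..T} \<Longrightarrow> x \<notin> K \<Longrightarrow> \<Theta> t x = 0" and \<epsilon>: "\<epsilon> > 0"
  obtains \<delta> where "\<delta> > 0" "\<And>s t x y. s \<in> {0..T} \<Longrightarrow> t \<in> {0..T} \<Longrightarrow> \<bar>s - t\<bar> < \<delta> \<Longrightarrow> norm (x - y) < \<delta> \<Longrightarrow>
    \<bar>\<Theta> s x - \<Theta> t y\<bar> < \<epsilon>"
proof -
  obtain r where r: "r > 0" "\<And>x. x \<in> K \<Longrightarrow> norm x \<le> r"
    using compact_imp_bounded[OF K] bounded_pos by metis
  have "uniformly_continuous_on ({0..T} \<times> cball 0 (r + 1)) (\<lambda>(t, x). \<Theta> t x)"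
    by (rule compact_uniformly_continuous[OF continuous_on_subset[OF \<Theta>]]) (auto intro: compact_Times)
  then obtain d where d: "d > 0" "\<And>p q. p \<in> {0..T} \<times> cball 0 (r + 1) \<Longrightarrow> q \<in> {0..T} \<times> cball 0 (r + 1) \<Longrightarrow>
     dist q p < d \<Longrightarrow> dist (case q of (t, x) \<Rightarrow> \<Theta> t x) (case p of (t, x) \<Rightarrow> \<Theta> t x) < \<epsilon>"
    unfolding uniformly_continuous_on_def using \<epsilon> by meson
  show thesis
  proof (rule that[of "min 1 (d / 2)"])
    show "0 < min 1 (d / 2)" using d by simp
    fix s t :: real and x y :: 'a assume st: "s \<in> {0..T}" "t \<in> {0..T}" "\<bar>s - t\<bar> < min 1 (d / 2)" "norm (x - y) < min 1 (d / 2)"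
    show "\<bar>\<Theta> s x - \<Theta> t y\<bar> < \<epsilon>"
    proof (cases "x \<in> K \<or> y \<in> K")
      case True
      have "norm x \<le> r + 1" "norm y \<le> r + 1"
        using True r(2) st(4) norm_triangle_sub[of x y] norm_triangle_sub[of y x] by (force simp: norm_minus_commute)+
      moreover have "dist (s, x) (t, y) < d"
        using st sqrt_sum_squares_le_sum_abs[of "dist s t" "dist x y"]
        by (auto simp: dist_Pair_Pair dist_real_def dist_norm norm_Pair)
      ultimately show ?thesis using d(2)[of "(t, y)" "(s, x)"] st by (simp add: dist_real_def)
    next
      case False
      then show ?thesis using z st \<epsilon> by simp
    qed
  qed
qed

lemma bounded_compact_support:
  fixes \<Theta> :: "real \<Rightarrow> 'a::euclidean_space \<Rightarrow> real"
  assumes \<Theta>: "continuous_on ({0..T} \<times> UNIV) (\<lambda>(t, x). \<Theta> t x)" and K: "compact K"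
    and z: "\<And>t x. t \<in> {0..T} \<Longrightarrow> x \<notin> K \<Longrightarrow> \<Theta> t x = 0"
  obtains A where "A > 0" "\<And>t x. t \<in> {0..T} \<Longrightarrow> \<bar>\<Theta> t x\<bar> \<le> A"
proof -
  have "compact ((\<lambda>(t, x). \<Theta> t x) ` ({0..T} \<times> K))"
    by (rule compact_continuous_image[OF continuous_on_subset[OF \<Theta>]]) (auto intro: compact_Times K)
  then obtain A where A: "A > 0" "\<forall>y \<in> (\<lambda>(t, x). \<Theta> t x) ` ({0..T} \<times> K). norm y \<le> A"
    using compact_imp_bounded bounded_pos by metis
  have "\<bar>\<Theta> t x\<bar> \<le> A" if "t \<in> {0..T}" for t x
    using A z that by (cases "x \<in> K") fastforce+
  then show thesis using that A(1) by blast
qed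

lemma continuous_on_slice:
  assumes "continuous_on (S \<times> UNIV) (\<lambda>(t, x). F t x)" "t \<in> S"
  shows "continuous_on UNIV (F t)"
proof -
  have "continuous_on UNIV ((\<lambda>(t, x). F t x) \<circ> Pair t)"
    by (rule continuous_on_compose[OF _ continuous_on_subset[OF assms(1)]])
       (use assms(2) in \<open>auto intro!: continuous_intros\<close>)
  then show ?thesis by (simp add: o_def)
qed

lemma continuous_on_time_slice:
  assumes "continuous_on (S \<times> UNIV) (\<lambda>(t, x). F t x)" "R \<subseteq> S"
  shows "continuous_on R (\<lambda>t. F t x)"
proof -
  have "continuous_on R ((\<lambda>(t, x). F t x) \<circ> (\<lambda>t. (t, x)))"
    by (rule continuous_on_compose[OF _ continuous_on_subset[OF assms(1)]])
       (use assms(2) in \<open>auto intro!: continuous_intros\<close>)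
  then show ?thesis by (simp add: o_def)
qed

text \<open>Freeze the integrand at time \<open>t\<close>: its change in time is uniformly small, and the frozen integrand moves
  slowly by \<open>integral_diff_le_prw_dist\<close>, where pairs of points at distance at least \<open>\<delta>\<close> are paid for by the
  Lipschitz part \<open>2 A / \<delta>\<close>.\<close>

lemma continuous_on_integral_moving:
  fixes \<Theta> :: "real \<Rightarrow> 'a::euclidean_space \<Rightarrow> real"
  assumes b: "b > 0" and m: "prw_continuous b T m"
    and \<Theta>: "continuous_on ({0..T} \<times> UNIV) (\<lambda>(t, x). \<Theta> t x)" and K: "compact K"
    and z: "\<And>t x. t \<in> {0..T} \<Longrightarrow> x \<notin> K \<Longrightarrow> \<Theta> t x = 0"
  shows "continuous_on {0..T} (\<lambda>t. \<integral>x. \<Theta> t x \<partial>m t)"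
  unfolding continuous_on_iff
proof (intro ballI allI impI)
  fix t \<epsilon> :: real assume t: "t \<in> {0..T}" and \<epsilon>: "\<epsilon> > 0"
  obtain N where N: "N > 0" "\<And>t. t \<in> {0..T} \<Longrightarrow> measure (m t) UNIV \<le> N" using mass_bounded[OF b m] by blast
  obtain A where A: "A > 0" "\<And>t x. t \<in> {0..T} \<Longrightarrow> \<bar>\<Theta> t x\<bar> \<le> A" using bounded_compact_support[OF \<Theta> K z] by blast
  define \<eta> where "\<eta> = \<epsilon> / (4 * N)"
  have \<eta>: "\<eta> > 0" using \<epsilon> N by (simp add: \<eta>_def)
  obtain \<delta> where \<delta>: "\<delta> > 0" "\<And>s t x y. s \<in> {0..T} \<Longrightarrow> t \<in> {0..T} \<Longrightarrow> \<bar>s - t\<bar> < \<delta> \<Longrightarrow> norm (x - y) < \<delta> \<Longrightarrow>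
    \<bar>\<Theta> s x - \<Theta> t y\<bar> < \<eta>" using uniformly_continuous_compact_support[OF \<Theta> K z \<eta>] by blast
  define L where "L = 2 * A / \<delta> + A / b"
  have L: "L > 0" using A \<delta> b by (simp add: L_def add_pos_pos)
  obtain d where d: "d > 0" "\<forall>s\<in>{0..T}. \<bar>s - t\<bar> < d \<longrightarrow> prw_dist b (m t) (m s) < \<epsilon> / (4 * L)"
    using prw_continuousD(2)[OF m t, of "\<epsilon> / (4 * L)"] L \<epsilon> by auto
  have meas: "\<Theta> s \<in> borel_measurable borel" if "s \<in> {0..T}" for s
    using continuous_on_slice[OF \<Theta> that] by (rule borel_measurable_continuous_onI)
  have mod: "\<bar>\<Theta> t x - \<Theta> t y\<bar> \<le> \<eta> + 2 * A / \<delta> * norm (x - y)" for x y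
  proof (cases "norm (x - y) < \<delta>")
    case True
    have "\<bar>\<Theta> t x - \<Theta> t y\<bar> < \<eta>" using \<delta>(2)[OF t t _ True] \<delta>(1) by simp
    moreover have "0 \<le> 2 * A / \<delta> * norm (x - y)" using A \<delta>(1) by simp
    ultimately show ?thesis by linarith
  next
    case False
    have "\<bar>\<Theta> t x - \<Theta> t y\<bar> \<le> 2 * A" using A(2)[OF t, of x] A(2)[OF t, of y] by linarith
    also have "\<dots> \<le> 2 * A / \<delta> * norm (x - y)"
      using False A(1) \<delta>(1) by (simp add: pos_le_divide_eq)
    finally show ?thesis using \<eta> by linarith
  qed
  have "dist (\<integral>x. \<Theta> s x \<partial>m s) (\<integral>x. \<Theta> t x \<partial>m t) < \<epsilon>" if s: "s \<in> {0..T}" "dist s t < min \<delta> d" for s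
  proof -
    have ms: "m s \<in> fin_measures" and mt: "m t \<in> fin_measures" using prw_continuousD(1)[OF m] s t by auto
    have 1: "\<bar>\<integral>x. \<Theta> s x - \<Theta> t x \<partial>m s\<bar> \<le> \<eta> * measure (m s) UNIV"
      by (rule fin_measures_integral_bound[OF ms])
         (use \<delta>(2)[OF s(1) t, of x x for x] s(2) \<delta>(1) in \<open>auto simp: dist_real_def intro: less_imp_le\<close>)
    have 2: "\<bar>(\<integral>x. \<Theta> t x \<partial>m t) - (\<integral>x. \<Theta> t x \<partial>m s)\<bar> \<le> \<eta> * measure (m t) UNIV + L * prw_dist b (m t) (m s)"
      unfolding L_def
      by (rule integral_diff_le_prw_dist[OF b mt ms meas[OF t] A(2)[OF t] mod]) (use \<eta> A \<delta> in auto)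
    have 3: "\<eta> * measure (m s) UNIV \<le> \<epsilon> / 4" "\<eta> * measure (m t) UNIV \<le> \<epsilon> / 4"
      using mult_left_mono[OF N(2)[OF s(1)], of \<eta>] mult_left_mono[OF N(2)[OF t], of \<eta>] \<eta> N(1)
      by (auto simp: \<eta>_def)
    have "prw_dist b (m t) (m s) < \<epsilon> / (4 * L)" using d s by (simp add: dist_real_def)
    then have 4: "L * prw_dist b (m t) (m s) < \<epsilon> / 4" using L by (simp add: field_simps)
    have 5: "(\<integral>x. \<Theta> s x - \<Theta> t x \<partial>m s) = (\<integral>x. \<Theta> s x \<partial>m s) - (\<integral>x. \<Theta> t x \<partial>m s)"
      using fin_measures_integrable[OF ms meas[OF s(1)] A(2)[OF s(1)]] fin_measures_integrable[OF ms meas[OF t] A(2)[OF t]]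
      by simp
    show ?thesis using 1 2 3 4 \<epsilon> unfolding 5 dist_real_def by linarith
  qed
  then show "\<exists>d>0. \<forall>x'\<in>{0..T}. dist x' t < d \<longrightarrow> dist (\<integral>x. \<Theta> x' x \<partial>m x') (\<integral>x. \<Theta> t x \<partial>m t) < \<epsilon>"
    using \<delta>(1) d(1) by (intro exI[of _ "min \<delta> d"]) auto
qed

lemma continuous_on_coefficient:
  fixes F :: "real \<Rightarrow> 'a::euclidean_space \<Rightarrow> 'a measure \<Rightarrow> 'c::metric_space"
  assumes F: "jointly_continuous b T F" and m: "prw_continuous b T m"
  shows "continuous_on ({0..T} \<times> UNIV) (\<lambda>(t, x). F t x (m t))"
  unfolding continuous_on_iff
proof (intro ballI allI impI)
  fix p \<epsilon> assume p: "p \<in> {0..T} \<times> (UNIV :: 'a set)" and \<epsilon>: "(0::real) < \<epsilon>"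
  obtain t x where tx: "p = (t, x)" "t \<in> {0..T}" using p by auto
  obtain \<delta> where \<delta>: "\<delta> > 0" "\<And>t' x' m'. t' \<in> {0..T} \<Longrightarrow> m' \<in> fin_measures \<Longrightarrow> \<bar>t' - t\<bar> < \<delta> \<Longrightarrow> norm (x' - x) < \<delta> \<Longrightarrow>
      prw_dist b (m t) m' < \<delta> \<Longrightarrow> dist (F t' x' m') (F t x (m t)) < \<epsilon>"
    using F[unfolded jointly_continuous_def, THEN bspec, OF tx(2), THEN spec, THEN bspec, OF prw_continuousD(1)[OF m tx(2)],
      THEN spec, THEN mp, OF \<epsilon>] by blast
  obtain d where d: "d > 0" "\<forall>s\<in>{0..T}. \<bar>s - t\<bar> < d \<longrightarrow> prw_dist b (m t) (m s) < \<delta>"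
    using prw_continuousD(2)[OF m tx(2) \<delta>(1)] by auto
  have "dist (case q of (t, x) \<Rightarrow> F t x (m t)) (case p of (t, x) \<Rightarrow> F t x (m t)) < \<epsilon>"
    if q: "q \<in> {0..T} \<times> UNIV" "dist q p < min \<delta> d" for q
  proof -
    obtain s y where sy: "q = (s, y)" "s \<in> {0..T}" using q by auto
    have "dist s t < min \<delta> d" "dist y x < min \<delta> d"
      using q(2) dist_fst_le[of q p] dist_snd_le[of q p] by (auto simp: sy tx)
    then show ?thesis
      using \<delta>(2)[OF sy(2) prw_continuousD(1)[OF m sy(2)], of y] d(2) sy tx by (simp add: dist_real_def dist_norm)
  qed
  then show "\<exists>d>0. \<forall>x'\<in>{0..T} \<times> UNIV. dist x' p < d \<longrightarrow>
      dist (case x' of (t, x) \<Rightarrow> F t x (m t)) (case p of (t, x) \<Rightarrow> F t x (m t)) < \<epsilon>"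
    using \<delta>(1) d(1) by (intro exI[of _ "min \<delta> d"]) auto
qed

section \<open>A compactly supported bump function\<close>

text \<open>Differentiability of the bump function and of mollified functions is obtained from their quadratic
  remainders, which are needed for the estimates in any case.\<close>

lemma GDERIV_quadraticI:
  fixes \<phi> :: "'a::euclidean_space \<Rightarrow> real"
  assumes q: "\<And>a. norm a \<le> 1 \<Longrightarrow> \<bar>\<phi> (x + a) - \<phi> x - a \<bullet> D\<bar> \<le> C * (norm a)\<^sup>2"
  shows "GDERIV \<phi> x :> D"
  unfolding gderiv_def has_derivative_at
proof (intro conjI)
  show "bounded_linear (\<lambda>h. h \<bullet> D)" by (rule bounded_linear_inner_left)
  have C: "C \<ge> 0"
  proof -
    obtain a :: 'a where "norm a = 1" by (metis norm_axis_1 SOME_Basis norm_Basis)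
    then show ?thesis using q[of a] by (metis abs_ge_zero mult.right_neutral one_power2 order.trans order_refl)
  qed
  show "(\<lambda>a. norm (\<phi> (x + a) - \<phi> x - a \<bullet> D) / norm a) \<midarrow>0\<rightarrow> 0"
  proof (rule tendsto_0_le[where K = 1])
    show "(\<lambda>a::'a. C * norm a) \<midarrow>0\<rightarrow> 0" by (auto intro!: tendsto_eq_intros)
    have "eventually (\<lambda>a::'a. norm a \<le> 1) (at 0)"
      unfolding eventually_at by (intro exI[of _ 1]) (auto simp: dist_norm)
    then show "\<forall>\<^sub>F a in at 0. norm (norm (\<phi> (x + a) - \<phi> x - a \<bullet> D) / norm a) \<le> norm (C * norm a) * 1"
    proof eventually_elim
      case (elim a)
      then show ?case using q[OF elim] C
        by (cases "a = 0") (auto simp: divide_le_eq power2_eq_square mult.assoc)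
    qed
  qed
qed

text \<open>One function serves both as a cutoff (\<open>r \<rightarrow> \<infinity>\<close>) and as a mollifier (\<open>r \<rightarrow> 0\<close>): it is \<open>C\<^sup>1\<close> with Lipschitz gradient and
  vanishes outside the ball of radius \<open>r\<close>.\<close>

definition bump :: "real \<Rightarrow> 'a::euclidean_space \<Rightarrow> real" where
  "bump r x = (max 0 (1 - (norm x / r)\<^sup>2))\<^sup>2"

definition bump_grad :: "real \<Rightarrow> 'a::euclidean_space \<Rightarrow> 'a" where
  "bump_grad r x = (- (4 / r\<^sup>2) * max 0 (1 - (norm x / r)\<^sup>2)) *\<^sub>R x"

lemma bump_bounds: "0 \<le> bump r x" "bump r x \<le> 1"
proof -
  have "max 0 (1 - (norm x / r)\<^sup>2) \<le> 1" by simp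
  then show "0 \<le> bump r x" "bump r x \<le> 1" unfolding bump_def by (auto simp: power_le_one)
qed

lemma bump_outside:
  assumes "r > 0" "norm x \<ge> r"
  shows "bump r x = 0" "bump_grad r x = 0"
proof -
  have "norm x / r \<ge> 1" using assms by simp
  then have "(norm x / r)\<^sup>2 \<ge> 1" by simp
  then show "bump r x = 0" "bump_grad r x = 0" by (simp_all add: bump_def bump_grad_def)
qed

lemma continuous_on_bump [continuous_intros]:
  "continuous_on S (bump r)" "continuous_on S (bump_grad r)"
proof -
  have 1: "bump r = (\<lambda>x::'a. (max 0 (1 - (norm x * inverse r)\<^sup>2))\<^sup>2)"
    "bump_grad r = (\<lambda>x::'a. (- (4 / r\<^sup>2) * max 0 (1 - (norm x * inverse r)\<^sup>2)) *\<^sub>R x)"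
    by (auto simp: bump_def bump_grad_def fun_eq_iff divide_inverse)
  show "continuous_on S (bump r)" "continuous_on S (bump_grad r)"
    unfolding 1 by (intro continuous_intros)+
qed

text \<open>The map \<open>s \<mapsto> (max 0 s)\<^sup>2\<close> has a Lipschitz derivative, hence a quadratic Taylor remainder.\<close>

lemma bump_taylor:
  fixes x a :: "'a::euclidean_space"
  assumes r: "r > 0" and a: "norm a \<le> 1"
  shows "\<bar>bump r (x + a) - bump r x - a \<bullet> bump_grad r x\<bar> \<le> (2 / r\<^sup>2 + (2 * r + 3)\<^sup>2 / r^4) * (norm a)\<^sup>2"
proof (cases "norm x \<le> r + 1")
  case True
  define q where "q y = 1 - (norm y / r)\<^sup>2" for y :: 'a
  have tay: "\<bar>(max 0 s')\<^sup>2 - (max 0 s)\<^sup>2 - 2 * max 0 s * (s' - s)\<bar> \<le> (s' - s)\<^sup>2" for s s' :: real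
  proof -
    consider "s \<ge> 0" "s' \<ge> 0" | "s \<ge> 0" "s' < 0" | "s < 0" "s' \<ge> 0" | "s < 0" "s' < 0" by linarith
    then show ?thesis
    proof cases
      case 1
      have "s'\<^sup>2 - s\<^sup>2 - 2 * s * (s' - s) = (s' - s)\<^sup>2" by (simp add: power2_eq_square algebra_simps)
      then show ?thesis using 1 by simp
    next
      case 2
      have "s * s' \<le> 0" "0 \<le> s * s" "0 \<le> s' * s'" using 2 by (auto simp: mult_nonneg_nonpos)
      moreover have "\<bar>s * s - 2 * (s * s')\<bar> = s * s - 2 * (s * s')" using calculation by linarith
      ultimately show ?thesis using 2 by (simp add: power2_eq_square algebra_simps)
    next
      case 3
      have "s * s' \<le> 0" "0 \<le> s * s" "0 \<le> s' * s'" using 3 by (auto simp: mult_nonpos_nonneg)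
      then show ?thesis using 3 by (simp add: power2_eq_square algebra_simps abs_le_iff)
    qed auto
  qed
  have dq: "q (x + a) - q x = - (2 * (x \<bullet> a) + a \<bullet> a) / r\<^sup>2"
    unfolding q_def power_divide power2_norm_eq_inner
    using r by (simp add: inner_add_left inner_add_right inner_commute field_simps)
  have rem: "bump r (x + a) - bump r x - a \<bullet> bump_grad r x =
     ((max 0 (q (x + a)))\<^sup>2 - (max 0 (q x))\<^sup>2 - 2 * max 0 (q x) * (q (x + a) - q x)) - 2 * max 0 (q x) * ((norm a)\<^sup>2 / r\<^sup>2)"
    unfolding bump_def bump_grad_def q_def[symmetric] dq power2_norm_eq_inner
    using r by (simp add: inner_commute field_simps)
  have "\<bar>x \<bullet> a\<bar> \<le> (r + 1) * norm a"
    using Cauchy_Schwarz_ineq2[of x a] mult_right_mono[OF True norm_ge_zero[of a]] by linarith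
  moreover have "a \<bullet> a \<le> norm a" "0 \<le> a \<bullet> a"
    using a by (simp_all add: power2_norm_eq_inner[symmetric] power2_eq_square mult_left_le)
  ultimately have "\<bar>2 * (x \<bullet> a) + a \<bullet> a\<bar> \<le> (2 * r + 3) * norm a"
    using norm_ge_zero[of a] unfolding abs_le_iff distrib_right mult.assoc by linarith
  then have "(2 * (x \<bullet> a) + a \<bullet> a)\<^sup>2 \<le> ((2 * r + 3) * norm a)\<^sup>2" by (metis abs_ge_zero power2_abs power_mono)
  then have "(q (x + a) - q x)\<^sup>2 \<le> (2 * r + 3)\<^sup>2 / r^4 * (norm a)\<^sup>2"
    unfolding dq power_divide power2_minus using r
    by (simp add: divide_right_mono power_mult_distrib power_mult[symmetric])
  moreover have "2 * max 0 (q x) * ((norm a)\<^sup>2 / r\<^sup>2) \<le> 2 / r\<^sup>2 * (norm a)\<^sup>2"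
    using mult_right_mono[of "max 0 (q x)" 1 "2 * ((norm a)\<^sup>2 / r\<^sup>2)"] by (simp add: q_def mult.commute mult.left_commute)
  moreover have "0 \<le> 2 * max 0 (q x) * ((norm a)\<^sup>2 / r\<^sup>2)" by simp
  ultimately show ?thesis
    unfolding rem distrib_right using tay[of "q (x + a)" "q x"] by linarith
next
  case False
  have "norm (x + a) \<ge> r" using False a norm_triangle_ineq4[of "x + a" a] by simp
  then show ?thesis using False r by (simp add: bump_outside)
qed

lemma GDERIV_bump: "r > 0 \<Longrightarrow> GDERIV (bump r) x :> bump_grad r x"
  using bump_taylor by (rule GDERIV_quadraticI)

lemma norm_bump_grad_le:
  assumes "r > 0"
  shows "norm (bump_grad r x) \<le> 4 / r"
proof (cases "norm x \<le> r")
  case True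
  have "norm (bump_grad r x) = 4 / r\<^sup>2 * (max 0 (1 - (norm x / r)\<^sup>2) * norm x)"
    using assms by (simp add: bump_grad_def abs_mult)
  also have "\<dots> \<le> 4 / r\<^sup>2 * (1 * r)"
    by (intro mult_left_mono mult_mono) (use True assms in auto)
  finally show ?thesis using assms by (simp add: power2_eq_square)
next
  case False
  then show ?thesis using assms bump_outside(2)[of r x] by simp
qed

section \<open>Weak formulations\<close>

definition C1_pair :: "('a::euclidean_space \<Rightarrow> real) \<Rightarrow> ('a \<Rightarrow> 'a) \<Rightarrow> bool" where
  "C1_pair \<phi> D \<longleftrightarrow> (\<forall>x. GDERIV \<phi> x :> D x) \<and> continuous_on UNIV D"

lemma GDERIV_unique:
  assumes "GDERIV \<phi> x :> D" "GDERIV \<phi> x :> D'"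
  shows "D = D'"
proof -
  have "(\<lambda>h. h \<bullet> D) = (\<lambda>h. h \<bullet> D')" using assms unfolding gderiv_def by (rule has_derivative_unique)
  then show ?thesis by (metis inner_commute vector_eq_ldot)
qed

lemma grad_eq: "GDERIV \<phi> x :> D \<Longrightarrow> grad \<phi> x = D"
  unfolding grad_def by (rule the_equality) (auto intro: GDERIV_unique)

lemma C1_pairD:
  assumes "C1_pair \<phi> D"
  shows "continuous_on UNIV \<phi>" "continuous_on UNIV D" "\<phi> \<in> borel_measurable borel" "D \<in> borel_measurable borel"
    "GDERIV \<phi> x :> D x" "grad \<phi> x = D x"
proof -
  have g: "GDERIV \<phi> x :> D x" for x using assms by (simp add: C1_pair_def)
  show c: "continuous_on UNIV \<phi>"
    unfolding continuous_on_eq_continuous_within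
    using g has_derivative_continuous unfolding gderiv_def by blast
  show d: "continuous_on UNIV D" using assms by (simp add: C1_pair_def)
  show "\<phi> \<in> borel_measurable borel" "D \<in> borel_measurable borel"
    using c d by (auto intro: borel_measurable_continuous_onI)
  show "GDERIV \<phi> x :> D x" "grad \<phi> x = D x" using g grad_eq by auto
qed

lemma C1_pair_mult:
  assumes "C1_pair \<phi> D" "C1_pair \<psi> E"
  shows "C1_pair (\<lambda>x. \<phi> x * \<psi> x) (\<lambda>x. \<phi> x *\<^sub>R E x + \<psi> x *\<^sub>R D x)"
  using GDERIV_mult[OF C1_pairD(5)[OF assms(1)] C1_pairD(5)[OF assms(2)]]
  unfolding C1_pair_def by (auto intro!: continuous_intros C1_pairD[OF assms(1)] C1_pairD[OF assms(2)])

lemma C1_pair_bump: "r > 0 \<Longrightarrow> C1_pair (bump r) (bump_grad r)"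
  unfolding C1_pair_def by (auto intro: GDERIV_bump continuous_on_bump)

lemma GDERIV_zero_outside:
  assumes "GDERIV \<phi> x :> D" and K: "closed K" "\<And>x. x \<notin> K \<Longrightarrow> \<phi> x = 0" "x \<notin> K"
  shows "D = 0"
proof -
  have "GDERIV \<phi> x :> 0"
    unfolding gderiv_def
  proof (rule has_derivative_transform_within_open[where f = "\<lambda>_. 0" and s = "- K"])
    show "((\<lambda>_. 0) has_derivative (\<lambda>h. h \<bullet> 0)) (at x)" by simp
  qed (use K in auto)
  then show ?thesis using GDERIV_unique assms(1) by blast
qed

lemma C1_pair_bounded:
  fixes \<phi> :: "'a::euclidean_space \<Rightarrow> real"
  assumes C: "C1_pair \<phi> D" and K: "compact K" and z: "\<And>x. x \<notin> K \<Longrightarrow> \<phi> x = 0"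
  shows "\<exists>A B. (\<forall>x. \<bar>\<phi> x\<bar> \<le> A) \<and> (\<forall>x. norm (D x) \<le> B)"
proof -
  have z': "x \<notin> K \<Longrightarrow> D x = 0" for x
    by (rule GDERIV_zero_outside[OF C1_pairD(5)[OF C] compact_imp_closed[OF K] z])
  have "bounded (\<phi> ` K)" "bounded (D ` K)"
    using C1_pairD(1,2)[OF C] K
    by (auto intro!: compact_imp_bounded compact_continuous_image intro: continuous_on_subset)
  then obtain A B where "\<forall>x\<in>K. \<bar>\<phi> x\<bar> \<le> A" "\<forall>x\<in>K. norm (D x) \<le> B" unfolding bounded_iff by auto
  then have "\<bar>\<phi> x\<bar> \<le> max 0 A" "norm (D x) \<le> max 0 B" for x
    using z[of x] z'[of x] by (cases "x \<in> K"; force)+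
  then show ?thesis by blast
qed

lemma set_integral_point: "(LINT \<tau>:{c..c}|lborel. H \<tau>) = (0 :: real)" for c :: real
  using AE_lborel_singleton[of c] unfolding set_lebesgue_integral_def
  by (intro integral_eq_zero_AE, elim eventually_mono) (auto simp: indicator_def)

text \<open>The linear equation with coefficients depending on time and space only, tested with functions
  constant in time. Both sides of the equivalence reduce to it, with the coefficients evaluated along
  the curve itself.\<close>

definition weak_eq :: "real \<Rightarrow> 'a::euclidean_space measure \<Rightarrow> (real \<Rightarrow> 'a \<Rightarrow> 'a) \<Rightarrow> (real \<Rightarrow> 'a \<Rightarrow> real) \<Rightarrow>
    (real \<Rightarrow> 'a measure) \<Rightarrow> bool" where
  "weak_eq T m0 v h n \<longleftrightarrow> (\<forall>\<phi> D K. C1_pair \<phi> D \<longrightarrow> compact K \<longrightarrow> (\<forall>x. x \<notin> K \<longrightarrow> \<phi> x = 0) \<longrightarrow>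
     (\<forall>t\<in>{0..T}. (\<integral>x. \<phi> x \<partial>n t) - (\<integral>x. \<phi> x \<partial>m0) =
        (LINT \<tau>:{0..t}|lborel. (\<integral>x. v \<tau> x \<bullet> D x + h \<tau> x * \<phi> x \<partial>n \<tau>))))"

lemma weak_eq_cong:
  assumes weak: "weak_eq T m0 v h n"
    and eq: "\<And>t. t \<in> {0..T} \<Longrightarrow> n' t = n t" "\<And>t. t \<in> {0..T} \<Longrightarrow> v' t = v t" "\<And>t. t \<in> {0..T} \<Longrightarrow> h' t = h t"
  shows "weak_eq T m0 v' h' n'"
  unfolding weak_eq_def
proof (intro allI impI ballI)
  fix \<phi> :: "'a \<Rightarrow> real" and D K t
  assume C: "C1_pair \<phi> D" and K: "compact K" and z: "\<forall>x. x \<notin> K \<longrightarrow> \<phi> x = 0" and t: "t \<in> {0..T}"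
  have "(LINT \<tau>:{0..t}|lborel. (\<integral>x. v' \<tau> x \<bullet> D x + h' \<tau> x * \<phi> x \<partial>n' \<tau>)) =
      (LINT \<tau>:{0..t}|lborel. (\<integral>x. v \<tau> x \<bullet> D x + h \<tau> x * \<phi> x \<partial>n \<tau>))"
    by (rule set_lebesgue_integral_cong) (use t eq in auto)
  then show "(\<integral>x. \<phi> x \<partial>n' t) - (\<integral>x. \<phi> x \<partial>m0) = (LINT \<tau>:{0..t}|lborel. (\<integral>x. v' \<tau> x \<bullet> D x + h' \<tau> x * \<phi> x \<partial>n' \<tau>))"
    using weak[unfolded weak_eq_def, rule_format, OF C K _ t] z eq(1)[OF t] by simp
qed

lemma continuous_on_weak_integrand:
  assumes v: "continuous_on ({0..T} \<times> UNIV) (\<lambda>(t, x). v t x)" and h: "continuous_on ({0..T} \<times> UNIV) (\<lambda>(t, x). h t x)"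
    and \<phi>: "continuous_on UNIV \<phi>" "continuous_on UNIV D"
  shows "continuous_on ({0..T} \<times> UNIV) (\<lambda>(t, x). v t x \<bullet> D x + h t x * (\<phi> x :: real))"
proof -
  have "continuous_on ({0..T} \<times> UNIV) (\<lambda>p. D (snd p))" "continuous_on ({0..T} \<times> UNIV) (\<lambda>p. \<phi> (snd p))"
    by (auto intro!: continuous_on_compose2[OF \<phi>(1)] continuous_on_compose2[OF \<phi>(2)] continuous_intros)
  then show ?thesis using v h unfolding case_prod_beta' by (auto intro!: continuous_intros)
qed

locale transport_coefficients =
  fixes b T Cv Ch :: real and v :: "real \<Rightarrow> 'a::euclidean_space \<Rightarrow> 'a" and h :: "real \<Rightarrow> 'a \<Rightarrow> real"
  assumes b: "b > 0" and T: "T > 0"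
    and v_cont: "continuous_on ({0..T} \<times> UNIV) (\<lambda>(t, x). v t x)"
    and h_cont: "continuous_on ({0..T} \<times> UNIV) (\<lambda>(t, x). h t x)"
    and v_bound: "\<And>t x. t \<in> {0..T} \<Longrightarrow> norm (v t x) \<le> Cv"
    and h_bound: "\<And>t x. t \<in> {0..T} \<Longrightarrow> \<bar>h t x\<bar> \<le> Ch"
begin

lemma C_nonneg: "0 \<le> Cv" "0 \<le> Ch"
proof -
  have "0 \<in> {0..T}" using T by simp
  from v_bound[OF this, of undefined] h_bound[OF this, of undefined] show "0 \<le> Cv" "0 \<le> Ch"
    using norm_ge_zero[of "v 0 undefined"] by linarith+
qed

lemma weak_integrand_bound:
  assumes "t \<in> {0..T}" "\<bar>p\<bar> \<le> A" "norm d \<le> B"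
  shows "\<bar>v t x \<bullet> d + h t x * p\<bar> \<le> Cv * B + Ch * A"
proof -
  have "\<bar>v t x \<bullet> d\<bar> \<le> Cv * B"
    using Cauchy_Schwarz_ineq2[of "v t x" d] mult_mono[OF v_bound[OF assms(1), of x] assms(3)] C_nonneg by auto
  moreover have "\<bar>h t x * p\<bar> \<le> Ch * A"
    unfolding abs_mult using mult_mono[OF h_bound[OF assms(1), of x] assms(2)] C_nonneg by auto
  ultimately show ?thesis by linarith
qed

lemma measurable_coeffs:
  assumes "t \<in> {0..T}"
  shows "v t \<in> borel_measurable borel" "h t \<in> borel_measurable borel"
  using continuous_on_slice[OF v_cont assms] continuous_on_slice[OF h_cont assms]
  by (auto intro: borel_measurable_continuous_onI)

text \<open>Cutting off at radius \<open>r\<close> adds a gradient of size \<open>4 / r\<close>, which disappears as \<open>r \<rightarrow> \<infinity>\<close>. With the test function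
  \<open>1\<close> this gives the balance of the total mass, and mollified functions become admissible.\<close>

lemma weak_eq_bounded_test:
  assumes m0: "m0 \<in> fin_measures" and n: "prw_continuous b T n" and weak: "weak_eq T m0 v h n"
    and C: "C1_pair \<phi> D" and bd: "\<And>x. \<bar>\<phi> x\<bar> \<le> A" "\<And>x. norm (D x) \<le> B" and t: "t \<in> {0..T}"
  shows "set_integrable lborel {0..t} (\<lambda>\<tau>. \<integral>x. v \<tau> x \<bullet> D x + h \<tau> x * \<phi> x \<partial>n \<tau>)"
    and "(\<integral>x. \<phi> x \<partial>n t) - (\<integral>x. \<phi> x \<partial>m0) = (LINT \<tau>:{0..t}|lborel. (\<integral>x. v \<tau> x \<bullet> D x + h \<tau> x * \<phi> x \<partial>n \<tau>))"
proof -
  note n' = prw_continuousD(1)[OF n]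
  have A: "A \<ge> 0" using bd(1)[of undefined] by linarith
  have B: "B \<ge> 0" using bd(2)[of undefined] norm_ge_zero[of "D undefined"] by linarith
  obtain N where N: "N > 0" "\<And>t. t \<in> {0..T} \<Longrightarrow> measure (n t) UNIV \<le> N" using mass_bounded[OF b n] by blast
  define r where "r j = real j + 1" for j
  have r: "r j > 0" "r j \<ge> 1" for j by (auto simp: r_def)
  define p where "p j x = \<phi> x * bump (r j) x" for j x
  define d where "d j x = \<phi> x *\<^sub>R bump_grad (r j) x + bump (r j) x *\<^sub>R D x" for j x
  have Cj: "C1_pair (p j) (d j)" for j
    using C1_pair_mult[OF C C1_pair_bump[OF r(1)]] unfolding p_def[abs_def] d_def[abs_def] .
  have p_bd: "\<bar>p j x\<bar> \<le> A" for j x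
    using mult_mono[OF bd(1)[of x], of "\<bar>bump (r j) x\<bar>" 1] bump_bounds(1,2)[of "r j" x] A by (auto simp: p_def abs_mult)
  have d_bd: "norm (d j x) \<le> A * 4 + B" for j x
  proof -
    have "4 / r j \<le> 4" using r[of j] by (simp add: divide_le_eq)
    then have g4: "norm (bump_grad (r j) x) \<le> 4" using norm_bump_grad_le[OF r(1)[of j], of x] by linarith
    have "norm (d j x) \<le> \<bar>\<phi> x\<bar> * norm (bump_grad (r j) x) + \<bar>bump (r j) x\<bar> * norm (D x)"
      unfolding d_def by (rule order_trans[OF norm_triangle_ineq]) simp
    also have "\<dots> \<le> A * 4 + 1 * B"
      by (intro add_mono mult_mono g4 bd) (use A bump_bounds(1,2)[of "r j" x] in auto)
    finally show ?thesis by simp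
  qed
  have z: "x \<notin> cball 0 (r j) \<Longrightarrow> p j x = 0 \<and> d j x = 0" for j x
    using bump_outside[OF r(1), of j x] by (auto simp: p_def d_def)
  have inv: "(\<lambda>j. 1 / r j) \<longlonglongrightarrow> 0"
    unfolding r_def using LIMSEQ_inverse_real_of_nat by (simp add: inverse_eq_divide add.commute)
  have "(\<lambda>j. norm x * (1 / r j)) \<longlonglongrightarrow> 0" for x :: 'a using tendsto_mult_right_zero[OF inv] .
  then have "(\<lambda>j. (max 0 (1 - (norm x * (1 / r j))\<^sup>2))\<^sup>2) \<longlonglongrightarrow> (max 0 (1 - 0\<^sup>2))\<^sup>2" for x :: 'a
    by (intro tendsto_intros)
  then have bl: "(\<lambda>j. bump (r j) x) \<longlonglongrightarrow> 1" for x :: 'a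
    by (simp add: bump_def)
  have "(\<lambda>j. 4 / r j) \<longlonglongrightarrow> 0" using tendsto_mult_right_zero[OF inv, of 4] by simp
  then have gl: "(\<lambda>j. bump_grad (r j) x) \<longlonglongrightarrow> 0" for x :: 'a
    by (rule tendsto_0_le[where K = 1])
       (use norm_bump_grad_le[OF r(1)] r in \<open>auto intro!: always_eventually simp: less_imp_le\<close>)
  have pl: "(\<lambda>j. p j x) \<longlonglongrightarrow> \<phi> x" for x
    using tendsto_mult[OF tendsto_const bl, of "\<phi> x"] by (simp add: p_def)
  have "(\<lambda>j. d j x) \<longlonglongrightarrow> \<phi> x *\<^sub>R 0 + 1 *\<^sub>R D x" for x
    unfolding d_def by (intro tendsto_intros bl gl)
  then have dl: "(\<lambda>j. d j x) \<longlonglongrightarrow> D x" for x by simp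
  have conv: "(\<lambda>j. \<integral>x. p j x \<partial>m) \<longlonglongrightarrow> (\<integral>x. \<phi> x \<partial>m)" if m: "m \<in> fin_measures" for m
  proof (rule integral_dominated_convergence[where w = "\<lambda>_. A"])
    interpret finite_measure m using fin_measuresD[OF m] by simp
    show "integrable m (\<lambda>_. A)" by simp
  qed (use C1_pairD(3)[OF C] C1_pairD(3)[OF Cj] fin_measuresD[OF m] p_bd pl in \<open>auto cong: measurable_cong_sets\<close>)
  let ?G = "\<lambda>\<tau>. \<integral>x. v \<tau> x \<bullet> D x + h \<tau> x * \<phi> x \<partial>n \<tau>"
  let ?H = "\<lambda>j \<tau>. \<integral>x. v \<tau> x \<bullet> d j x + h \<tau> x * p j x \<partial>n \<tau>"
  let ?M = "Cv * (A * 4 + B) + Ch * A"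
  have Hl: "(\<lambda>j. ?H j \<tau>) \<longlonglongrightarrow> ?G \<tau>" if \<tau>: "\<tau> \<in> {0..T}" for \<tau>
  proof (rule integral_dominated_convergence[where w = "\<lambda>_. ?M"])
    interpret finite_measure "n \<tau>" using fin_measuresD[OF n'[OF \<tau>]] by simp
    show "integrable (n \<tau>) (\<lambda>_. ?M)" by simp
    note s = measurable_cong_sets[OF fin_measuresD(2)[OF n'[OF \<tau>]] refl]
    note [measurable] = measurable_coeffs[OF \<tau>] C1_pairD(3,4)[OF C] C1_pairD(3,4)[OF Cj]
    show "(\<lambda>x. v \<tau> x \<bullet> D x + h \<tau> x * \<phi> x) \<in> borel_measurable (n \<tau>)" unfolding s by measurable
    show "(\<lambda>x. v \<tau> x \<bullet> d j x + h \<tau> x * p j x) \<in> borel_measurable (n \<tau>)" for j unfolding s by measurable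
    show "AE x in n \<tau>. (\<lambda>j. v \<tau> x \<bullet> d j x + h \<tau> x * p j x) \<longlonglongrightarrow> v \<tau> x \<bullet> D x + h \<tau> x * \<phi> x"
      by (auto intro!: tendsto_intros dl pl)
    show "AE x in n \<tau>. norm (v \<tau> x \<bullet> d j x + h \<tau> x * p j x) \<le> ?M" for j
      using weak_integrand_bound[OF \<tau> p_bd d_bd] by simp
  qed
  have Hb: "\<bar>?H j \<tau>\<bar> \<le> ?M * N" if \<tau>: "\<tau> \<in> {0..T}" for j \<tau>
  proof -
    have "\<bar>?H j \<tau>\<bar> \<le> ?M * measure (n \<tau>) UNIV"
      by (rule fin_measures_integral_bound[OF n'[OF \<tau>] weak_integrand_bound[OF \<tau> p_bd d_bd]])
    also have "\<dots> \<le> ?M * N" using A B C_nonneg N(2)[OF \<tau>] by (intro mult_left_mono) auto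
    finally show ?thesis .
  qed
  have Hc: "continuous_on {0..T} (?H j)" for j
  proof (rule continuous_on_integral_moving[OF b n _ compact_cball[of 0 "r j"]])
    show "continuous_on ({0..T} \<times> UNIV) (\<lambda>(\<tau>, x). v \<tau> x \<bullet> d j x + h \<tau> x * p j x)"
      by (rule continuous_on_weak_integrand[OF v_cont h_cont C1_pairD(1,2)[OF Cj]])
  qed (use z in auto)
  have sub: "{0..t} \<subseteq> {0..T}" using t by auto
  have mH: "(\<lambda>\<tau>. indicator {0..t} \<tau> *\<^sub>R ?H j \<tau>) \<in> borel_measurable lborel" for j
    using borel_integrable_atLeastAtMost'[OF continuous_on_subset[OF Hc sub]] unfolding set_integrable_def by auto
  have mG: "(\<lambda>\<tau>. indicator {0..t} \<tau> *\<^sub>R ?G \<tau>) \<in> borel_measurable lborel"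
  proof (rule borel_measurable_LIMSEQ_real)
    show "(\<lambda>j. indicator {0..t} \<tau> *\<^sub>R ?H j \<tau>) \<longlonglongrightarrow> indicator {0..t} \<tau> *\<^sub>R ?G \<tau>" for \<tau>
      using Hl[of \<tau>] sub by (cases "\<tau> \<in> {0..t}") auto
  qed (rule mH)
  have w: "integrable lborel (\<lambda>\<tau>. indicator {0..t} \<tau> *\<^sub>R (?M * N))"
    using borel_integrable_atLeastAtMost'[OF continuous_on_const, of 0 t] unfolding set_integrable_def .
  have lim: "AE \<tau> in lborel. (\<lambda>j. indicator {0..t} \<tau> *\<^sub>R ?H j \<tau>) \<longlonglongrightarrow> indicator {0..t} \<tau> *\<^sub>R ?G \<tau>"
    using Hl sub by (intro AE_I2) (auto simp: indicator_def)
  have bnd: "AE \<tau> in lborel. norm (indicator {0..t} \<tau> *\<^sub>R ?H j \<tau>) \<le> indicator {0..t} \<tau> *\<^sub>R (?M * N)" for j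
    using Hb sub by (auto intro!: AE_I2 simp: indicator_def)
  show "set_integrable lborel {0..t} ?G"
    unfolding set_integrable_def by (rule integrable_dominated_convergence[OF mG mH w lim bnd])
  have "(\<lambda>j. LINT \<tau>:{0..t}|lborel. ?H j \<tau>) \<longlonglongrightarrow> (LINT \<tau>:{0..t}|lborel. ?G \<tau>)"
    unfolding set_lebesgue_integral_def by (rule integral_dominated_convergence[OF mG mH w lim bnd])
  moreover have "(LINT \<tau>:{0..t}|lborel. ?H j \<tau>) = (\<integral>x. p j x \<partial>n t) - (\<integral>x. p j x \<partial>m0)" for j
    using weak[unfolded weak_eq_def, rule_format, OF Cj compact_cball[of 0 "r j"] _ t] z by auto
  moreover have "(\<lambda>j. (\<integral>x. p j x \<partial>n t) - (\<integral>x. p j x \<partial>m0)) \<longlonglongrightarrow> (\<integral>x. \<phi> x \<partial>n t) - (\<integral>x. \<phi> x \<partial>m0)"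
    by (intro tendsto_diff conv n' t m0)
  ultimately show "(\<integral>x. \<phi> x \<partial>n t) - (\<integral>x. \<phi> x \<partial>m0) = (LINT \<tau>:{0..t}|lborel. ?G \<tau>)"
    using LIMSEQ_unique by auto
qed

end

section \<open>Mass balance and moving test functions\<close>

lemma has_field_derivative_transform:
  assumes "x \<in> S" "\<And>y. y \<in> S \<Longrightarrow> g y = f y" "(f has_field_derivative f') (at x within S)"
  shows "(g has_field_derivative f') (at x within S)"
  using assms unfolding has_field_derivative_def by (rule has_derivative_transform)

lemma gronwall:
  fixes u :: "real \<Rightarrow> real"
  assumes u: "continuous_on {0..T} u" and C: "C \<ge> 0"
    and le: "\<And>t. t \<in> {0..T} \<Longrightarrow> u t \<le> u0 + C * integral {0..t} u" and t: "t \<in> {0..T}"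
  shows "u t \<le> u0 * exp (C * t)"
proof -
  define W where "W s = u0 + C * integral {0..s} u" for s
  have d: "((\<lambda>s. W s * exp (- C * s)) has_real_derivative (C * (u s - W s)) * exp (- C * s)) (at s within {0..T})"
    if s: "s \<in> {0..T}" for s
  proof -
    have "((\<lambda>s. integral {0..s} u) has_real_derivative u s) (at s within {0..T})"
      using integral_has_vector_derivative[OF u s] by (simp add: has_real_derivative_iff_has_vector_derivative)
    then show ?thesis unfolding W_def
      by (auto intro!: derivative_eq_intros simp: algebra_simps)
  qed
  have "W t * exp (- C * t) \<le> W 0 * exp (- C * 0)"
  proof (rule DERIV_nonpos_imp_decreasing_open[where f = "\<lambda>s. W s * exp (- C * s)" and a = 0 and b = t])
    fix s assume s: "0 < s" "s < t"
    have "at s within {0..T} = at s" by (rule at_within_interior) (use s t in auto)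
    moreover have "C * (u s - W s) * exp (- C * s) \<le> 0"
      using le[of s] s t C by (auto simp: W_def mult_le_0_iff)
    ultimately show "\<exists>y. DERIV (\<lambda>s. W s * exp (- C * s)) s :> y \<and> y \<le> 0" using d[of s] s t by auto
  next
    have "continuous_on {0..T} (\<lambda>s. W s * exp (- C * s))"
      unfolding continuous_on_eq_continuous_within using d DERIV_continuous by blast
    then show "continuous_on {0..t} (\<lambda>s. W s * exp (- C * s))" by (rule continuous_on_subset) (use t in auto)
  qed (use t in auto)
  then have "W t \<le> u0 * exp (C * t)"
    by (simp add: W_def exp_minus field_simps)
  then show ?thesis using le[OF t] by (simp add: W_def)
qed

context transport_coefficients
begin

lemma mass_balance:
  assumes m0: "m0 \<in> fin_measures" and n: "prw_continuous b T n" and weak: "weak_eq T m0 v h n" and t: "t \<in> {0..T}"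
  shows "set_integrable lborel {0..t} (\<lambda>\<tau>. \<integral>x. h \<tau> x \<partial>n \<tau>)"
    "measure (n t) UNIV - measure m0 UNIV = (LINT \<tau>:{0..t}|lborel. (\<integral>x. h \<tau> x \<partial>n \<tau>))"
proof -
  have C: "C1_pair (\<lambda>_. 1) (\<lambda>_. 0 :: 'a)" by (simp add: C1_pair_def GDERIV_const)
  show "set_integrable lborel {0..t} (\<lambda>\<tau>. \<integral>x. h \<tau> x \<partial>n \<tau>)"
    "measure (n t) UNIV - measure m0 UNIV = (LINT \<tau>:{0..t}|lborel. (\<integral>x. h \<tau> x \<partial>n \<tau>))"
    using weak_eq_bounded_test[OF m0 n weak C, of 1 0 t] t fin_measuresD[OF m0] fin_measuresD[OF prw_continuousD(1)[OF n t]]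
    by simp_all
qed

lemma mass_bound:
  assumes m0: "m0 \<in> fin_measures" and n: "prw_continuous b T n" and weak: "weak_eq T m0 v h n" and t: "t \<in> {0..T}"
  shows "measure (n t) UNIV \<le> measure m0 UNIV * exp (Ch * t)"
proof (rule gronwall[OF continuous_on_mass[OF b n] C_nonneg(2) _ t])
  fix s assume s: "s \<in> {0..T}"
  have c: "set_integrable lborel {0..s} (\<lambda>\<tau>. Ch * measure (n \<tau>) UNIV)"
    by (rule borel_integrable_atLeastAtMost')
       (use s in \<open>auto intro!: continuous_intros continuous_on_subset[OF continuous_on_mass[OF b n]]\<close>)
  have "(LINT \<tau>:{0..s}|lborel. (\<integral>x. h \<tau> x \<partial>n \<tau>)) \<le> (LINT \<tau>:{0..s}|lborel. Ch * measure (n \<tau>) UNIV)"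
  proof (rule set_integral_mono[OF mass_balance(1)[OF m0 n weak s] c])
    fix \<tau> assume "\<tau> \<in> {0..s}"
    then have \<tau>: "\<tau> \<in> {0..T}" using s by auto
    show "(\<integral>x. h \<tau> x \<partial>n \<tau>) \<le> Ch * measure (n \<tau>) UNIV"
      using fin_measures_integral_bound[OF prw_continuousD(1)[OF n \<tau>] h_bound[OF \<tau>]] by (simp add: abs_le_iff)
  qed
  also have "\<dots> = Ch * integral {0..s} (\<lambda>\<tau>. measure (n \<tau>) UNIV)"
    using set_borel_integral_eq_integral(2)[OF c] by simp
  finally show "measure (n s) UNIV \<le> measure m0 UNIV + Ch * integral {0..s} (\<lambda>\<tau>. measure (n \<tau>) UNIV)"
    using mass_balance(2)[OF m0 n weak s] by simp
qed

text \<open>For a moving test function the increment splits into a change of the test function and a change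
  of the measure. Writing the former as \<open>(s - t) * Q s x\<close> with \<open>Q\<close> jointly continuous turns its
  derivative into a plain continuity statement.\<close>

lemma weak_eq_moving_test:
  assumes n: "prw_continuous b T n" and weak: "weak_eq T m0 v h n"
    and dt: "\<And>t x. t \<in> {0..T} \<Longrightarrow> ((\<lambda>s. \<phi> s x) has_real_derivative dt t x) (at t within {0..T})"
    and dx: "\<And>t x. t \<in> {0..T} \<Longrightarrow> GDERIV (\<phi> t) x :> dx t x"
    and dt_cont: "continuous_on ({0..T} \<times> UNIV) (\<lambda>(t, x). dt t x)"
    and dx_cont: "continuous_on ({0..T} \<times> UNIV) (\<lambda>(t, x). dx t x)"
    and K: "compact K" and z: "\<And>t x. t \<in> {0..T} \<Longrightarrow> x \<notin> K \<Longrightarrow> \<phi> t x = 0" and s: "s \<in> {0..T}"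
  shows "(\<integral>x. \<phi> s x \<partial>n s) - (\<integral>x. \<phi> 0 x \<partial>m0) =
     (LINT t:{0..s}|lborel. (\<integral>x. dt t x + dx t x \<bullet> v t x + \<phi> t x * h t x \<partial>n t))"
proof -
  have T0: "0 \<in> {0..T}" using T by simp
  have Cp: "C1_pair (\<phi> t) (dx t)" if "t \<in> {0..T}" for t
    using dx[OF that] continuous_on_slice[OF dx_cont that] by (simp add: C1_pair_def)
  have dt0: "dt t x = 0" if "t \<in> {0..T}" "x \<notin> K" for t x
  proof -
    have 1: "((\<lambda>_. 0) has_real_derivative dt t x) (at t within {0..T})"
      by (rule has_field_derivative_transform[OF that(1) _ dt[OF that(1)]]) (use z that in auto)
    have 2: "((\<lambda>_. 0) has_vector_derivative (0::real)) (at t within {0..T})" by simp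
    show ?thesis
      using vector_derivative_within_closed_interval[OF T that(1) 2] vector_derivative_within_closed_interval[OF T that(1)] 1
      by (metis has_real_derivative_iff_has_vector_derivative)
  qed
  have dx0: "dx t x = 0" if "t \<in> {0..T}" "x \<notin> K" for t x
    using GDERIV_zero_outside[OF dx[OF that(1)] compact_imp_closed[OF K]] z that by blast
  define Q where "Q t s x = integral {0..1} (\<lambda>r. dt (t + r * (s - t)) x)" for t s x
  have seg: "t + r * (s - t) \<in> {0..T}" if "t \<in> {0..T}" "s \<in> {0..T}" "r \<in> {0..1}" for r s t :: real
    using convexD_alt[of "{0..T}" t s r] that by (simp add: algebra_simps)
  have Q: "\<phi> s x - \<phi> t x = (s - t) * Q t s x" if ts: "t \<in> {0..T}" "s \<in> {0..T}" for s t x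
  proof -
    have "((\<lambda>r. \<phi> (t + r * (s - t)) x) has_vector_derivative dt (t + r * (s - t)) x * (s - t)) (at r within {0..1})"
      if r: "r \<in> {0..1}" for r
    proof -
      have "((\<lambda>r. t + r * (s - t)) has_real_derivative (s - t)) (at r within {0..1})"
        by (auto intro!: derivative_eq_intros)
      moreover have "((\<lambda>s. \<phi> s x) has_real_derivative dt (t + r * (s - t)) x) (at (t + r * (s - t)) within (\<lambda>r. t + r * (s - t)) ` {0..1})"
        by (rule DERIV_subset[OF dt[OF seg[OF ts r]]]) (use seg ts in auto)
      ultimately show ?thesis
        using DERIV_image_chain[of "\<lambda>s. \<phi> s x" _ "\<lambda>r. t + r * (s - t)" r "{0..1}"]
        by (simp add: has_real_derivative_iff_has_vector_derivative o_def)
    qed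
    from fundamental_theorem_of_calculus[OF _ this]
    have "((\<lambda>r. dt (t + r * (s - t)) x * (s - t)) has_integral \<phi> s x - \<phi> t x) {0..1}" by simp
    then have "integral {0..1} (\<lambda>r. dt (t + r * (s - t)) x * (s - t)) = \<phi> s x - \<phi> t x" by (rule integral_unique)
    then show ?thesis by (simp add: Q_def mult.commute)
  qed
  have Qc: "continuous_on ({0..T} \<times> UNIV) (\<lambda>(s, x). Q t s x)" if t: "t \<in> {0..T}" for t
  proof -
    have "continuous_on (({0..T} \<times> UNIV) \<times> cbox 0 1) (\<lambda>q. (\<lambda>(t, x). dt t x) (t + snd q * (fst (fst q) - t), snd (fst q)))"
      by (rule continuous_on_compose2[OF dt_cont]) (use seg t in \<open>auto intro!: continuous_intros\<close>)
    then have "continuous_on (({0..T} \<times> UNIV) \<times> cbox 0 1) (\<lambda>(p, r). dt (t + r * (fst p - t)) (snd p))"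
      by (simp add: case_prod_beta')
    from integral_continuous_on_param[OF this] show ?thesis by (simp add: Q_def case_prod_beta')
  qed
  have Q0: "Q t s x = 0" if "t \<in> {0..T}" "s \<in> {0..T}" "x \<notin> K" for t s x
  proof -
    have "Q t s x = integral {0..1} (\<lambda>r::real. 0)"
      unfolding Q_def by (rule integral_cong) (use dt0 seg that in auto)
    then show ?thesis by simp
  qed
  have \<phi>c: "continuous_on ({0..T} \<times> UNIV) (\<lambda>(t, x). \<phi> t x)"
  proof -
    have "continuous_on ({0..T} \<times> (UNIV :: 'a set)) (\<lambda>p. \<phi> 0 (snd p))"
      by (rule continuous_on_compose2[OF C1_pairD(1)[OF Cp[OF T0]]]) (auto intro!: continuous_intros)
    then have "continuous_on ({0..T} \<times> UNIV) (\<lambda>p. \<phi> 0 (snd p) + fst p * Q 0 (fst p) (snd p))"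
      using Qc[OF T0] by (auto intro!: continuous_intros simp: case_prod_beta')
    moreover have "\<phi> 0 (snd p) + fst p * Q 0 (fst p) (snd p) = (case p of (t, x) \<Rightarrow> \<phi> t x)"
      if "p \<in> {0..T} \<times> (UNIV :: 'a set)" for p
      using Q[OF T0, of "fst p" "snd p"] that by (simp add: case_prod_beta' mem_Times_iff)
    ultimately show ?thesis by (simp cong: continuous_on_cong)
  qed
  define F where "F t = (\<integral>x. \<phi> t x \<partial>n t)" for t
  define G where "G t = (\<integral>x. dt t x + dx t x \<bullet> v t x + \<phi> t x * h t x \<partial>n t)" for t
  have gc: "continuous_on ({0..T} \<times> UNIV) (\<lambda>(t, x). dt t x + dx t x \<bullet> v t x + \<phi> t x * h t x)"
    using dt_cont dx_cont \<phi>c v_cont h_cont unfolding case_prod_beta' by (auto intro!: continuous_intros)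
  have Gc: "continuous_on {0..T} G"
    unfolding G_def by (rule continuous_on_integral_moving[OF b n gc K]) (simp add: z dt0 dx0)
  note n' = prw_continuousD(1)[OF n]
  have int: "integrable (n s) (\<Theta> t)" if \<Theta>c: "continuous_on ({0..T} \<times> UNIV) (\<lambda>(t, x). \<Theta> t x)"
    and \<Theta>0: "\<And>t x. t \<in> {0..T} \<Longrightarrow> x \<notin> K \<Longrightarrow> \<Theta> t x = 0" and st: "s \<in> {0..T}" "t \<in> {0..T}" for \<Theta> :: "real \<Rightarrow> 'a \<Rightarrow> real" and s t
  proof -
    obtain A where A: "A > 0" "\<And>t x. t \<in> {0..T} \<Longrightarrow> \<bar>\<Theta> t x\<bar> \<le> A" using bounded_compact_support[OF \<Theta>c K \<Theta>0] by blast
    show ?thesis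
      by (rule fin_measures_integrable[OF n'[OF st(1)] _ A(2)[OF st(2)]])
         (rule borel_measurable_continuous_onI[OF continuous_on_slice[OF \<Theta>c st(2)]])
  qed
  have dF: "(F has_vector_derivative G t) (at t within {0..T})" if t: "t \<in> {0..T}" for t
  proof -
    define q where "q s = (\<integral>x. Q t s x \<partial>n s)" for s
    have qc: "continuous_on {0..T} q"
      unfolding q_def by (rule continuous_on_integral_moving[OF b n Qc[OF t] K]) (use Q0 t in auto)
    define H where "H \<tau> = (\<integral>x. v \<tau> x \<bullet> dx t x + h \<tau> x * \<phi> t x \<partial>n \<tau>)" for \<tau>
    have Hc: "continuous_on {0..T} H"
      unfolding H_def
      by (rule continuous_on_integral_moving[OF b n continuous_on_weak_integrand[OF v_cont h_cont C1_pairD(1,2)[OF Cp[OF t]]] K])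
         (use z[OF t] dx0[OF t] in simp)
    have p: "(\<integral>x. \<phi> t x \<partial>n s) = (\<integral>x. \<phi> t x \<partial>m0) + integral {0..s} H" if s: "s \<in> {0..T}" for s
    proof -
      have "set_integrable lborel {0..s} H"
        by (rule borel_integrable_atLeastAtMost'[OF continuous_on_subset[OF Hc]]) (use s in auto)
      then have "(LINT \<tau>:{0..s}|lborel. H \<tau>) = integral {0..s} H" by (rule set_borel_integral_eq_integral)
      then show ?thesis
        using weak[unfolded weak_eq_def, rule_format, OF Cp[OF t] K z[OF t] s] unfolding H_def by simp
    qed
    have FF: "F s = (s - t) * q s + ((\<integral>x. \<phi> t x \<partial>m0) + integral {0..s} H)" if s: "s \<in> {0..T}" for s
    proof -
      have "F s - (\<integral>x. \<phi> t x \<partial>n s) = (\<integral>x. \<phi> s x - \<phi> t x \<partial>n s)"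
        unfolding F_def using int[OF \<phi>c z s s] int[OF \<phi>c z s t] by simp
      also have "\<dots> = (s - t) * q s" unfolding q_def using Q[OF t s] by simp
      finally show ?thesis using p[OF s] by simp
    qed
    have 1: "((\<lambda>s. (s - t) * q s) has_real_derivative q t) (at t within {0..T})"
      unfolding has_field_derivative_iff
    proof (rule Lim_transform_within[where d = 1])
      show "(q \<longlongrightarrow> q t) (at t within {0..T})" using qc t by (simp add: continuous_on)
    qed auto
    have 2: "((\<lambda>s. (\<integral>x. \<phi> t x \<partial>m0) + integral {0..s} H) has_real_derivative H t) (at t within {0..T})"
      using integral_has_vector_derivative[OF Hc t]
      by (auto intro!: derivative_eq_intros simp: has_real_derivative_iff_has_vector_derivative[symmetric])
    have qt: "q t = (\<integral>x. dt t x \<partial>n t)" unfolding q_def Q_def by simp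
    have "G t = q t + H t"
    proof -
      have wc: "continuous_on ({0..T} \<times> UNIV) (\<lambda>(\<tau>, x). v \<tau> x \<bullet> dx \<tau> x + h \<tau> x * \<phi> \<tau> x)"
        using dx_cont \<phi>c v_cont h_cont unfolding case_prod_beta' by (auto intro!: continuous_intros)
      have "q t + H t = (\<integral>x. dt t x + (v t x \<bullet> dx t x + h t x * \<phi> t x) \<partial>n t)"
        unfolding qt H_def
        by (rule Bochner_Integration.integral_add[symmetric, OF int[OF dt_cont dt0 t t] int[OF wc _ t t]]) (simp_all add: z dx0)
      then show ?thesis by (simp add: G_def inner_commute mult.commute add.assoc)
    qed
    then have "((\<lambda>s. (s - t) * q s + ((\<integral>x. \<phi> t x \<partial>m0) + integral {0..s} H)) has_real_derivative G t) (at t within {0..T})"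
      using DERIV_add[OF 1 2] by simp
    then have "(F has_real_derivative G t) (at t within {0..T})"
      by (rule has_field_derivative_transform[OF t FF, rotated])
    then show ?thesis by (simp add: has_real_derivative_iff_has_vector_derivative)
  qed
  have "(G has_integral F s - F 0) {0..s}"
  proof (rule fundamental_theorem_of_calculus)
    fix t assume "t \<in> {0..s}"
    then show "(F has_vector_derivative G t) (at t within {0..s})"
      using s by (auto intro!: has_vector_derivative_within_subset[OF dF])
  qed (use s in auto)
  then have "integral {0..s} G = F s - F 0" by (rule integral_unique)
  moreover have "(LINT t:{0..s}|lborel. G t) = integral {0..s} G"
    by (rule set_borel_integral_eq_integral, rule borel_integrable_atLeastAtMost', rule continuous_on_subset[OF Gc])
       (use s in auto)
  moreover have "F 0 = (\<integral>x. \<phi> 0 x \<partial>m0)"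
    using weak[unfolded weak_eq_def, rule_format, OF Cp[OF T0] K z[OF T0] T0] unfolding F_def set_integral_point by simp
  ultimately show ?thesis unfolding F_def G_def by simp
qed

end

section \<open>The balance equation and the equation for flows\<close>

locale balance_coefficients =
  fixes b T Cf Cg :: real and f :: "real \<Rightarrow> 'a::euclidean_space \<Rightarrow> 'a measure \<Rightarrow> 'a" and g :: "real \<Rightarrow> 'a \<Rightarrow> 'a measure \<Rightarrow> real"
  assumes b: "b > 0" and T: "T > 0"
    and f_cont: "jointly_continuous b T f" and g_cont: "jointly_continuous b T g"
    and f_bound: "\<And>t x m. t \<in> {0..T} \<Longrightarrow> m \<in> fin_measures \<Longrightarrow> norm (f t x m) \<le> Cf"
    and g_bound: "\<And>t x m. t \<in> {0..T} \<Longrightarrow> m \<in> fin_measures \<Longrightarrow> \<bar>g t x m\<bar> \<le> Cg"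
begin

lemma transport_coefficients_along:
  assumes m: "prw_continuous b T m"
  shows "transport_coefficients b T Cf Cg (\<lambda>t x. f t x (m t)) (\<lambda>t x. g t x (m t))"
  using b T f_bound g_bound prw_continuousD(1)[OF m] continuous_on_coefficient[OF f_cont m] continuous_on_coefficient[OF g_cont m]
  by (unfold_locales) auto

text \<open>Test functions constant in time form a subclass of all test functions; \<open>weak_eq_moving_test\<close> shows
  that they already suffice.\<close>

lemma weak_solution_iff:
  "weak_solution b T f g m0 m \<longleftrightarrow>
     prw_continuous b T m \<and> weak_eq T m0 (\<lambda>t x. f t x (m t)) (\<lambda>t x. g t x (m t)) m"
proof (cases "prw_continuous b T m")
  case True
  interpret transport_coefficients b T Cf Cg "\<lambda>t x. f t x (m t)" "\<lambda>t x. g t x (m t)"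
    by (rule transport_coefficients_along[OF True])
  show ?thesis
  proof
    assume w: "weak_solution b T f g m0 m"
    show "prw_continuous b T m \<and> weak_eq T m0 (\<lambda>t x. f t x (m t)) (\<lambda>t x. g t x (m t)) m"
      unfolding weak_eq_def
    proof (intro conjI True allI impI ballI)
      fix \<phi> :: "'a \<Rightarrow> real" and D K t
      assume C: "C1_pair \<phi> D" and K: "compact K" and z: "\<forall>x. x \<notin> K \<longrightarrow> \<phi> x = 0" and t: "t \<in> {0..T}"
      have "(\<lambda>_. \<phi>) \<in> C1c T"
        unfolding C1c_def mem_Collect_eq
      proof (intro conjI exI[of _ "\<lambda>_ _. 0 :: real"] exI[of _ "\<lambda>_. D"] ballI allI)
        show "continuous_on ({0..T} \<times> UNIV) (\<lambda>(t::real, x). D x)"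
          unfolding case_prod_beta'
          by (rule continuous_on_compose2[OF C1_pairD(2)[OF C]]) (auto intro!: continuous_intros)
        have "bounded ({0..T} \<times> K)" by (rule bounded_Times) (auto intro: compact_imp_bounded K)
        then show "compact (closure {(t, x). t \<in> {0..T} \<and> \<phi> x \<noteq> 0})"
          by (simp, elim bounded_subset) (use z in auto)
      qed (use C1_pairD(5)[OF C] in auto)
      from w[unfolded weak_solution_def, THEN conjunct2, THEN conjunct2, rule_format, OF this t]
      have "(\<integral>x. \<phi> x \<partial>m t) - (\<integral>x. \<phi> x \<partial>m0) = (LINT \<tau>:{0..t}|lborel. (\<integral>x. vector_derivative (\<lambda>r. \<phi> x) (at \<tau> within {0..T})
                 + grad \<phi> x \<bullet> f \<tau> x (m \<tau>) + \<phi> x * g \<tau> x (m \<tau>) \<partial>m \<tau>))" .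
      also have "\<dots> = (LINT \<tau>:{0..t}|lborel. (\<integral>x. f \<tau> x (m \<tau>) \<bullet> D x + g \<tau> x (m \<tau>) * \<phi> x \<partial>m \<tau>))"
      proof (rule set_lebesgue_integral_cong)
        show "\<forall>\<tau>. \<tau> \<in> {0..t} \<longrightarrow> (\<integral>x. vector_derivative (\<lambda>r. \<phi> x) (at \<tau> within {0..T})
                 + grad \<phi> x \<bullet> f \<tau> x (m \<tau>) + \<phi> x * g \<tau> x (m \<tau>) \<partial>m \<tau>) = (\<integral>x. f \<tau> x (m \<tau>) \<bullet> D x + g \<tau> x (m \<tau>) * \<phi> x \<partial>m \<tau>)"
        proof (intro allI impI Bochner_Integration.integral_cong refl)
          fix \<tau> x assume "\<tau> \<in> {0..t}"
          then have "vector_derivative (\<lambda>r. \<phi> x) (at \<tau> within {0..T}) = 0"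
            using t T by (intro vector_derivative_within_closed_interval) auto
          then show "vector_derivative (\<lambda>r. \<phi> x) (at \<tau> within {0..T}) + grad \<phi> x \<bullet> f \<tau> x (m \<tau>) + \<phi> x * g \<tau> x (m \<tau>) =
              f \<tau> x (m \<tau>) \<bullet> D x + g \<tau> x (m \<tau>) * \<phi> x"
            by (simp add: C1_pairD(6)[OF C] inner_commute)
        qed
      qed simp
      finally show "(\<integral>x. \<phi> x \<partial>m t) - (\<integral>x. \<phi> x \<partial>m0) = \<dots>" .
    qed
  next
    assume w: "prw_continuous b T m \<and> weak_eq T m0 (\<lambda>t x. f t x (m t)) (\<lambda>t x. g t x (m t)) m"
    show "weak_solution b T f g m0 m"
      unfolding weak_solution_def
    proof (intro conjI ballI)
      fix \<phi> :: "real \<Rightarrow> 'a \<Rightarrow> real" and s assume \<phi>: "\<phi> \<in> C1c T" and s: "s \<in> {0..T}"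
      obtain dt dx where d: "\<And>t x. t \<in> {0..T} \<Longrightarrow> ((\<lambda>s. \<phi> s x) has_real_derivative dt t x) (at t within {0..T})"
        "\<And>t x. t \<in> {0..T} \<Longrightarrow> GDERIV (\<phi> t) x :> dx t x"
        "continuous_on ({0..T} \<times> UNIV) (\<lambda>(t, x). dt t x)" "continuous_on ({0..T} \<times> UNIV) (\<lambda>(t, x). dx t x)"
        and c: "compact (closure {(t, x). t \<in> {0..T} \<and> \<phi> t x \<noteq> 0})"
        using \<phi> unfolding C1c_def by blast
      define K where "K = snd ` closure {(t, x). t \<in> {0..T} \<and> \<phi> t x \<noteq> 0}"
      have K: "compact K" unfolding K_def by (rule compact_continuous_image[OF _ c]) (intro continuous_intros)
      have z: "\<phi> t x = 0" if "t \<in> {0..T}" "x \<notin> K" for t x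
      proof (rule ccontr)
        assume "\<phi> t x \<noteq> 0"
        then have "(t, x) \<in> closure {(t, x). t \<in> {0..T} \<and> \<phi> t x \<noteq> 0}" using that(1) by (intro closure_subset[THEN subsetD]) auto
        then show False using that(2) unfolding K_def by force
      qed
      have "(\<integral>x. \<phi> s x \<partial>m s) - (\<integral>x. \<phi> 0 x \<partial>m0) =
         (LINT t:{0..s}|lborel. (\<integral>x. dt t x + dx t x \<bullet> f t x (m t) + \<phi> t x * g t x (m t) \<partial>m t))"
        using weak_eq_moving_test[OF True conjunct2[OF w] d K z s] .
      also have "\<dots> = (LINT t:{0..s}|lborel. (\<integral>x. vector_derivative (\<lambda>r. \<phi> r x) (at t within {0..T})
                 + grad (\<phi> t) x \<bullet> f t x (m t) + \<phi> t x * g t x (m t) \<partial>m t))"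
      proof (rule set_lebesgue_integral_cong)
        show "\<forall>t. t \<in> {0..s} \<longrightarrow> (\<integral>x. dt t x + dx t x \<bullet> f t x (m t) + \<phi> t x * g t x (m t) \<partial>m t) =
          (\<integral>x. vector_derivative (\<lambda>r. \<phi> r x) (at t within {0..T})
                 + grad (\<phi> t) x \<bullet> f t x (m t) + \<phi> t x * g t x (m t) \<partial>m t)"
        proof (intro allI impI Bochner_Integration.integral_cong refl)
          fix t x assume "t \<in> {0..s}"
          then have t: "t \<in> {0..T}" using s by auto
          have "vector_derivative (\<lambda>r. \<phi> r x) (at t within {0..T}) = dt t x"
            using d(1)[OF t, of x] unfolding has_real_derivative_iff_has_vector_derivative
            by (rule vector_derivative_within_closed_interval[OF T t])
          then show "dt t x + dx t x \<bullet> f t x (m t) + \<phi> t x * g t x (m t) = vector_derivative (\<lambda>r. \<phi> r x) (at t within {0..T})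
                 + grad (\<phi> t) x \<bullet> f t x (m t) + \<phi> t x * g t x (m t)"
            by (simp add: grad_eq[OF d(2)[OF t]])
        qed
      qed simp
      finally show "(\<integral>x. \<phi> s x \<partial>m s) - (\<integral>x. \<phi> 0 x \<partial>m0) = \<dots>" .
    qed (use True[unfolded prw_continuous_def] in blast)+
  qed
next
  case False
  then show ?thesis unfolding weak_solution_def prw_continuous_def by blast
qed

lemma prw_continuous_scaled_restr:
  assumes R: "R > 0" and \<mu>: "prob_flow b T \<mu>"
  shows "prw_continuous b T (\<lambda>t. scaled_restr R (\<mu> t))"
  unfolding prw_continuous_def
proof (intro conjI ballI allI impI)
  have p: "\<mu> t \<in> prob1_star b" if "t \<in> {0..T}" for t using \<mu> that by (simp add: prob_flow_def)
  note p' = prob1_starD[OF p]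
  show "scaled_restr R (\<mu> t) \<in> fin_measures" if "t \<in> {0..T}" for t
    using scaled_restr_in_fin_measures[OF b p'(3)[OF that] p'(2)[OF that]] .
  fix t \<epsilon> :: real assume t: "t \<in> {0..T}" and \<epsilon>: "\<epsilon> > 0"
  obtain \<delta> where \<delta>: "\<delta> > 0" "\<forall>s\<in>{0..T}. \<bar>s - t\<bar> < \<delta> \<longrightarrow> W1_star b (\<mu> t) (\<mu> s) < \<epsilon> / R"
    using \<mu> t divide_pos_pos[OF \<epsilon> R] unfolding prob_flow_def by blast
  have "prw_dist b (scaled_restr R (\<mu> t)) (scaled_restr R (\<mu> s)) < \<epsilon>" if s: "s \<in> {0..T}" "\<bar>s - t\<bar> < \<delta>" for s
  proof -
    have "R * W1_star b (\<mu> t) (\<mu> s) < \<epsilon>" using \<delta>(2) s R by (simp add: pos_less_divide_eq mult.commute)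
    then show ?thesis
      using prw_dist_scaled_restr_le[OF b R p'(3)[OF t] p'(1)[OF t] p'(3)[OF s(1)] p'(1)[OF s(1)]] by linarith
  qed
  then show "\<exists>\<delta>>0. \<forall>s\<in>{0..T}. \<bar>s - t\<bar> < \<delta> \<longrightarrow> prw_dist b (scaled_restr R (\<mu> t)) (scaled_restr R (\<mu> s)) < \<epsilon>"
    using \<delta>(1) by blast
qed

text \<open>Births leave the remote point at a rate with denominator \<open>\<mu>{\<star>}\<close>, which integration against \<open>\<mu>\<close> cancels. The
  two jump parts therefore carry the factors \<open>- g\<^sup>-\<close> and \<open>g\<^sup>+\<close> in front of the same increment of \<open>\<phi>\<close>, and these
  add up to \<open>g\<close>.\<close>

lemma integral_generator:
  fixes \<phi> :: "'a option \<Rightarrow> real"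
  assumes R: "R > 0" and t: "t \<in> {0..T}" and \<mu>: "\<mu> \<in> prob1_star b" and pos: "measure \<mu> {None} > 0"
    and C: "C1_pair (\<lambda>x. \<phi> (Some x)) D" and bd: "\<And>x. \<bar>\<phi> (Some x)\<bar> \<le> A" "\<And>x. norm (D x) \<le> B"
    and fc: "continuous_on UNIV (\<lambda>x. f t x (scaled_restr R \<mu>))" and gc: "continuous_on UNIV (\<lambda>x. g t x (scaled_restr R \<mu>))"
  defines "m \<equiv> scaled_restr R \<mu>"
  shows "(\<integral>x. generator R f g t \<mu> \<phi> x \<partial>\<mu>) =
    (1 / R) * (\<integral>x. f t x m \<bullet> D x + g t x m * (\<phi> (Some x) - \<phi> None) \<partial>m)"
proof -
  note p = prob1_starD[OF \<mu>]
  interpret prob_space \<mu> by (rule p(1))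
  have m: "m \<in> fin_measures" unfolding m_def by (rule scaled_restr_in_fin_measures[OF b p(3) p(2)])
  have fm[measurable]: "(\<lambda>x. f t x m) \<in> borel_measurable borel" and gm[measurable]: "(\<lambda>x. g t x m) \<in> borel_measurable borel"
    using fc gc by (auto intro: borel_measurable_continuous_onI simp: m_def)
  note [measurable] = C1_pairD(3,4)[OF C]
  have A: "A \<ge> 0" using bd(1)[of undefined] by linarith
  have B: "B \<ge> 0" using bd(2)[of undefined] norm_ge_zero[of "D undefined"] by linarith
  have Cg: "Cg \<ge> 0" "Cf \<ge> 0"
    using g_bound[OF t m, of undefined] f_bound[OF t m, of undefined] norm_ge_zero[of "f t undefined m"] by linarith+
  note star_meas = star_measurable[OF b p(3)]
  have sa: "aug_fun R h t (Some y) \<mu> = h t y m" "aug_fun R h t None \<mu> = 0" for y and h :: "real \<Rightarrow> 'a \<Rightarrow> 'a measure \<Rightarrow> 'c::zero"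
    by (simp_all add: aug_fun_def m_def)
  have gm': "(\<lambda>y. aug_fun R g t y \<mu>) \<in> borel_measurable \<mu>" by (rule star_meas) (simp add: sa)
  have pm: "(\<lambda>y. \<phi> y - \<phi> None) \<in> borel_measurable \<mu>" by (rule star_meas) simp
  define bn where "bn = (\<integral>y. max (aug_fun R g t y \<mu>) 0 * (\<phi> y - \<phi> None) \<partial>\<mu>)"
  have gN: "generator R f g t \<mu> \<phi> None = inverse (measure \<mu> {None}) * bn"
    unfolding generator_def bn_def using integral_nu_plus[OF pm gm']
    by (simp add: nu_minus_def sa)
  have gS: "generator R f g t \<mu> \<phi> (Some y) = f t y m \<bullet> D y + max (- g t y m) 0 * (\<phi> None - \<phi> (Some y))" for y
  proof -
    have "(\<integral>u. (\<phi> (jump (Some y) u) - \<phi> (Some y)) \<partial>(nu_minus R g t (Some y) \<mu>)) = max (- g t y m) 0 * (\<phi> None - \<phi> (Some y))"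
      unfolding nu_minus_def sa by (subst integral_scale_measure) (simp_all add: integral_return jump_def)
    then show ?thesis unfolding generator_def sa by (simp add: nu_plus_def C1_pairD(6)[OF C])
  qed
  have bd0: "\<bar>\<phi> x - \<phi> None\<bar> \<le> A + \<bar>\<phi> None\<bar>" for x using A bd(1) by (cases x) (auto intro: order_trans[OF abs_triangle_ineq4] add_mono)
  have pb: "\<bar>max (- g t y m) 0\<bar> \<le> Cg" "\<bar>max (g t y m) 0\<bar> \<le> Cg" for y using g_bound[OF t m, of y] by auto
  have i1: "integrable \<mu> (generator R f g t \<mu> \<phi>)"
  proof (rule integrable_const_bound)
    let ?K = "max (Cf * B + Cg * (A + \<bar>\<phi> None\<bar>)) \<bar>generator R f g t \<mu> \<phi> None\<bar>"
    show "generator R f g t \<mu> \<phi> \<in> borel_measurable \<mu>" by (rule star_meas) (unfold gS, measurable)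
    have "norm (generator R f g t \<mu> \<phi> x) \<le> ?K" for x
    proof (cases x)
      case (Some y)
      have "\<bar>f t y m \<bullet> D y\<bar> \<le> Cf * B"
        using Cauchy_Schwarz_ineq2[of "f t y m" "D y"] mult_mono[OF f_bound[OF t m, of y] bd(2)[of y]] Cg by auto
      moreover have "\<bar>max (- g t y m) 0 * (\<phi> None - \<phi> (Some y))\<bar> \<le> Cg * (A + \<bar>\<phi> None\<bar>)"
        unfolding abs_mult using mult_mono[OF pb(1)[of y] bd0[of "Some y"]] Cg by (simp add: abs_minus_commute)
      ultimately show ?thesis unfolding Some gS by simp
    qed simp
    then show "AE x in \<mu>. norm (generator R f g t \<mu> \<phi> x) \<le> ?K" by simp
  qed
  have i2: "integrable \<mu> (\<lambda>y. max (aug_fun R g t y \<mu>) 0 * (\<phi> y - \<phi> None))"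
  proof (rule integrable_const_bound)
    show "(\<lambda>y. max (aug_fun R g t y \<mu>) 0 * (\<phi> y - \<phi> None)) \<in> borel_measurable \<mu>" using gm' pm by measurable
    have "norm (max (aug_fun R g t y \<mu>) 0 * (\<phi> y - \<phi> None)) \<le> Cg * (A + \<bar>\<phi> None\<bar>)" for y
    proof (cases y)
      case (Some z)
      then show ?thesis using mult_mono[OF pb(2)[of z] bd0[of "Some z"]] Cg by (simp add: abs_mult sa)
    qed (use A Cg in \<open>simp add: sa\<close>)
    then show "AE y in \<mu>. norm (max (aug_fun R g t y \<mu>) 0 * (\<phi> y - \<phi> None)) \<le> Cg * (A + \<bar>\<phi> None\<bar>)" by simp
  qed
  let ?u = "\<lambda>y. f t y m \<bullet> D y + max (- g t y m) 0 * (\<phi> None - \<phi> (Some y))" and ?w = "\<lambda>y. max (g t y m) 0 * (\<phi> (Some y) - \<phi> None)"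
  have bn: "bn = (1 / R) * (\<integral>y. ?w y \<partial>m)"
    unfolding bn_def using integral_star[OF b p(3) p(2) i2] integral_scaled_restr[of R ?w \<mu>] R by (simp add: sa m_def[symmetric])
  have "(\<integral>x. generator R f g t \<mu> \<phi> x \<partial>\<mu>) = (\<integral>y. ?u y \<partial>restr \<mu>) + generator R f g t \<mu> \<phi> None * measure \<mu> {None}"
    using integral_star[OF b p(3) p(2) i1] unfolding gS .
  also have "generator R f g t \<mu> \<phi> None * measure \<mu> {None} = bn" using pos by (simp add: gN)
  also have "(\<integral>y. ?u y \<partial>restr \<mu>) = (1 / R) * (\<integral>y. ?u y \<partial>m)"
    using integral_scaled_restr[of R ?u \<mu>] R by (simp add: m_def[symmetric])
  also have "(1 / R) * (\<integral>y. ?u y \<partial>m) + bn = (1 / R) * ((\<integral>y. ?u y \<partial>m) + (\<integral>y. ?w y \<partial>m))"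
    by (simp add: bn distrib_left)
  also have "(\<integral>y. ?u y \<partial>m) + (\<integral>y. ?w y \<partial>m) = (\<integral>y. ?u y + ?w y \<partial>m)"
  proof (rule Bochner_Integration.integral_add[symmetric])
    have "\<bar>?u y\<bar> \<le> Cf * B + Cg * (A + \<bar>\<phi> None\<bar>)" for y
    proof -
      have "\<bar>f t y m \<bullet> D y\<bar> \<le> Cf * B"
        using Cauchy_Schwarz_ineq2[of "f t y m" "D y"] mult_mono[OF f_bound[OF t m, of y] bd(2)[of y]] Cg by auto
      moreover have "\<bar>max (- g t y m) 0 * (\<phi> None - \<phi> (Some y))\<bar> \<le> Cg * (A + \<bar>\<phi> None\<bar>)"
        unfolding abs_mult using mult_mono[OF pb(1)[of y] bd0[of "Some y"]] Cg by (simp add: abs_minus_commute)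
      ultimately show ?thesis by linarith
    qed
    then show "integrable m ?u" by (intro fin_measures_integrable[OF m]) auto
    have "\<bar>?w y\<bar> \<le> Cg * (A + \<bar>\<phi> None\<bar>)" for y
      unfolding abs_mult using mult_mono[OF pb(2)[of y] bd0[of "Some y"]] Cg by simp
    then show "integrable m ?w" by (intro fin_measures_integrable[OF m]) auto
  qed
  also have "\<dots> = (\<integral>x. f t x m \<bullet> D x + g t x m * (\<phi> (Some x) - \<phi> None) \<partial>m)"
    by (rule Bochner_Integration.integral_cong) (auto simp: max_def algebra_simps)
  finally show ?thesis .
qed

text \<open>Since \<open>\<mu>\<close> has total mass one, the value of a test function at the remote point enters both sides only
  through the mass of \<open>m\<close>, and its contributions agree by \<open>mass_balance\<close>.\<close>

lemma solves_flow_eq_iff: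
  assumes R: "R > 0" and \<mu>: "prob_flow b T \<mu>"
  defines "m \<equiv> \<lambda>t. scaled_restr R (\<mu> t)"
  shows "solves_flow_eq b T R f g \<mu> \<longleftrightarrow> (\<forall>t\<in>{0..T}. measure (\<mu> t) {None} > 0) \<and>
     weak_eq T (m 0) (\<lambda>t x. f t x (m t)) (\<lambda>t x. g t x (m t)) m"
proof (cases "\<forall>t\<in>{0..T}. measure (\<mu> t) {None} > 0")
  case pos: True
  have mc: "prw_continuous b T m" unfolding m_def by (rule prw_continuous_scaled_restr[OF R \<mu>])
  note m' = prw_continuousD(1)[OF mc]
  interpret transport_coefficients b T Cf Cg "\<lambda>t x. f t x (m t)" "\<lambda>t x. g t x (m t)"
    by (rule transport_coefficients_along[OF mc])
  have T0: "0 \<in> {0..T}" using T by simp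
  have p: "\<mu> t \<in> prob1_star b" if "t \<in> {0..T}" for t using \<mu> that by (simp add: prob_flow_def)
  note p' = prob1_starD[OF p]
  have split: "(\<integral>x. \<phi> x \<partial>\<mu> t) = (1 / R) * (\<integral>x. \<phi> (Some x) \<partial>m t) + \<phi> None * (1 - measure (m t) UNIV / R)"
    if C: "C1_pair (\<lambda>x. \<phi> (Some x)) D" and A: "\<And>x. \<bar>\<phi> (Some x)\<bar> \<le> A" and t: "t \<in> {0..T}"
    for \<phi> :: "'a option \<Rightarrow> real" and D A t
  proof -
    interpret prob_space "\<mu> t" by (rule p'(1)[OF t])
    have "\<phi> \<in> borel_measurable (\<mu> t)" by (rule star_measurable[OF b p'(3)[OF t] C1_pairD(3)[OF C]])
    moreover have "\<bar>\<phi> x\<bar> \<le> max A \<bar>\<phi> None\<bar>" for x using A by (cases x) (auto simp: le_max_iff_disj)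
    ultimately have "integrable (\<mu> t) \<phi>" by (intro integrable_const_bound[where B = "max A \<bar>\<phi> None\<bar>"]) auto
    from integral_star[OF b p'(3)[OF t] p'(2)[OF t] this]
    show ?thesis
      using integral_scaled_restr[of R "\<lambda>x. \<phi> (Some x)" "\<mu> t"] C1_pairD(3)[OF C] R
        measure_scaled_restr[OF b p'(3)[OF t] p'(1)[OF t], of R] by (simp add: m_def)
  qed
  have gen: "(\<integral>x. generator R f g \<tau> (\<mu> \<tau>) \<phi> x \<partial>\<mu> \<tau>) =
      (1 / R) * ((\<integral>x. f \<tau> x (m \<tau>) \<bullet> D x + g \<tau> x (m \<tau>) * \<phi> (Some x) \<partial>m \<tau>) - \<phi> None * (\<integral>x. g \<tau> x (m \<tau>) \<partial>m \<tau>))"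
    if C: "C1_pair (\<lambda>x. \<phi> (Some x)) D" and bd: "\<And>x. \<bar>\<phi> (Some x)\<bar> \<le> A" "\<And>x. norm (D x) \<le> B" and t: "\<tau> \<in> {0..T}"
    for \<phi> :: "'a option \<Rightarrow> real" and D A B \<tau>
  proof -
    have c: "continuous_on UNIV (\<lambda>x. f \<tau> x (m \<tau>))" "continuous_on UNIV (\<lambda>x. g \<tau> x (m \<tau>))"
      using continuous_on_slice[OF v_cont t] continuous_on_slice[OF h_cont t] by auto
    have meas: "(\<lambda>x. f \<tau> x (m \<tau>) \<bullet> D x + g \<tau> x (m \<tau>) * \<phi> (Some x)) \<in> borel_measurable borel"
      using measurable_coeffs[OF t] C1_pairD(3,4)[OF C] by auto
    have "(\<integral>x. generator R f g \<tau> (\<mu> \<tau>) \<phi> x \<partial>\<mu> \<tau>) =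
      (1 / R) * (\<integral>x. f \<tau> x (m \<tau>) \<bullet> D x + g \<tau> x (m \<tau>) * (\<phi> (Some x) - \<phi> None) \<partial>m \<tau>)"
      unfolding m_def
      by (rule integral_generator[OF R t p[OF t] _ C bd]) (use pos t c in \<open>auto simp: m_def\<close>)
    also have "(\<integral>x. f \<tau> x (m \<tau>) \<bullet> D x + g \<tau> x (m \<tau>) * (\<phi> (Some x) - \<phi> None) \<partial>m \<tau>) =
        (\<integral>x. (f \<tau> x (m \<tau>) \<bullet> D x + g \<tau> x (m \<tau>) * \<phi> (Some x)) - \<phi> None * g \<tau> x (m \<tau>) \<partial>m \<tau>)"
      by (simp add: algebra_simps)
    also have "\<dots> = (\<integral>x. f \<tau> x (m \<tau>) \<bullet> D x + g \<tau> x (m \<tau>) * \<phi> (Some x) \<partial>m \<tau>) - \<phi> None * (\<integral>x. g \<tau> x (m \<tau>) \<partial>m \<tau>)"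
      using fin_measures_integrable[OF m'[OF t] meas weak_integrand_bound[OF t bd]]
        fin_measures_integrable[OF m'[OF t] measurable_coeffs(2)[OF t] h_bound[OF t]]
      by simp
    finally show ?thesis .
  qed
  show ?thesis
  proof
    assume sol: "solves_flow_eq b T R f g \<mu>"
    have "weak_eq T (m 0) (\<lambda>t x. f t x (m t)) (\<lambda>t x. g t x (m t)) m"
      unfolding weak_eq_def
    proof (intro allI impI ballI)
      fix \<psi> :: "'a \<Rightarrow> real" and D K t
      assume C: "C1_pair \<psi> D" and K: "compact K" and z: "\<forall>x. x \<notin> K \<longrightarrow> \<psi> x = 0" and t: "t \<in> {0..T}"
      obtain A B where bd: "\<And>x. \<bar>\<psi> x\<bar> \<le> A" "\<And>x. norm (D x) \<le> B" using C1_pair_bounded[OF C K] z by blast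
      define \<phi> where "\<phi> x = (case x of None \<Rightarrow> 0 | Some y \<Rightarrow> \<psi> y)" for x
      have \<phi>: "\<phi> (Some x) = \<psi> x" "\<phi> None = 0" for x by (simp_all add: \<phi>_def)
      have C': "C1_pair (\<lambda>x. \<phi> (Some x)) D" using C by (simp add: \<phi>)
      have bd': "\<bar>\<phi> (Some x)\<bar> \<le> A" for x using bd by (simp add: \<phi>)
      have "\<phi> \<in> C01_star"
        unfolding C01_star_def mem_Collect_eq
      proof (intro conjI exI[of _ D])
        have "bounded K" using K by (rule compact_imp_bounded)
        then show "compact (closure {x. \<phi> (Some x) \<noteq> 0})"
          by (simp add: \<phi>, elim bounded_subset) (use z in auto)
      qed (use C in \<open>auto simp: \<phi> C1_pair_def\<close>)
      then have "(\<integral>x. \<phi> x \<partial>\<mu> t) - (\<integral>x. \<phi> x \<partial>\<mu> 0) =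
        (LINT \<tau>:{0..t}|lborel. (\<integral>x. generator R f g \<tau> (\<mu> \<tau>) \<phi> x \<partial>\<mu> \<tau>))"
        using sol t by (simp add: solves_flow_eq_def)
      also have "\<dots> = (LINT \<tau>:{0..t}|lborel. (1 / R) * (\<integral>x. f \<tau> x (m \<tau>) \<bullet> D x + g \<tau> x (m \<tau>) * \<psi> x \<partial>m \<tau>))"
        by (rule set_lebesgue_integral_cong) (use gen[OF C' bd' bd(2)] t in \<open>auto simp: \<phi>\<close>)
      finally show "(\<integral>x. \<psi> x \<partial>m t) - (\<integral>x. \<psi> x \<partial>m 0) = (LINT \<tau>:{0..t}|lborel. (\<integral>x. f \<tau> x (m \<tau>) \<bullet> D x + g \<tau> x (m \<tau>) * \<psi> x \<partial>m \<tau>))"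
        using R by (simp add: split[OF C' bd' t] split[OF C' bd' T0] \<phi> field_simps)
    qed
    with pos show "(\<forall>t\<in>{0..T}. measure (\<mu> t) {None} > 0) \<and> weak_eq T (m 0) (\<lambda>t x. f t x (m t)) (\<lambda>t x. g t x (m t)) m" by blast
  next
    assume "(\<forall>t\<in>{0..T}. measure (\<mu> t) {None} > 0) \<and> weak_eq T (m 0) (\<lambda>t x. f t x (m t)) (\<lambda>t x. g t x (m t)) m"
    then have weak: "weak_eq T (m 0) (\<lambda>t x. f t x (m t)) (\<lambda>t x. g t x (m t)) m" by blast
    show "solves_flow_eq b T R f g \<mu>"
      unfolding solves_flow_eq_def
    proof (intro conjI \<mu> pos ballI)
      fix \<phi> :: "'a option \<Rightarrow> real" and t assume "\<phi> \<in> C01_star" and t: "t \<in> {0..T}"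
      then obtain D where D: "\<And>x. GDERIV (\<lambda>z. \<phi> (Some z)) x :> D x" "continuous_on UNIV D"
        and K: "compact (closure {x. \<phi> (Some x) \<noteq> 0})" unfolding C01_star_def by blast
      have C: "C1_pair (\<lambda>x. \<phi> (Some x)) D" using D by (simp add: C1_pair_def)
      obtain A B where bd: "\<And>x. \<bar>\<phi> (Some x)\<bar> \<le> A" "\<And>x. norm (D x) \<le> B"
        using C1_pair_bounded[OF C K] closure_subset[of "{x. \<phi> (Some x) \<noteq> 0}"] by blast
      let ?a = "\<phi> None"
      have "(LINT \<tau>:{0..t}|lborel. (\<integral>x. generator R f g \<tau> (\<mu> \<tau>) \<phi> x \<partial>\<mu> \<tau>)) =
        (LINT \<tau>:{0..t}|lborel. (1 / R) * ((\<integral>x. f \<tau> x (m \<tau>) \<bullet> D x + g \<tau> x (m \<tau>) * \<phi> (Some x) \<partial>m \<tau>) - ?a * (\<integral>x. g \<tau> x (m \<tau>) \<partial>m \<tau>)))"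
        by (rule set_lebesgue_integral_cong) (use gen[OF C bd] t in auto)
      also have "\<dots> = (1 / R) * ((LINT \<tau>:{0..t}|lborel. (\<integral>x. f \<tau> x (m \<tau>) \<bullet> D x + g \<tau> x (m \<tau>) * \<phi> (Some x) \<partial>m \<tau>))
           - ?a * (LINT \<tau>:{0..t}|lborel. (\<integral>x. g \<tau> x (m \<tau>) \<partial>m \<tau>)))"
        using weak_eq_bounded_test(1)[OF m'[OF T0] mc weak C bd t] mass_balance(1)[OF m'[OF T0] mc weak t]
        by simp
      also have "\<dots> = (1 / R) * (((\<integral>x. \<phi> (Some x) \<partial>m t) - (\<integral>x. \<phi> (Some x) \<partial>m 0)) - ?a * (measure (m t) UNIV - measure (m 0) UNIV))"
        using weak_eq_bounded_test(2)[OF m'[OF T0] mc weak C bd t] mass_balance(2)[OF m'[OF T0] mc weak t] by simp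
      also have "\<dots> = (\<integral>x. \<phi> x \<partial>\<mu> t) - (\<integral>x. \<phi> x \<partial>\<mu> 0)"
        unfolding split[OF C bd(1) t] split[OF C bd(1) T0] using R by (simp add: field_simps)
      finally show "(\<integral>x. \<phi> x \<partial>\<mu> t) - (\<integral>x. \<phi> x \<partial>\<mu> 0) = (LINT \<tau>:{0..t}|lborel. (\<integral>x. generator R f g \<tau> (\<mu> \<tau>) \<phi> x \<partial>\<mu> \<tau>))" ..
    qed
  qed
qed (auto simp: solves_flow_eq_def)

end

section \<open>Mollification\<close>

lemma integrable_compact_support:
  fixes F :: "'a::euclidean_space \<Rightarrow> 'b::euclidean_space"
  assumes "continuous_on UNIV F" "compact K" "\<And>x. x \<notin> K \<Longrightarrow> F x = 0"
  shows "integrable lborel F"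
proof -
  have "integrable lborel (\<lambda>x. indicator K x *\<^sub>R F x)"
    by (rule borel_integrable_compact[OF assms(2) continuous_on_subset[OF assms(1)]]) simp
  moreover have "(\<lambda>x. indicator K x *\<^sub>R F x) = F" using assms(3) by (auto simp: indicator_def fun_eq_iff)
  ultimately show ?thesis by simp
qed

lemma integral_lborel_translate:
  fixes F :: "'a::euclidean_space \<Rightarrow> real"
  assumes "F \<in> borel_measurable borel"
  shows "(\<integral>z. F (a + z) \<partial>lborel) = (\<integral>z. F z \<partial>lborel)"
  using integral_distr[of "(+) a" lborel borel F] assms by (simp add: lborel_distr_plus)

lemma bump_integral_pos:
  assumes "\<epsilon> > 0"
  shows "0 < (\<integral>z. bump \<epsilon> (z :: 'a::euclidean_space) \<partial>lborel)"
proof -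
  have i: "integrable lborel (bump \<epsilon> :: 'a \<Rightarrow> real)"
    by (rule integrable_compact_support[OF continuous_on_bump(1) compact_cball[of 0 \<epsilon>]])
       (simp add: bump_outside(1)[OF assms])
  have "9/16 * measure lborel (ball (0::'a) (\<epsilon>/2)) = (\<integral>z. 9/16 * indicator (ball (0::'a) (\<epsilon>/2)) z \<partial>lborel)"
    by simp
  also have "\<dots> \<le> (\<integral>z. bump \<epsilon> (z::'a) \<partial>lborel)"
  proof (rule integral_mono[OF _ i])
    show "integrable lborel (\<lambda>z. 9/16 * indicator (ball (0::'a) (\<epsilon>/2)) z :: real)"
      by (intro integrable_mult_right integrable_real_indicator emeasure_bounded_finite) auto
    fix z :: 'a
    show "9/16 * indicator (ball (0::'a) (\<epsilon>/2)) z \<le> bump \<epsilon> z"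
    proof (cases "norm z < \<epsilon> / 2")
      case True
      then have "norm z / \<epsilon> \<le> 1/2" using assms by (simp add: field_simps)
      then have "(norm z / \<epsilon>)\<^sup>2 \<le> (1/2)\<^sup>2" using assms by (intro power_mono) auto
      then have "(norm z / \<epsilon>)\<^sup>2 \<le> 1/4" by (simp add: power2_eq_square)
      then have q: "3/4 \<le> max 0 (1 - (norm z / \<epsilon>)\<^sup>2)" by linarith
      have "(3/4)\<^sup>2 \<le> bump \<epsilon> z" unfolding bump_def by (rule power_mono[OF q]) simp
      then show ?thesis using True by (simp add: indicator_def power2_eq_square)
    qed (auto simp: bump_bounds indicator_def)
  qed
  finally have "9/16 * measure lborel (ball (0::'a) (\<epsilon>/2)) \<le> (\<integral>z. bump \<epsilon> (z::'a) \<partial>lborel)" .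
  moreover have "0 < measure lborel (ball (0::'a) (\<epsilon>/2))" by (rule content_ball_pos) (use assms in simp)
  ultimately show ?thesis by linarith
qed

definition mollify :: "real \<Rightarrow> ('a::euclidean_space \<Rightarrow> real) \<Rightarrow> 'a \<Rightarrow> real" where
  "mollify \<epsilon> \<phi> x = (\<integral>z. \<phi> (x + z) * bump \<epsilon> z \<partial>lborel) / (\<integral>z. bump \<epsilon> (z::'a) \<partial>lborel)"

text \<open>The derivative falls on the kernel; the sign is negative because moving \<open>x\<close> by \<open>a\<close> amounts to moving the
  kernel by \<open>- a\<close>.\<close>

definition mollify_grad :: "real \<Rightarrow> ('a::euclidean_space \<Rightarrow> real) \<Rightarrow> 'a \<Rightarrow> 'a" where
  "mollify_grad \<epsilon> \<phi> x = - (\<integral>z. \<phi> (x + z) *\<^sub>R bump_grad \<epsilon> z \<partial>lborel) /\<^sub>R (\<integral>z. bump \<epsilon> (z::'a) \<partial>lborel)"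

lemma integrable_mollify:
  fixes \<phi> :: "'a::euclidean_space \<Rightarrow> real"
  assumes "\<epsilon> > 0" "continuous_on UNIV \<phi>"
  shows "integrable lborel (\<lambda>z. \<phi> (x + z) * bump \<epsilon> z)"
proof (rule integrable_compact_support[OF _ compact_cball[of 0 \<epsilon>]])
  show "continuous_on UNIV (\<lambda>z. \<phi> (x + z) * bump \<epsilon> z)"
    by (intro continuous_intros continuous_on_compose2[OF assms(2)]) auto
qed (simp add: bump_outside(1)[OF assms(1)])

text \<open>Every pointwise comparison on the ball of radius \<open>\<epsilon>\<close> survives averaging; all estimates on
  mollified functions except the Taylor expansion are instances.\<close>

lemma mollify_diff_le:
  fixes \<phi> \<psi> :: "'a::euclidean_space \<Rightarrow> real"
  assumes \<epsilon>: "\<epsilon> > 0" and c: "continuous_on UNIV \<phi>" "continuous_on UNIV \<psi>"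
    and le: "\<And>z. norm z \<le> \<epsilon> \<Longrightarrow> \<bar>\<psi> (x + z) - c * \<phi> (y + z)\<bar> \<le> e"
  shows "\<bar>mollify \<epsilon> \<psi> x - c * mollify \<epsilon> \<phi> y\<bar> \<le> e"
proof -
  let ?Z = "\<integral>z. bump \<epsilon> (z::'a) \<partial>lborel"
  have Z: "?Z > 0" by (rule bump_integral_pos[OF \<epsilon>])
  have i: "integrable lborel (bump \<epsilon> :: 'a \<Rightarrow> real)"
    using integrable_mollify[OF \<epsilon> continuous_on_const, of 1] by simp
  note i1 = integrable_mollify[OF \<epsilon> c(2), of x] and i2 = integrable_mollify[OF \<epsilon> c(1), of y]
  have "\<bar>(\<integral>z. \<psi> (x + z) * bump \<epsilon> z \<partial>lborel) - c * (\<integral>z. \<phi> (y + z) * bump \<epsilon> z \<partial>lborel)\<bar>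
      = \<bar>\<integral>z. \<psi> (x + z) * bump \<epsilon> z - c * (\<phi> (y + z) * bump \<epsilon> z) \<partial>lborel\<bar>"
    using i1 i2 by simp
  also have "\<dots> \<le> (\<integral>z. \<bar>\<psi> (x + z) * bump \<epsilon> z - c * (\<phi> (y + z) * bump \<epsilon> z)\<bar> \<partial>lborel)" by (rule integral_abs_bound)
  also have "\<dots> \<le> (\<integral>z. e * bump \<epsilon> (z::'a) \<partial>lborel)"
  proof (rule integral_mono)
    fix z :: 'a
    have eq: "\<psi> (x + z) * bump \<epsilon> z - c * (\<phi> (y + z) * bump \<epsilon> z) = (\<psi> (x + z) - c * \<phi> (y + z)) * bump \<epsilon> z"
      by (simp add: algebra_simps)
    show "\<bar>\<psi> (x + z) * bump \<epsilon> z - c * (\<phi> (y + z) * bump \<epsilon> z)\<bar> \<le> e * bump \<epsilon> z"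
    proof (cases "norm z \<le> \<epsilon>")
      case True
      show ?thesis unfolding eq abs_mult using mult_right_mono[OF le[OF True] bump_bounds(1)[of \<epsilon> z]] by (simp add: bump_bounds(1))
    qed (use bump_outside(1)[OF \<epsilon>, of z] in simp)
  qed (use i i1 i2 in auto)
  finally have "\<bar>(\<integral>z. \<psi> (x + z) * bump \<epsilon> z \<partial>lborel) - c * (\<integral>z. \<phi> (y + z) * bump \<epsilon> z \<partial>lborel)\<bar> \<le> e * ?Z" by simp
  then have "\<bar>(\<integral>z. \<psi> (x + z) * bump \<epsilon> z \<partial>lborel) - c * (\<integral>z. \<phi> (y + z) * bump \<epsilon> z \<partial>lborel)\<bar> / ?Z \<le> e"
    using Z by (simp add: divide_le_eq)
  then show ?thesis unfolding mollify_def using Z by (simp add: diff_divide_distrib[symmetric])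
qed

lemma mollify_cmult: "mollify \<epsilon> (\<lambda>x. c * \<phi> x) x = c * mollify \<epsilon> \<phi> x"
  by (simp add: mollify_def mult.assoc)

text \<open>The constant depends on the dimension, which is passed as a type.\<close>

definition taylor_const :: "real \<Rightarrow> 'a::euclidean_space itself \<Rightarrow> real" where
  "taylor_const \<epsilon> _ = (2 / \<epsilon>\<^sup>2 + (2 * \<epsilon> + 3)\<^sup>2 / \<epsilon>^4) * measure lborel (cball (0::'a) (\<epsilon> + 1)) / (\<integral>z. bump \<epsilon> (z::'a) \<partial>lborel)"

text \<open>After a translation the increment acts on the kernel, so the remainder is inherited from the bump
  function.\<close>

lemma mollify_taylor:
  fixes \<phi> :: "'a::euclidean_space \<Rightarrow> real"
  assumes \<epsilon>: "\<epsilon> > 0" and c: "continuous_on UNIV \<phi>" and bd: "\<And>x. \<bar>\<phi> x\<bar> \<le> 1" and a: "norm a \<le> 1"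
  shows "\<bar>mollify \<epsilon> \<phi> (x + a) - mollify \<epsilon> \<phi> x - a \<bullet> mollify_grad \<epsilon> \<phi> x\<bar> \<le> taylor_const \<epsilon> TYPE('a) * (norm a)\<^sup>2"
proof -
  let ?Z = "\<integral>z. bump \<epsilon> (z::'a) \<partial>lborel" and ?C = "2 / \<epsilon>\<^sup>2 + (2 * \<epsilon> + 3)\<^sup>2 / \<epsilon>^4"
  have Z: "?Z > 0" by (rule bump_integral_pos[OF \<epsilon>])
  have cx: "continuous_on UNIV (\<lambda>z. \<phi> (x + z))" by (rule continuous_on_compose2[OF c]) (auto intro!: continuous_intros)
  have ca: "continuous_on UNIV (\<lambda>z. \<phi> (x + z) * bump \<epsilon> (z - a))"
    by (intro continuous_intros cx continuous_on_compose2[OF continuous_on_bump(1)]) auto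
  have out: "bump \<epsilon> (z - a) = 0" "bump \<epsilon> z = 0" "bump_grad \<epsilon> z = 0" if "z \<notin> cball 0 (\<epsilon> + 1)" for z
  proof -
    have "norm z > \<epsilon> + 1" using that by simp
    then have "norm (z - a) \<ge> \<epsilon>" "norm z \<ge> \<epsilon>" using a norm_triangle_ineq2[of z a] by auto
    then show "bump \<epsilon> (z - a) = 0" "bump \<epsilon> z = 0" "bump_grad \<epsilon> z = 0" using bump_outside[OF \<epsilon>] by auto
  qed
  have i1: "integrable lborel (\<lambda>z. \<phi> (x + z) * bump \<epsilon> (z - a))"
    by (rule integrable_compact_support[OF ca compact_cball[of 0 "\<epsilon> + 1"]]) (use out in auto)
  have i2: "integrable lborel (\<lambda>z. \<phi> (x + z) * bump \<epsilon> z)" by (rule integrable_mollify[OF \<epsilon> c])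
  have i3: "integrable lborel (\<lambda>z. \<phi> (x + z) *\<^sub>R bump_grad \<epsilon> z)"
    by (rule integrable_compact_support[OF _ compact_cball[of 0 "\<epsilon> + 1"]]) (use out cx in \<open>auto intro!: continuous_intros\<close>)
  have t: "(\<integral>z. \<phi> (x + a + z) * bump \<epsilon> z \<partial>lborel) = (\<integral>z. \<phi> (x + z) * bump \<epsilon> (z - a) \<partial>lborel)"
    using integral_lborel_translate[OF borel_measurable_continuous_onI[OF ca], of a] by (simp add: add.assoc)
  have g: "a \<bullet> (\<integral>z. \<phi> (x + z) *\<^sub>R bump_grad \<epsilon> z \<partial>lborel) = (\<integral>z. a \<bullet> (\<phi> (x + z) *\<^sub>R bump_grad \<epsilon> z) \<partial>lborel)"
    using i3 by (rule integral_inner_right[symmetric])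
  let ?rem = "\<lambda>z. bump \<epsilon> (z - a) - bump \<epsilon> z + a \<bullet> bump_grad \<epsilon> z"
  have "?Z * (mollify \<epsilon> \<phi> (x + a) - mollify \<epsilon> \<phi> x - a \<bullet> mollify_grad \<epsilon> \<phi> x) =
      (\<integral>z. \<phi> (x + z) * bump \<epsilon> (z - a) \<partial>lborel) - (\<integral>z. \<phi> (x + z) * bump \<epsilon> z \<partial>lborel) + (\<integral>z. a \<bullet> (\<phi> (x + z) *\<^sub>R bump_grad \<epsilon> z) \<partial>lborel)"
    unfolding mollify_def mollify_grad_def t using Z g by (simp add: field_simps)
  also have "\<dots> = (\<integral>z. (\<phi> (x + z) * bump \<epsilon> (z - a) - \<phi> (x + z) * bump \<epsilon> z) + a \<bullet> (\<phi> (x + z) *\<^sub>R bump_grad \<epsilon> z) \<partial>lborel)"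
    using i1 i2 integrable_inner_right[OF i3, of a] by simp
  also have "\<dots> = (\<integral>z. \<phi> (x + z) * ?rem z \<partial>lborel)"
    by (rule Bochner_Integration.integral_cong) (auto simp: algebra_simps)
  finally have eq: "?Z * (mollify \<epsilon> \<phi> (x + a) - mollify \<epsilon> \<phi> x - a \<bullet> mollify_grad \<epsilon> \<phi> x) = (\<integral>z. \<phi> (x + z) * ?rem z \<partial>lborel)" .
  have ir: "integrable lborel (\<lambda>z. \<phi> (x + z) * ?rem z)"
    by (rule integrable_compact_support[OF _ compact_cball[of 0 "\<epsilon> + 1"]])
       (use out in \<open>auto intro!: continuous_intros cx continuous_on_compose2[OF continuous_on_bump(1)]\<close>)
  have "\<bar>\<integral>z. \<phi> (x + z) * ?rem z \<partial>lborel\<bar> \<le> (\<integral>z. \<bar>\<phi> (x + z) * ?rem z\<bar> \<partial>lborel)" by (rule integral_abs_bound)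
  also have "\<dots> \<le> (\<integral>z. ?C * (norm a)\<^sup>2 * indicator (cball 0 (\<epsilon> + 1)) (z::'a) \<partial>lborel)"
  proof (rule integral_mono)
    show "integrable lborel (\<lambda>z::'a. ?C * (norm a)\<^sup>2 * indicator (cball 0 (\<epsilon> + 1)) z)"
      by (intro integrable_mult_right integrable_real_indicator emeasure_bounded_finite) auto
    fix z :: 'a
    show "\<bar>\<phi> (x + z) * ?rem z\<bar> \<le> ?C * (norm a)\<^sup>2 * indicator (cball 0 (\<epsilon> + 1)) z"
    proof (cases "z \<in> cball 0 (\<epsilon> + 1)")
      case True
      have "\<bar>?rem z\<bar> \<le> ?C * (norm a)\<^sup>2" using bump_taylor[OF \<epsilon>, of "- a" z] a by simp
      then have "\<bar>\<phi> (x + z)\<bar> * \<bar>?rem z\<bar> \<le> 1 * (?C * (norm a)\<^sup>2)" by (intro mult_mono bd) auto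
      then show ?thesis using True by (simp add: abs_mult)
    qed (use out in auto)
  qed (use ir in auto)
  also have "\<dots> = ?C * (norm a)\<^sup>2 * measure lborel (cball (0::'a) (\<epsilon> + 1))" by simp
  finally have "?Z * \<bar>mollify \<epsilon> \<phi> (x + a) - mollify \<epsilon> \<phi> x - a \<bullet> mollify_grad \<epsilon> \<phi> x\<bar> \<le> ?C * (norm a)\<^sup>2 * measure lborel (cball (0::'a) (\<epsilon> + 1))"
    using Z unfolding eq[symmetric] abs_mult by simp
  then show ?thesis using Z by (simp add: taylor_const_def field_simps)
qed

lemma taylor_const_nonneg: "\<epsilon> > 0 \<Longrightarrow> 0 \<le> taylor_const \<epsilon> TYPE('a::euclidean_space)"
  unfolding taylor_const_def using bump_integral_pos[of \<epsilon>, where 'a = 'a] by (intro divide_nonneg_pos mult_nonneg_nonneg) auto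

text \<open>Comparing the expansions at two points with a common third point shows that a uniform quadratic
  remainder makes the gradient Lipschitz.\<close>

lemma quadratic_remainder_C11:
  fixes p :: "'a::euclidean_space \<Rightarrow> real"
  assumes t: "\<And>x a. norm a \<le> 1 \<Longrightarrow> \<bar>p (x + a) - p x - a \<bullet> G x\<bar> \<le> C * (norm a)\<^sup>2" and bd: "\<And>x. \<bar>p x\<bar> \<le> 1" and C: "C \<ge> 0"
  shows "norm (G x) \<le> C + 2" "norm (G x - G y) \<le> (6 * C + 4 * (C + 2)) * norm (x - y)" "C1_pair p G"
proof -
  have unit: "norm e \<le> B" if "\<And>u. norm u = 1 \<Longrightarrow> u \<bullet> e \<le> B" "B \<ge> 0" for e :: 'a and B
  proof (cases "e = 0")
    case False
    have "sgn e \<bullet> e = norm e"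
      using False by (simp add: sgn_div_norm inner_simps power2_norm_eq_inner[symmetric] power2_eq_square)
    then show ?thesis using that(1)[of "sgn e"] False by (simp add: norm_sgn)
  qed (use that in simp)
  have g: "norm (G x) \<le> C + 2" for x
  proof (rule unit)
    fix u :: 'a assume "norm u = 1"
    then show "u \<bullet> G x \<le> C + 2" using t[of u x] bd[of "x + u"] bd[of x] by (simp add: abs_le_iff)
  qed (use C in simp)
  then show "norm (G x) \<le> C + 2" .
  have lip: "norm (G x - G y) \<le> (6 * C + 4 * (C + 2)) * norm (x - y)" for x y
  proof (cases "norm (x - y) \<le> 1/2")
    case True
    define s where "s = norm (x - y)"
    have s: "s \<ge> 0" "s \<le> 1/2" using True by (auto simp: s_def)
    show ?thesis
    proof (cases "s = 0")
      case False
      then have sp: "s > 0" using s by simp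
      \<comment> \<open>Three expansions with increments of length at most \<open>s\<close>, \<open>2 s\<close> and \<open>s\<close> give \<open>1 + 4 + 1 = 6\<close>.\<close>
      have "norm (G x - G y) \<le> 6 * C * s"
      proof (rule unit)
        fix u :: 'a assume u: "norm u = 1"
        have nu: "norm (s *\<^sub>R u) = s" using u s by simp
        have n2: "norm ((x - y) + s *\<^sub>R u) \<le> 2 * s" using norm_triangle_ineq[of "x - y" "s *\<^sub>R u"] unfolding nu by (simp add: s_def)
        have "\<bar>p (x + s *\<^sub>R u) - p x - (s *\<^sub>R u) \<bullet> G x\<bar> \<le> C * s\<^sup>2"
        proof -
          have "norm (s *\<^sub>R u) \<le> 1" using nu s by linarith
          from t[OF this, of x] show ?thesis unfolding nu .
        qed
        moreover have "\<bar>p (x + s *\<^sub>R u) - p y - ((x - y) + s *\<^sub>R u) \<bullet> G y\<bar> \<le> C * (2 * s)\<^sup>2"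
        proof -
          have "norm ((x - y) + s *\<^sub>R u) \<le> 1" using n2 s by linarith
          from t[OF this, of y]
          have "\<bar>p (x + s *\<^sub>R u) - p y - ((x - y) + s *\<^sub>R u) \<bullet> G y\<bar> \<le> C * (norm ((x - y) + s *\<^sub>R u))\<^sup>2"
            by (simp add: algebra_simps)
          also have "\<dots> \<le> C * (2 * s)\<^sup>2" using n2 C by (intro mult_left_mono power_mono) auto
          finally show ?thesis .
        qed
        moreover have "\<bar>p x - p y - (x - y) \<bullet> G y\<bar> \<le> C * s\<^sup>2"
          using t[of "x - y" y] s by (simp add: s_def)
        ultimately have "s * (u \<bullet> G x) - s * (u \<bullet> G y) \<le> 6 * (C * s\<^sup>2)"
          unfolding inner_add_left inner_scaleR_left power_mult_distrib abs_le_iff by (simp add: mult.left_commute)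
        then have "s * (u \<bullet> (G x - G y)) \<le> s * (6 * C * s)" by (simp add: inner_diff_right algebra_simps power2_eq_square)
        then show "u \<bullet> (G x - G y) \<le> 6 * C * s" using sp by simp
      qed (use C s in simp)
      also have "\<dots> \<le> (6 * C + 4 * (C + 2)) * s" using C s by (intro mult_right_mono) auto
      finally show ?thesis by (simp add: s_def)
    qed (auto simp: s_def)
  next
    case False
    have "norm (G x - G y) \<le> 2 * (C + 2)" using order_trans[OF norm_triangle_ineq4 add_mono[OF g[of x] g[of y]]] by (simp add: algebra_simps)
    also have "\<dots> \<le> (6 * C + 4 * (C + 2)) * (1/2)" using C by simp
    also have "\<dots> \<le> (6 * C + 4 * (C + 2)) * norm (x - y)" using False C by (intro mult_left_mono) auto
    finally show ?thesis .
  qed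
  then show "norm (G x - G y) \<le> (6 * C + 4 * (C + 2)) * norm (x - y)" .
  have "continuous_on UNIV G"
  proof (rule lipschitz_on_continuous_on)
    show "(6 * C + 4 * (C + 2))-lipschitz_on UNIV G" using lip C by (auto simp: lipschitz_on_def dist_norm)
  qed
  then show "C1_pair p G" using GDERIV_quadraticI[OF t] by (auto simp: C1_pair_def)
qed

section \<open>Uniqueness for the linear transport equation\<close>

text \<open>The error \<open>o(\<delta>)\<close> may depend on \<open>t\<close>, because only the last point before \<open>D\<close> exceeds the comparison
  function matters. The rate \<open>C + 1\<close> in place of \<open>C\<close> absorbs the source term: the comparison function
  \<open>(A + \<eta>) exp ((C + 1) t)\<close> is itself at least \<open>A + \<eta>\<close>.\<close>

lemma dini_gronwall:
  fixes D :: "real \<Rightarrow> real"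
  assumes cont: "continuous_on {0..T} D" and D0: "D 0 \<le> 0" and C: "C \<ge> 0" and A: "A \<ge> 0"
    and step: "\<And>t \<eta>. 0 \<le> t \<Longrightarrow> t < T \<Longrightarrow> \<eta> > 0 \<Longrightarrow>
       \<exists>\<delta>0>0. \<forall>\<delta>. 0 < \<delta> \<longrightarrow> \<delta> < \<delta>0 \<longrightarrow> t + \<delta> \<le> T \<longrightarrow> D (t + \<delta>) \<le> D t + \<delta> * (C * D t + A + \<eta>)"
    and t: "t \<in> {0..T}"
  shows "D t \<le> A * exp ((C + 1) * t)"
proof -
  have main: "D t \<le> (A + \<eta>) * exp ((C + 1) * t)" if \<eta>: "\<eta> > 0" for \<eta>
  proof (rule ccontr)
    assume neg: "\<not> ?thesis"
    define y where "y s = (A + \<eta>) * exp ((C + 1) * s)" for s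
    define Bad where "Bad = {s \<in> {0..T}. D s > y s}"
    have tB: "t \<in> Bad" using neg t by (simp add: Bad_def y_def)
    have bb: "bdd_below Bad" by (rule bdd_belowI[of _ 0]) (simp add: Bad_def)
    define s where "s = Inf Bad"
    have s0: "0 \<le> s" unfolding s_def by (rule cInf_greatest) (use tB in \<open>auto simp: Bad_def\<close>)
    have st: "s \<le> t" unfolding s_def by (rule cInf_lower[OF tB bb])
    have sT: "s \<in> {0..T}" using s0 st t by auto
    have y0: "y r \<ge> A + \<eta>" if "r \<ge> 0" for r
      using that A \<eta> C by (simp add: y_def mult_le_cancel_left1)
    have s_good: "D s \<le> y s"
    proof (rule ccontr)
      assume "\<not> D s \<le> y s"
      then have bad: "D s - y s > 0" by simp
      have "s \<noteq> 0" using bad D0 y0[of 0] A \<eta> by auto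
      then have sp: "s > 0" using s0 by simp
      have "continuous_on {0..T} (\<lambda>s. D s - y s)" unfolding y_def by (intro continuous_intros cont)
      then obtain d where d: "d > 0" "\<And>r. r \<in> {0..T} \<Longrightarrow> dist r s < d \<Longrightarrow> dist (D r - y r) (D s - y s) < D s - y s"
        unfolding continuous_on_iff using sT bad by meson
      define r where "r = max 0 (s - d / 2)"
      have r: "r \<in> {0..T}" "dist r s < d" "r < s" using sp sT d(1) by (auto simp: r_def dist_real_def)
      have "D r > y r" using d(2)[OF r(1,2)] by (simp add: dist_real_def)
      then have "r \<in> Bad" using r by (simp add: Bad_def)
      then show False using cInf_lower[OF _ bb, of r] r(3) by (simp add: s_def)
    qed
    have "s \<noteq> t" using s_good tB by (auto simp: Bad_def)
    then have "s < T" using st t by auto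
    then obtain \<delta>0 where \<delta>0: "\<delta>0 > 0" "\<And>\<delta>. 0 < \<delta> \<Longrightarrow> \<delta> < \<delta>0 \<Longrightarrow> s + \<delta> \<le> T \<Longrightarrow> D (s + \<delta>) \<le> D s + \<delta> * (C * D s + A + \<eta>)"
      using step[OF s0 _ \<eta>] by meson
    obtain r where r: "r \<in> Bad" "r < s + \<delta>0"
      using cInf_less_iff[OF _ bb, of "s + \<delta>0"] tB \<delta>0(1) by (auto simp: s_def)
    have "s \<le> r" unfolding s_def by (rule cInf_lower[OF r(1) bb])
    moreover have "r \<noteq> s" using r(1) s_good by (auto simp: Bad_def)
    ultimately have rs: "0 < r - s" by simp
    define \<delta> where "\<delta> = r - s"
    have "D r \<le> D s + \<delta> * (C * D s + A + \<eta>)"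
      using \<delta>0(2)[of \<delta>] rs r by (simp add: \<delta>_def Bad_def)
    also have "\<dots> \<le> y s + \<delta> * (C * y s + y s)"
    proof -
      have "C * D s + A + \<eta> \<le> C * y s + y s" using y0[OF s0] mult_left_mono[OF s_good C] by linarith
      then have "\<delta> * (C * D s + A + \<eta>) \<le> \<delta> * (C * y s + y s)" using rs by (intro mult_left_mono) (auto simp: \<delta>_def)
      then show ?thesis using s_good by linarith
    qed
    also have "\<dots> = y s * (1 + (C + 1) * \<delta>)" by (simp add: algebra_simps)
    also have "\<dots> \<le> y s * exp ((C + 1) * \<delta>)"
      using y0[OF s0] A \<eta> exp_ge_add_one_self[of "(C + 1) * \<delta>"] by (intro mult_left_mono) auto
    also have "\<dots> = y r" by (simp add: y_def \<delta>_def mult.assoc exp_add[symmetric] algebra_simps)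
    finally show False using r(1) by (simp add: Bad_def)
  qed
  have "D t \<le> A * exp ((C + 1) * t) + e" if "e > 0" for e
    using main[of "e / exp ((C + 1) * t)"] that by (simp add: distrib_right)
  then show ?thesis by (rule field_le_epsilon)
qed

text \<open>The indicator of a closed set is the limit of truncated affine functions of the distance to it, and these
  are scalar multiples of functions bounded by \<open>1\<close> and \<open>1\<close>-Lipschitz.\<close>

lemma fin_measures_eqI:
  fixes m n :: "'a::euclidean_space measure"
  assumes m: "m \<in> fin_measures" and n: "n \<in> fin_measures"
    and eq: "\<And>\<phi>. (\<And>x. \<bar>\<phi> x\<bar> \<le> 1) \<Longrightarrow> (\<And>x y. \<bar>\<phi> x - \<phi> y\<bar> \<le> norm (x - y)) \<Longrightarrow> (\<integral>x. \<phi> x \<partial>m) = (\<integral>x. \<phi> x \<partial>n)"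
  shows "m = n"
proof (rule measure_eqI_generator_eq[where \<Omega> = UNIV and E = "Collect closed" and A = "\<lambda>_. UNIV"])
  have sb: "sets borel = sigma_sets (UNIV :: 'a set) (Collect closed)" by (subst borel_eq_closed) simp
  then show "sets m = sigma_sets UNIV (Collect closed)" "sets n = sigma_sets UNIV (Collect closed)"
    using m n by (auto simp: fin_measures_def)
  fix F :: "'a set" assume "F \<in> Collect closed"
  then have F: "closed F" by simp
  show "emeasure m F = emeasure n F"
  proof (cases "F = {}")
    case False
    \<comment> \<open>The shift in \<open>real k + 1\<close> avoids division by zero when the function is scaled into the class.\<close>
    define p where "p k x = max 0 (1 - (real k + 1) * infdist x F)" for k x
    have pc: "continuous_on UNIV (p k)" for k unfolding p_def by (intro continuous_intros)
    then have pm: "p k \<in> borel_measurable borel" for k by (rule borel_measurable_continuous_onI)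
    have p01: "0 \<le> p k x" "p k x \<le> 1" for k x unfolding p_def by (auto simp: infdist_nonneg)
    have plip: "\<bar>p k x - p k y\<bar> \<le> (real k + 1) * norm (x - y)" for k x y
    proof -
      have "\<bar>p k x - p k y\<bar> \<le> \<bar>(real k + 1) * infdist x F - (real k + 1) * infdist y F\<bar>" unfolding p_def by linarith
      also have "\<dots> = (real k + 1) * \<bar>infdist x F - infdist y F\<bar>" by (simp add: right_diff_distrib[symmetric] abs_mult)
      also have "\<dots> \<le> (real k + 1) * norm (x - y)"
        using infdist_triangle_abs[of x F y] by (intro mult_left_mono) (auto simp: dist_norm)
      finally show ?thesis .
    qed
    have pe: "(\<integral>x. p k x \<partial>m) = (\<integral>x. p k x \<partial>n)" for k
    proof -
      have "(\<integral>x. p k x / (real k + 1) \<partial>m) = (\<integral>x. p k x / (real k + 1) \<partial>n)"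
      proof (rule eq)
        show "\<bar>p k x / (real k + 1)\<bar> \<le> 1" for x using p01[of k x] by (simp add: abs_of_nonneg)
        show "\<bar>p k x / (real k + 1) - p k y / (real k + 1)\<bar> \<le> norm (x - y)" for x y
          using plip[of k x y] by (simp add: diff_divide_distrib[symmetric] divide_le_eq mult.commute)
      qed
      then show ?thesis by simp
    qed
    have pl: "(\<lambda>k. p k x) \<longlonglongrightarrow> indicator F x" for x
    proof (cases "x \<in> F")
      case True
      then show ?thesis using F False by (simp add: p_def)
    next
      case out: False
      then have pos: "infdist x F > 0" using F False infdist_pos_not_in_closed by blast
      then obtain K where K: "1 < real K * infdist x F" using reals_Archimedean3 by blast
      have "p k x = 0" if "k \<ge> K" for k
      proof -
        have "real K * infdist x F \<le> (real k + 1) * infdist x F" using that pos by (intro mult_right_mono) auto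
        then show ?thesis using K by (simp add: p_def)
      qed
      then have "eventually (\<lambda>k. p k x = indicator F x) sequentially"
        using out by (auto simp: eventually_sequentially)
      then show ?thesis by (rule tendsto_eventually)
    qed
    have lim: "(\<lambda>k. \<integral>x. p k x \<partial>q) \<longlonglongrightarrow> measure q F" if q: "q \<in> fin_measures" for q
    proof -
      interpret finite_measure q using fin_measuresD[OF q] by simp
      have Fq: "F \<in> sets q" using F fin_measuresD[OF q] by simp
      have "(\<lambda>k. \<integral>x. p k x \<partial>q) \<longlonglongrightarrow> (\<integral>x. indicator F x \<partial>q)"
      proof (rule integral_dominated_convergence[where w = "\<lambda>_. 1"])
        show "p k \<in> borel_measurable q" for k using pm fin_measuresD[OF q] by (simp cong: measurable_cong_sets)
      qed (use pl p01 Fq in auto)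
      then show ?thesis using Fq by simp
    qed
    have "measure m F = measure n F" using lim[OF m] lim[OF n] pe LIMSEQ_unique by auto
    then show ?thesis using fin_measuresD(1)[OF m] fin_measuresD(1)[OF n] by (simp add: finite_measure.emeasure_eq_measure)
  qed simp
next
  show "emeasure m (UNIV :: 'a set) \<noteq> \<infinity>" using fin_measuresD(1)[OF m] by (simp add: finite_measure.emeasure_finite)
qed (auto simp: Int_stable_def)

locale lipschitz_transport = transport_coefficients b T Cv Ch v h
  for b T Cv Ch :: real and v :: "real \<Rightarrow> 'a::euclidean_space \<Rightarrow> 'a" and h :: "real \<Rightarrow> 'a \<Rightarrow> real" +
  fixes L :: real
  assumes L: "L \<ge> 0"
    and v_lip: "\<And>t x y. t \<in> {0..T} \<Longrightarrow> norm (v t x - v t y) \<le> L * norm (x - y)"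
    and h_lip: "\<And>t x y. t \<in> {0..T} \<Longrightarrow> \<bar>h t x - h t y\<bar> \<le> L * norm (x - y)"
begin

text \<open>Continuity in time is uniform only on compact sets of space. Against the fixed measure \<open>n t\<close> dominated
  convergence suffices, and the Lipschitz bounds allow replacing \<open>n \<tau>\<close> by \<open>n t\<close>.\<close>

lemma coefficient_gap_vanishes:
  assumes n: "prw_continuous b T n" and t: "t \<in> {0..T}" and M: "M \<ge> 0" and \<eta>: "\<eta> > 0"
  shows "\<exists>\<delta>>0. \<forall>\<tau>\<in>{0..T}. \<bar>\<tau> - t\<bar> < \<delta> \<longrightarrow> (\<integral>x. M * norm (v \<tau> x - v t x) + \<bar>h \<tau> x - h t x\<bar> \<partial>n \<tau>) < \<eta>"
proof -
  note n' = prw_continuousD(1)[OF n]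
  define e where "e \<tau> x = M * norm (v \<tau> x - v t x) + \<bar>h \<tau> x - h t x\<bar>" for \<tau> x
  define B where "B = M * (2 * Cv) + 2 * Ch"
  define K where "K = M * (2 * L) + 2 * L"
  have B: "B \<ge> 0" and K: "K \<ge> 0" using M C_nonneg L by (auto simp: B_def K_def)
  have e0: "0 \<le> e \<tau> x" for \<tau> x using M by (simp add: e_def)
  have e_bd: "\<bar>e \<tau> x\<bar> \<le> B" if \<tau>: "\<tau> \<in> {0..T}" for \<tau> x
  proof -
    have "norm (v \<tau> x - v t x) \<le> 2 * Cv"
      using norm_triangle_ineq4[of "v \<tau> x" "v t x"] v_bound[OF \<tau>, of x] v_bound[OF t, of x] by linarith
    moreover have "\<bar>h \<tau> x - h t x\<bar> \<le> 2 * Ch" using h_bound[OF \<tau>, of x] h_bound[OF t, of x] by linarith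
    ultimately have "e \<tau> x \<le> B" unfolding e_def B_def using M by (intro add_mono mult_left_mono) auto
    then show ?thesis using e0[of \<tau> x] by simp
  qed
  have e_lip: "\<bar>e \<tau> x - e \<tau> y\<bar> \<le> 0 + K * norm (x - y)" if \<tau>: "\<tau> \<in> {0..T}" for \<tau> x y
  proof -
    have "\<bar>norm (v \<tau> x - v t x) - norm (v \<tau> y - v t y)\<bar> \<le> norm ((v \<tau> x - v \<tau> y) - (v t x - v t y))"
      using norm_triangle_ineq3[of "v \<tau> x - v t x" "v \<tau> y - v t y"] by (simp add: algebra_simps)
    also have "\<dots> \<le> 2 * L * norm (x - y)"
      using norm_triangle_ineq4[of "v \<tau> x - v \<tau> y" "v t x - v t y"] v_lip[OF \<tau>, of x y] v_lip[OF t, of x y] by linarith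
    finally have 1: "\<bar>norm (v \<tau> x - v t x) - norm (v \<tau> y - v t y)\<bar> \<le> 2 * L * norm (x - y)" .
    have "\<bar>M * norm (v \<tau> x - v t x) - M * norm (v \<tau> y - v t y)\<bar> = M * \<bar>norm (v \<tau> x - v t x) - norm (v \<tau> y - v t y)\<bar>"
      using M by (simp add: right_diff_distrib[symmetric] abs_mult)
    also have "\<dots> \<le> M * (2 * L * norm (x - y))" using 1 M by (rule mult_left_mono)
    finally have 2: "\<bar>M * norm (v \<tau> x - v t x) - M * norm (v \<tau> y - v t y)\<bar> \<le> M * (2 * L * norm (x - y))" .
    have 3: "\<bar>\<bar>h \<tau> x - h t x\<bar> - \<bar>h \<tau> y - h t y\<bar>\<bar> \<le> 2 * (L * norm (x - y))"
      using h_lip[OF \<tau>, of x y] h_lip[OF t, of x y] by linarith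
    show ?thesis unfolding e_def K_def distrib_right using 2 3 by (simp add: mult.assoc abs_le_iff)
  qed
  have em: "e \<tau> \<in> borel_measurable borel" if \<tau>: "\<tau> \<in> {0..T}" for \<tau>
    unfolding e_def using measurable_coeffs[OF \<tau>] measurable_coeffs[OF t] by measurable
  have "((\<lambda>\<tau>. \<integral>x. e \<tau> x \<partial>n t) \<longlongrightarrow> 0) (at t within {0..T})"
    unfolding tendsto_at_iff_sequentially comp_def
  proof (intro allI impI)
    fix X assume X: "\<forall>i. X i \<in> {0..T} - {t}" "X \<longlonglongrightarrow> t"
    interpret finite_measure "n t" using fin_measuresD[OF n'[OF t]] by simp
    have "(\<lambda>i. \<integral>x. e (X i) x \<partial>n t) \<longlonglongrightarrow> (\<integral>x. 0 \<partial>n t)"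
    proof (rule integral_dominated_convergence[where w = "\<lambda>_. B"])
      show "e (X i) \<in> borel_measurable (n t)" for i
        using em[of "X i"] X(1) fin_measuresD[OF n'[OF t]] by (simp cong: measurable_cong_sets)
      have "(\<lambda>i. e (X i) x) \<longlonglongrightarrow> M * norm (v t x - v t x) + \<bar>h t x - h t x\<bar>" for x
      proof -
        have p: "(\<lambda>i. (X i, x)) \<longlonglongrightarrow> (t, x)" by (intro tendsto_intros X(2))
        have "(\<lambda>i. v (X i) x) \<longlonglongrightarrow> v t x" "(\<lambda>i. h (X i) x) \<longlonglongrightarrow> h t x"
          using continuous_on_tendsto_compose[OF v_cont p] continuous_on_tendsto_compose[OF h_cont p] X(1) t by auto
        then show ?thesis unfolding e_def by (intro tendsto_intros)
      qed
      then show "AE x in n t. (\<lambda>i. e (X i) x) \<longlonglongrightarrow> 0" by simp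
      show "AE x in n t. norm (e (X i) x) \<le> B" for i using e_bd[of "X i"] X(1) by simp
    qed auto
    then show "(\<lambda>i. \<integral>x. e (X i) x \<partial>n t) \<longlonglongrightarrow> 0" by simp
  qed
  then obtain d1 where d1: "d1 > 0" "\<And>\<tau>. \<tau> \<in> {0..T} \<Longrightarrow> \<tau> \<noteq> t \<Longrightarrow> \<bar>\<tau> - t\<bar> < d1 \<Longrightarrow> \<bar>\<integral>x. e \<tau> x \<partial>n t\<bar> < \<eta> / 2"
    using \<eta> unfolding tendsto_iff eventually_at dist_real_def by (metis half_gt_zero_iff diff_zero)
  define Q where "Q = K + B / b + 1"
  have Q: "Q > 0" using K B b by (simp add: Q_def add_nonneg_pos)
  obtain d2 where d2: "d2 > 0" "\<forall>s\<in>{0..T}. \<bar>s - t\<bar> < d2 \<longrightarrow> prw_dist b (n t) (n s) < \<eta> / (2 * Q)"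
    using prw_continuousD(2)[OF n t, of "\<eta> / (2 * Q)"] Q \<eta> by auto
  have "(\<integral>x. e \<tau> x \<partial>n \<tau>) < \<eta>" if \<tau>: "\<tau> \<in> {0..T}" "\<bar>\<tau> - t\<bar> < min d1 d2" for \<tau>
  proof -
    have "\<bar>(\<integral>x. e \<tau> x \<partial>n t) - (\<integral>x. e \<tau> x \<partial>n \<tau>)\<bar> \<le> 0 * measure (n t) UNIV + (K + B / b) * prw_dist b (n t) (n \<tau>)"
      by (rule integral_diff_le_prw_dist[OF b n'[OF t] n'[OF \<tau>(1)] em[OF \<tau>(1)] e_bd[OF \<tau>(1)] e_lip[OF \<tau>(1)]]) (use K in auto)
    also have "\<dots> \<le> Q * prw_dist b (n t) (n \<tau>)" using prw_dist_nonneg by (simp add: Q_def distrib_right)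
    also have "\<dots> < \<eta> / 2"
    proof -
      have "prw_dist b (n t) (n \<tau>) < \<eta> / (2 * Q)" using d2 \<tau> by simp
      then show ?thesis using Q by (simp add: field_simps)
    qed
    finally have 1: "\<bar>(\<integral>x. e \<tau> x \<partial>n t) - (\<integral>x. e \<tau> x \<partial>n \<tau>)\<bar> < \<eta> / 2" .
    have "\<bar>\<integral>x. e \<tau> x \<partial>n t\<bar> < \<eta> / 2"
    proof (cases "\<tau> = t")
      case True
      then have "e \<tau> x = 0" for x by (simp add: e_def)
      then show ?thesis using \<eta> by simp
    qed (use d1(2)[OF \<tau>(1)] \<tau>(2) in simp)
    then show ?thesis using 1 by linarith
  qed
  then show ?thesis unfolding e_def using d1(1) d2(1) by (intro exI[of _ "min d1 d2"]) auto
qed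

text \<open>The dual distance is a supremum over test functions, so its increments need an error that is uniform
  over them. The integrand of the rate of change is Lipschitz with a constant depending only on \<open>M\<close>, so
  the transport metric controls it.\<close>

lemma weak_increment:
  assumes m0: "m0 \<in> fin_measures" and n: "prw_continuous b T n" and weak: "weak_eq T m0 v h n"
    and t: "0 \<le> t" "t < T" and M: "M \<ge> 0" and \<eta>: "\<eta> > 0"
  shows "\<exists>\<delta>0>0. \<forall>\<delta> p G. 0 < \<delta> \<longrightarrow> \<delta> < \<delta>0 \<longrightarrow> t + \<delta> \<le> T \<longrightarrow> C1_pair p G \<longrightarrow> (\<forall>x. \<bar>p x\<bar> \<le> 1) \<longrightarrow> (\<forall>x. norm (G x) \<le> M) \<longrightarrow>
     (\<forall>x y. \<bar>p x - p y\<bar> \<le> norm (x - y)) \<longrightarrow> (\<forall>x y. norm (G x - G y) \<le> M * norm (x - y)) \<longrightarrow>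
     \<bar>(\<integral>x. p x \<partial>n (t + \<delta>)) - (\<integral>x. p x \<partial>n t) - \<delta> * (\<integral>x. v t x \<bullet> G x + h t x * p x \<partial>n t)\<bar> \<le> \<delta> * \<eta>"
proof -
  note n' = prw_continuousD(1)[OF n]
  have t': "t \<in> {0..T}" using t by simp
  define A where "A = Cv * M + Ch * 1"
  define K where "K = (L * M + Cv * M) + (L + Ch)"
  have A: "A \<ge> 0" and K: "K \<ge> 0" using M C_nonneg L by (auto simp: A_def K_def)
  define Q where "Q = K + A / b + 1"
  have Q: "Q > 0" using K A b by (simp add: Q_def add_nonneg_pos)
  obtain d1 where d1: "d1 > 0" "\<forall>\<tau>\<in>{0..T}. \<bar>\<tau> - t\<bar> < d1 \<longrightarrow> (\<integral>x. M * norm (v \<tau> x - v t x) + \<bar>h \<tau> x - h t x\<bar> \<partial>n \<tau>) < \<eta> / 2"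
    using coefficient_gap_vanishes[OF n t' M, of "\<eta> / 2"] \<eta> by auto
  obtain d2 where d2: "d2 > 0" "\<forall>s\<in>{0..T}. \<bar>s - t\<bar> < d2 \<longrightarrow> prw_dist b (n t) (n s) < \<eta> / (2 * Q)"
    using prw_continuousD(2)[OF n t', of "\<eta> / (2 * Q)"] Q \<eta> by auto
  have main: "\<bar>(\<integral>x. p x \<partial>n (t + \<delta>)) - (\<integral>x. p x \<partial>n t) - \<delta> * (\<integral>x. v t x \<bullet> G x + h t x * p x \<partial>n t)\<bar> \<le> \<delta> * \<eta>"
    if \<delta>: "0 < \<delta>" "\<delta> < min d1 d2" "t + \<delta> \<le> T" and C: "C1_pair p G" and p1: "\<And>x. \<bar>p x\<bar> \<le> 1" and GM: "\<And>x. norm (G x) \<le> M"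
      and plip: "\<And>x y. \<bar>p x - p y\<bar> \<le> norm (x - y)" and Glip: "\<And>x y. norm (G x - G y) \<le> M * norm (x - y)" for \<delta> p G
  proof -
    define H where "H \<tau> = (\<integral>x. v \<tau> x \<bullet> G x + h \<tau> x * p x \<partial>n \<tau>)" for \<tau>
    have td: "t + \<delta> \<in> {0..T}" using t \<delta> by simp
    have meas: "(\<lambda>x. v \<tau> x \<bullet> G x + h \<tau> x * p x) \<in> borel_measurable borel" if "\<tau> \<in> {0..T}" for \<tau>
      using measurable_coeffs[OF that] C1_pairD(3,4)[OF C] by auto
    have bd: "\<bar>v \<tau> x \<bullet> G x + h \<tau> x * p x\<bar> \<le> A" if "\<tau> \<in> {0..T}" for \<tau> x
      unfolding A_def by (rule weak_integrand_bound[OF that p1 GM])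
    have Psi_lip: "\<bar>(v t x \<bullet> G x + h t x * p x) - (v t y \<bullet> G y + h t y * p y)\<bar> \<le> 0 + K * norm (x - y)" for x y
    proof -
      have "v t x \<bullet> G x - v t y \<bullet> G y = (v t x - v t y) \<bullet> G x + v t y \<bullet> (G x - G y)" by (simp add: inner_simps)
      moreover have "\<bar>(v t x - v t y) \<bullet> G x\<bar> \<le> (L * norm (x - y)) * M"
        by (rule order_trans[OF Cauchy_Schwarz_ineq2 mult_mono[OF v_lip[OF t'] GM]]) (use L in auto)
      moreover have "\<bar>v t y \<bullet> (G x - G y)\<bar> \<le> Cv * (M * norm (x - y))"
        by (rule order_trans[OF Cauchy_Schwarz_ineq2 mult_mono[OF v_bound[OF t'] Glip]]) (use C_nonneg in auto)
      moreover have "h t x * p x - h t y * p y = (h t x - h t y) * p x + h t y * (p x - p y)" by (simp add: algebra_simps)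
      moreover have "\<bar>(h t x - h t y) * p x\<bar> \<le> (L * norm (x - y)) * 1"
        unfolding abs_mult by (rule mult_mono[OF h_lip[OF t'] p1]) (use L in auto)
      moreover have "\<bar>h t y * (p x - p y)\<bar> \<le> Ch * norm (x - y)"
        unfolding abs_mult by (rule mult_mono[OF h_bound[OF t'] plip]) (use C_nonneg in auto)
      ultimately show ?thesis by (simp add: K_def algebra_simps)
    qed
    have Hdiff: "\<bar>H \<tau> - H t\<bar> \<le> \<eta>" if \<tau>: "\<tau> \<in> {t..t + \<delta>}" for \<tau>
    proof -
      have \<tau>': "\<tau> \<in> {0..T}" "\<bar>\<tau> - t\<bar> < min d1 d2" using \<tau> t \<delta> by auto
      have i1: "integrable (n \<tau>) (\<lambda>x. v \<tau> x \<bullet> G x + h \<tau> x * p x)"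
        by (rule fin_measures_integrable[OF n'[OF \<tau>'(1)] meas[OF \<tau>'(1)] bd[OF \<tau>'(1)]])
      have i2: "integrable (n \<tau>) (\<lambda>x. v t x \<bullet> G x + h t x * p x)"
        by (rule fin_measures_integrable[OF n'[OF \<tau>'(1)] meas[OF t'] bd[OF t']])
      have "\<bar>(\<integral>x. v \<tau> x \<bullet> G x + h \<tau> x * p x \<partial>n \<tau>) - (\<integral>x. v t x \<bullet> G x + h t x * p x \<partial>n \<tau>)\<bar>
          = \<bar>\<integral>x. (v \<tau> x \<bullet> G x + h \<tau> x * p x) - (v t x \<bullet> G x + h t x * p x) \<partial>n \<tau>\<bar>"
        using i1 i2 by simp
      also have "\<dots> \<le> (\<integral>x. \<bar>(v \<tau> x \<bullet> G x + h \<tau> x * p x) - (v t x \<bullet> G x + h t x * p x)\<bar> \<partial>n \<tau>)" by (rule integral_abs_bound)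
      also have "\<dots> \<le> (\<integral>x. M * norm (v \<tau> x - v t x) + \<bar>h \<tau> x - h t x\<bar> \<partial>n \<tau>)"
      proof (rule integral_mono)
        show "integrable (n \<tau>) (\<lambda>x. \<bar>(v \<tau> x \<bullet> G x + h \<tau> x * p x) - (v t x \<bullet> G x + h t x * p x)\<bar>)" using i1 i2 by auto
        show "integrable (n \<tau>) (\<lambda>x. M * norm (v \<tau> x - v t x) + \<bar>h \<tau> x - h t x\<bar>)"
        proof (rule fin_measures_integrable[OF n'[OF \<tau>'(1)], of _ "M * (2 * Cv) + 2 * Ch"])
          show "(\<lambda>x. M * norm (v \<tau> x - v t x) + \<bar>h \<tau> x - h t x\<bar>) \<in> borel_measurable borel"
            using measurable_coeffs[OF \<tau>'(1)] measurable_coeffs[OF t'] by measurable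
          fix x
          have "norm (v \<tau> x - v t x) \<le> 2 * Cv"
            using norm_triangle_ineq4[of "v \<tau> x" "v t x"] v_bound[OF \<tau>'(1), of x] v_bound[OF t', of x] by linarith
          moreover have "\<bar>h \<tau> x - h t x\<bar> \<le> 2 * Ch" using h_bound[OF \<tau>'(1), of x] h_bound[OF t', of x] by linarith
          ultimately have "M * norm (v \<tau> x - v t x) + \<bar>h \<tau> x - h t x\<bar> \<le> M * (2 * Cv) + 2 * Ch"
            using M by (intro add_mono mult_left_mono) auto
          then show "\<bar>M * norm (v \<tau> x - v t x) + \<bar>h \<tau> x - h t x\<bar>\<bar> \<le> M * (2 * Cv) + 2 * Ch" using M by simp
        qed
        fix x
        have "(v \<tau> x \<bullet> G x + h \<tau> x * p x) - (v t x \<bullet> G x + h t x * p x) = (v \<tau> x - v t x) \<bullet> G x + (h \<tau> x - h t x) * p x"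
          by (simp add: algebra_simps inner_simps)
        moreover have "\<bar>(v \<tau> x - v t x) \<bullet> G x\<bar> \<le> norm (v \<tau> x - v t x) * M"
          by (rule order_trans[OF Cauchy_Schwarz_ineq2 mult_left_mono[OF GM]]) simp
        moreover have "\<bar>(h \<tau> x - h t x) * p x\<bar> \<le> \<bar>h \<tau> x - h t x\<bar> * 1"
          unfolding abs_mult by (rule mult_left_mono[OF p1]) simp
        ultimately show "\<bar>(v \<tau> x \<bullet> G x + h \<tau> x * p x) - (v t x \<bullet> G x + h t x * p x)\<bar> \<le> M * norm (v \<tau> x - v t x) + \<bar>h \<tau> x - h t x\<bar>"
          by (simp add: mult.commute)
      qed
      also have "\<dots> < \<eta> / 2" using d1 \<tau>' by simp
      finally have 1: "\<bar>H \<tau> - (\<integral>x. v t x \<bullet> G x + h t x * p x \<partial>n \<tau>)\<bar> < \<eta> / 2" unfolding H_def .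
      have "\<bar>(\<integral>x. v t x \<bullet> G x + h t x * p x \<partial>n t) - (\<integral>x. v t x \<bullet> G x + h t x * p x \<partial>n \<tau>)\<bar>
          \<le> 0 * measure (n t) UNIV + (K + A / b) * prw_dist b (n t) (n \<tau>)"
        by (rule integral_diff_le_prw_dist[OF b n'[OF t'] n'[OF \<tau>'(1)] meas[OF t'] bd[OF t'] Psi_lip]) (use K in auto)
      also have "\<dots> \<le> Q * prw_dist b (n t) (n \<tau>)" using prw_dist_nonneg by (simp add: Q_def distrib_right)
      also have "\<dots> < \<eta> / 2"
      proof -
        have "prw_dist b (n t) (n \<tau>) < \<eta> / (2 * Q)" using d2 \<tau>' by simp
        then show ?thesis using Q by (simp add: field_simps)
      qed
      finally show ?thesis using 1 unfolding H_def by linarith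
    qed
    note wb = weak_eq_bounded_test[OF m0 n weak C p1 GM]
    have I: "H integrable_on {0..s}" "(\<integral>x. p x \<partial>n s) - (\<integral>x. p x \<partial>m0) = integral {0..s} H" if "s \<in> {0..T}" for s
      using wb(2)[OF that] set_borel_integral_eq_integral[OF wb(1)[OF that]] unfolding H_def by auto
    have sub: "H integrable_on {t..t + \<delta>}" by (rule integrable_subinterval_real[OF I(1)[OF td]]) (use t \<delta> in auto)
    have "integral {0..t} H + integral {t..t + \<delta>} H = integral {0..t + \<delta>} H"
      by (rule Henstock_Kurzweil_Integration.integral_combine) (use t \<delta> I(1)[OF td] in auto)
    then have inc: "(\<integral>x. p x \<partial>n (t + \<delta>)) - (\<integral>x. p x \<partial>n t) = integral {t..t + \<delta>} H"
      using I(2)[OF td] I(2)[OF t'] by simp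
    have "((\<lambda>\<tau>. H \<tau> - H t) has_integral (integral {t..t + \<delta>} H - H t * \<delta>)) {t..t + \<delta>}"
      using has_integral_diff[OF integrable_integral[OF sub] has_integral_const_real[of "H t" t "t + \<delta>"]] \<delta> by (simp add: mult.commute)
    then have "norm (integral {t..t + \<delta>} H - H t * \<delta>) \<le> \<eta> * measure lborel {t..t + \<delta>}"
      by (rule has_integral_bound_real[of \<eta> "{}", rotated 2]) (use Hdiff \<eta> in auto)
    then show ?thesis unfolding inc using \<delta> by (simp add: H_def mult.commute)
  qed
  show ?thesis
  proof (intro exI[of _ "min d1 d2"] conjI allI impI)
    show "0 < min d1 d2" using d1(1) d2(1) by simp
  qed (rule main; blast)
qed

definition "Lip1 = {\<phi> :: 'a \<Rightarrow> real. (\<forall>x. \<bar>\<phi> x\<bar> \<le> 1) \<and> (\<forall>x y. \<bar>\<phi> x - \<phi> y\<bar> \<le> norm (x - y))}"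

lemma Lip1D:
  assumes "\<phi> \<in> Lip1"
  shows "\<bar>\<phi> x\<bar> \<le> 1" "\<bar>\<phi> x - \<phi> y\<bar> \<le> norm (x - y)" "continuous_on UNIV \<phi>" "\<phi> \<in> borel_measurable borel"
proof -
  show "\<bar>\<phi> x\<bar> \<le> 1" "\<bar>\<phi> x - \<phi> y\<bar> \<le> norm (x - y)" using assms by (auto simp: Lip1_def)
  have "1-lipschitz_on UNIV \<phi>" using assms by (auto simp: lipschitz_on_def Lip1_def dist_norm)
  then show "continuous_on UNIV \<phi>" by (rule lipschitz_on_continuous_on)
  then show "\<phi> \<in> borel_measurable borel" by (rule borel_measurable_continuous_onI)
qed

lemma mollify_Lip1:
  assumes \<epsilon>: "\<epsilon> > 0" and \<phi>: "\<phi> \<in> Lip1"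
  shows "mollify \<epsilon> \<phi> \<in> Lip1" "\<bar>mollify \<epsilon> \<phi> x - \<phi> x\<bar> \<le> \<epsilon>"
proof -
  note l = Lip1D[OF \<phi>]
  have "\<bar>mollify \<epsilon> \<phi> x - 0 * mollify \<epsilon> \<phi> x\<bar> \<le> 1" for x
    by (rule mollify_diff_le[OF \<epsilon> l(3) l(3)]) (use l(1) in simp)
  moreover have "\<bar>mollify \<epsilon> \<phi> x - 1 * mollify \<epsilon> \<phi> y\<bar> \<le> norm (x - y)" for x y
    by (rule mollify_diff_le[OF \<epsilon> l(3) l(3)]) (use l(2)[of "x + z" "y + z" for z] in simp)
  ultimately show "mollify \<epsilon> \<phi> \<in> Lip1" by (simp add: Lip1_def)
  have one: "mollify \<epsilon> (\<lambda>_. 1) x = 1" for x :: 'a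
    using bump_integral_pos[OF \<epsilon>, where 'a = 'a] by (simp add: mollify_def)
  have "\<bar>mollify \<epsilon> \<phi> x - \<phi> x * mollify \<epsilon> (\<lambda>_. 1) x\<bar> \<le> \<epsilon>"
  proof (rule mollify_diff_le[OF \<epsilon> continuous_on_const l(3)])
    fix z :: 'a assume "norm z \<le> \<epsilon>"
    then show "\<bar>\<phi> (x + z) - \<phi> x * 1\<bar> \<le> \<epsilon>" using l(2)[of "x + z" x] by simp
  qed
  then show "\<bar>mollify \<epsilon> \<phi> x - \<phi> x\<bar> \<le> \<epsilon>" by (simp add: one)
qed

text \<open>An explicit Euler step, backward in time, for the dual equation \<open>\<partial>\<^sub>t\<phi> + v \<bullet> \<nabla>\<phi> + h \<phi> = 0\<close>.\<close>

definition backward_step :: "real \<Rightarrow> real \<Rightarrow> ('a \<Rightarrow> real) \<Rightarrow> 'a \<Rightarrow> real" where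
  "backward_step t \<delta> \<phi> x = \<phi> (x + \<delta> *\<^sub>R v t x) * (1 + \<delta> * h t x)"

definition "growth = 2 * L + Ch + L * Ch"

lemma growth_nonneg: "growth \<ge> 0"
  using L C_nonneg by (simp add: growth_def)

text \<open>The test class is invariant up to the factor \<open>1 + growth * \<delta>\<close>, which is why the dual distance of two
  solutions can be estimated by itself at the previous time.\<close>

lemma backward_step_Lip1:
  assumes t: "t \<in> {0..T}" and \<delta>: "0 < \<delta>" "\<delta> \<le> 1" and \<phi>: "\<phi> \<in> Lip1"
  shows "(\<lambda>x. inverse (1 + growth * \<delta>) * backward_step t \<delta> \<phi> x) \<in> Lip1"
proof -
  note l = Lip1D[OF \<phi>]
  have g: "1 + growth * \<delta> > 0" using growth_nonneg \<delta> by (simp add: add_pos_nonneg)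
  have dh: "\<bar>1 + \<delta> * h t x\<bar> \<le> 1 + \<delta> * Ch" for x
  proof -
    have "\<bar>1 + \<delta> * h t x\<bar> \<le> 1 + \<delta> * \<bar>h t x\<bar>" using abs_triangle_ineq[of 1 "\<delta> * h t x"] \<delta> by (simp add: abs_mult)
    moreover have "\<delta> * \<bar>h t x\<bar> \<le> \<delta> * Ch" using h_bound[OF t, of x] \<delta> by simp
    ultimately show ?thesis by linarith
  qed
  have 1: "\<bar>backward_step t \<delta> \<phi> x\<bar> \<le> 1 + growth * \<delta>" for x
  proof -
    have "\<bar>backward_step t \<delta> \<phi> x\<bar> \<le> 1 * (1 + \<delta> * Ch)"
      unfolding backward_step_def abs_mult by (rule mult_mono[OF l(1) dh]) auto
    also have "\<dots> \<le> 1 + growth * \<delta>"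
      using L C_nonneg \<delta> by (simp add: growth_def mult.commute mult_left_mono)
    finally show ?thesis .
  qed
  have 2: "\<bar>backward_step t \<delta> \<phi> x - backward_step t \<delta> \<phi> y\<bar> \<le> (1 + growth * \<delta>) * norm (x - y)" for x y
  proof -
    have "norm ((x + \<delta> *\<^sub>R v t x) - (y + \<delta> *\<^sub>R v t y)) \<le> norm (x - y) + \<delta> * (L * norm (x - y))"
    proof -
      have "norm ((x + \<delta> *\<^sub>R v t x) - (y + \<delta> *\<^sub>R v t y)) = norm ((x - y) + \<delta> *\<^sub>R (v t x - v t y))" by (simp add: algebra_simps)
      also have "\<dots> \<le> norm (x - y) + \<delta> * norm (v t x - v t y)" using norm_triangle_ineq[of "x - y" "\<delta> *\<^sub>R (v t x - v t y)"] \<delta> by simp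
      also have "\<dots> \<le> norm (x - y) + \<delta> * (L * norm (x - y))" using v_lip[OF t, of x y] \<delta> by simp
      finally show ?thesis .
    qed
    then have a: "\<bar>\<phi> (x + \<delta> *\<^sub>R v t x) - \<phi> (y + \<delta> *\<^sub>R v t y)\<bar> \<le> (1 + \<delta> * L) * norm (x - y)"
      using l(2)[of "x + \<delta> *\<^sub>R v t x" "y + \<delta> *\<^sub>R v t y"] by (simp add: algebra_simps)
    have "backward_step t \<delta> \<phi> x - backward_step t \<delta> \<phi> y =
        (\<phi> (x + \<delta> *\<^sub>R v t x) - \<phi> (y + \<delta> *\<^sub>R v t y)) * (1 + \<delta> * h t x) + \<phi> (y + \<delta> *\<^sub>R v t y) * (\<delta> * (h t x - h t y))"
      by (simp add: backward_step_def algebra_simps)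
    moreover have "\<bar>(\<phi> (x + \<delta> *\<^sub>R v t x) - \<phi> (y + \<delta> *\<^sub>R v t y)) * (1 + \<delta> * h t x)\<bar> \<le> ((1 + \<delta> * L) * norm (x - y)) * (1 + \<delta> * Ch)"
      unfolding abs_mult using \<delta> L by (intro mult_mono a dh) auto
    moreover have "\<bar>\<phi> (y + \<delta> *\<^sub>R v t y) * (\<delta> * (h t x - h t y))\<bar> \<le> 1 * (\<delta> * (L * norm (x - y)))"
      unfolding abs_mult by (intro mult_mono l(1)) (use \<delta> h_lip[OF t, of x y] in auto)
    ultimately have "\<bar>backward_step t \<delta> \<phi> x - backward_step t \<delta> \<phi> y\<bar> \<le>
        ((1 + \<delta> * L) * norm (x - y)) * (1 + \<delta> * Ch) + \<delta> * (L * norm (x - y))" by linarith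
    also have "\<dots> = (1 + \<delta> * (2 * L + Ch + \<delta> * (L * Ch))) * norm (x - y)" by (simp add: algebra_simps)
    also have "\<dots> \<le> (1 + growth * \<delta>) * norm (x - y)"
    proof (rule mult_right_mono)
      have "\<delta> * (L * Ch) \<le> L * Ch" using mult_right_mono[OF \<delta>(2), of "L * Ch"] L C_nonneg by simp
      then have "\<delta> * (2 * L + Ch + \<delta> * (L * Ch)) \<le> \<delta> * growth" using \<delta> by (intro mult_left_mono) (auto simp: growth_def)
      then show "1 + \<delta> * (2 * L + Ch + \<delta> * (L * Ch)) \<le> 1 + growth * \<delta>" by (simp add: mult.commute)
    qed simp
    finally show ?thesis .
  qed
  show ?thesis
    unfolding Lip1_def mem_Collect_eq
  proof (intro conjI allI)
    show "\<bar>inverse (1 + growth * \<delta>) * backward_step t \<delta> \<phi> x\<bar> \<le> 1" for x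
      using 1[of x] g by (simp add: abs_mult field_simps)
    fix x y
    have "\<bar>inverse (1 + growth * \<delta>) * backward_step t \<delta> \<phi> x - inverse (1 + growth * \<delta>) * backward_step t \<delta> \<phi> y\<bar>
        = inverse (1 + growth * \<delta>) * \<bar>backward_step t \<delta> \<phi> x - backward_step t \<delta> \<phi> y\<bar>"
      using g by (simp add: right_diff_distrib[symmetric] abs_mult)
    also have "\<dots> \<le> inverse (1 + growth * \<delta>) * ((1 + growth * \<delta>) * norm (x - y))"
      by (rule mult_left_mono[OF 2]) (use g in simp)
    also have "\<dots> = norm (x - y)" using g by (simp add: mult.assoc[symmetric])
    finally show "\<bar>inverse (1 + growth * \<delta>) * backward_step t \<delta> \<phi> x - inverse (1 + growth * \<delta>) * backward_step t \<delta> \<phi> y\<bar> \<le> norm (x - y)" .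
  qed
qed

text \<open>The velocity varies by at most \<open>L * \<epsilon>\<close> over the averaging ball, so up to \<open>O(\<delta> \<epsilon>)\<close> the step may be taken with
  the velocity at the centre, and then it acts on the mollified function. The term of order \<open>\<delta>\<^sup>2\<close> comes from
  the Taylor expansion of that function.\<close>

lemma mollify_backward_step:
  assumes t: "t \<in> {0..T}" and \<epsilon>: "\<epsilon> > 0" and \<delta>: "0 < \<delta>" "\<delta> \<le> 1" "\<delta> * Cv \<le> 1" and \<phi>: "\<phi> \<in> Lip1"
  shows "\<bar>mollify \<epsilon> (backward_step t \<delta> \<phi>) x - mollify \<epsilon> \<phi> x
      - \<delta> * (v t x \<bullet> mollify_grad \<epsilon> \<phi> x + h t x * mollify \<epsilon> \<phi> x)\<bar>
    \<le> \<delta> * (L * \<epsilon> * (2 + Ch)) + \<delta> * (\<delta> * (taylor_const \<epsilon> TYPE('a) * Cv\<^sup>2 + Ch * Cv))"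
proof -
  note l = Lip1D[OF \<phi>]
  have bc: "continuous_on UNIV (backward_step t \<delta> \<phi>)"
    unfolding backward_step_def
    by (intro continuous_intros continuous_on_compose2[OF l(3)] continuous_on_slice[OF v_cont t] continuous_on_slice[OF h_cont t]) auto
  define c where "c = 1 + \<delta> * h t x"
  define y where "y = x + \<delta> *\<^sub>R v t x"
  have A: "\<bar>mollify \<epsilon> (backward_step t \<delta> \<phi>) x - c * mollify \<epsilon> \<phi> y\<bar> \<le> \<delta> * (L * \<epsilon> * (2 + Ch))"
  proof (rule mollify_diff_le[OF \<epsilon> l(3) bc])
    fix z :: 'a assume z: "norm z \<le> \<epsilon>"
    have Lz: "L * norm z \<le> L * \<epsilon>" using z L by (rule mult_left_mono)
    have dv: "norm (v t (x + z) - v t x) \<le> L * \<epsilon>" using v_lip[OF t, of "x + z" x] Lz by simp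
    have dh: "\<bar>h t (x + z) - h t x\<bar> \<le> L * \<epsilon>" using h_lip[OF t, of "x + z" x] Lz by simp
    have "\<delta> * \<bar>h t (x + z)\<bar> \<le> 1 * Ch" using h_bound[OF t, of "x + z"] \<delta> C_nonneg by (intro mult_mono) auto
    then have hb: "\<bar>1 + \<delta> * h t (x + z)\<bar> \<le> 1 + Ch"
      using abs_triangle_ineq[of 1 "\<delta> * h t (x + z)"] \<delta> by (simp add: abs_mult)
    have "backward_step t \<delta> \<phi> (x + z) - c * \<phi> (y + z) =
      (\<phi> (x + z + \<delta> *\<^sub>R v t (x + z)) - \<phi> (y + z)) * (1 + \<delta> * h t (x + z)) + \<phi> (y + z) * (\<delta> * (h t (x + z) - h t x))"
      by (simp add: backward_step_def c_def algebra_simps)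
    moreover have "\<bar>\<phi> (x + z + \<delta> *\<^sub>R v t (x + z)) - \<phi> (y + z)\<bar> \<le> \<delta> * (L * \<epsilon>)"
    proof -
      have "\<bar>\<phi> (x + z + \<delta> *\<^sub>R v t (x + z)) - \<phi> (y + z)\<bar> \<le> norm (\<delta> *\<^sub>R (v t (x + z) - v t x))"
        using l(2)[of "x + z + \<delta> *\<^sub>R v t (x + z)" "y + z"] by (simp add: y_def algebra_simps)
      also have "\<dots> \<le> \<delta> * (L * \<epsilon>)" using dv \<delta> by simp
      finally show ?thesis .
    qed
    then have "\<bar>(\<phi> (x + z + \<delta> *\<^sub>R v t (x + z)) - \<phi> (y + z)) * (1 + \<delta> * h t (x + z))\<bar> \<le> \<delta> * (L * \<epsilon>) * (1 + Ch)"
      unfolding abs_mult using hb \<delta> L \<epsilon> by (intro mult_mono) auto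
    moreover have "\<bar>\<phi> (y + z) * (\<delta> * (h t (x + z) - h t x))\<bar> \<le> 1 * (\<delta> * (L * \<epsilon>))"
      unfolding abs_mult by (intro mult_mono l(1)) (use dh \<delta> in auto)
    ultimately show "\<bar>backward_step t \<delta> \<phi> (x + z) - c * \<phi> (y + z)\<bar> \<le> \<delta> * (L * \<epsilon> * (2 + Ch))"
      by (simp add: algebra_simps)
  qed
  have dvC: "norm (\<delta> *\<^sub>R v t x) \<le> \<delta> * Cv" using v_bound[OF t, of x] \<delta> by simp
  have "\<bar>mollify \<epsilon> \<phi> y - mollify \<epsilon> \<phi> x - (\<delta> *\<^sub>R v t x) \<bullet> mollify_grad \<epsilon> \<phi> x\<bar> \<le> taylor_const \<epsilon> TYPE('a) * (norm (\<delta> *\<^sub>R v t x))\<^sup>2"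
    unfolding y_def by (rule mollify_taylor[OF \<epsilon> l(3) l(1)]) (use dvC \<delta> in linarith)
  also have "\<dots> \<le> taylor_const \<epsilon> TYPE('a) * (\<delta> * Cv)\<^sup>2"
    by (intro mult_left_mono power_mono dvC taylor_const_nonneg \<epsilon>) simp
  finally have B: "\<bar>mollify \<epsilon> \<phi> y - mollify \<epsilon> \<phi> x - (\<delta> *\<^sub>R v t x) \<bullet> mollify_grad \<epsilon> \<phi> x\<bar> \<le> taylor_const \<epsilon> TYPE('a) * (\<delta> * Cv)\<^sup>2" .
  have "\<bar>mollify \<epsilon> \<phi> y - mollify \<epsilon> \<phi> x\<bar> \<le> \<delta> * Cv"
    using Lip1D(2)[OF mollify_Lip1(1)[OF \<epsilon> \<phi>], of y x] dvC by (simp add: y_def)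
  then have D: "\<bar>(\<delta> * h t x) * (mollify \<epsilon> \<phi> y - mollify \<epsilon> \<phi> x)\<bar> \<le> (\<delta> * Ch) * (\<delta> * Cv)"
    unfolding abs_mult[of "\<delta> * h t x"] using h_bound[OF t, of x] \<delta> C_nonneg by (intro mult_mono) (auto simp: abs_mult)
  have "c * mollify \<epsilon> \<phi> y - mollify \<epsilon> \<phi> x - \<delta> * (v t x \<bullet> mollify_grad \<epsilon> \<phi> x + h t x * mollify \<epsilon> \<phi> x)
     = (mollify \<epsilon> \<phi> y - mollify \<epsilon> \<phi> x - (\<delta> *\<^sub>R v t x) \<bullet> mollify_grad \<epsilon> \<phi> x) + (\<delta> * h t x) * (mollify \<epsilon> \<phi> y - mollify \<epsilon> \<phi> x)"
    by (simp add: c_def algebra_simps)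
  then have "\<bar>c * mollify \<epsilon> \<phi> y - mollify \<epsilon> \<phi> x - \<delta> * (v t x \<bullet> mollify_grad \<epsilon> \<phi> x + h t x * mollify \<epsilon> \<phi> x)\<bar>
     \<le> taylor_const \<epsilon> TYPE('a) * (\<delta> * Cv)\<^sup>2 + (\<delta> * Ch) * (\<delta> * Cv)" using B D by linarith
  also have "\<dots> = \<delta> * (\<delta> * (taylor_const \<epsilon> TYPE('a) * Cv\<^sup>2 + Ch * Cv))" by (simp add: algebra_simps power2_eq_square)
  finally show ?thesis using A by linarith
qed

text \<open>\<open>D \<epsilon> s\<close> is the dual Lipschitz distance of the two mollified solutions at time \<open>s\<close>. By \<open>weak_increment\<close> the
  change of \<open>\<integral>\<phi>\<^sub>\<epsilon> dn\<close> over a short time is that of replacing \<open>\<phi>\<^sub>\<epsilon>\<close> by its Euler step at a fixed time, and by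
  \<open>mollify_backward_step\<close> this is the mollified \<open>backward_step\<close> of \<open>\<phi>\<close> up to \<open>O(\<delta> \<epsilon>)\<close>. So \<open>D \<epsilon>\<close> grows at most
  exponentially from \<open>0\<close> with a source of size \<open>O(\<epsilon>)\<close>; all terms that deteriorate as \<open>\<epsilon> \<rightarrow> 0\<close> are \<open>o(\<delta>)\<close> and
  disappear in the difference inequality.\<close>

lemma weak_eq_unique:
  assumes m0: "m0 \<in> fin_measures" and n1: "prw_continuous b T n1" "weak_eq T m0 v h n1"
    and n2: "prw_continuous b T n2" "weak_eq T m0 v h n2" and t: "t \<in> {0..T}"
  shows "n1 t = n2 t"
proof -
  note f1 = prw_continuousD(1)[OF n1(1)] and f2 = prw_continuousD(1)[OF n2(1)]
  obtain N1 where N1: "N1 > 0" "\<And>t. t \<in> {0..T} \<Longrightarrow> measure (n1 t) UNIV \<le> N1" using mass_bounded[OF b n1(1)] by blast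
  obtain N2 where N2: "N2 > 0" "\<And>t. t \<in> {0..T} \<Longrightarrow> measure (n2 t) UNIV \<le> N2" using mass_bounded[OF b n2(1)] by blast
  define N where "N = N1 + N2"
  have N: "N > 0" using N1 N2 by (simp add: N_def)
  have T0: "0 \<in> {0..T}" using T by simp
  have int_bd: "\<bar>\<integral>x. q x \<partial>n1 s\<bar> + \<bar>\<integral>x. q x \<partial>n2 s\<bar> \<le> B * N" if s: "s \<in> {0..T}" and q: "\<And>x. \<bar>q x\<bar> \<le> B" for s q B
  proof -
    have B: "B \<ge> 0" using q[of undefined] by linarith
    have "\<bar>\<integral>x. q x \<partial>n1 s\<bar> \<le> B * N1" "\<bar>\<integral>x. q x \<partial>n2 s\<bar> \<le> B * N2"
      using order_trans[OF fin_measures_integral_bound[OF f1[OF s] q] mult_left_mono[OF N1(2)[OF s] B]]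
        order_trans[OF fin_measures_integral_bound[OF f2[OF s] q] mult_left_mono[OF N2(2)[OF s] B]] by auto
    then show ?thesis by (simp add: N_def distrib_left)
  qed
  define J where "J \<epsilon> \<phi> s = (\<integral>x. mollify \<epsilon> \<phi> x \<partial>n1 s) - (\<integral>x. mollify \<epsilon> \<phi> x \<partial>n2 s)" for \<epsilon> \<phi> s
  define D where "D \<epsilon> s = (SUP \<phi>\<in>Lip1. \<bar>J \<epsilon> \<phi> s\<bar>)" for \<epsilon> s
  have zero_Lip: "(\<lambda>_. 0) \<in> Lip1" by (simp add: Lip1_def)
  have J_bd: "\<bar>J \<epsilon> \<phi> s\<bar> \<le> N" if "\<epsilon> > 0" "\<phi> \<in> Lip1" "s \<in> {0..T}" for \<epsilon> \<phi> s
    using int_bd[of s "mollify \<epsilon> \<phi>" 1, OF that(3) Lip1D(1)[OF mollify_Lip1(1)[OF that(1,2)]]] unfolding J_def by linarith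
  have J_le_D: "\<bar>J \<epsilon> \<phi> s\<bar> \<le> D \<epsilon> s" if "\<epsilon> > 0" "\<phi> \<in> Lip1" "s \<in> {0..T}" for \<epsilon> \<phi> s
    unfolding D_def by (rule cSUP_upper[OF that(2)]) (use J_bd that in \<open>auto intro!: bdd_aboveI[of _ N]\<close>)
  have D_le: "D \<epsilon> s \<le> B" if "\<And>\<phi>. \<phi> \<in> Lip1 \<Longrightarrow> \<bar>J \<epsilon> \<phi> s\<bar> \<le> B" for \<epsilon> s B
    unfolding D_def by (rule cSUP_least) (use that zero_Lip in auto)
  define A where "A = N * (L * (2 + Ch))"
  have A: "A \<ge> 0" using N L C_nonneg by (simp add: A_def)
  have D_bound: "D \<epsilon> t \<le> (A * \<epsilon>) * exp ((growth + 1) * t)" if \<epsilon>: "\<epsilon> > 0" for \<epsilon>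
  proof (rule dini_gronwall[OF _ _ growth_nonneg _ _ t])
    define Q where "Q = 1 + 1 / b"
    have Q: "Q > 0" using b by (simp add: Q_def add_pos_pos)
    have J_diff: "\<bar>J \<epsilon> \<phi> s - J \<epsilon> \<phi> r\<bar> \<le> Q * (prw_dist b (n1 s) (n1 r) + prw_dist b (n2 s) (n2 r))"
      if \<phi>: "\<phi> \<in> Lip1" and s: "s \<in> {0..T}" and r: "r \<in> {0..T}" for \<phi> s r
    proof -
      note l = Lip1D[OF mollify_Lip1(1)[OF \<epsilon> \<phi>]]
      have l2: "\<bar>mollify \<epsilon> \<phi> x - mollify \<epsilon> \<phi> y\<bar> \<le> 0 + 1 * norm (x - y)" for x y using l(2) by simp
      have "\<bar>(\<integral>x. mollify \<epsilon> \<phi> x \<partial>n1 s) - (\<integral>x. mollify \<epsilon> \<phi> x \<partial>n1 r)\<bar> \<le> Q * prw_dist b (n1 s) (n1 r)"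
        using integral_diff_le_prw_dist[OF b f1[OF s] f1[OF r] l(4) l(1) l2] by (simp add: Q_def)
      moreover have "\<bar>(\<integral>x. mollify \<epsilon> \<phi> x \<partial>n2 s) - (\<integral>x. mollify \<epsilon> \<phi> x \<partial>n2 r)\<bar> \<le> Q * prw_dist b (n2 s) (n2 r)"
        using integral_diff_le_prw_dist[OF b f2[OF s] f2[OF r] l(4) l(1) l2] by (simp add: Q_def)
      ultimately show ?thesis unfolding J_def distrib_left by linarith
    qed
    show "continuous_on {0..T} (D \<epsilon>)"
      unfolding continuous_on_iff
    proof (intro ballI allI impI)
      fix s e :: real assume s: "s \<in> {0..T}" and e: "e > 0"
      have e': "e / (4 * Q) > 0" using e Q by simp
      obtain d1 where d1: "d1 > 0" "\<forall>r\<in>{0..T}. \<bar>r - s\<bar> < d1 \<longrightarrow> prw_dist b (n1 s) (n1 r) < e / (4 * Q)"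
        using prw_continuousD(2)[OF n1(1) s e'] by blast
      obtain d2 where d2: "d2 > 0" "\<forall>r\<in>{0..T}. \<bar>r - s\<bar> < d2 \<longrightarrow> prw_dist b (n2 s) (n2 r) < e / (4 * Q)"
        using prw_continuousD(2)[OF n2(1) s e'] by blast
      have "dist (D \<epsilon> r) (D \<epsilon> s) < e" if r: "r \<in> {0..T}" "dist r s < min d1 d2" for r
      proof -
        have "prw_dist b (n1 s) (n1 r) + prw_dist b (n2 s) (n2 r) \<le> e / (2 * Q)"
          using d1(2)[rule_format, OF r(1)] d2(2)[rule_format, OF r(1)] r(2) by (simp add: dist_real_def)
        then have "Q * (prw_dist b (n1 s) (n1 r) + prw_dist b (n2 s) (n2 r)) \<le> e / 2"
          using Q by (simp add: field_simps)
        then have close: "\<bar>J \<epsilon> \<phi> s - J \<epsilon> \<phi> r\<bar> \<le> e / 2" if "\<phi> \<in> Lip1" for \<phi> using J_diff[OF that s r(1)] by linarith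
        have "D \<epsilon> r \<le> D \<epsilon> s + e / 2"
        proof (rule D_le)
          fix \<phi> assume \<phi>: "\<phi> \<in> Lip1"
          show "\<bar>J \<epsilon> \<phi> r\<bar> \<le> D \<epsilon> s + e / 2" using close[OF \<phi>] J_le_D[OF \<epsilon> \<phi> s] by linarith
        qed
        moreover have "D \<epsilon> s \<le> D \<epsilon> r + e / 2"
        proof (rule D_le)
          fix \<phi> assume \<phi>: "\<phi> \<in> Lip1"
          show "\<bar>J \<epsilon> \<phi> s\<bar> \<le> D \<epsilon> r + e / 2" using close[OF \<phi>] J_le_D[OF \<epsilon> \<phi> r(1)] by linarith
        qed
        ultimately show ?thesis using e by (simp add: dist_real_def abs_le_iff)
      qed
      then show "\<exists>d>0. \<forall>x'\<in>{0..T}. dist x' s < d \<longrightarrow> dist (D \<epsilon> x') (D \<epsilon> s) < e"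
        using d1(1) d2(1) by (intro exI[of _ "min d1 d2"]) auto
    qed
    define M where "M = 6 * taylor_const \<epsilon> TYPE('a) + 4 * (taylor_const \<epsilon> TYPE('a) + 2)"
    have tc: "taylor_const \<epsilon> TYPE('a) \<ge> 0" by (rule taylor_const_nonneg[OF \<epsilon>])
    have M: "M \<ge> 0" using tc by (simp add: M_def)
    have C11: "C1_pair (mollify \<epsilon> \<phi>) (mollify_grad \<epsilon> \<phi>)" "norm (mollify_grad \<epsilon> \<phi> x) \<le> M"
        "norm (mollify_grad \<epsilon> \<phi> x - mollify_grad \<epsilon> \<phi> y) \<le> M * norm (x - y)" if \<phi>: "\<phi> \<in> Lip1" for \<phi> x y
    proof -
      note q = quadratic_remainder_C11[of "mollify \<epsilon> \<phi>", OF mollify_taylor[OF \<epsilon> Lip1D(3)[OF \<phi>] Lip1D(1)[OF \<phi>]]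
          Lip1D(1)[OF mollify_Lip1(1)[OF \<epsilon> \<phi>]] tc]
      show "C1_pair (mollify \<epsilon> \<phi>) (mollify_grad \<epsilon> \<phi>)" by (rule q(3))
      show "norm (mollify_grad \<epsilon> \<phi> x - mollify_grad \<epsilon> \<phi> y) \<le> M * norm (x - y)" unfolding M_def by (rule q(2))
      show "norm (mollify_grad \<epsilon> \<phi> x) \<le> M" using q(1)[of x] tc by (simp add: M_def)
    qed
    show "D \<epsilon> 0 \<le> 0"
    proof (rule D_le)
      fix \<phi> assume \<phi>: "\<phi> \<in> Lip1"
      note wb = weak_eq_bounded_test(2)[OF m0 _ _ C11(1)[OF \<phi>] Lip1D(1)[OF mollify_Lip1(1)[OF \<epsilon> \<phi>]] C11(2)[OF \<phi>] T0]
      show "\<bar>J \<epsilon> \<phi> 0\<bar> \<le> 0" using wb[OF n1] wb[OF n2] unfolding J_def set_integral_point by simp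
    qed
    show "0 \<le> A * \<epsilon>" using A \<epsilon> by simp
    fix s \<eta> :: real assume s: "0 \<le> s" "s < T" and \<eta>: "\<eta> > 0"
    have s': "s \<in> {0..T}" using s by simp
    obtain d1 where d1: "d1 > 0" "\<And>\<delta> p G. 0 < \<delta> \<Longrightarrow> \<delta> < d1 \<Longrightarrow> s + \<delta> \<le> T \<Longrightarrow> C1_pair p G \<Longrightarrow> \<forall>x. \<bar>p x\<bar> \<le> 1 \<Longrightarrow> \<forall>x. norm (G x) \<le> M \<Longrightarrow>
     \<forall>x y. \<bar>p x - p y\<bar> \<le> norm (x - y) \<Longrightarrow> \<forall>x y. norm (G x - G y) \<le> M * norm (x - y) \<Longrightarrow>
     \<bar>(\<integral>x. p x \<partial>n1 (s + \<delta>)) - (\<integral>x. p x \<partial>n1 s) - \<delta> * (\<integral>x. v s x \<bullet> G x + h s x * p x \<partial>n1 s)\<bar> \<le> \<delta> * (\<eta> / 4)"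
      using weak_increment[OF m0 n1 s M, of "\<eta> / 4"] \<eta> by auto
    obtain d2 where d2: "d2 > 0" "\<And>\<delta> p G. 0 < \<delta> \<Longrightarrow> \<delta> < d2 \<Longrightarrow> s + \<delta> \<le> T \<Longrightarrow> C1_pair p G \<Longrightarrow> \<forall>x. \<bar>p x\<bar> \<le> 1 \<Longrightarrow> \<forall>x. norm (G x) \<le> M \<Longrightarrow>
     \<forall>x y. \<bar>p x - p y\<bar> \<le> norm (x - y) \<Longrightarrow> \<forall>x y. norm (G x - G y) \<le> M * norm (x - y) \<Longrightarrow>
     \<bar>(\<integral>x. p x \<partial>n2 (s + \<delta>)) - (\<integral>x. p x \<partial>n2 s) - \<delta> * (\<integral>x. v s x \<bullet> G x + h s x * p x \<partial>n2 s)\<bar> \<le> \<delta> * (\<eta> / 4)"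
      using weak_increment[OF m0 n2 s M, of "\<eta> / 4"] \<eta> by auto
    define R where "R = taylor_const \<epsilon> TYPE('a) * Cv\<^sup>2 + Ch * Cv"
    have R: "R \<ge> 0" using tc C_nonneg by (simp add: R_def)
    \<comment> \<open>Besides the two increment estimates, \<open>\<delta> \<le> 1\<close>, \<open>\<delta> Cv \<le> 1\<close> and \<open>N R \<delta> \<le> \<eta> / 2\<close> are needed.\<close>
    define d where "d = min (min d1 d2) (min (min 1 (1 / (Cv + 1))) (\<eta> / (2 * (N * R + 1))))"
    have NR: "N * R + 1 > 0" using N R by (simp add: add_nonneg_pos)
    have d: "d > 0" using d1(1) d2(1) C_nonneg \<eta> NR by (simp add: d_def)
    show "\<exists>\<delta>0>0. \<forall>\<delta>. 0 < \<delta> \<longrightarrow> \<delta> < \<delta>0 \<longrightarrow> s + \<delta> \<le> T \<longrightarrow> D \<epsilon> (s + \<delta>) \<le> D \<epsilon> s + \<delta> * (growth * D \<epsilon> s + A * \<epsilon> + \<eta>)"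
    proof (intro exI[of _ d] conjI d allI impI)
      fix \<delta> assume \<delta>: "0 < \<delta>" "\<delta> < d" "s + \<delta> \<le> T"
      have \<delta>': "\<delta> < d1" "\<delta> < d2" "\<delta> \<le> 1" "\<delta> < 1 / (Cv + 1)" "\<delta> < \<eta> / (2 * (N * R + 1))" using \<delta>(2) by (auto simp: d_def)
      have "\<delta> * (Cv + 1) < 1" using \<delta>'(4) C_nonneg by (simp add: pos_less_divide_eq)
      then have \<delta>Cv: "\<delta> * Cv \<le> 1" using \<delta> by (simp add: distrib_left)
      have "\<delta> * (2 * (N * R + 1)) < \<eta>" using \<delta>'(5) NR by (simp add: pos_less_divide_eq)
      then have \<delta>NR: "N * (\<delta> * R) \<le> \<eta> / 2" using \<delta> by (simp add: algebra_simps)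
      show "D \<epsilon> (s + \<delta>) \<le> D \<epsilon> s + \<delta> * (growth * D \<epsilon> s + A * \<epsilon> + \<eta>)"
      proof (rule D_le)
        fix \<phi> assume \<phi>: "\<phi> \<in> Lip1"
        let ?p = "mollify \<epsilon> \<phi>" and ?G = "mollify_grad \<epsilon> \<phi>" and ?q = "mollify \<epsilon> (backward_step s \<delta> \<phi>)"
        note pl = Lip1D[OF mollify_Lip1(1)[OF \<epsilon> \<phi>]]
        define H1 where "H1 = (\<integral>x. v s x \<bullet> ?G x + h s x * ?p x \<partial>n1 s)"
        define H2 where "H2 = (\<integral>x. v s x \<bullet> ?G x + h s x * ?p x \<partial>n2 s)"
        have i1: "\<bar>(\<integral>x. ?p x \<partial>n1 (s + \<delta>)) - (\<integral>x. ?p x \<partial>n1 s) - \<delta> * H1\<bar> \<le> \<delta> * (\<eta> / 4)"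
          unfolding H1_def by (rule d1(2)[OF \<delta>(1) \<delta>'(1) \<delta>(3) C11(1)[OF \<phi>]]) (use pl C11[OF \<phi>] in auto)
        have i2: "\<bar>(\<integral>x. ?p x \<partial>n2 (s + \<delta>)) - (\<integral>x. ?p x \<partial>n2 s) - \<delta> * H2\<bar> \<le> \<delta> * (\<eta> / 4)"
          unfolding H2_def by (rule d2(2)[OF \<delta>(1) \<delta>'(2) \<delta>(3) C11(1)[OF \<phi>]]) (use pl C11[OF \<phi>] in auto)
        define \<psi> where "\<psi> x = inverse (1 + growth * \<delta>) * backward_step s \<delta> \<phi> x" for x
        have \<psi>: "\<psi> \<in> Lip1" unfolding \<psi>_def by (rule backward_step_Lip1[OF s' \<delta>(1) \<delta>'(3) \<phi>])
        have g: "1 + growth * \<delta> > 0" using growth_nonneg \<delta> by (simp add: add_pos_nonneg)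
        have bs: "backward_step s \<delta> \<phi> = (\<lambda>x. (1 + growth * \<delta>) * \<psi> x)" using g by (auto simp: \<psi>_def fun_eq_iff)
        have q: "?q x = (1 + growth * \<delta>) * mollify \<epsilon> \<psi> x" for x unfolding bs by (rule mollify_cmult)
        have Jq: "(\<integral>x. ?q x \<partial>n1 s) - (\<integral>x. ?q x \<partial>n2 s) = (1 + growth * \<delta>) * J \<epsilon> \<psi> s"
          unfolding q J_def by (simp add: right_diff_distrib)
        define E where "E x = ?q x - ?p x - \<delta> * (v s x \<bullet> ?G x + h s x * ?p x)" for x
        define \<kappa> where "\<kappa> = \<delta> * (L * \<epsilon> * (2 + Ch)) + \<delta> * (\<delta> * R)"
        have E: "\<bar>E x\<bar> \<le> \<kappa>" for x
          unfolding E_def \<kappa>_def R_def by (rule mollify_backward_step[OF s' \<epsilon> \<delta>(1) \<delta>'(3) \<delta>Cv \<phi>])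
        have Ei: "(\<integral>x. E x \<partial>n) = (\<integral>x. ?q x \<partial>n) - (\<integral>x. ?p x \<partial>n) - \<delta> * (\<integral>x. v s x \<bullet> ?G x + h s x * ?p x \<partial>n)"
          if n: "n \<in> fin_measures" for n
        proof -
          have "integrable n ?q" unfolding q
            using fin_measures_integrable[OF n Lip1D(4,1)[OF mollify_Lip1(1)[OF \<epsilon> \<psi>]]] by simp
          moreover have "integrable n ?p" by (rule fin_measures_integrable[OF n pl(4) pl(1)])
          moreover have "integrable n (\<lambda>x. v s x \<bullet> ?G x + h s x * ?p x)"
            by (rule fin_measures_integrable[OF n _ weak_integrand_bound[OF s' pl(1) C11(2)[OF \<phi>]]])
               (use measurable_coeffs[OF s'] C1_pairD(3,4)[OF C11(1)[OF \<phi>]] in measurable)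
          ultimately show ?thesis unfolding E_def by simp
        qed
        have Eb: "\<bar>\<integral>x. E x \<partial>n1 s\<bar> + \<bar>\<integral>x. E x \<partial>n2 s\<bar> \<le> \<kappa> * N" by (rule int_bd[OF s' E])
        have "J \<epsilon> \<phi> (s + \<delta>) = (1 + growth * \<delta>) * J \<epsilon> \<psi> s - (\<integral>x. E x \<partial>n1 s) + (\<integral>x. E x \<partial>n2 s)
            + ((\<integral>x. ?p x \<partial>n1 (s + \<delta>)) - (\<integral>x. ?p x \<partial>n1 s) - \<delta> * H1) - ((\<integral>x. ?p x \<partial>n2 (s + \<delta>)) - (\<integral>x. ?p x \<partial>n2 s) - \<delta> * H2)"
          using Jq unfolding Ei[OF f1[OF s']] Ei[OF f2[OF s']] H1_def H2_def J_def by linarith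
        then have "\<bar>J \<epsilon> \<phi> (s + \<delta>)\<bar> \<le> \<bar>(1 + growth * \<delta>) * J \<epsilon> \<psi> s\<bar> + \<kappa> * N + \<delta> * (\<eta> / 4) + \<delta> * (\<eta> / 4)"
          using Eb i1 i2 by linarith
        also have "\<bar>(1 + growth * \<delta>) * J \<epsilon> \<psi> s\<bar> \<le> (1 + growth * \<delta>) * D \<epsilon> s"
          using J_le_D[OF \<epsilon> \<psi> s'] g by (simp add: abs_mult)
        also have "\<kappa> * N = \<delta> * (A * \<epsilon>) + \<delta> * (N * (\<delta> * R))" by (simp add: \<kappa>_def A_def algebra_simps)
        also have "\<delta> * (N * (\<delta> * R)) \<le> \<delta> * (\<eta> / 2)" using \<delta>NR \<delta> by (intro mult_left_mono) auto
        finally show "\<bar>J \<epsilon> \<phi> (s + \<delta>)\<bar> \<le> D \<epsilon> s + \<delta> * (growth * D \<epsilon> s + A * \<epsilon> + \<eta>)"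
          by (simp add: algebra_simps)
      qed
    qed
  qed
  show ?thesis
  proof (rule fin_measures_eqI[OF f1[OF t] f2[OF t]])
    fix \<phi> :: "'a \<Rightarrow> real" assume "\<And>x. \<bar>\<phi> x\<bar> \<le> 1" "\<And>x y. \<bar>\<phi> x - \<phi> y\<bar> \<le> norm (x - y)"
    then have \<phi>: "\<phi> \<in> Lip1" by (simp add: Lip1_def)
    define W where "W = N + A * exp ((growth + 1) * t)"
    have W: "W > 0" using N A by (simp add: W_def add_pos_nonneg)
    have est: "\<bar>(\<integral>x. \<phi> x \<partial>n1 t) - (\<integral>x. \<phi> x \<partial>n2 t)\<bar> \<le> \<epsilon> * W" if \<epsilon>: "\<epsilon> > 0" for \<epsilon>
    proof -
      note pl = Lip1D[OF mollify_Lip1(1)[OF \<epsilon> \<phi>]]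
      have Ei: "(\<integral>x. mollify \<epsilon> \<phi> x - \<phi> x \<partial>n) = (\<integral>x. mollify \<epsilon> \<phi> x \<partial>n) - (\<integral>x. \<phi> x \<partial>n)" if n: "n \<in> fin_measures" for n
        using fin_measures_integrable[OF n pl(4,1)] fin_measures_integrable[OF n Lip1D(4,1)[OF \<phi>]] by simp
      have "\<bar>\<integral>x. mollify \<epsilon> \<phi> x - \<phi> x \<partial>n1 t\<bar> + \<bar>\<integral>x. mollify \<epsilon> \<phi> x - \<phi> x \<partial>n2 t\<bar> \<le> \<epsilon> * N"
        by (rule int_bd[OF t mollify_Lip1(2)[OF \<epsilon> \<phi>]])
      moreover have "\<bar>J \<epsilon> \<phi> t\<bar> \<le> (A * \<epsilon>) * exp ((growth + 1) * t)" using J_le_D[OF \<epsilon> \<phi> t] D_bound[OF \<epsilon>] by linarith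
      ultimately have "\<bar>(\<integral>x. \<phi> x \<partial>n1 t) - (\<integral>x. \<phi> x \<partial>n2 t)\<bar> \<le> \<epsilon> * N + (A * \<epsilon>) * exp ((growth + 1) * t)"
        unfolding J_def Ei[OF f1[OF t]] Ei[OF f2[OF t]] by linarith
      then show ?thesis by (simp add: W_def algebra_simps)
    qed
    have "\<bar>(\<integral>x. \<phi> x \<partial>n1 t) - (\<integral>x. \<phi> x \<partial>n2 t)\<bar> \<le> 0 + e" if "e > 0" for e
      using est[of "e / W"] that W by simp
    then have "\<bar>(\<integral>x. \<phi> x \<partial>n1 t) - (\<integral>x. \<phi> x \<partial>n2 t)\<bar> \<le> 0" by (rule field_le_epsilon)
    then show "(\<integral>x. \<phi> x \<partial>n1 t) = (\<integral>x. \<phi> x \<partial>n2 t)" by simp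
  qed
qed

end

section \<open>Picard iteration\<close>

text \<open>Rescaling to \<open>[0, 1]\<close> removes the parameter from the domain of integration.\<close>

lemma continuous_on_indefinite_integral:
  fixes f :: "real \<Rightarrow> 'a::euclidean_space \<Rightarrow> 'b::euclidean_space"
  assumes f: "continuous_on ({0..T} \<times> UNIV) (\<lambda>(t, x). f t x)"
  shows "continuous_on ({0..T} \<times> UNIV) (\<lambda>(t, x). integral {0..t} (\<lambda>\<tau>. f \<tau> x))"
proof -
  have int: "(\<lambda>\<tau>. f \<tau> x) integrable_on {0..t}" if "t \<in> {0..T}" for t x
    by (rule integrable_continuous_real[OF continuous_on_time_slice[OF f]]) (use that in auto)
  have sub: "integral {0..t} (\<lambda>\<tau>. f \<tau> x) = t *\<^sub>R integral {0..1} (\<lambda>r. f (r * t) x)" if t: "t \<in> {0..T}" for t x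
  proof (cases "t = 0")
    case False
    then have tp: "t > 0" using t by simp
    have "((\<lambda>r. f (t *\<^sub>R r + 0) x) has_integral (1 / (\<bar>t\<bar> ^ DIM(real))) *\<^sub>R integral {0..t} (\<lambda>\<tau>. f \<tau> x))
        ((\<lambda>r. (1 / t) *\<^sub>R r + -((1 / t) *\<^sub>R 0)) ` cbox 0 t)"
      by (rule has_integral_affinity) (use integrable_integral[OF int[OF t]] tp in \<open>auto simp: cbox_interval\<close>)
    moreover have "(\<lambda>r. (1 / t) *\<^sub>R r + -((1 / t) *\<^sub>R 0)) ` cbox 0 t = {0..1}"
      using tp image_divide_atLeastAtMost[of t 0 t] by (simp add: cbox_interval)
    ultimately have "((\<lambda>r. f (t * r) x) has_integral (1 / t) *\<^sub>R integral {0..t} (\<lambda>\<tau>. f \<tau> x)) {0..1}" using tp by simp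
    then have "integral {0..1} (\<lambda>r. f (t * r) x) = (1 / t) *\<^sub>R integral {0..t} (\<lambda>\<tau>. f \<tau> x)" by (rule integral_unique)
    then show ?thesis using tp by (simp add: mult.commute)
  qed simp
  have seg: "r * t \<in> {0..T}" if "r \<in> {0..1}" "t \<in> {0..T}" for r t :: real
    using that mult_left_le_one_le[of t r] by auto
  have "continuous_on (({0..T} \<times> UNIV) \<times> cbox 0 1) (\<lambda>q. (\<lambda>(t, x). f t x) (snd q * fst (fst q), snd (fst q)))"
    by (rule continuous_on_compose2[OF f]) (use seg in \<open>auto intro!: continuous_intros\<close>)
  then have "continuous_on (({0..T} \<times> UNIV) \<times> cbox 0 1) (\<lambda>(p, r). f (r * fst p) (snd p))"
    by (simp add: case_prod_beta')
  from integral_continuous_on_param[OF this]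
  have "continuous_on ({0..T} \<times> UNIV) (\<lambda>p. fst p *\<^sub>R integral {0..1} (\<lambda>r. f (r * fst p) (snd p)))"
    by (intro continuous_intros) simp
  then show ?thesis
    by (rule continuous_on_cong[THEN iffD1, rotated -1]) (use sub in auto)
qed

definition bdd_cont :: "real \<Rightarrow> (real \<Rightarrow> 'a::euclidean_space \<Rightarrow> 'b::euclidean_space) \<Rightarrow> bool" where
  "bdd_cont T u \<longleftrightarrow> continuous_on ({0..T} \<times> UNIV) (\<lambda>(t, x). u t x) \<and> (\<exists>A. \<forall>t\<in>{0..T}. \<forall>x. norm (u t x) \<le> A)"

text \<open>In the norm weighted by \<open>exp (- \<Lambda> t)\<close> the Volterra operator is a contraction, however long the interval.\<close>

lemma picard:
  fixes F :: "(real \<Rightarrow> 'a::euclidean_space \<Rightarrow> 'b::euclidean_space) \<Rightarrow> real \<Rightarrow> 'a \<Rightarrow> 'b"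
  assumes T: "T > 0" and K: "K \<ge> 0"
    and cont: "\<And>u. bdd_cont T u \<Longrightarrow> continuous_on ({0..T} \<times> UNIV) (\<lambda>(t, x). F u t x)"
    and bdd: "\<And>u t x. bdd_cont T u \<Longrightarrow> t \<in> {0..T} \<Longrightarrow> norm (F u t x) \<le> B"
    and lip: "\<And>u w t d x. bdd_cont T u \<Longrightarrow> bdd_cont T w \<Longrightarrow> t \<in> {0..T} \<Longrightarrow> (\<And>x. norm (u t x - w t x) \<le> d) \<Longrightarrow> norm (F u t x - F w t x) \<le> K * d"
  shows "\<exists>u. bdd_cont T u \<and> (\<forall>t\<in>{0..T}. \<forall>x. u t x = integral {0..t} (\<lambda>\<tau>. F u \<tau> x))"
    and "bdd_cont T u \<Longrightarrow> (\<And>t x. t \<in> {0..T} \<Longrightarrow> u t x = integral {0..t} (\<lambda>\<tau>. F u \<tau> x)) \<Longrightarrow>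
      bdd_cont T w \<Longrightarrow> (\<And>t x. t \<in> {0..T} \<Longrightarrow> w t x = integral {0..t} (\<lambda>\<tau>. F w \<tau> x)) \<Longrightarrow> t \<in> {0..T} \<Longrightarrow> u t x = w t x"
proof -
  define \<Lambda> where "\<Lambda> = 2 * K + 1"
  have \<Lambda>: "\<Lambda> > 0" "K / \<Lambda> < 1" "0 \<le> K / \<Lambda>" using K by (auto simp: \<Lambda>_def)
  define c where "c t = max 0 (min t T)" for t
  have c: "c t \<in> {0..T}" "t \<in> {0..T} \<Longrightarrow> c t = t" for t using T by (auto simp: c_def)
  have cc: "continuous_on S c" for S unfolding c_def by (intro continuous_intros)
  \<comment> \<open>Time is clamped to \<open>[0, T]\<close>, so that functions on the slab become bounded functions on the whole space.\<close>
  define enc where "enc u = Bcontfun (\<lambda>p. exp (- \<Lambda> * c (fst p)) *\<^sub>R u (c (fst p)) (snd p))" for u :: "real \<Rightarrow> 'a \<Rightarrow> 'b"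
  define dec where "dec U t x = exp (\<Lambda> * t) *\<^sub>R apply_bcontfun U (t, x)" for U :: "(real \<times> 'a) \<Rightarrow>\<^sub>C 'b" and t x
  have enc: "apply_bcontfun (enc u) (t, x) = exp (- \<Lambda> * c t) *\<^sub>R u (c t) x" if u: "bdd_cont T u" for u t x
  proof -
    obtain A where A: "\<And>t x. t \<in> {0..T} \<Longrightarrow> norm (u t x) \<le> A" using u unfolding bdd_cont_def by blast
    have uc: "continuous_on ({0..T} \<times> UNIV) (\<lambda>(t, x). u t x)" using u by (simp add: bdd_cont_def)
    have "continuous_on UNIV (\<lambda>p. (\<lambda>(t, x). u t x) (c (fst p), snd p))"
      by (rule continuous_on_compose2[OF uc]) (use c in \<open>auto intro!: continuous_intros continuous_on_compose2[OF cc]\<close>)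
    then have 1: "continuous_on UNIV (\<lambda>p. exp (- \<Lambda> * c (fst p)) *\<^sub>R u (c (fst p)) (snd p))"
      by (auto intro!: continuous_intros continuous_on_compose2[OF cc])
    have "(\<lambda>p. exp (- \<Lambda> * c (fst p)) *\<^sub>R u (c (fst p)) (snd p)) \<in> bcontfun"
    proof (rule bcontfun_normI[OF 1])
      fix p :: "real \<times> 'a"
      have "exp (- \<Lambda> * c (fst p)) \<le> 1" using c(1)[of "fst p"] \<Lambda> by simp
      then have "exp (- \<Lambda> * c (fst p)) * norm (u (c (fst p)) (snd p)) \<le> 1 * A"
        by (intro mult_mono A c) auto
      then show "norm (exp (- \<Lambda> * c (fst p)) *\<^sub>R u (c (fst p)) (snd p)) \<le> A" by simp
    qed
    then show ?thesis unfolding enc_def by (simp add: Bcontfun_inverse)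
  qed
  have bdd_cont_dec: "bdd_cont T (dec U)" for U
    unfolding bdd_cont_def
  proof (intro conjI exI ballI allI)
    have "continuous_on ({0..T} \<times> UNIV) (\<lambda>p. exp (\<Lambda> * fst p) *\<^sub>R apply_bcontfun U p)" by (intro continuous_intros) auto
    then show "continuous_on ({0..T} \<times> UNIV) (\<lambda>(t, x). dec U t x)" by (simp add: dec_def case_prod_beta')
    fix t x assume t: "t \<in> {0..T}"
    have "exp (\<Lambda> * t) * norm (apply_bcontfun U (t, x)) \<le> exp (\<Lambda> * T) * norm U"
      using t \<Lambda> by (intro mult_mono norm_bounded) auto
    then show "norm (dec U t x) \<le> exp (\<Lambda> * T) * norm U" by (simp add: dec_def)
  qed
  define I where "I u t x = integral {0..t} (\<lambda>\<tau>. F u \<tau> x)" for u t x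
  have int: "(\<lambda>\<tau>. F u \<tau> x) integrable_on {0..t}" if u: "bdd_cont T u" and t: "t \<in> {0..T}" for u t x
    by (rule integrable_continuous_real[OF continuous_on_time_slice[OF cont[OF u]]]) (use t in auto)
  have B: "B \<ge> 0" using order_trans[OF norm_ge_zero bdd[OF bdd_cont_dec, of 0]] T by simp
  have bdd_cont_I: "bdd_cont T (I u)" if u: "bdd_cont T u" for u
    unfolding bdd_cont_def
  proof (intro conjI exI ballI allI)
    show "continuous_on ({0..T} \<times> UNIV) (\<lambda>(t, x). I u t x)"
      unfolding I_def by (rule continuous_on_indefinite_integral[OF cont[OF u]])
    fix t x assume t: "t \<in> {0..T}"
    have "norm (I u t x) \<le> B * measure lborel {0..t}"
      unfolding I_def by (rule has_integral_bound_real[OF B, of "{}", OF _ integrable_integral[OF int[OF u t]]])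
        (use bdd[OF u] t in auto)
    also have "\<dots> \<le> B * T" using t B by (intro mult_left_mono) auto
    finally show "norm (I u t x) \<le> B * T" .
  qed
  define \<Psi> where "\<Psi> U = enc (I (dec U))" for U
  have \<Psi>: "apply_bcontfun (\<Psi> U) (t, x) = exp (- \<Lambda> * c t) *\<^sub>R I (dec U) (c t) x" for U t x
    unfolding \<Psi>_def by (rule enc[OF bdd_cont_I[OF bdd_cont_dec]])
  have contr: "dist (\<Psi> U) (\<Psi> W) \<le> K / \<Lambda> * dist U W" for U W
  proof (rule dist_bound)
    fix p :: "real \<times> 'a"
    obtain t0 x where p: "p = (t0, x)" by (cases p)
    define t where "t = c t0"
    have t: "t \<in> {0..T}" unfolding t_def by (rule c(1))
    have d: "norm (F (dec U) \<tau> x - F (dec W) \<tau> x) \<le> K * dist U W * exp (\<Lambda> * \<tau>)" if "\<tau> \<in> {0..t}" for \<tau>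
    proof -
      have "norm (F (dec U) \<tau> x - F (dec W) \<tau> x) \<le> K * (exp (\<Lambda> * \<tau>) * dist U W)"
      proof (rule lip[OF bdd_cont_dec bdd_cont_dec])
        fix y
        have "norm (dec U \<tau> y - dec W \<tau> y) = exp (\<Lambda> * \<tau>) * dist (apply_bcontfun U (\<tau>, y)) (apply_bcontfun W (\<tau>, y))"
          unfolding dec_def scaleR_diff_right[symmetric] by (simp add: dist_norm)
        then show "norm (dec U \<tau> y - dec W \<tau> y) \<le> exp (\<Lambda> * \<tau>) * dist U W"
          using dist_bounded[of U "(\<tau>, y)" W] by simp
      qed (use that t in auto)
      then show ?thesis by (simp add: mult.assoc mult.commute mult.left_commute)
    qed
    have "((\<lambda>\<tau>. K * dist U W * exp (\<Lambda> * \<tau>)) has_integral (K * dist U W / \<Lambda> * exp (\<Lambda> * t) - K * dist U W / \<Lambda> * exp (\<Lambda> * 0))) {0..t}"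
      by (rule fundamental_theorem_of_calculus)
         (use t \<Lambda> in \<open>auto intro!: derivative_eq_intros simp: has_real_derivative_iff_has_vector_derivative[symmetric]\<close>)
    then have e: "(\<lambda>\<tau>. K * dist U W * exp (\<Lambda> * \<tau>)) integrable_on {0..t}"
      "integral {0..t} (\<lambda>\<tau>. K * dist U W * exp (\<Lambda> * \<tau>)) \<le> K / \<Lambda> * dist U W * exp (\<Lambda> * t)"
      using K \<Lambda> by (auto simp: has_integral_iff)
    have "norm (I (dec U) t x - I (dec W) t x) = norm (integral {0..t} (\<lambda>\<tau>. F (dec U) \<tau> x - F (dec W) \<tau> x))"
      unfolding I_def using int[OF bdd_cont_dec t] by (simp add: Henstock_Kurzweil_Integration.integral_diff)
    also have "\<dots> \<le> integral {0..t} (\<lambda>\<tau>. K * dist U W * exp (\<Lambda> * \<tau>))"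
      by (rule integral_norm_bound_integral[OF integrable_diff[OF int[OF bdd_cont_dec t] int[OF bdd_cont_dec t]] e(1) d])
    also note e(2)
    finally have "exp (- \<Lambda> * t) * norm (I (dec U) t x - I (dec W) t x) \<le> exp (- \<Lambda> * t) * (K / \<Lambda> * dist U W * exp (\<Lambda> * t))"
      by (rule mult_left_mono) simp
    also have "\<dots> = K / \<Lambda> * dist U W" by (simp add: exp_minus)
    finally show "dist (apply_bcontfun (\<Psi> U) p) (apply_bcontfun (\<Psi> W) p) \<le> K / \<Lambda> * dist U W"
      unfolding p \<Psi> t_def[symmetric] dist_norm scaleR_diff_right[symmetric] by simp
  qed
  have ex1: "\<exists>!U. \<Psi> U = U" by (rule banach_fix_type[OF \<Lambda>(3,2)]) (use contr in auto)
  then obtain U where U: "\<Psi> U = U" by blast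
  show "\<exists>u. bdd_cont T u \<and> (\<forall>t\<in>{0..T}. \<forall>x. u t x = integral {0..t} (\<lambda>\<tau>. F u \<tau> x))"
  proof (intro exI[of _ "dec U"] conjI bdd_cont_dec ballI allI)
    fix t x assume t: "t \<in> {0..T}"
    have "dec U t x = exp (\<Lambda> * t) *\<^sub>R (exp (- \<Lambda> * c t) *\<^sub>R I (dec U) (c t) x)"
      unfolding dec_def[of U t] \<Psi>[symmetric] U ..
    then show "dec U t x = integral {0..t} (\<lambda>\<tau>. F (dec U) \<tau> x)" using c(2)[OF t] by (simp add: I_def exp_minus)
  qed
  have fp: "\<Psi> (enc u) = enc u" "t \<in> {0..T} \<Longrightarrow> dec (enc u) t x = u t x"
    if u: "bdd_cont T u" and eq: "\<And>t x. t \<in> {0..T} \<Longrightarrow> u t x = integral {0..t} (\<lambda>\<tau>. F u \<tau> x)" for u t x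
  proof -
    have de: "dec (enc u) t x = u t x" if "t \<in> {0..T}" for t x
      unfolding dec_def enc[OF u] using c(2)[OF that] by (simp add: exp_minus)
    then show "t \<in> {0..T} \<Longrightarrow> dec (enc u) t x = u t x" .
    have "F (dec (enc u)) \<tau> x = F u \<tau> x" if "\<tau> \<in> {0..T}" for \<tau> x
      using lip[OF bdd_cont_dec u that, of "enc u" 0 x] de[OF that] by simp
    then have "I (dec (enc u)) t x = I u t x" if "t \<in> {0..T}" for t x
      unfolding I_def by (intro integral_cong) (use that in auto)
    then have "apply_bcontfun (\<Psi> (enc u)) (t, x) = apply_bcontfun (enc u) (t, x)" for t x
      unfolding \<Psi> enc[OF u] using c(1)[of t] eq[OF c(1)[of t], of x] by (simp add: I_def)
    then show "\<Psi> (enc u) = enc u" by (intro bcontfun_eqI) auto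
  qed
  assume u: "bdd_cont T u" "\<And>t x. t \<in> {0..T} \<Longrightarrow> u t x = integral {0..t} (\<lambda>\<tau>. F u \<tau> x)"
    and w: "bdd_cont T w" "\<And>t x. t \<in> {0..T} \<Longrightarrow> w t x = integral {0..t} (\<lambda>\<tau>. F w \<tau> x)" and t: "t \<in> {0..T}"
  have "enc u = enc w" using fp(1)[OF u] fp(1)[OF w] ex1 by blast
  then show "u t x = w t x" using fp(2)[OF u t, of x] fp(2)[OF w t, of x] by simp
qed

section \<open>Weighted push-forwards and their couplings\<close>

definition push :: "('a::euclidean_space \<Rightarrow> 'a) \<Rightarrow> ('a \<Rightarrow> real) \<Rightarrow> 'a measure \<Rightarrow> 'a measure" where
  "push X w m0 = distr (density m0 (\<lambda>x. ennreal (w x))) borel X"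

lemma integral_push:
  fixes \<phi> :: "'a::euclidean_space \<Rightarrow> real"
  assumes m0: "m0 \<in> fin_measures" and X: "X \<in> borel_measurable borel" and w: "w \<in> borel_measurable borel" "\<And>x. 0 \<le> w x"
    and \<phi>: "\<phi> \<in> borel_measurable borel"
  shows "(\<integral>x. \<phi> x \<partial>push X w m0) = (\<integral>x. w x * \<phi> (X x) \<partial>m0)"
proof -
  note s = measurable_cong_sets[OF fin_measuresD(2)[OF m0] refl]
  have "X \<in> density m0 (\<lambda>x. ennreal (w x)) \<rightarrow>\<^sub>M borel" using X by (simp add: s)
  then have "(\<integral>x. \<phi> x \<partial>push X w m0) = (\<integral>x. \<phi> (X x) \<partial>density m0 (\<lambda>x. ennreal (w x)))"
    unfolding push_def using \<phi> by (rule integral_distr)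
  also have "\<dots> = (\<integral>x. w x *\<^sub>R \<phi> (X x) \<partial>m0)"
    by (rule integral_density) (use w measurable_compose[OF X \<phi>] in \<open>auto simp: s\<close>)
  finally show ?thesis by simp
qed

lemma nn_integral_push:
  assumes m0: "m0 \<in> fin_measures" and X: "X \<in> borel_measurable borel" and w: "w \<in> borel_measurable borel"
    and F: "F \<in> borel_measurable borel"
  shows "(\<integral>\<^sup>+x. F x \<partial>push X w m0) = (\<integral>\<^sup>+x. ennreal (w x) * F (X x) \<partial>m0)"
proof -
  note s = measurable_cong_sets[OF fin_measuresD(2)[OF m0] refl]
  have "X \<in> density m0 (\<lambda>x. ennreal (w x)) \<rightarrow>\<^sub>M borel" using X by (simp add: s)
  then have "(\<integral>\<^sup>+x. F x \<partial>push X w m0) = (\<integral>\<^sup>+x. F (X x) \<partial>density m0 (\<lambda>x. ennreal (w x)))"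
    unfolding push_def using F by (simp add: nn_integral_distr)
  also have "\<dots> = (\<integral>\<^sup>+x. ennreal (w x) * F (X x) \<partial>m0)"
    by (rule nn_integral_density) (use w measurable_compose[OF X F] in \<open>auto simp: s\<close>)
  finally show ?thesis .
qed

lemma emeasure_push:
  assumes m0: "m0 \<in> fin_measures" and X: "X \<in> borel_measurable borel" and w: "w \<in> borel_measurable borel" and A: "A \<in> sets borel"
  shows "emeasure (push X w m0) A = (\<integral>\<^sup>+x. ennreal (w x) * indicator A (X x) \<partial>m0)"
  using nn_integral_push[OF m0 X w, of "indicator A"] A by (simp add: push_def)

lemma push_in_fin_measures:
  assumes m0: "m0 \<in> fin_measures" and X: "X \<in> borel_measurable borel" and w: "w \<in> borel_measurable borel" "\<And>x. w x \<le> M"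
  shows "push X w m0 \<in> fin_measures"
proof -
  interpret finite_measure m0 using fin_measuresD[OF m0] by simp
  have "emeasure (push X w m0) UNIV \<le> (\<integral>\<^sup>+x. ennreal M \<partial>m0)"
    by (subst emeasure_push[OF m0 X w(1)]) (simp, rule nn_integral_mono, simp add: ennreal_leI w(2))
  also have "\<dots> < \<infinity>" by (simp add: emeasure_finite less_top[symmetric] ennreal_mult_eq_top_iff)
  finally show ?thesis by (auto simp: fin_measures_def push_def intro!: finite_measureI)
qed

lemma push_id: "m0 \<in> fin_measures \<Longrightarrow> push (\<lambda>x. x) (\<lambda>_. 1) m0 = m0"
  using distr_id2[of borel m0] by (simp add: push_def density_1 fin_measuresD)

lemma prob_factor:
  assumes m0: "m0 \<in> fin_measures"
  obtains p where "prob_space p" "sets p = sets borel" "m0 = scale_measure (ennreal (measure m0 UNIV)) p"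
proof (cases "measure m0 UNIV = 0")
  case True
  interpret finite_measure m0 using fin_measuresD[OF m0] by simp
  have "emeasure m0 A = 0" for A
  proof -
    have "emeasure m0 A \<le> emeasure m0 (space m0)" by (rule emeasure_space)
    also have "\<dots> = 0" using True fin_measuresD[OF m0] by (simp add: emeasure_eq_measure)
    finally show ?thesis by simp
  qed
  then have "m0 = scale_measure (ennreal (measure m0 UNIV)) (return borel 0)"
    using fin_measuresD[OF m0] by (intro measure_eqI) (simp_all add: True)
  then show thesis using that[of "return borel 0"] by (simp add: prob_space_return)
next
  case False
  interpret finite_measure m0 using fin_measuresD[OF m0] by simp
  let ?\<theta> = "measure m0 UNIV" and ?p = "scale_measure (ennreal (inverse (measure m0 UNIV))) m0"
  have \<theta>: "?\<theta> > 0" using False by (simp add: zero_less_measure_iff)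
  have one: "ennreal ?\<theta> * ennreal (inverse ?\<theta>) = 1" using \<theta> by (simp add: ennreal_mult''[symmetric])
  have "emeasure ?p (space ?p) = 1"
    using one fin_measuresD[OF m0] by (simp add: space_scale_measure emeasure_eq_measure mult.commute)
  then have "prob_space ?p" by (rule prob_spaceI)
  moreover have "m0 = scale_measure (ennreal ?\<theta>) ?p" using one by simp
  ultimately show thesis using that[of ?p] fin_measuresD[OF m0] by simp
qed

definition label :: "real measure" where "label = uniform_measure lborel {0..1}"

lemma label: "prob_space label" "sets label = sets borel" "space label = UNIV"
  "0 \<le> q \<Longrightarrow> q \<le> 1 \<Longrightarrow> emeasure label {s. s < q} = ennreal q"
  "q \<le> 1 \<Longrightarrow> 0 \<le> p \<Longrightarrow> p \<le> q \<Longrightarrow> emeasure label {s. p \<le> s \<and> s < q} = ennreal (q - p)"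
proof -
  show "prob_space label" unfolding label_def by (rule prob_space_uniform_measure) auto
  show "sets label = sets borel" "space label = UNIV" by (simp_all add: label_def)
  have e: "emeasure label B = emeasure lborel ({0..1} \<inter> B)" if "B \<in> sets borel" for B
    using that unfolding label_def by (subst emeasure_uniform_measure) (simp_all add: divide_ennreal_def)
  show "emeasure label {s. s < q} = ennreal q" if "0 \<le> q" "q \<le> 1" for q
  proof -
    have "{0..1} \<inter> {s. s < q} = {0..<q}" using that by auto
    then show ?thesis using that by (simp add: e)
  qed
  show "emeasure label {s. p \<le> s \<and> s < q} = ennreal (q - p)" if "q \<le> 1" "0 \<le> p" "p \<le> q" for p q
  proof -
    have "{0..1} \<inter> {s. p \<le> s \<and> s < q} = {p..<q}" using that by auto
    moreover have "{s. p \<le> s \<and> s < q} \<in> sets borel" by measurable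
    ultimately show ?thesis using that by (simp only: e) simp
  qed
qed

text \<open>The measures \<open>push X w m0\<close> are seen as restrictions of laws of random points of the augmented space, all
  defined on one probability space: a starting point \<open>x\<close> comes with an independent uniform label, and it is
  sent to \<open>X x\<close> while the label is below the scaled weight and to the remote point otherwise. A pair of
  such random points is a coupling of their laws.\<close>

definition star_point :: "real \<Rightarrow> ('a::euclidean_space \<Rightarrow> 'a) \<Rightarrow> ('a \<Rightarrow> real) \<Rightarrow> 'a \<times> real \<Rightarrow> 'a option" where
  "star_point r X w \<omega> = (if snd \<omega> < r * w (fst \<omega>) then Some (X (fst \<omega>)) else None)"

definition star_law :: "real \<Rightarrow> 'a::euclidean_space measure \<Rightarrow> real \<Rightarrow> ('a \<Rightarrow> 'a) \<Rightarrow> ('a \<Rightarrow> real) \<Rightarrow> 'a option measure" where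
  "star_law b p r X w = distr (p \<Otimes>\<^sub>M label) (star_borel b) (star_point r X w)"

text \<open>Here \<open>p\<close> is \<open>m0\<close> divided by its mass \<open>\<theta>\<close> (any probability if \<open>\<theta> = 0\<close>), and the scale \<open>r = \<theta> / R\<close> is such that \<open>r * w x\<close> is a probability for every
  weight \<open>w \<le> M\<close>.\<close>

locale label_space =
  fixes b :: real and p :: "'a::euclidean_space measure" and r M R \<theta> :: real and m0 :: "'a measure"
  assumes b: "b > 0" and p: "prob_space p" and sp: "sets p = sets borel" and R: "R > 0"
    and \<theta>: "\<theta> \<ge> 0" and m0: "m0 = scale_measure (ennreal \<theta>) p" and r: "r = \<theta> / R" and rM: "r * M \<le> 1"
begin

sublocale pair: pair_prob_space p label
proof -
  interpret p: prob_space p by (rule p)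
  interpret l: prob_space label by (rule label(1))
  show "pair_prob_space p label" ..
qed

lemma r_nonneg: "r \<ge> 0" using \<theta> R by (simp add: r)

lemma sets_label_pair: "sets (p \<Otimes>\<^sub>M label) = sets (borel \<Otimes>\<^sub>M borel)"
  using sp label(2) by (rule sets_pair_measure_cong)

lemma measurable_star_point:
  assumes X: "X \<in> borel_measurable borel" and w: "w \<in> borel_measurable borel"
  shows "star_point r X w \<in> p \<Otimes>\<^sub>M label \<rightarrow>\<^sub>M star_borel b"
  unfolding star_point_def measurable_cong_sets[OF sets_label_pair refl]
proof (rule measurable_If)
  note [measurable] = X w
  show "(\<lambda>\<omega>. Some (X (fst \<omega>))) \<in> borel \<Otimes>\<^sub>M borel \<rightarrow>\<^sub>M star_borel b"
    by (rule measurable_compose[OF _ measurable_Some_star[OF b]]) measurable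
  show "{\<omega> \<in> space (borel \<Otimes>\<^sub>M borel). snd \<omega> < r * w (fst \<omega>)} \<in> sets (borel \<Otimes>\<^sub>M borel)" by measurable
qed simp

lemma star_law_basic:
  assumes X: "X \<in> borel_measurable borel" and w: "w \<in> borel_measurable borel" "\<And>x. 0 \<le> w x" "\<And>x. w x \<le> M"
  shows "sets (star_law b p r X w) = sets (star_borel b)" "prob_space (star_law b p r X w)"
    "scaled_restr R (star_law b p r X w) = push X w m0"
proof -
  note ms = measurable_star_point[OF X w(1)]
  show s: "sets (star_law b p r X w) = sets (star_borel b)" by (simp add: star_law_def)
  show "prob_space (star_law b p r X w)" unfolding star_law_def by (rule pair.prob_space_distr[OF ms])
  have m0f: "m0 \<in> fin_measures"
  proof -
    interpret prob_space p by (rule p)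
    show ?thesis unfolding m0 by (auto simp: fin_measures_def sp space_scale_measure ennreal_mult_eq_top_iff intro!: finite_measureI)
  qed
  show "scaled_restr R (star_law b p r X w) = push X w m0"
  proof (rule measure_eqI)
    show "sets (scaled_restr R (star_law b p r X w)) = sets (push X w m0)" by (simp add: scaled_restr_def push_def)
    fix A assume "A \<in> sets (scaled_restr R (star_law b p r X w))"
    then have A: "A \<in> sets borel" by (simp add: scaled_restr_def)
    have SA: "Some ` A \<in> sets (star_borel b)"
      using sets_star_borel_iff[OF b, of "Some ` A"] A by (simp only: inj_vimage_image_eq[OF inj_Some])
    let ?E = "star_point r X w -` (Some ` A) \<inter> space (p \<Otimes>\<^sub>M label)"
    have E: "?E \<in> sets (p \<Otimes>\<^sub>M label)" by (rule measurable_sets[OF ms SA])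
    have spp: "space p = UNIV" using sets_eq_imp_space_eq[OF sp] by simp
    have "emeasure (scaled_restr R (star_law b p r X w)) A = ennreal R * emeasure (p \<Otimes>\<^sub>M label) ?E"
      unfolding scaled_restr_def emeasure_scale_measure emeasure_restr[OF b s A]
      unfolding star_law_def emeasure_distr[OF ms SA] ..
    also have "emeasure (p \<Otimes>\<^sub>M label) ?E = (\<integral>\<^sup>+x. emeasure label (Pair x -` ?E) \<partial>p)"
      by (rule pair.M2.emeasure_pair_measure_alt[OF E])
    also have "\<dots> = (\<integral>\<^sup>+x. ennreal (r * w x) * indicator A (X x) \<partial>p)"
    proof (rule nn_integral_cong)
      fix x
      have "Pair x -` ?E = (if X x \<in> A then {s. s < r * w x} else {})"
        by (auto simp: star_point_def space_pair_measure spp label(3) split: if_splits)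
      moreover have "0 \<le> r * w x" using r_nonneg w(2) by simp
      moreover have "r * w x \<le> 1" using mult_left_mono[OF w(3)[of x] r_nonneg] rM by linarith
      ultimately show "emeasure label (Pair x -` ?E) = ennreal (r * w x) * indicator A (X x)"
        by (simp add: label(4))
    qed
    also have "ennreal R * \<dots> = (\<integral>\<^sup>+x. ennreal \<theta> * (ennreal (w x) * indicator A (X x)) \<partial>p)"
    proof (subst nn_integral_cmult[symmetric])
      have "(\<lambda>x. ennreal (r * w x) * indicator A (X x)) \<in> borel_measurable borel" using X w(1) A by measurable
      then show "(\<lambda>x. ennreal (r * w x) * indicator A (X x)) \<in> borel_measurable p" by (simp add: sp cong: measurable_cong_sets)
      have "ennreal R * ennreal (r * w x) = ennreal \<theta> * ennreal (w x)" for x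
        using R w(2) \<theta> by (simp add: r ennreal_mult''[symmetric])
      then show "(\<integral>\<^sup>+x. ennreal R * (ennreal (r * w x) * indicator A (X x)) \<partial>p) = (\<integral>\<^sup>+x. ennreal \<theta> * (ennreal (w x) * indicator A (X x)) \<partial>p)"
        by (simp add: mult.assoc[symmetric])
    qed
    also have "\<dots> = (\<integral>\<^sup>+x. ennreal (w x) * indicator A (X x) \<partial>m0)"
    proof -
      have "(\<lambda>x. ennreal (w x) * indicator A (X x)) \<in> borel_measurable borel" using X w(1) A by measurable
      then have "(\<lambda>x. ennreal (w x) * indicator A (X x)) \<in> borel_measurable p" by (simp add: sp cong: measurable_cong_sets)
      then show ?thesis unfolding m0 by (simp add: nn_integral_scale_measure nn_integral_cmult)
    qed
    also have "\<dots> = emeasure (push X w m0) A" by (rule emeasure_push[OF m0f X w(1) A, symmetric])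
    finally show "emeasure (scaled_restr R (star_law b p r X w)) A = emeasure (push X w m0) A" .
  qed
qed

text \<open>Labels below both scaled weights contribute the distance of the two images, and labels between the
  two weights put exactly one of the points at \<open>\<star>\<close>, at cost \<open>b\<close>.\<close>

lemma star_law_W1:
  assumes X: "X1 \<in> borel_measurable borel" "X2 \<in> borel_measurable borel"
    and w1: "w1 \<in> borel_measurable borel" "\<And>x. 0 \<le> w1 x" "\<And>x. w1 x \<le> M"
    and w2: "w2 \<in> borel_measurable borel" "\<And>x. 0 \<le> w2 x" "\<And>x. w2 x \<le> M"
    and i: "integrable m0 (\<lambda>x. w1 x * norm (X1 x - X2 x) + b * \<bar>w1 x - w2 x\<bar>)"
  shows "W1_star b (star_law b p r X1 w1) (star_law b p r X2 w2) \<le>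
     (1 / R) * (\<integral>x. w1 x * norm (X1 x - X2 x) + b * \<bar>w1 x - w2 x\<bar> \<partial>m0)"
proof (rule W1_star_le)
  note ms1 = measurable_star_point[OF X(1) w1(1)] and ms2 = measurable_star_point[OF X(2) w2(1)]
  let ?P = "p \<Otimes>\<^sub>M label" and ?A1 = "star_point r X1 w1" and ?A2 = "star_point r X2 w2"
  let ?S = "star_borel b \<Otimes>\<^sub>M star_borel b :: ('a option \<times> 'a option) measure"
  define W where "W = distr ?P ?S (\<lambda>\<omega>. (?A1 \<omega>, ?A2 \<omega>))"
  have mp: "(\<lambda>\<omega>. (?A1 \<omega>, ?A2 \<omega>)) \<in> ?P \<rightarrow>\<^sub>M ?S" using ms1 ms2 by (rule measurable_Pair)
  show "sets W = sets ?S" by (simp add: W_def)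
  show "distr W (star_borel b) fst = star_law b p r X1 w1" "distr W (star_borel b) snd = star_law b p r X2 w2"
    unfolding W_def star_law_def by (subst distr_distr[OF _ mp], simp, simp add: o_def)+
  have spp: "space p = UNIV" using sets_eq_imp_space_eq[OF sp] by simp
  let ?g = "\<lambda>x. w1 x * norm (X1 x - X2 x) + b * \<bar>w1 x - w2 x\<bar>"
  have g0: "0 \<le> ?g x" for x using w1(2)[of x] b by simp
  have gm: "?g \<in> borel_measurable borel" using X w1(1) w2(1) by measurable
  then have gmp: "?g \<in> borel_measurable p" by (simp add: sp cong: measurable_cong_sets)
  have "(\<integral>\<^sup>+ (x, y). ennreal (rho_star b x y) \<partial>W) = (\<integral>\<^sup>+\<omega>. ennreal (rho_star b (?A1 \<omega>) (?A2 \<omega>)) \<partial>?P)"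
    unfolding W_def using measurable_rho_star[OF b, of ?S]
    by (subst nn_integral_distr[OF mp]) (auto simp: case_prod_beta')
  also have "\<dots> = (\<integral>\<^sup>+x. \<integral>\<^sup>+s. ennreal (rho_star b (?A1 (x, s)) (?A2 (x, s))) \<partial>label \<partial>p)"
    using measurable_compose[OF mp measurable_compose[OF measurable_rho_star[OF b refl] measurable_ennreal]]
    by (intro pair.M2.nn_integral_fst[symmetric]) simp
  also have "\<dots> \<le> (\<integral>\<^sup>+x. ennreal (r * ?g x) \<partial>p)"
  proof (rule nn_integral_mono)
    fix x
    define q1 where "q1 = r * w1 x"
    define q2 where "q2 = r * w2 x"
    define lo where "lo = min q1 q2"
    define hi where "hi = max q1 q2"
    have q: "0 \<le> q1" "0 \<le> q2" "q1 \<le> 1" "q2 \<le> 1"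
      using r_nonneg w1(2)[of x] w2(2)[of x] rM mult_left_mono[OF w1(3)[of x] r_nonneg] mult_left_mono[OF w2(3)[of x] r_nonneg]
      by (auto simp: q1_def q2_def)
    have lh: "0 \<le> lo" "lo \<le> hi" "hi \<le> 1" "hi - lo = \<bar>q1 - q2\<bar>" using q by (auto simp: lo_def hi_def)
    have "(\<integral>\<^sup>+s. ennreal (rho_star b (?A1 (x, s)) (?A2 (x, s))) \<partial>label)
       \<le> (\<integral>\<^sup>+s. ennreal (norm (X1 x - X2 x)) * indicator {s. s < q1} s + ennreal b * indicator {s. lo \<le> s \<and> s < hi} s \<partial>label)"
      using b by (intro nn_integral_mono) (auto simp: star_point_def indicator_def lo_def hi_def q1_def q2_def intro!: ennreal_leI)
    also have "\<dots> = ennreal (norm (X1 x - X2 x)) * ennreal q1 + ennreal b * ennreal (hi - lo)"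
    proof -
      have "{s. s < q1} \<in> sets label" "{s. lo \<le> s \<and> s < hi} \<in> sets label" unfolding label(2) by measurable
      then show ?thesis
        using label(4)[OF q(1,3)] label(5)[OF lh(3,1,2)]
        by (subst nn_integral_add) (auto simp: nn_integral_cmult_indicator)
    qed
    also have "\<dots> = ennreal (norm (X1 x - X2 x) * q1 + b * \<bar>q1 - q2\<bar>)"
      using q b by (simp add: lh(4) ennreal_mult'' ennreal_plus)
    also have "norm (X1 x - X2 x) * q1 + b * \<bar>q1 - q2\<bar> = r * ?g x"
    proof -
      have "\<bar>q1 - q2\<bar> = r * \<bar>w1 x - w2 x\<bar>"
        unfolding q1_def q2_def right_diff_distrib[symmetric] abs_mult using r_nonneg by simp
      then show ?thesis by (simp add: q1_def distrib_left mult.commute mult.left_commute)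
    qed
    finally show "(\<integral>\<^sup>+s. ennreal (rho_star b (?A1 (x, s)) (?A2 (x, s))) \<partial>label) \<le> ennreal (r * ?g x)" .
  qed
  also have "\<dots> = ennreal ((1 / R) * (\<integral>x. ?g x \<partial>m0))"
  proof -
    have "(\<integral>\<^sup>+x. ennreal (r * ?g x) \<partial>p) = ennreal (1 / R) * (\<integral>\<^sup>+x. ennreal (?g x) \<partial>m0)"
    proof -
      have "(\<integral>\<^sup>+x. ennreal (r * ?g x) \<partial>p) = (\<integral>\<^sup>+x. (ennreal (1 / R) * ennreal \<theta>) * ennreal (?g x) \<partial>p)"
        using R \<theta> g0 by (intro nn_integral_cong) (simp add: r ennreal_mult''[symmetric] ennreal_mult[symmetric] mult.assoc)
      also have "\<dots> = (ennreal (1 / R) * ennreal \<theta>) * (\<integral>\<^sup>+x. ennreal (?g x) \<partial>p)"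
        by (rule nn_integral_cmult) (use gmp in simp)
      also have "\<dots> = ennreal (1 / R) * (\<integral>\<^sup>+x. ennreal (?g x) \<partial>m0)"
        unfolding m0 using gmp by (simp add: nn_integral_scale_measure mult.assoc)
      finally show ?thesis .
    qed
    also have "(\<integral>\<^sup>+x. ennreal (?g x) \<partial>m0) = ennreal (\<integral>x. ?g x \<partial>m0)" by (rule nn_integral_eq_integral[OF i]) (use g0 in simp)
    finally show ?thesis using R g0 by (simp add: ennreal_mult''[symmetric] ennreal_mult[symmetric])
  qed
  finally show "(\<integral>\<^sup>+ (x, y). ennreal (rho_star b x y) \<partial>W) \<le> ennreal ((1 / R) * (\<integral>x. ?g x \<partial>m0))" .
  show "0 \<le> (1 / R) * (\<integral>x. ?g x \<partial>m0)" using R g0 by (intro mult_nonneg_nonneg Bochner_Integration.integral_nonneg) auto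
qed

end

text \<open>The estimate for star laws, with \<open>R\<close> so large that the weights fit, transferred to the transport metric.\<close>

lemma prw_push_le:
  fixes m0 :: "'a::euclidean_space measure"
  assumes b: "b > 0" and m0: "m0 \<in> fin_measures"
    and X: "X1 \<in> borel_measurable borel" "X2 \<in> borel_measurable borel"
    and w1: "w1 \<in> borel_measurable borel" "\<And>x. 0 \<le> w1 x" "\<And>x. w1 x \<le> M"
    and w2: "w2 \<in> borel_measurable borel" "\<And>x. 0 \<le> w2 x" "\<And>x. w2 x \<le> M"
    and A: "\<And>x. norm (X1 x - X2 x) \<le> A"
  shows "prw_dist b (push X1 w1 m0) (push X2 w2 m0) \<le> (\<integral>x. w1 x * norm (X1 x - X2 x) + b * \<bar>w1 x - w2 x\<bar> \<partial>m0)"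
    (is "_ \<le> (\<integral>x. ?g x \<partial>m0)")
proof -
  obtain p where p: "prob_space p" "sets p = sets borel" "m0 = scale_measure (ennreal (measure m0 UNIV)) p"
    using prob_factor[OF m0] .
  have M: "M \<ge> 0" using order_trans[OF w1(2) w1(3)] .
  define R where "R = M * measure m0 UNIV + 1"
  have R: "R > 0" using M by (simp add: R_def add_nonneg_pos)
  interpret L: label_space b p "measure m0 UNIV / R" M R "measure m0 UNIV" m0
  proof (rule label_space.intro)
    have "measure m0 UNIV * M \<le> 1 * R" by (simp add: R_def mult.commute)
    then show "measure m0 UNIV / R * M \<le> 1" using R by (simp add: divide_le_eq)
    show "m0 = scale_measure (ennreal (measure m0 UNIV)) p" by (rule p(3))
  qed (use b p(1,2) R in simp_all)
  have "\<bar>?g x\<bar> \<le> M * A + b * M" for x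
  proof -
    have "w1 x * norm (X1 x - X2 x) \<le> M * A" using w1(2,3)[of x] A M by (intro mult_mono) auto
    moreover have "b * \<bar>w1 x - w2 x\<bar> \<le> b * M" using w1(2,3)[of x] w2(2,3)[of x] b by (intro mult_left_mono) auto
    moreover have "0 \<le> ?g x" using w1(2)[of x] b by simp
    ultimately show ?thesis by simp
  qed
  moreover have "?g \<in> borel_measurable borel" using X w1(1) w2(1) by measurable
  ultimately have i: "integrable m0 ?g" by (intro fin_measures_integrable[OF m0])
  note s1 = L.star_law_basic[OF X(1) w1] and s2 = L.star_law_basic[OF X(2) w2]
  have "prw_dist b (push X1 w1 m0) (push X2 w2 m0)
      \<le> R * W1_star b (star_law b p (measure m0 UNIV / R) X1 w1) (star_law b p (measure m0 UNIV / R) X2 w2)"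
    using prw_dist_scaled_restr_le[OF b R s1(1,2) s2(1,2)] unfolding s1(3) s2(3) .
  also have "\<dots> \<le> R * ((1 / R) * (\<integral>x. ?g x \<partial>m0))"
    by (rule mult_left_mono[OF L.star_law_W1[OF X w1 w2 i]]) (use R in simp)
  finally show ?thesis using R by simp
qed

lemma push_gap_vanishes:
  fixes m0 :: "'a::euclidean_space measure" and Y :: "real \<Rightarrow> 'a \<Rightarrow> 'a" and w :: "real \<Rightarrow> 'a \<Rightarrow> real"
  assumes b: "b > 0" and m0: "m0 \<in> fin_measures"
    and Y: "continuous_on ({0..T} \<times> UNIV) (\<lambda>(t, x). Y t x)" "\<And>t x. t \<in> {0..T} \<Longrightarrow> norm (Y t x) \<le> A"
    and w: "continuous_on ({0..T} \<times> UNIV) (\<lambda>(t, x). w t x)" "\<And>t x. t \<in> {0..T} \<Longrightarrow> 0 \<le> w t x" "\<And>t x. t \<in> {0..T} \<Longrightarrow> w t x \<le> M"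
    and t: "t \<in> {0..T}" and \<epsilon>: "\<epsilon> > 0"
  shows "\<exists>\<delta>>0. \<forall>s\<in>{0..T}. \<bar>s - t\<bar> < \<delta> \<longrightarrow>
    (\<integral>x. w t x * norm ((x + Y t x) - (x + Y s x)) + b * \<bar>w t x - w s x\<bar> \<partial>m0) < \<epsilon>"
proof -
  define e where "e s x = w t x * norm ((x + Y t x) - (x + Y s x)) + b * \<bar>w t x - w s x\<bar>" for s x
  have meas: "Y s \<in> borel_measurable borel" "w s \<in> borel_measurable borel" if "s \<in> {0..T}" for s
    using continuous_on_slice[OF Y(1) that] continuous_on_slice[OF w(1) that] by (auto intro: borel_measurable_continuous_onI)
  have bd: "norm (e s x) \<le> M * (2 * A) + b * M" if s: "s \<in> {0..T}" for s x
  proof -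
    have M: "M \<ge> 0" using order_trans[OF w(2)[OF t] w(3)[OF t]] .
    have "norm ((x + Y t x) - (x + Y s x)) \<le> 2 * A"
      using norm_triangle_ineq4[of "Y t x" "Y s x"] Y(2)[OF t, of x] Y(2)[OF s, of x] by simp
    then have "w t x * norm ((x + Y t x) - (x + Y s x)) \<le> M * (2 * A)" using w(2,3)[OF t, of x] M by (intro mult_mono) auto
    moreover have "b * \<bar>w t x - w s x\<bar> \<le> b * M" using w(2,3)[OF t, of x] w(2,3)[OF s, of x] b by (intro mult_left_mono) auto
    moreover have "0 \<le> e s x" using w(2)[OF t, of x] b by (simp add: e_def)
    ultimately show ?thesis by (simp add: e_def)
  qed
  have "((\<lambda>s. \<integral>x. e s x \<partial>m0) \<longlongrightarrow> 0) (at t within {0..T})"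
    unfolding tendsto_at_iff_sequentially comp_def
  proof (intro allI impI)
    fix S assume S: "\<forall>i. S i \<in> {0..T} - {t}" "S \<longlonglongrightarrow> t"
    interpret finite_measure m0 using fin_measuresD[OF m0] by simp
    have "(\<lambda>i. \<integral>x. e (S i) x \<partial>m0) \<longlonglongrightarrow> (\<integral>x. 0 \<partial>m0)"
    proof (rule integral_dominated_convergence[where w = "\<lambda>_. M * (2 * A) + b * M"])
      have "e (S i) \<in> borel_measurable borel" for i
      proof -
        have Si: "S i \<in> {0..T}" using S(1) by blast
        show ?thesis unfolding e_def using meas[OF t] meas[OF Si] by measurable
      qed
      then show "e (S i) \<in> borel_measurable m0" for i using fin_measuresD[OF m0] by (simp cong: measurable_cong_sets)
      have "(\<lambda>i. e (S i) x) \<longlonglongrightarrow> w t x * norm ((x + Y t x) - (x + Y t x)) + b * \<bar>w t x - w t x\<bar>" for x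
      proof -
        have p: "(\<lambda>i. (S i, x)) \<longlonglongrightarrow> (t, x)" by (intro tendsto_intros S(2))
        have "(\<lambda>i. Y (S i) x) \<longlonglongrightarrow> Y t x" "(\<lambda>i. w (S i) x) \<longlonglongrightarrow> w t x"
          using continuous_on_tendsto_compose[OF Y(1) p] continuous_on_tendsto_compose[OF w(1) p] S(1) t by auto
        then show ?thesis unfolding e_def by (intro tendsto_intros)
      qed
      then show "AE x in m0. (\<lambda>i. e (S i) x) \<longlonglongrightarrow> 0" by simp
      show "AE x in m0. norm (e (S i) x) \<le> M * (2 * A) + b * M" for i using bd[of "S i"] S(1) by simp
    qed auto
    then show "(\<lambda>i. \<integral>x. e (S i) x \<partial>m0) \<longlonglongrightarrow> 0" by simp
  qed
  then obtain d where d: "d > 0" "\<And>s. s \<in> {0..T} \<Longrightarrow> s \<noteq> t \<Longrightarrow> \<bar>s - t\<bar> < d \<Longrightarrow> \<bar>\<integral>x. e s x \<partial>m0\<bar> < \<epsilon>"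
    using \<epsilon> unfolding tendsto_iff eventually_at dist_real_def by (metis diff_zero)
  have "(\<integral>x. e s x \<partial>m0) < \<epsilon>" if s: "s \<in> {0..T}" "\<bar>s - t\<bar> < d" for s
  proof (cases "s = t")
    case True
    then have "e s x = 0" for x by (simp add: e_def)
    then show ?thesis using \<epsilon> by simp
  qed (use d(2)[OF s(1) _ s(2)] in simp)
  then show ?thesis unfolding e_def using d(1) by blast
qed

lemma push_prw_continuous:
  fixes m0 :: "'a::euclidean_space measure" and Y :: "real \<Rightarrow> 'a \<Rightarrow> 'a" and w :: "real \<Rightarrow> 'a \<Rightarrow> real"
  assumes b: "b > 0" and m0: "m0 \<in> fin_measures"
    and Y: "continuous_on ({0..T} \<times> UNIV) (\<lambda>(t, x). Y t x)" "\<And>t x. t \<in> {0..T} \<Longrightarrow> norm (Y t x) \<le> A"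
    and w: "continuous_on ({0..T} \<times> UNIV) (\<lambda>(t, x). w t x)" "\<And>t x. t \<in> {0..T} \<Longrightarrow> 0 \<le> w t x" "\<And>t x. t \<in> {0..T} \<Longrightarrow> w t x \<le> M"
  shows "prw_continuous b T (\<lambda>t. push (\<lambda>x. x + Y t x) (w t) m0)"
  unfolding prw_continuous_def
proof (intro conjI ballI allI impI)
  have meas: "(\<lambda>x. x + Y s x) \<in> borel_measurable borel" "w s \<in> borel_measurable borel" if "s \<in> {0..T}" for s
    using borel_measurable_continuous_onI[OF continuous_on_slice[OF Y(1) that]]
      borel_measurable_continuous_onI[OF continuous_on_slice[OF w(1) that]] by auto
  show "push (\<lambda>x. x + Y t x) (w t) m0 \<in> fin_measures" if "t \<in> {0..T}" for t
    by (rule push_in_fin_measures[OF m0 meas[OF that] w(3)[OF that]])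
  fix t \<epsilon> :: real assume t: "t \<in> {0..T}" and \<epsilon>: "\<epsilon> > 0"
  obtain \<delta> where \<delta>: "\<delta> > 0" "\<And>s. s \<in> {0..T} \<Longrightarrow> \<bar>s - t\<bar> < \<delta> \<Longrightarrow>
    (\<integral>x. w t x * norm ((x + Y t x) - (x + Y s x)) + b * \<bar>w t x - w s x\<bar> \<partial>m0) < \<epsilon>"
    using push_gap_vanishes[OF b m0 Y w t \<epsilon>] by blast
  have "prw_dist b (push (\<lambda>x. x + Y t x) (w t) m0) (push (\<lambda>x. x + Y s x) (w s) m0) < \<epsilon>"
    if s: "s \<in> {0..T}" "\<bar>s - t\<bar> < \<delta>" for s
  proof (rule le_less_trans[OF prw_push_le[OF b m0 meas(1)[OF t] meas(1)[OF s(1)] meas(2)[OF t] w(2)[OF t] w(3)[OF t]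
        meas(2)[OF s(1)] w(2)[OF s(1)] w(3)[OF s(1)]] \<delta>(2)[OF s]])
    show "norm ((x + Y t x) - (x + Y s x)) \<le> 2 * A" for x
      using norm_triangle_ineq4[of "Y t x" "Y s x"] Y(2)[OF t, of x] Y(2)[OF s(1), of x] by simp
  qed
  then show "\<exists>\<delta>>0. \<forall>s\<in>{0..T}. \<bar>s - t\<bar> < \<delta> \<longrightarrow>
      prw_dist b (push (\<lambda>x. x + Y t x) (w t) m0) (push (\<lambda>x. x + Y s x) (w s) m0) < \<epsilon>"
    using \<delta>(1) by blast
qed

section \<open>Characteristics\<close>

lemma bdd_contD:
  fixes u :: "real \<Rightarrow> 'a::euclidean_space \<Rightarrow> 'a \<times> real"
  assumes "bdd_cont T u"
  shows "continuous_on ({0..T} \<times> UNIV) (\<lambda>(t, x). fst (u t x))" "continuous_on ({0..T} \<times> UNIV) (\<lambda>(t, x). snd (u t x))"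
    "\<exists>A. \<forall>t\<in>{0..T}. \<forall>x. norm (fst (u t x)) \<le> A \<and> \<bar>snd (u t x)\<bar> \<le> A"
proof -
  have c: "continuous_on ({0..T} \<times> UNIV) (\<lambda>p. u (fst p) (snd p))" using assms by (simp add: bdd_cont_def case_prod_beta')
  show "continuous_on ({0..T} \<times> UNIV) (\<lambda>(t, x). fst (u t x))" "continuous_on ({0..T} \<times> UNIV) (\<lambda>(t, x). snd (u t x))"
    unfolding case_prod_beta' by (intro continuous_intros c)+
  obtain A where A: "\<forall>t\<in>{0..T}. \<forall>x. norm (u t x) \<le> A" using assms unfolding bdd_cont_def by blast
  have "norm (fst q) \<le> norm q \<and> \<bar>snd q\<bar> \<le> norm q" for q :: "'a \<times> real"
    using norm_fst_le[of "fst q" "snd q"] norm_snd_le[of "snd q" "fst q"] by simp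
  then have "\<forall>t\<in>{0..T}. \<forall>x. norm (fst (u t x)) \<le> A \<and> \<bar>snd (u t x)\<bar> \<le> A" using A order_trans by blast
  then show "\<exists>A. \<forall>t\<in>{0..T}. \<forall>x. norm (fst (u t x)) \<le> A \<and> \<bar>snd (u t x)\<bar> \<le> A" by blast
qed

lemma continuous_on_along:
  fixes F :: "real \<Rightarrow> 'a::euclidean_space \<Rightarrow> 'b::topological_space"
  assumes F: "continuous_on ({0..T} \<times> UNIV) (\<lambda>(t, x). F t x)" and Y: "continuous_on ({0..T} \<times> UNIV) (\<lambda>(t, x). Y t x)"
  shows "continuous_on ({0..T} \<times> UNIV) (\<lambda>(t, x). F t (x + Y t x))"
proof -
  have "continuous_on ({0..T} \<times> UNIV) (\<lambda>p. (\<lambda>(t, x). F t x) (fst p, snd p + Y (fst p) (snd p)))"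
    by (rule continuous_on_compose2[OF F]) (use Y in \<open>auto intro!: continuous_intros simp: case_prod_beta'\<close>)
  then show ?thesis by (simp add: case_prod_beta')
qed

context transport_coefficients
begin

text \<open>Along characteristics, \<open>w \<phi>(X)\<close> has derivative \<open>w (v \<bullet> \<nabla>\<phi> + h \<phi>)(X)\<close>; integrating in time and over
  the starting points gives the weak equation by Fubini.\<close>

lemma weak_eq_characteristics:
  assumes m0: "m0 \<in> fin_measures" and u: "bdd_cont T u"
    and eq: "\<And>t x. t \<in> {0..T} \<Longrightarrow> u t x = integral {0..t} (\<lambda>\<tau>. (v \<tau> (x + fst (u \<tau> x)), h \<tau> (x + fst (u \<tau> x))))"
  shows "weak_eq T m0 v h (\<lambda>t. push (\<lambda>x. x + fst (u t x)) (\<lambda>x. exp (snd (u t x))) m0)"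
  unfolding weak_eq_def
proof (intro allI impI ballI)
  fix \<phi> :: "'a \<Rightarrow> real" and D K t
  assume C: "C1_pair \<phi> D" and K: "compact K" and z: "\<forall>x. x \<notin> K \<longrightarrow> \<phi> x = 0" and t: "t \<in> {0..T}"
  define X where "X t x = x + fst (u t x)" for t x
  define w where "w t x = exp (snd (u t x))" for t x
  note uc = bdd_contD(1,2)[OF u]
  obtain A where A: "\<And>t x. t \<in> {0..T} \<Longrightarrow> \<bar>snd (u t x)\<bar> \<le> A" using bdd_contD(3)[OF u] by blast
  have Xc: "continuous_on ({0..T} \<times> UNIV) (\<lambda>(t, x). X t x)" "continuous_on ({0..T} \<times> UNIV) (\<lambda>(t, x). w t x)"
    using uc unfolding X_def w_def case_prod_beta' by (auto intro!: continuous_intros)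
  have vh: "continuous_on ({0..T} \<times> UNIV) (\<lambda>(t, x). v t (X t x))" "continuous_on ({0..T} \<times> UNIV) (\<lambda>(t, x). h t (X t x))"
    unfolding X_def using continuous_on_along[OF v_cont uc(1)] continuous_on_along[OF h_cont uc(1)] .
  note slice = continuous_on_time_slice[OF _ subset_refl]
  define G where "G t x = w t x * (v t (X t x) \<bullet> D (X t x) + h t (X t x) * \<phi> (X t x))" for t x
  have Gc: "continuous_on ({0..T} \<times> UNIV) (\<lambda>(t, x). G t x)"
  proof -
    have "continuous_on ({0..T} \<times> UNIV) (\<lambda>p. D (X (fst p) (snd p)))" "continuous_on ({0..T} \<times> UNIV) (\<lambda>p. \<phi> (X (fst p) (snd p)))"
      using Xc(1) unfolding case_prod_beta'
      by (auto intro!: continuous_on_compose2[OF C1_pairD(1)[OF C]] continuous_on_compose2[OF C1_pairD(2)[OF C]])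
    then show ?thesis using Xc(2) vh unfolding G_def case_prod_beta' by (auto intro!: continuous_intros)
  qed
  have du: "((\<lambda>t. u t x) has_vector_derivative (v t (X t x), h t (X t x))) (at t within {0..T})" if t: "t \<in> {0..T}" for t x
  proof -
    have "continuous_on {0..T} (\<lambda>t. (v t (X t x), h t (X t x)))" by (rule continuous_on_Pair[OF slice[OF vh(1)] slice[OF vh(2)]])
    from integral_has_vector_derivative[OF this t]
    show ?thesis
      by (rule has_vector_derivative_transform[OF t, rotated]) (use eq in \<open>auto simp: X_def\<close>)
  qed
  have dG: "((\<lambda>t. w t x * \<phi> (X t x)) has_vector_derivative G t x) (at t within {0..T})" if t: "t \<in> {0..T}" for t x
  proof -
    have dX: "((\<lambda>t. X t x) has_derivative (\<lambda>r. r *\<^sub>R v t (X t x))) (at t within {0..T})"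
      using has_derivative_add[OF has_derivative_const has_derivative_fst[OF du[OF t, of x, unfolded has_vector_derivative_def]], of x]
      by (simp add: X_def)
    have dl: "((\<lambda>t. snd (u t x)) has_real_derivative h t (X t x)) (at t within {0..T})"
      using has_derivative_snd[OF du[OF t, unfolded has_vector_derivative_def], of x]
      by (simp add: has_field_derivative_def mult.commute[of _ "h t (X t x)"])
    have dw: "((\<lambda>t. w t x) has_real_derivative w t x * h t (X t x)) (at t within {0..T})"
      unfolding w_def by (auto intro!: derivative_eq_intros dl)
    have "((\<lambda>t. \<phi> (X t x)) has_derivative (\<lambda>r. (r *\<^sub>R v t (X t x)) \<bullet> D (X t x))) (at t within {0..T})"
      by (rule has_derivative_compose[OF dX C1_pairD(5)[OF C, unfolded gderiv_def]])
    then have dp: "((\<lambda>t. \<phi> (X t x)) has_real_derivative v t (X t x) \<bullet> D (X t x)) (at t within {0..T})"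
      by (simp add: has_field_derivative_def mult.commute[of _ "v t (X t x) \<bullet> D (X t x)"])
    show ?thesis
      unfolding has_real_derivative_iff_has_vector_derivative[symmetric]
      by (rule DERIV_cong[OF DERIV_mult[OF dw dp]]) (simp add: G_def algebra_simps)
  qed
  have inc: "w t x * \<phi> (X t x) - \<phi> x = (\<integral>\<tau>. indicator {0..t} \<tau> *\<^sub>R G \<tau> x \<partial>lborel)" for x
  proof -
    have sub: "{0..t} \<subseteq> {0..T}" using t by auto
    have "(\<integral>\<tau>. indicator {0..t} \<tau> *\<^sub>R G \<tau> x \<partial>lborel) = w t x * \<phi> (X t x) - w 0 x * \<phi> (X 0 x)"
    proof (rule integral_FTC_atLeastAtMost)
      fix \<tau> assume "0 \<le> \<tau>" "\<tau> \<le> t"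
      then show "((\<lambda>t. w t x * \<phi> (X t x)) has_vector_derivative G \<tau> x) (at \<tau> within {0..t})"
        using t by (intro has_vector_derivative_within_subset[OF dG sub]) auto
    qed (use t continuous_on_subset[OF slice[OF Gc] sub] in auto)
    moreover have "u 0 x = 0" using eq[of 0 x] T by simp
    ultimately show ?thesis by (simp add: w_def X_def)
  qed
  obtain A1 B1 where A1: "\<And>x. \<bar>\<phi> x\<bar> \<le> A1" and B1: "\<And>x. norm (D x) \<le> B1"
    using C1_pair_bounded[OF C K] z by blast
  have w_bd: "0 \<le> w t x" "w t x \<le> exp A" if "t \<in> {0..T}" for t x using A[OF that, of x] by (auto simp: w_def)
  have meas: "X s \<in> borel_measurable borel" "w s \<in> borel_measurable borel" if "s \<in> {0..T}" for s
    using continuous_on_slice[OF Xc(1) that] continuous_on_slice[OF Xc(2) that] by (auto intro: borel_measurable_continuous_onI)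
  have ip: "(\<integral>x. q x \<partial>push (X s) (w s) m0) = (\<integral>x. w s x * q (X s x) \<partial>m0)"
    if "s \<in> {0..T}" "q \<in> borel_measurable borel" for s and q :: "'a \<Rightarrow> real"
    by (rule integral_push[OF m0 meas[OF that(1)] w_bd(1)[OF that(1)] that(2)])
  interpret m0: finite_measure m0 using fin_measuresD[OF m0] by simp
  interpret pair_sigma_finite lborel m0 by (simp add: pair_sigma_finite_def lborel.sigma_finite_measure_axioms m0.sigma_finite_measure_axioms)
  let ?\<Phi> = "\<lambda>(\<tau>, x). indicator {0..t} \<tau> *\<^sub>R G \<tau> x"
  define CG where "CG = exp A * (Cv * B1 + Ch * A1)"
  have G_bd: "\<bar>G \<tau> x\<bar> \<le> CG" if "\<tau> \<in> {0..T}" for \<tau> x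
    unfolding G_def CG_def abs_mult
    by (intro mult_mono weak_integrand_bound[OF that A1 B1]) (use w_bd[OF that, of x] in auto)
  have sb: "sets (lborel \<Otimes>\<^sub>M m0) = sets borel"
  proof -
    have "sets (lborel \<Otimes>\<^sub>M m0) = sets (borel \<Otimes>\<^sub>M borel)" by (rule sets_pair_measure_cong) (simp_all add: fin_measuresD[OF m0])
    then show ?thesis by (simp only: borel_prod)
  qed
  have "integrable (lborel \<Otimes>\<^sub>M m0) ?\<Phi>"
  proof (rule Bochner_Integration.integrable_bound)
    have "emeasure (lborel \<Otimes>\<^sub>M m0) ({0..t} \<times> UNIV) < \<infinity>"
      using m0.emeasure_pair_measure_Times[of "{0..t}" lborel UNIV] fin_measuresD[OF m0] t
      by (simp add: m0.emeasure_eq_measure ennreal_mult''[symmetric])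
    moreover have "{0..t} \<times> (UNIV :: 'a set) \<in> sets (lborel \<Otimes>\<^sub>M m0)" unfolding sb by (intro borel_closed closed_Times) auto
    ultimately show "integrable (lborel \<Otimes>\<^sub>M m0) (\<lambda>p. CG * indicator ({0..t} \<times> UNIV) p)" by simp
    have "(\<lambda>p. indicator ({0..t} \<times> UNIV) p *\<^sub>R (\<lambda>(t, x). G t x) p) \<in> borel_measurable borel"
    proof (rule borel_measurable_continuous_on_indicator)
      show "{0..t} \<times> (UNIV :: 'a set) \<in> sets borel" by (intro borel_closed closed_Times) auto
      show "continuous_on ({0..t} \<times> UNIV) (\<lambda>(t, x). G t x)" by (rule continuous_on_subset[OF Gc]) (use t in auto)
    qed
    moreover have "(\<lambda>p. indicator ({0..t} \<times> UNIV) p *\<^sub>R (\<lambda>(t, x). G t x) p) = ?\<Phi>" by (auto simp: fun_eq_iff indicator_def)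
    ultimately show "?\<Phi> \<in> borel_measurable (lborel \<Otimes>\<^sub>M m0)" unfolding measurable_cong_sets[OF sb refl] by simp
    show "AE p in lborel \<Otimes>\<^sub>M m0. norm (?\<Phi> p) \<le> norm (CG * indicator ({0..t} \<times> UNIV) p)"
    proof (rule AE_I2)
      fix p :: "real \<times> 'a"
      obtain \<tau> x where p: "p = (\<tau>, x)" by (cases p)
      show "norm (?\<Phi> p) \<le> norm (CG * indicator ({0..t} \<times> UNIV) p)"
      proof (cases "\<tau> \<in> {0..t}")
        case True
        then have "\<bar>G \<tau> x\<bar> \<le> CG" using t by (intro G_bd) auto
        then show ?thesis using True by (simp add: p)
      qed (simp add: p)
    qed
  qed
  then have fub: "(\<integral>x. (\<integral>\<tau>. indicator {0..t} \<tau> *\<^sub>R G \<tau> x \<partial>lborel) \<partial>m0) = (\<integral>\<tau>. (\<integral>x. indicator {0..t} \<tau> *\<^sub>R G \<tau> x \<partial>m0) \<partial>lborel)"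
    by (rule Fubini_integral)
  have phim: "\<phi> \<in> borel_measurable borel" by (rule C1_pairD(3)[OF C])
  have "(\<integral>x. \<phi> x \<partial>push (X t) (w t) m0) - (\<integral>x. \<phi> x \<partial>m0) = (\<integral>x. w t x * \<phi> (X t x) - \<phi> x \<partial>m0)"
  proof -
    have "integrable m0 (\<lambda>x. w t x * \<phi> (X t x))"
    proof (rule fin_measures_integrable[OF m0])
      show "(\<lambda>x. w t x * \<phi> (X t x)) \<in> borel_measurable borel" using meas[OF t] phim by measurable
      show "\<bar>w t x * \<phi> (X t x)\<bar> \<le> exp A * A1" for x
        unfolding abs_mult by (intro mult_mono A1) (use w_bd[OF t, of x] in auto)
    qed
    then show ?thesis unfolding ip[OF t phim] using fin_measures_integrable[OF m0 phim A1] by simp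
  qed
  also have "\<dots> = (\<integral>\<tau>. (\<integral>x. indicator {0..t} \<tau> *\<^sub>R G \<tau> x \<partial>m0) \<partial>lborel)" unfolding inc fub ..
  also have "\<dots> = (LINT \<tau>:{0..t}|lborel. (\<integral>x. v \<tau> x \<bullet> D x + h \<tau> x * \<phi> x \<partial>push (X \<tau>) (w \<tau>) m0))"
    unfolding set_lebesgue_integral_def
  proof (rule Bochner_Integration.integral_cong[OF refl])
    fix \<tau> :: real
    show "(\<integral>x. indicator {0..t} \<tau> *\<^sub>R G \<tau> x \<partial>m0) = indicator {0..t} \<tau> *\<^sub>R (\<integral>x. v \<tau> x \<bullet> D x + h \<tau> x * \<phi> x \<partial>push (X \<tau>) (w \<tau>) m0)"
    proof (cases "\<tau> \<in> {0..t}")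
      case True
      then have \<tau>: "\<tau> \<in> {0..T}" using t by auto
      have "(\<lambda>x. v \<tau> x \<bullet> D x + h \<tau> x * \<phi> x) \<in> borel_measurable borel"
        using measurable_coeffs[OF \<tau>] C1_pairD(3,4)[OF C] by measurable
      from ip[OF \<tau> this] show ?thesis using True by (simp add: G_def)
    qed simp
  qed
  finally show "(\<integral>x. \<phi> x \<partial>push (\<lambda>x. x + fst (u t x)) (\<lambda>x. exp (snd (u t x))) m0) - (\<integral>x. \<phi> x \<partial>m0) =
      (LINT \<tau>:{0..t}|lborel. (\<integral>x. v \<tau> x \<bullet> D x + h \<tau> x * \<phi> x \<partial>push (\<lambda>x. x + fst (u \<tau> x)) (\<lambda>x. exp (snd (u \<tau> x))) m0))"
    unfolding X_def w_def .
qed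

end

section \<open>The nonlinear equation\<close>

lemma integral_component_bound:
  fixes F :: "real \<Rightarrow> 'a::euclidean_space \<times> real"
  assumes t: "0 \<le> t" and F: "F integrable_on {0..t}" and C: "\<And>\<tau>. \<tau> \<in> {0..t} \<Longrightarrow> \<bar>snd (F \<tau>)\<bar> \<le> C" "C \<ge> 0"
  shows "snd (integral {0..t} F) \<le> C * t"
proof -
  have "((\<lambda>\<tau>. snd (F \<tau>)) has_integral snd (integral {0..t} F)) {0..t}"
    using has_integral_linear[OF integrable_integral[OF F] bounded_linear_snd] by (simp add: o_def)
  then have "norm (snd (integral {0..t} F)) \<le> C * measure lborel {0..t}"
    by (rule has_integral_bound_real[OF C(2), of "{}", rotated]) (use C in auto)
  then show ?thesis using t by simp
qed

locale balance_lipschitz = balance_coefficients b T Cf Cg f g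
  for b T Cf Cg :: real and f :: "real \<Rightarrow> 'a::euclidean_space \<Rightarrow> 'a measure \<Rightarrow> 'a" and g :: "real \<Rightarrow> 'a \<Rightarrow> 'a measure \<Rightarrow> real" +
  fixes L :: real and m0 :: "'a measure"
  assumes L: "L \<ge> 0" and m0: "m0 \<in> fin_measures"
    and f_lip: "\<And>t x1 x2 m1 m2. t \<in> {0..T} \<Longrightarrow> m1 \<in> fin_measures \<Longrightarrow> m2 \<in> fin_measures \<Longrightarrow>
           norm (f t x1 m1 - f t x2 m2) \<le> L * (norm (x1 - x2) + prw_dist b m1 m2)"
    and g_lip: "\<And>t x1 x2 m1 m2. t \<in> {0..T} \<Longrightarrow> m1 \<in> fin_measures \<Longrightarrow> m2 \<in> fin_measures \<Longrightarrow>
           \<bar>g t x1 m1 - g t x2 m2\<bar> \<le> L * (norm (x1 - x2) + prw_dist b m1 m2)"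
begin

lemma Cg_nonneg: "Cg \<ge> 0" and Cf_nonneg: "Cf \<ge> 0"
proof -
  have "0 \<in> {0..T}" using T by simp
  from g_bound[OF this m0, of undefined] f_bound[OF this m0, of undefined] show "Cg \<ge> 0" "Cf \<ge> 0"
    using norm_ge_zero[of "f 0 undefined m0"] by linarith+
qed

lemma prw_dist_self: "m \<in> fin_measures \<Longrightarrow> prw_dist b m m = 0"
proof -
  assume m: "m \<in> fin_measures"
  have "prw_dist b (push (\<lambda>x. x) (\<lambda>_. 1) m) (push (\<lambda>x. x) (\<lambda>_. 1) m) \<le> (\<integral>x. 1 * norm (x - x) + b * \<bar>1 - 1 :: real\<bar> \<partial>m)"
    by (rule prw_push_le[OF b m, where M = 1 and A = 0]) auto
  then show ?thesis using prw_dist_nonneg[of b m m] by (simp add: push_id[OF m])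
qed

lemma lipschitz_transport_along:
  assumes m: "prw_continuous b T m"
  shows "lipschitz_transport b T Cf Cg (\<lambda>t x. f t x (m t)) (\<lambda>t x. g t x (m t)) L"
proof (intro lipschitz_transport.intro transport_coefficients_along[OF m] lipschitz_transport_axioms.intro L)
  fix t x y assume t: "t \<in> {0..T}"
  note mt = prw_continuousD(1)[OF m t]
  show "norm (f t x (m t) - f t y (m t)) \<le> L * norm (x - y)" "\<bar>g t x (m t) - g t y (m t)\<bar> \<le> L * norm (x - y)"
    using f_lip[OF t mt mt, of x y] g_lip[OF t mt mt, of x y] prw_dist_self[OF mt] by simp_all
qed

text \<open>The unknown \<open>u t x\<close> consists of the displacement of the particle starting at \<open>x\<close> and the logarithm
  of its weight; capping the logarithm at its a priori bound makes the weight globally Lipschitz.\<close>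

definition weight :: "(real \<Rightarrow> 'a \<Rightarrow> 'a \<times> real) \<Rightarrow> real \<Rightarrow> 'a \<Rightarrow> real" where
  "weight u t x = exp (min (snd (u t x)) (Cg * T))"

definition transported :: "(real \<Rightarrow> 'a \<Rightarrow> 'a \<times> real) \<Rightarrow> real \<Rightarrow> 'a measure" where
  "transported u t = push (\<lambda>x. x + fst (u t x)) (weight u t) m0"

lemma weight_bounds: "0 \<le> weight u t x" "weight u t x \<le> exp (Cg * T)"
  by (simp_all add: weight_def)

lemma weight_continuous: "bdd_cont T u \<Longrightarrow> continuous_on ({0..T} \<times> UNIV) (\<lambda>(t, x). weight u t x)"
  using bdd_contD(2)[of T u] unfolding weight_def case_prod_beta' by (auto intro!: continuous_intros)

lemma measurable_transport:
  assumes "bdd_cont T u" "t \<in> {0..T}"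
  shows "(\<lambda>x. x + fst (u t x)) \<in> borel_measurable borel" "weight u t \<in> borel_measurable borel"
  using borel_measurable_continuous_onI[OF continuous_on_slice[OF bdd_contD(1)[OF assms(1)] assms(2)]]
    borel_measurable_continuous_onI[OF continuous_on_slice[OF weight_continuous[OF assms(1)] assms(2)]] by auto

lemma transported_continuous:
  assumes u: "bdd_cont T u"
  shows "prw_continuous b T (transported u)"
proof -
  obtain A where A: "\<And>t x. t \<in> {0..T} \<Longrightarrow> norm (fst (u t x)) \<le> A" using bdd_contD(3)[OF u] by blast
  show ?thesis unfolding transported_def
    by (rule push_prw_continuous[OF b m0 bdd_contD(1)[OF u] A weight_continuous[OF u] weight_bounds])
qed

lemma weight_diff_le: "\<bar>weight u t x - weight w t y\<bar> \<le> exp (Cg * T) * \<bar>snd (u t x) - snd (w t y)\<bar>"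
proof -
  have e: "\<bar>exp p - exp q\<bar> \<le> exp B * \<bar>p - q\<bar>" if "p \<le> B" "q \<le> B" for p q B :: real
  proof -
    have one: "exp p - exp q \<le> exp B * (p - q)" if "q \<le> p" "p \<le> B" for p q :: real
    proof -
      have "exp p * (1 - exp (q - p)) \<le> exp p * (p - q)"
      proof (rule mult_left_mono)
        show "1 - exp (q - p) \<le> p - q" using exp_ge_add_one_self[of "q - p"] by linarith
      qed simp
      also have "\<dots> \<le> exp B * (p - q)" using that by (intro mult_right_mono) auto
      also have "exp p * (1 - exp (q - p)) = exp p - exp q" by (simp add: right_diff_distrib exp_add[symmetric])
      finally show ?thesis .
    qed
    show ?thesis
    proof (cases "q \<le> p")
      case True
      then show ?thesis using one[OF True that(1)] by (simp add: abs_of_nonneg)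
    next
      case False
      then have "\<bar>exp p - exp q\<bar> = exp q - exp p" "\<bar>p - q\<bar> = q - p" by auto
      then show ?thesis using one[of p q] False that(2) by simp
    qed
  qed
  have "\<bar>weight u t x - weight w t y\<bar> \<le> exp (Cg * T) * \<bar>min (snd (u t x)) (Cg * T) - min (snd (w t y)) (Cg * T)\<bar>"
    unfolding weight_def by (rule e) auto
  also have "\<dots> \<le> exp (Cg * T) * \<bar>snd (u t x) - snd (w t y)\<bar>" by (intro mult_left_mono) auto
  finally show ?thesis .
qed

definition "stability = exp (Cg * T) * (1 + b) * measure m0 UNIV"

lemma prw_dist_transported:
  assumes u: "bdd_cont T u" and w: "bdd_cont T w" and t: "t \<in> {0..T}" and d: "\<And>x. norm (u t x - w t x) \<le> d"
  shows "prw_dist b (transported u t) (transported w t) \<le> stability * d"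
proof -
  have d0: "0 \<le> d" using order_trans[OF norm_ge_zero d] .
  have df: "norm (fst (u t x) - fst (w t x)) \<le> d" "\<bar>snd (u t x) - snd (w t x)\<bar> \<le> d" for x
    using d[of x] norm_fst_le[of "fst (u t x) - fst (w t x)" "snd (u t x) - snd (w t x)"]
      norm_snd_le[of "snd (u t x) - snd (w t x)" "fst (u t x) - fst (w t x)"]
    by (auto simp: minus_prod_def intro: order_trans)
  have X: "norm ((x + fst (u t x)) - (x + fst (w t x))) \<le> d" for x using df(1) by simp
  let ?g = "\<lambda>x. weight u t x * norm ((x + fst (u t x)) - (x + fst (w t x))) + b * \<bar>weight u t x - weight w t x\<bar>"
  have g: "\<bar>?g x\<bar> \<le> exp (Cg * T) * (1 + b) * d" for x
  proof -
    have "weight u t x * norm ((x + fst (u t x)) - (x + fst (w t x))) \<le> exp (Cg * T) * d"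
      using weight_bounds X by (intro mult_mono) auto
    moreover have "b * \<bar>weight u t x - weight w t x\<bar> \<le> b * (exp (Cg * T) * d)"
      using weight_diff_le[of u t x w x] df(2)[of x] b
      by (intro mult_left_mono) (auto intro: order_trans mult_left_mono)
    moreover have "0 \<le> ?g x" using weight_bounds(1)[of u t x] b by simp
    ultimately show ?thesis by (simp add: algebra_simps)
  qed
  have "prw_dist b (transported u t) (transported w t) \<le> (\<integral>x. ?g x \<partial>m0)"
    unfolding transported_def
    by (rule prw_push_le[OF b m0 measurable_transport(1)[OF u t] measurable_transport(1)[OF w t] measurable_transport(2)[OF u t]
        weight_bounds measurable_transport(2)[OF w t] weight_bounds X])
  also have "\<dots> \<le> exp (Cg * T) * (1 + b) * d * measure m0 UNIV"
    using fin_measures_integral_bound[OF m0 g] by (simp add: abs_le_iff)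
  finally show ?thesis by (simp add: stability_def mult.commute mult.left_commute)
qed

definition field_along :: "(real \<Rightarrow> 'a measure) \<Rightarrow> (real \<Rightarrow> 'a \<Rightarrow> 'a \<times> real) \<Rightarrow> real \<Rightarrow> 'a \<Rightarrow> 'a \<times> real" where
  "field_along m u t x = (f t (x + fst (u t x)) (m t), g t (x + fst (u t x)) (m t))"

lemma field_along_continuous:
  assumes m: "prw_continuous b T m" and u: "bdd_cont T u"
  shows "continuous_on ({0..T} \<times> UNIV) (\<lambda>(t, x). field_along m u t x)"
  using continuous_on_along[OF continuous_on_coefficient[OF f_cont m] bdd_contD(1)[OF u]]
    continuous_on_along[OF continuous_on_coefficient[OF g_cont m] bdd_contD(1)[OF u]]
  unfolding field_along_def case_prod_beta' by (intro continuous_on_Pair)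

lemma field_along_bound:
  assumes "prw_continuous b T m" "t \<in> {0..T}"
  shows "norm (field_along m u t x) \<le> Cf + Cg" "\<bar>snd (field_along m u t x)\<bar> \<le> Cg"
  using norm_Pair_le[of "f t (x + fst (u t x)) (m t)" "g t (x + fst (u t x)) (m t)"]
    f_bound[OF assms(2) prw_continuousD(1)[OF assms], of "x + fst (u t x)"]
    g_bound[OF assms(2) prw_continuousD(1)[OF assms], of "x + fst (u t x)"]
  by (simp_all add: field_along_def)

lemma field_along_lipschitz:
  assumes m: "prw_continuous b T m" and n: "prw_continuous b T n" and t: "t \<in> {0..T}"
    and d: "norm (u t x - w t x) \<le> d" and e: "prw_dist b (m t) (n t) \<le> e"
  shows "norm (field_along m u t x - field_along n w t x) \<le> 2 * L * (d + e)"
proof -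
  have "norm (fst (u t x) - fst (w t x)) \<le> norm (u t x - w t x)"
    using norm_fst_le[of "fst (u t x) - fst (w t x)" "snd (u t x) - snd (w t x)"] by (simp add: minus_prod_def)
  then have "norm ((x + fst (u t x)) - (x + fst (w t x))) + prw_dist b (m t) (n t) \<le> d + e" using d e by simp
  then have "L * (norm ((x + fst (u t x)) - (x + fst (w t x))) + prw_dist b (m t) (n t)) \<le> L * (d + e)"
    using L by (rule mult_left_mono)
  then have "norm (f t (x + fst (u t x)) (m t) - f t (x + fst (w t x)) (n t)) \<le> L * (d + e)"
    "\<bar>g t (x + fst (u t x)) (m t) - g t (x + fst (w t x)) (n t)\<bar> \<le> L * (d + e)"
    using f_lip[OF t prw_continuousD(1)[OF m t] prw_continuousD(1)[OF n t]]
      g_lip[OF t prw_continuousD(1)[OF m t] prw_continuousD(1)[OF n t]] order_trans by blast+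
  then show ?thesis
    using norm_Pair_le[of "f t (x + fst (u t x)) (m t) - f t (x + fst (w t x)) (n t)"
      "g t (x + fst (u t x)) (m t) - g t (x + fst (w t x)) (n t)"]
    by (simp add: field_along_def)
qed

lemma stability_nonneg: "stability \<ge> 0"
  using b by (simp add: stability_def)

text \<open>The coefficients depend on the measure through the transport metric, and the transported measure is
  Lipschitz in \<open>u\<close> by \<open>prw_dist_transported\<close>; hence so is the whole right-hand side, at each time
  separately.\<close>

lemma nonlinear_picard:
  shows "\<exists>u. bdd_cont T u \<and> (\<forall>t\<in>{0..T}. \<forall>x. u t x = integral {0..t} (\<lambda>\<tau>. field_along (transported u) u \<tau> x))"
    and "bdd_cont T u \<Longrightarrow> (\<And>t x. t \<in> {0..T} \<Longrightarrow> u t x = integral {0..t} (\<lambda>\<tau>. field_along (transported u) u \<tau> x)) \<Longrightarrow>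
      bdd_cont T w \<Longrightarrow> (\<And>t x. t \<in> {0..T} \<Longrightarrow> w t x = integral {0..t} (\<lambda>\<tau>. field_along (transported w) w \<tau> x)) \<Longrightarrow>
      t \<in> {0..T} \<Longrightarrow> u t x = w t x"
proof -
  have K: "0 \<le> 2 * L * (1 + stability)" using L stability_nonneg by simp
  note tc = transported_continuous
  have lip: "norm (field_along (transported u) u t x - field_along (transported w) w t x) \<le> 2 * L * (1 + stability) * d"
    if "bdd_cont T u" "bdd_cont T w" "t \<in> {0..T}" "\<And>x. norm (u t x - w t x) \<le> d" for u w t d x
    using field_along_lipschitz[where u = u and w = w and x = x, OF tc[OF that(1)] tc[OF that(2)] that(3) that(4)[of x] prw_dist_transported[OF that]]
    by (simp add: algebra_simps)
  note pic = picard[where F = "\<lambda>u. field_along (transported u) u" and B = "Cf + Cg", OF T K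
      field_along_continuous[OF tc] field_along_bound(1)[OF tc] lip]
  show "\<exists>u. bdd_cont T u \<and> (\<forall>t\<in>{0..T}. \<forall>x. u t x = integral {0..t} (\<lambda>\<tau>. field_along (transported u) u \<tau> x))"
    by (rule pic(1))
  show "bdd_cont T u \<Longrightarrow> (\<And>t x. t \<in> {0..T} \<Longrightarrow> u t x = integral {0..t} (\<lambda>\<tau>. field_along (transported u) u \<tau> x)) \<Longrightarrow>
      bdd_cont T w \<Longrightarrow> (\<And>t x. t \<in> {0..T} \<Longrightarrow> w t x = integral {0..t} (\<lambda>\<tau>. field_along (transported w) w \<tau> x)) \<Longrightarrow>
      t \<in> {0..T} \<Longrightarrow> u t x = w t x"
    by (rule pic(2))
qed

text \<open>The logarithm of the weight is at most \<open>Cg * t\<close> along characteristics, so the cap in \<open>weight\<close> is never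
  active.\<close>

lemma characteristics_solve:
  assumes m: "prw_continuous b T m" and u: "bdd_cont T u"
    and eq: "\<And>t x. t \<in> {0..T} \<Longrightarrow> u t x = integral {0..t} (\<lambda>\<tau>. field_along m u \<tau> x)"
  shows "weak_eq T m0 (\<lambda>t x. f t x (m t)) (\<lambda>t x. g t x (m t)) (transported u)"
proof -
  interpret transport_coefficients b T Cf Cg "\<lambda>t x. f t x (m t)" "\<lambda>t x. g t x (m t)"
    by (rule transport_coefficients_along[OF m])
  have w: "weak_eq T m0 (\<lambda>t x. f t x (m t)) (\<lambda>t x. g t x (m t)) (\<lambda>t. push (\<lambda>x. x + fst (u t x)) (\<lambda>x. exp (snd (u t x))) m0)"
    by (rule weak_eq_characteristics[OF m0 u]) (use eq in \<open>simp add: field_along_def\<close>)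
  have "weight u t = (\<lambda>x. exp (snd (u t x)))" if t: "t \<in> {0..T}" for t
  proof
    fix x
    have "(\<lambda>\<tau>. field_along m u \<tau> x) integrable_on {0..t}"
      by (rule integrable_continuous_real[OF continuous_on_time_slice[OF field_along_continuous[OF m u]]]) (use t in auto)
    then have "snd (u t x) \<le> Cg * t"
      unfolding eq[OF t] using t field_along_bound(2)[OF m] Cg_nonneg
      by (intro integral_component_bound) auto
    also have "\<dots> \<le> Cg * T" using t Cg_nonneg by (intro mult_left_mono) auto
    finally show "weight u t x = exp (snd (u t x))" by (simp add: weight_def)
  qed
  then show ?thesis by (intro weak_eq_cong[OF w]) (auto simp: transported_def)
qed

text \<open>The solution and the measure transported by the characteristics of its frozen coefficients solve the
  same linear equation, so they coincide by \<open>weak_eq_unique\<close>.\<close>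

lemma solution_is_transported:
  assumes m: "prw_continuous b T m" and weak: "weak_eq T m0 (\<lambda>t x. f t x (m t)) (\<lambda>t x. g t x (m t)) m"
  obtains u where "bdd_cont T u" "\<And>t x. t \<in> {0..T} \<Longrightarrow> u t x = integral {0..t} (\<lambda>\<tau>. field_along (transported u) u \<tau> x)"
    "\<And>t. t \<in> {0..T} \<Longrightarrow> m t = transported u t"
proof -
  have K: "0 \<le> 2 * L" using L by simp
  have lip: "norm (field_along m u t x - field_along m w t x) \<le> 2 * L * d"
    if "bdd_cont T u" "bdd_cont T w" "t \<in> {0..T}" "\<And>x. norm (u t x - w t x) \<le> d" for u w t d x
    using field_along_lipschitz[OF m m that(3), of u x w d 0] that(4) prw_dist_self[OF prw_continuousD(1)[OF m that(3)]] by simp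
  obtain u where u: "bdd_cont T u" "\<And>t x. t \<in> {0..T} \<Longrightarrow> u t x = integral {0..t} (\<lambda>\<tau>. field_along m u \<tau> x)"
    using picard(1)[where F = "field_along m" and B = "Cf + Cg", OF T K field_along_continuous[OF m] field_along_bound(1)[OF m] lip] by blast
  interpret lipschitz_transport b T Cf Cg "\<lambda>t x. f t x (m t)" "\<lambda>t x. g t x (m t)" L
    by (rule lipschitz_transport_along[OF m])
  have eq: "m t = transported u t" if "t \<in> {0..T}" for t
    by (rule weak_eq_unique[OF m0 m weak transported_continuous[OF u(1)] characteristics_solve[OF m u] that])
  have "u t x = integral {0..t} (\<lambda>\<tau>. field_along (transported u) u \<tau> x)" if t: "t \<in> {0..T}" for t x
  proof -
    have "integral {0..t} (\<lambda>\<tau>. field_along (transported u) u \<tau> x) = integral {0..t} (\<lambda>\<tau>. field_along m u \<tau> x)"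
      by (rule integral_cong) (use t eq in \<open>auto simp: field_along_def\<close>)
    then show ?thesis using u(2)[OF t] by simp
  qed
  then show thesis using that[OF u(1)] eq by blast
qed

text \<open>Both solutions are transported measures, and the displacements and log-weights that transport them
  are fixed points of the same contraction.\<close>

lemma balance_unique:
  assumes m: "prw_continuous b T m" "weak_eq T m0 (\<lambda>t x. f t x (m t)) (\<lambda>t x. g t x (m t)) m"
    and n: "prw_continuous b T n" "weak_eq T m0 (\<lambda>t x. f t x (n t)) (\<lambda>t x. g t x (n t)) n" and t: "t \<in> {0..T}"
  shows "m t = n t"
proof -
  obtain u where u: "bdd_cont T u" "\<And>t x. t \<in> {0..T} \<Longrightarrow> u t x = integral {0..t} (\<lambda>\<tau>. field_along (transported u) u \<tau> x)"
    "\<And>t. t \<in> {0..T} \<Longrightarrow> m t = transported u t" using solution_is_transported[OF m] by metis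
  obtain w where w: "bdd_cont T w" "\<And>t x. t \<in> {0..T} \<Longrightarrow> w t x = integral {0..t} (\<lambda>\<tau>. field_along (transported w) w \<tau> x)"
    "\<And>t. t \<in> {0..T} \<Longrightarrow> n t = transported w t" using solution_is_transported[OF n] by metis
  have "u t = w t" using nonlinear_picard(2)[OF u(1,2) w(1,2) t] by auto
  then have "weight u t = weight w t" "(\<lambda>x. x + fst (u t x)) = (\<lambda>x. x + fst (w t x))" by (auto simp: weight_def fun_eq_iff)
  then show ?thesis unfolding u(3)[OF t] w(3)[OF t] transported_def by simp
qed

text \<open>The random points at different times live on the same probability space, so continuity in time is a
  matter of dominated convergence.\<close>

lemma star_flow_exists:
  assumes R: "R > 0" and mass: "exp (Cg * T) * measure m0 UNIV \<le> R" and mom: "m0 \<in> fin_measures1" and u: "bdd_cont T u"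
  shows "\<exists>\<mu>. prob_flow b T \<mu> \<and> (\<forall>t\<in>{0..T}. scaled_restr R (\<mu> t) = transported u t)"
proof -
  obtain p where p: "prob_space p" "sets p = sets borel" "m0 = scale_measure (ennreal (measure m0 UNIV)) p"
    using prob_factor[OF m0] .
  interpret S: label_space b p "measure m0 UNIV / R" "exp (Cg * T)" R "measure m0 UNIV" m0
  proof (rule label_space.intro)
    show "measure m0 UNIV / R * exp (Cg * T) \<le> 1" using R mass by (simp add: divide_le_eq mult.commute)
    show "m0 = scale_measure (ennreal (measure m0 UNIV)) p" by (rule p(3))
  qed (use b p(1,2) R in simp_all)
  obtain A where A: "\<And>t x. t \<in> {0..T} \<Longrightarrow> norm (fst (u t x)) \<le> A" using bdd_contD(3)[OF u] by blast
  have A0: "A \<ge> 0" using order_trans[OF norm_ge_zero A, of 0] T by simp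
  define \<mu> where "\<mu> t = star_law b p (measure m0 UNIV / R) (\<lambda>x. x + fst (u t x)) (weight u t)" for t
  note mt = measurable_transport[OF u]
  have basic: "sets (\<mu> t) = sets (star_borel b)" "prob_space (\<mu> t)" "scaled_restr R (\<mu> t) = transported u t" if t: "t \<in> {0..T}" for t
    unfolding \<mu>_def transported_def by (rule S.star_law_basic[OF mt[OF t] weight_bounds])+
  have prob1: "\<mu> t \<in> prob1_star b" if t: "t \<in> {0..T}" for t
  proof -
    have Fm: "(\<lambda>x :: 'a option. case x of None \<Rightarrow> 0 | Some y \<Rightarrow> ennreal (norm y)) \<in> borel_measurable (star_borel b)"
      by (rule star_measurable[OF b refl]) simp
    have "(\<integral>\<^sup>+x. ennreal (norm x) \<partial>transported u t) < \<infinity>"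
    proof -
      have "(\<integral>\<^sup>+x. ennreal (norm x) \<partial>transported u t) = (\<integral>\<^sup>+x. ennreal (weight u t x) * ennreal (norm (x + fst (u t x))) \<partial>m0)"
        unfolding transported_def by (rule nn_integral_push[OF m0 mt[OF t]]) simp
      also have "\<dots> \<le> (\<integral>\<^sup>+x. ennreal (exp (Cg * T)) * (ennreal (norm x) + ennreal A) \<partial>m0)"
      proof (intro nn_integral_mono mult_mono)
        fix x
        show "ennreal (weight u t x) \<le> ennreal (exp (Cg * T))" by (rule ennreal_leI[OF weight_bounds(2)])
        have "norm (x + fst (u t x)) \<le> norm x + A" using norm_triangle_ineq[of x "fst (u t x)"] A[OF t, of x] by linarith
        then show "ennreal (norm (x + fst (u t x))) \<le> ennreal (norm x) + ennreal A"
          using A0 by (simp add: ennreal_plus[symmetric] ennreal_leI del: ennreal_plus)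
      qed auto
      also have "\<dots> = ennreal (exp (Cg * T)) * ((\<integral>\<^sup>+x. ennreal (norm x) \<partial>m0) + ennreal A * emeasure m0 UNIV)"
      proof -
        have "(\<lambda>x. ennreal (norm x)) \<in> borel_measurable m0" using fin_measuresD[OF m0] by (simp cong: measurable_cong_sets)
        then show ?thesis using fin_measuresD[OF m0] by (simp add: nn_integral_cmult nn_integral_add)
      qed
      also have "\<dots> < \<infinity>"
        using mom fin_measuresD[OF m0]
        by (auto simp: fin_measures1_def ennreal_mult_less_top less_top[symmetric] finite_measure.emeasure_finite ennreal_mult_eq_top_iff)
      finally show ?thesis .
    qed
    moreover have "(\<integral>\<^sup>+x. ennreal (norm x) \<partial>transported u t) = ennreal R * (\<integral>\<^sup>+x. ennreal (norm x) \<partial>restr (\<mu> t))"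
      unfolding basic(3)[OF t, symmetric] scaled_restr_def
      by (rule nn_integral_scale_measure) (simp cong: measurable_cong_sets)
    ultimately have "(\<integral>\<^sup>+x. ennreal (norm x) \<partial>restr (\<mu> t)) < \<infinity>"
      using R by (auto simp: ennreal_mult_less_top less_top[symmetric])
    then show ?thesis
      using basic[OF t] nn_integral_star[OF b basic(1)[OF t] Fm] by (simp add: prob1_star_def)
  qed
  have "prob_flow b T \<mu>"
    unfolding prob_flow_def
  proof (intro conjI ballI allI impI prob1)
    fix t \<epsilon> :: real assume t: "t \<in> {0..T}" and \<epsilon>: "\<epsilon> > 0"
    let ?g = "\<lambda>s x. weight u t x * norm ((x + fst (u t x)) - (x + fst (u s x))) + b * \<bar>weight u t x - weight u s x\<bar>"
    have "R * \<epsilon> > 0" using R \<epsilon> by simp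
    from push_gap_vanishes[OF b m0 bdd_contD(1)[OF u] A weight_continuous[OF u] weight_bounds t this]
    obtain \<delta> where \<delta>: "\<delta> > 0" "\<And>s. s \<in> {0..T} \<Longrightarrow> \<bar>s - t\<bar> < \<delta> \<Longrightarrow> (\<integral>x. ?g s x \<partial>m0) < R * \<epsilon>" by blast
    have "W1_star b (\<mu> t) (\<mu> s) < \<epsilon>" if s: "s \<in> {0..T}" "\<bar>s - t\<bar> < \<delta>" for s
    proof -
      have "\<bar>?g s x\<bar> \<le> exp (Cg * T) * (2 * A) + b * exp (Cg * T)" for x
      proof -
        have "norm ((x + fst (u t x)) - (x + fst (u s x))) \<le> 2 * A"
          using norm_triangle_ineq4[of "fst (u t x)" "fst (u s x)"] A[OF t, of x] A[OF s(1), of x] by simp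
        then have "weight u t x * norm ((x + fst (u t x)) - (x + fst (u s x))) \<le> exp (Cg * T) * (2 * A)"
          using weight_bounds by (intro mult_mono) auto
        moreover have "b * \<bar>weight u t x - weight u s x\<bar> \<le> b * exp (Cg * T)"
          using weight_bounds[of u t x] weight_bounds[of u s x] b by (intro mult_left_mono) auto
        moreover have "0 \<le> ?g s x" using weight_bounds(1)[of u t x] b by simp
        ultimately show ?thesis by simp
      qed
      moreover have "?g s \<in> borel_measurable borel" using mt[OF t] mt[OF s(1)] by measurable
      ultimately have i: "integrable m0 (?g s)" by (intro fin_measures_integrable[OF m0])
      have "W1_star b (\<mu> t) (\<mu> s) \<le> (1 / R) * (\<integral>x. ?g s x \<partial>m0)"
        unfolding \<mu>_def by (rule S.star_law_W1[OF mt(1)[OF t] mt(1)[OF s(1)] mt(2)[OF t] weight_bounds mt(2)[OF s(1)] weight_bounds i])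
      also have "\<dots> < \<epsilon>" using \<delta>(2)[OF s] R by (simp add: divide_less_eq mult.commute)
      finally show ?thesis .
    qed
    then show "\<exists>\<delta>>0. \<forall>s\<in>{0..T}. \<bar>s - t\<bar> < \<delta> \<longrightarrow> W1_star b (\<mu> t) (\<mu> s) < \<epsilon>" using \<delta>(1) by blast
  qed
  then show ?thesis using basic(3) by blast
qed

end

theorem theorem5p2:
  fixes T b c R C_Lf C_Lg C_f C_g :: real
    and m0 :: "'a::euclidean_space measure"
    and f :: "real \<Rightarrow> 'a \<Rightarrow> 'a measure \<Rightarrow> 'a"
    and g :: "real \<Rightarrow> 'a \<Rightarrow> 'a measure \<Rightarrow> real"
    and \<mu>0 :: "'a option measure"
  assumes "T > 0" and "b > 0"
    and "m0 \<in> fin_measures1"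
    and "jointly_continuous b T f" and "jointly_continuous b T g"
    and "\<And>t x1 x2 m1 m2. t \<in> {0..T} \<Longrightarrow> m1 \<in> fin_measures \<Longrightarrow> m2 \<in> fin_measures \<Longrightarrow>
           norm (f t x1 m1 - f t x2 m2) \<le> C_Lf * (norm (x1 - x2) + prw_dist b m1 m2)"
    and "\<And>t x1 x2 m1 m2. t \<in> {0..T} \<Longrightarrow> m1 \<in> fin_measures \<Longrightarrow> m2 \<in> fin_measures \<Longrightarrow>
           \<bar>g t x1 m1 - g t x2 m2\<bar> \<le> C_Lg * (norm (x1 - x2) + prw_dist b m1 m2)"
    and "\<And>t x m. t \<in> {0..T} \<Longrightarrow> m \<in> fin_measures \<Longrightarrow> norm (f t x m) \<le> C_f"
    and "\<And>t x m. t \<in> {0..T} \<Longrightarrow> m \<in> fin_measures \<Longrightarrow> \<bar>g t x m\<bar> \<le> C_g"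
    and "c > 0" and "measure m0 UNIV \<le> c"
    and "R > c * exp (C_g * T)"
    and "\<mu>0 = scale_measure (ennreal (inverse R)) (augment b R m0)"
  shows "(\<forall>\<mu>. prob_flow b T \<mu> \<and> \<mu> 0 = \<mu>0 \<longrightarrow>
            (solves_flow_eq b T R f g \<mu> \<longleftrightarrow>
             weak_solution b T f g m0 (\<lambda>t. scaled_restr R (\<mu> t))))
       \<and> (\<exists>\<mu>. solves_flow_eq b T R f g \<mu> \<and> \<mu> 0 = \<mu>0 \<and>
            (\<forall>\<nu>. solves_flow_eq b T R f g \<nu> \<and> \<nu> 0 = \<mu>0 \<longrightarrow> (\<forall>t\<in>{0..T}. \<nu> t = \<mu> t)))"
proof -
  have m0: "m0 \<in> fin_measures" using assms(3) by (simp add: fin_measures1_def)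
  define L where "L = max \<bar>C_Lf\<bar> \<bar>C_Lg\<bar>"
  interpret balance_lipschitz b T C_f C_g f g L m0
  proof
    show "L \<ge> 0" by (simp add: L_def)
    fix t :: real and x1 x2 :: 'a and m1 m2 :: "'a measure"
    assume a: "t \<in> {0..T}" "m1 \<in> fin_measures" "m2 \<in> fin_measures"
    have n: "0 \<le> norm (x1 - x2) + prw_dist b m1 m2" using prw_dist_nonneg[of b m1 m2] by simp
    show "norm (f t x1 m1 - f t x2 m2) \<le> L * (norm (x1 - x2) + prw_dist b m1 m2)"
      by (rule order_trans[OF assms(6)[OF a] mult_right_mono[OF _ n]]) (auto simp: L_def)
    show "\<bar>g t x1 m1 - g t x2 m2\<bar> \<le> L * (norm (x1 - x2) + prw_dist b m1 m2)"
      by (rule order_trans[OF assms(7)[OF a] mult_right_mono[OF _ n]]) (auto simp: L_def)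
  qed (use assms m0 in auto)
  have E: "exp (C_g * T) \<ge> 1" using Cg_nonneg T by simp
  have "0 < c * exp (C_g * T)" using assms(10) by simp
  then have R: "R > 0" using assms(12) by linarith
  have mR: "measure m0 UNIV * exp (C_g * T) < R"
    by (rule le_less_trans[OF mult_right_mono[OF assms(11)] assms(12)]) simp
  have "measure m0 UNIV \<le> measure m0 UNIV * exp (C_g * T)"
    using mult_left_mono[OF E measure_nonneg[of m0 UNIV]] by simp
  then have le: "measure m0 UNIV \<le> R" using mR by simp
  note aug = scaled_restr_augment[OF b R m0 le, folded assms(13)]
  have T0: "0 \<in> {0..T}" using T by simp
  have part1: "solves_flow_eq b T R f g \<mu> \<longleftrightarrow> weak_solution b T f g m0 (\<lambda>t. scaled_restr R (\<mu> t))"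
    if \<mu>: "prob_flow b T \<mu>" "\<mu> 0 = \<mu>0" for \<mu>
  proof -
    let ?m = "\<lambda>t. scaled_restr R (\<mu> t)"
    have mc: "prw_continuous b T ?m" by (rule prw_continuous_scaled_restr[OF R \<mu>(1)])
    interpret transport_coefficients b T C_f C_g "\<lambda>t x. f t x (?m t)" "\<lambda>t x. g t x (?m t)"
      by (rule transport_coefficients_along[OF mc])
    \<comment> \<open>The mass of \<open>m\<close> stays below \<open>R\<close>.\<close>
    have pos: "measure (\<mu> t) {None} > 0"
      if weak: "weak_eq T m0 (\<lambda>t x. f t x (?m t)) (\<lambda>t x. g t x (?m t)) ?m" and t: "t \<in> {0..T}" for t
    proof -
      have "\<mu> t \<in> prob1_star b" using \<mu>(1) t by (simp add: prob_flow_def)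
      note p = prob1_starD[OF this]
      have "measure (?m t) UNIV \<le> measure m0 UNIV * exp (C_g * t)" by (rule mass_bound[OF m0 mc weak t])
      also have "\<dots> \<le> measure m0 UNIV * exp (C_g * T)" using t Cg_nonneg by (auto intro!: mult_left_mono)
      also have "\<dots> < R" by (rule mR)
      finally have "R * (1 - measure (\<mu> t) {None}) < R * 1"
        unfolding measure_scaled_restr[OF b p(3,1) less_imp_le[OF R]] by simp
      then show ?thesis using R by (simp add: mult_less_cancel_left_pos del: mult_1_right)
    qed
    show ?thesis
      unfolding solves_flow_eq_iff[OF R \<mu>(1)] weak_solution_iff \<mu>(2) aug(3) using mc pos by blast
  qed
  have unique: "\<nu> t = \<mu> t" if "solves_flow_eq b T R f g \<mu>" "\<mu> 0 = \<mu>0" "solves_flow_eq b T R f g \<nu>" "\<nu> 0 = \<mu>0" "t \<in> {0..T}" for \<mu> \<nu> t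
  proof -
    have fl: "prob_flow b T \<mu>" "prob_flow b T \<nu>" using that by (auto simp: solves_flow_eq_def)
    have "scaled_restr R (\<nu> t) = scaled_restr R (\<mu> t)"
      using part1[OF fl(1) that(2)] part1[OF fl(2) that(4)] that(1,3) unfolding weak_solution_iff
      by (intro balance_unique[OF _ _ _ _ that(5), of "\<lambda>t. scaled_restr R (\<nu> t)" "\<lambda>t. scaled_restr R (\<mu> t)"]) auto
    moreover have p: "\<mu> t \<in> prob1_star b" "\<nu> t \<in> prob1_star b" using fl that(5) by (auto simp: prob_flow_def)
    ultimately show ?thesis
      by (intro star_measure_eqI[OF b R prob1_starD(3,1)[OF p(2)] prob1_starD(3,1)[OF p(1)]])
  qed
  obtain u where u: "bdd_cont T u" "\<And>t x. t \<in> {0..T} \<Longrightarrow> u t x = integral {0..t} (\<lambda>\<tau>. field_along (transported u) u \<tau> x)"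
    using nonlinear_picard(1) by blast
  obtain \<mu> where \<mu>: "prob_flow b T \<mu>" "\<And>t. t \<in> {0..T} \<Longrightarrow> scaled_restr R (\<mu> t) = transported u t"
    using star_flow_exists[OF R _ assms(3) u(1)] mR by (auto simp: mult.commute)
  have "transported u 0 = m0"
  proof -
    have "u 0 x = 0" for x using u(2)[OF T0, of x] by simp
    then show ?thesis using Cg_nonneg T by (simp add: transported_def weight_def[abs_def] push_id[OF m0])
  qed
  then have eq0: "scaled_restr R (\<mu> 0) = scaled_restr R \<mu>0" using \<mu>(2)[OF T0] by (simp only: aug(3))
  have "\<mu> 0 \<in> prob1_star b" using \<mu>(1) T0 by (simp add: prob_flow_def)
  note p0 = prob1_starD[OF this]
  have init: "\<mu> 0 = \<mu>0" by (rule star_measure_eqI[OF b R p0(3,1) aug(1,2) eq0])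
  have cs: "weak_eq T m0 (\<lambda>t x. f t x (transported u t)) (\<lambda>t x. g t x (transported u t)) (transported u)"
    by (rule characteristics_solve[OF transported_continuous[OF u(1)] u])
  have "weak_eq T m0 (\<lambda>t x. f t x (scaled_restr R (\<mu> t))) (\<lambda>t x. g t x (scaled_restr R (\<mu> t))) (\<lambda>t. scaled_restr R (\<mu> t))"
    by (rule weak_eq_cong[OF cs]) (use \<mu>(2) in auto)
  then have sol: "solves_flow_eq b T R f g \<mu>"
    using part1[OF \<mu>(1) init] prw_continuous_scaled_restr[OF R \<mu>(1)] unfolding weak_solution_iff by blast
  show ?thesis using part1 sol init unique[OF sol init] by blast
qed

end
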